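(* Let $X$ be a complex Banach space, let $\alpha\in\mathbb{C}$ with $0<\operatorname{Re}\alpha<1$, and let $A$ be a densely defined sectorial operator in $X$. Let $T_\alpha$ be the (generalised) Dirichlet-to-Neumann operator associated with $$u''(t)+\frac{1-2\alpha}{t}u'(t)=Au(t)\quad(t>0),\qquad u(0)=x. \qquad (P_x)$$ Then $T_\alpha=c_\alpha A^\alpha$ (including equality of domains), where $c_\alpha=\dfrac{\Gamma(1-\alpha)}{2^{2\alpha-1}\,\Gamma(\alpha)}$.
   Context: Sectorial operators: a linear operator $A$ in $X$ is sectorial if $(-\infty,0)\subseteq\rho(A)$ and $\sup_{\lambda>0}\|\lambda(\lambda+A)^{-1}\|<\infty$. For $\theta\in(0,\pi)$, $S_\theta:=\{z\in\mathbb{C}\setminus(-\infty,0]:|\arg z|<\theta\}$ with $\arg z\in(-\pi,\pi)$; $S_0:=(0,\infty)$. The angle of sectoriality $\omega\in[0,\pi)$ of $A$ is the infimum of all $\theta\in[0,\pi)$ such that $\sigma(A)\subseteq\overline{S_\theta}$ and $\sup_{z\in\mathbb{C}\setminus S_\phi,\,z\ne0}\|z(z-A)^{-1}\|<\infty$ for every $\phi\in(\theta,\pi)$. Solution: a solution of $(P_x)$ is a function $u\in C_{\mathrm b}([0,\infty);X)$ (bounded and continuous) such that $u(0)=x$, $u(t)\in\mathcal{D}(A)$ for all $t>0$, $Au\in L^1_{\mathrm{loc}}((0,\infty);X)$, and for all $\phi\in C_{\mathrm c}^\infty((0,\infty))$ $$\int_0^\infty\Bigl(u(t)\phi''(t)-u(t)\frac{d}{dt}\Bigl(\frac{1-2\alpha}{t}\phi(t)\Bigr)\Bigr)dt=\int_0^\infty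 Au(t)\,\phi(t)\,dt .$$ Any such $u$ belongs to $C^1((0,\infty);X)$. For densely defined sectorial $A$ and every $x\in X$, $(P_x)$ has exactly one solution. Dirichlet-to-Neumann operator: $\mathcal{D}(T_\alpha)$ is the set of all $x\in X$ such that, for the solution $u$ of $(P_x)$, the limit $\lim_{t\to0+}-t^{1-2\alpha}u'(t)$ exists in $X$; for such $x$, $T_\alpha x:=\lim_{t\to0+}-t^{1-2\alpha}u'(t)$. Fractional power: $z^\alpha$ is the principal branch. $A^\alpha:=[\lambda\mapsto\lambda^\alpha](A)$ in the sectorial functional calculus; explicitly, for $0<\operatorname{Re}\alpha<1$, $A^\alpha=(1+A)\,g(A)$ with natural domain $\{x: g(A)x\in\mathcal{D}(A)\}$, where $g(\lambda)=\lambda^\alpha(1+\lambda)^{-1}$ and $g(A)=\frac1{2\pi i}\int_\gamma g(\lambda)(\lambda-A)^{-1}d\lambda\in L(X)$, with $\gamma$ the boundary of $S_\varphi$ for some $\varphi\in(\omega,\pi)$, oriented from $\infty e^{i\varphi}$ through $0$ to $\infty e^{-i\varphi}$. *)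

theory Defs
  imports "HOL-Analysis.Analysis"
begin

class complex_normed_vector = real_normed_vector +
  fixes scaleC :: "complex \<Rightarrow> 'a \<Rightarrow> 'a"  (infixr \<open>*\<^sub>C\<close> 75)
  assumes scaleC_add_right: "a *\<^sub>C (x + y) = a *\<^sub>C x + a *\<^sub>C y"
    and scaleC_add_left: "(a + b) *\<^sub>C x = a *\<^sub>C x + b *\<^sub>C x"
    and scaleC_scaleC: "a *\<^sub>C b *\<^sub>C x = (a * b) *\<^sub>C x"
    and scaleR_scaleC: "r *\<^sub>R x = complex_of_real r *\<^sub>C x"
    and norm_scaleC: "norm (a *\<^sub>C x) = cmod a * norm x"

class complex_banach = complex_normed_vector + banach


(* The library's has_bochner_integral and lebesgue_integral require a second countable
   codomain. Here the codomain may be non-separable (a general Banach space, or its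
   space of bounded operators), so the integrand has to be an a.e. limit of simple
   functions instead of merely Borel measurable. Only complete measures are used below. *)

definition has_Bochner_integral ::
  "'m measure \<Rightarrow> ('m \<Rightarrow> 'b::real_normed_vector) \<Rightarrow> 'b \<Rightarrow> bool"
  where "has_Bochner_integral M f I \<longleftrightarrow>
    (\<exists>s. (\<forall>i. Bochner_Integration.simple_bochner_integrable M (s i)) \<and>
         (AE t in M. (\<lambda>i. s i t) \<longlonglongrightarrow> f t) \<and>
         (\<lambda>i. \<integral>\<^sup>+t. ennreal (norm (f t - s i t)) \<partial>M) \<longlonglongrightarrow> 0 \<and>
         (\<lambda>i. Bochner_Integration.simple_bochner_integral M (s i)) \<longlonglongrightarrow> I)"

definition Bochner_integrable ::
  "'m measure \<Rightarrow> ('m \<Rightarrow> 'b::real_normed_vector) \<Rightarrow> bool"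
  where "Bochner_integrable M f \<longleftrightarrow> (\<exists>I. has_Bochner_integral M f I)"

definition Bochner_integral ::
  "'m measure \<Rightarrow> ('m \<Rightarrow> 'b::real_normed_vector) \<Rightarrow> 'b"
  where "Bochner_integral M f = (THE I. has_Bochner_integral M f I)"

definition L1_loc_pos :: "(real \<Rightarrow> 'b::real_normed_vector) \<Rightarrow> bool"
  where "L1_loc_pos f \<longleftrightarrow>
    (\<forall>K. compact K \<and> K \<subseteq> {0<..} \<longrightarrow> Bochner_integrable (lebesgue_on K) f)"


(* An unbounded operator in 'a is a partial function A :: 'a \<rightharpoonup> 'a with domain dom A;
   equality of partial functions includes equality of domains. *)

definition linear_operator :: "('a::complex_normed_vector \<rightharpoonup> 'a) \<Rightarrow> bool"
  where "linear_operator A \<longleftrightarrow>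
    0 \<in> dom A \<and>
    (\<forall>x\<in>dom A. \<forall>y\<in>dom A. x + y \<in> dom A \<and> the (A (x + y)) = the (A x) + the (A y)) \<and>
    (\<forall>c. \<forall>x\<in>dom A. c *\<^sub>C x \<in> dom A \<and> the (A (c *\<^sub>C x)) = c *\<^sub>C the (A x))"

definition densely_defined :: "('a::complex_normed_vector \<rightharpoonup> 'a) \<Rightarrow> bool"
  where "densely_defined A \<longleftrightarrow> closure (dom A) = UNIV"

definition scale_operator ::
  "complex \<Rightarrow> ('a::complex_normed_vector \<rightharpoonup> 'a) \<Rightarrow> ('a \<rightharpoonup> 'a)"
  where "scale_operator c A = (\<lambda>x. map_option (\<lambda>y. c *\<^sub>C y) (A x))"

definition resolvent ::
  "('a::complex_normed_vector \<rightharpoonup> 'a) \<Rightarrow> complex \<Rightarrow> 'a \<Rightarrow> 'a"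
  where "resolvent A z = inv_into (dom A) (\<lambda>x. z *\<^sub>C x - the (A x))"

definition resolvent_set :: "('a::complex_normed_vector \<rightharpoonup> 'a) \<Rightarrow> complex set"
  where "resolvent_set A =
    {z. bij_betw (\<lambda>x. z *\<^sub>C x - the (A x)) (dom A) UNIV \<and> bounded_linear (resolvent A z)}"

definition spectrum :: "('a::complex_normed_vector \<rightharpoonup> 'a) \<Rightarrow> complex set"
  where "spectrum A = - resolvent_set A"

(* l (l + A)^(-1) is expressed as - l R(-l, A), where R(z, A) = (z - A)^(-1). *)
definition sectorial :: "('a::complex_normed_vector \<rightharpoonup> 'a) \<Rightarrow> bool"
  where "sectorial A \<longleftrightarrow> linear_operator A \<and>
    complex_of_real ` {..<0} \<subseteq> resolvent_set A \<and>
    bdd_above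
      ((\<lambda>l. onorm (\<lambda>x. - (complex_of_real l *\<^sub>C resolvent A (- complex_of_real l) x))) ` {0<..})"

definition sector :: "real \<Rightarrow> complex set"
  where "sector \<theta> =
    (if \<theta> = 0 then complex_of_real ` {0<..} else {z. z \<notin> \<real>\<^sub>\<le>\<^sub>0 \<and> \<bar>Arg z\<bar> < \<theta>})"

definition sectoriality_angle :: "('a::complex_normed_vector \<rightharpoonup> 'a) \<Rightarrow> real"
  where "sectoriality_angle A =
    Inf {\<theta>. 0 \<le> \<theta> \<and> \<theta> < pi \<and> spectrum A \<subseteq> closure (sector \<theta>) \<and>
      (\<forall>\<phi>. \<theta> < \<phi> \<and> \<phi> < pi \<longrightarrow>
        bdd_above ((\<lambda>z. onorm (\<lambda>x. z *\<^sub>C resolvent A z x)) ` (- sector \<phi> - {0})))}"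


(* The integral of g(z) (z - A)^(-1) / (2 pi i) along the boundary of the sector of half
   angle \<phi>, running in along the ray with argument \<phi> and out along the ray with argument
   -\<phi>. The integrals are operator-valued, in the Banach space of bounded operators; the
   constant is applied to the values because blinfun carries only a real vector space
   structure. *)

definition ray_integral ::
  "('a::complex_banach \<rightharpoonup> 'a) \<Rightarrow> (complex \<Rightarrow> complex) \<Rightarrow> real \<Rightarrow> 'a \<Rightarrow>\<^sub>L 'a"
  where "ray_integral A g \<psi> =
    Bochner_integral (lebesgue_on {0<..})
      (\<lambda>r. let z = complex_of_real r * cis \<psi> in Blinfun (\<lambda>x. (g z * cis \<psi>) *\<^sub>C resolvent A z x))"

definition elementary_calculus ::
  "('a::complex_banach \<rightharpoonup> 'a) \<Rightarrow> (complex \<Rightarrow> complex) \<Rightarrow> 'a \<Rightarrow> 'a"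
  where "elementary_calculus A g x =
    (let \<phi> = (SOME \<phi>. sectoriality_angle A < \<phi> \<and> \<phi> < pi)
     in (1 / (2 * of_real pi * \<i>)) *\<^sub>C
          blinfun_apply (ray_integral A g (- \<phi>) - ray_integral A g \<phi>) x)"

definition fractional_power ::
  "('a::complex_banach \<rightharpoonup> 'a) \<Rightarrow> complex \<Rightarrow> ('a \<rightharpoonup> 'a)"
  where "fractional_power A \<alpha> =
    (\<lambda>x. let y = elementary_calculus A (\<lambda>z. z powr \<alpha> / (1 + z)) x
         in if y \<in> dom A then Some (y + the (A y)) else None)"


(* A function in C_c^infinity((0,infinity)) is represented by its extension by 0 to the reals. *)
definition test_function :: "(real \<Rightarrow> complex) \<Rightarrow> bool"
  where "test_function \<phi> \<longleftrightarrow>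
    (\<forall>n. ((\<lambda>f t. vector_derivative f (at t)) ^^ n) \<phi> differentiable_on UNIV) \<and>
    compact (closure {t. \<phi> t \<noteq> 0}) \<and> closure {t. \<phi> t \<noteq> 0} \<subseteq> {0<..}"

(* Only the values of u on [0,infinity) matter. *)
definition is_solution ::
  "('a::complex_banach \<rightharpoonup> 'a) \<Rightarrow> complex \<Rightarrow> 'a \<Rightarrow> (real \<Rightarrow> 'a) \<Rightarrow> bool"
  where "is_solution A \<alpha> x u \<longleftrightarrow>
    continuous_on {0..} u \<and> bounded (u ` {0..}) \<and> u 0 = x \<and>
    (\<forall>t>0. u t \<in> dom A) \<and> L1_loc_pos (\<lambda>t. the (A (u t))) \<and>
    (\<forall>\<phi>. test_function \<phi> \<longrightarrow>
      Bochner_integral (lebesgue_on {0<..})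
        (\<lambda>t. vector_derivative (\<lambda>s. vector_derivative \<phi> (at s)) (at t) *\<^sub>C u t
           - vector_derivative (\<lambda>s. (1 - 2 * \<alpha>) / of_real s * \<phi> s) (at t) *\<^sub>C u t)
      = Bochner_integral (lebesgue_on {0<..}) (\<lambda>t. \<phi> t *\<^sub>C the (A (u t))))"

definition Neumann_limit ::
  "('a::complex_banach \<rightharpoonup> 'a) \<Rightarrow> complex \<Rightarrow> 'a \<Rightarrow> 'a \<Rightarrow> bool"
  where "Neumann_limit A \<alpha> x y \<longleftrightarrow>
    (\<exists>u. is_solution A \<alpha> x u \<and>
      ((\<lambda>t. - (complex_of_real t powr (1 - 2 * \<alpha>) *\<^sub>C vector_derivative u (at t)))
        \<longlongrightarrow> y) (at_right 0))"

definition Dirichlet_to_Neumann ::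
  "('a::complex_banach \<rightharpoonup> 'a) \<Rightarrow> complex \<Rightarrow> ('a \<rightharpoonup> 'a)"
  where "Dirichlet_to_Neumann A \<alpha> =
    (\<lambda>x. if \<exists>y. Neumann_limit A \<alpha> x y then Some (THE y. Neumann_limit A \<alpha> x y) else None)"

end

theory Submission
  imports Defs "HOL-Complex_Analysis.Complex_Analysis" "HOL-Real_Asymp.Real_Asymp"
begin

text \<open>In the coordinate \<open>w = ln t\<close> the equation is governed by the normalised Bessel kernel
\<open>V\<close>, that is \<open>z powr al * K\<^sub>al(z)\<close> scaled to tend to 1 at 0. Inserting \<open>A\<close> by a contour
integral over the boundary of a sector gives the solution \<open>u\<close> of \<open>(P\<^sub>x)\<close>, and its weighted
derivative is the analogous integral for a second Bessel kernel. If the Neumann limit \<open>y\<close> exists,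
integrating \<open>u\<close> against \<open>V\<close> with the weight of the equation yields a resolvent identity that
determines \<open>g(A)x\<close> and shows \<open>y = c A\<^sup>al x\<close>. Conversely, for \<open>x\<close> in the domain of the power,
multiplicativity of the contour calculus turns the weighted derivative into an approximate identity
applied to \<open>c A\<^sup>al x\<close>, so the limit exists.\<close>

text \<open>With \<open>t = exp ta\<close> and spectral parameter \<open>exp w\<close>, the argument
  \<open>t * sqrt (exp w)\<close> of the kernel becomes \<open>exp (ta + w / 2)\<close>, dilations
  become translations, and the boundary of a sector becomes two horizontal lines. The weighted
  resolvent \<open>rho w\<close>, which is \<open>exp w\<close> times the resolvent at
  \<open>exp w\<close>, is bounded there and absorbs the Jacobian, so every estimate is one of
  exponential decay on the real line. Two obstacles shape the proof. The spectrum may reach 0, where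
  \<open>V\<close> tends to 1 and absolute convergence of the contour integral is lost; a rational
  symbol with the same value at 0 is therefore split off and realised by a resolvent. And a solution
  is only weak, with \<open>A u\<close> merely locally integrable; \<open>Rone\<close>, the inverse
  of \<open>1 + A\<close>, turns the equation into one with continuous data, and its injectivity
  carries the regularity back to \<open>u\<close>. The constant is the quotient of the values at 0
  of the two unnormalised kernels, of orders \<open>1 - al\<close> and \<open>al\<close>. An
  arbitrary solution with a Neumann limit is treated, so the formula for that limit also shows that
  it is unique.\<close>

abbreviation (input) "IU \<equiv> integral (UNIV :: real set)"
abbreviation (input) "cr \<equiv> complex_of_real"
abbreviation (input) "cont \<equiv> continuous_on UNIV"
abbreviation (input) "ed e s \<equiv> exp (- e * \<bar>s\<bar> :: real)"
notation (input) has_vector_derivative (infix "hvd" 50)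

lemma continuous_on_Pair_left [continuous_intros]: "continuous_on S (Pair x)"
 using continuous_on_Pair[OF continuous_on_const continuous_on_id] by (simp add: id_def)

lemma continuous_on_Pair_right [continuous_intros]: "continuous_on S (%x. (x, y))"
 by (intro continuous_on_Pair continuous_on_const continuous_on_id)

section \<open>Exponentially decaying integrands on the real line: shift, domination, Fubini\<close>

lemma has_integral_UNIV_shift:
 fixes f :: "real => 'a::banach"
 assumes "(f has_integral I) UNIV"
 shows "((%x. f (x + c)) has_integral I) UNIV"
proof -
 have int: "f integrable_on {a..b}" for a b
  by (rule integrable_on_subinterval[OF has_integral_integrable[OF assms]]) simp
 have sh: "integral {a..b} (%x. f (x + c)) = integral {a + c..b + c} f"
  and shi: "(%x. f (x + c)) integrable_on {a..b}" for a b
 proof -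
  have "(f has_integral integral {a + c..b + c} f) {a + c..b + c}"
   using int by blast
  then have "((%x. f (x + c)) has_integral integral {a + c..b + c} f) {a..b}"
   using has_integral_shift_Icc_real[of f c "integral {a + c..b + c} f" a b]
   by (simp add: o_def add.commute)
  then show "integral {a..b} (%x. f (x + c)) = integral {a + c..b + c} f"
   "(%x. f (x + c)) integrable_on {a..b}"
   by (auto simp: integral_unique has_integral_integrable)
 qed
 show ?thesis
  unfolding has_integral_alt'[of _ _ UNIV]
 proof (intro conjI allI impI)
  fix e :: real assume "e > 0"
  then obtain B where B: "B > 0" "!!a b. ball 0 B \<subseteq> {a..b} ==> norm (integral {a..b} f - I) < e"
   using assms unfolding has_integral_alt'[of f I UNIV] by auto
  have "norm (integral {a..b} (%x. f (x + c)) - I) < e" if "ball 0 (B + \<bar>c\<bar>) \<subseteq> {a..b}" for a b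
  proof -
   have "ball 0 B \<subseteq> {a + c..b + c}"
   proof
    fix y :: real assume "y \<in> ball 0 B"
    then have "y - c \<in> ball 0 (B + \<bar>c\<bar>)" by (auto simp: dist_real_def)
    then show "y \<in> {a + c..b + c}" using that by auto
   qed
   then show ?thesis using B(2) by (simp add: sh)
  qed
  then show "\<exists>Ba>0. \<forall>a b. ball 0 Ba \<subseteq> cbox a b \<longrightarrow>
    norm (integral (cbox a b) (%x. if x \<in> UNIV then f (x + c) else 0) - I) < e"
   using B(1) by (intro exI[of _ "B + \<bar>c\<bar>"]) auto
 qed (use shi in auto)
qed

lemma integral_UNIV_shift:
 fixes f :: "real => 'a::banach"
 assumes "f integrable_on UNIV"
 shows "IU (%x. f (x + c)) = IU f"
 using has_integral_UNIV_shift[OF integrable_integral[OF assms]] by (rule integral_unique)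

lemma has_integral_UNIV_reflect:
 fixes f :: "real => 'a::banach"
 assumes "(f has_integral I) UNIV"
 shows "((%x. f (- x)) has_integral I) UNIV"
proof -
 have int: "f integrable_on {a..b}" for a b
  by (rule integrable_on_subinterval[OF has_integral_integrable[OF assms]]) simp
 have sh: "integral {a..b} (%x. f (- x)) = integral {-b..-a} f"
  and shi: "(%x. f (- x)) integrable_on {a..b}" for a b
 proof -
  have "(f has_integral integral {-b..-a} f) {-b..-a}"
   using int by blast
  from has_integral_reflect_lemma_real[OF this]
  show "integral {a..b} (%x. f (- x)) = integral {-b..-a} f" "(%x. f (- x)) integrable_on {a..b}"
   by (auto simp: integral_unique has_integral_integrable)
 qed
 show ?thesis
  unfolding has_integral_alt'[of _ _ UNIV]
 proof (intro conjI allI impI)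
  fix e :: real assume "e > 0"
  then obtain B where B: "B > 0" "!!a b. ball 0 B \<subseteq> {a..b} ==> norm (integral {a..b} f - I) < e"
   using assms unfolding has_integral_alt'[of f I UNIV] by auto
  have "norm (integral {a..b} (%x. f (- x)) - I) < e" if "ball 0 B \<subseteq> {a..b}" for a b
  proof -
   have "ball 0 B \<subseteq> {-b..-a}"
   proof
    fix y :: real assume "y \<in> ball 0 B"
    then have "- y \<in> ball 0 B" by (auto simp: dist_real_def)
    then have "- y \<in> {a..b}" using that by blast
    then show "y \<in> {-b..-a}" by auto
   qed
   then show ?thesis using B(2) by (simp add: sh)
  qed
  then show "\<exists>Ba>0. \<forall>a b. ball 0 Ba \<subseteq> cbox a b \<longrightarrow>
    norm (integral (cbox a b) (%x. if x \<in> UNIV then f (- x) else 0) - I) < e"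
   using B(1) by (intro exI[of _ B]) auto
 qed (use shi in auto)
qed

lemma exp_abs_has_integral:
 fixes ep x :: real
 assumes "ep > 0"
 shows "((%s. exp (- ep * \<bar>s - x\<bar>)) has_integral (2 / ep)) UNIV"
proof -
 let ?f = "%s::real. if s \<in> {0..} then exp (- ep * s) else 0"
 have f: "(?f has_integral 1 / ep) UNIV"
  using has_integral_exp_minus_to_infinity[OF assms, of 0]
  unfolding has_integral_restrict_UNIV by simp
 have "((%s. ?f s + ?f (- s)) has_integral (1 / ep + 1 / ep)) UNIV"
  by (intro has_integral_add f has_integral_UNIV_reflect[of ?f])
 then have "((%s. ed ep s) has_integral (1 / ep + 1 / ep)) UNIV"
  by (rule has_integral_spike[of "{0}", rotated 2]) auto
 from has_integral_UNIV_shift[OF this, of "- x"] show ?thesis by simp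
qed

lemma exp_decay_integrable:
 fixes h :: "real => 'b::banach"
 assumes cont: "cont h" and eps: "ep > 0"
  and bound: "!!s. norm (h s) <= C * exp (- ep * \<bar>s - x\<bar>)"
 shows "h integrable_on UNIV" "norm (IU h) <= C * (2 / ep)"
proof -
 have g: "((%s. C * exp (- ep * \<bar>s - x\<bar>)) has_integral C * (2 / ep)) UNIV"
  by (intro has_integral_mult_right exp_abs_has_integral eps)
 show h: "h integrable_on UNIV"
 proof (rule integrable_on_all_intervals_integrable_bound[where g = "%s. C * exp (- ep * \<bar>s - x\<bar>)"])
  show "(%x. if x \<in> UNIV then h x else 0) integrable_on cbox a b" for a b
   by (simp add: integrable_continuous_interval continuous_on_subset[OF cont])
 qed (use bound g in \<open>auto simp: integrable_on_def\<close>)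
 show "norm (IU h) <= C * (2 / ep)"
  using integral_norm_bound_integral[OF h has_integral_integrable[OF g]] bound
  unfolding integral_unique[OF g] by blast
qed

text \<open>Half of the rate is traded for the factor \<open>exp (- ep * n / 2)\<close> outside
  \<open>{-n..n}\<close>. The other half keeps the integrand integrable, which is where
  \<open>4 / ep = 2 / (ep / 2)\<close> comes from.\<close>

lemma exp_decay_tail:
 fixes h :: "real => 'b::banach"
 assumes cont: "cont h" and eps: "ep > 0" and n: "n \<ge> 0"
  and bound: "!!s. norm (h s) <= C * ed ep s"
 shows "norm (IU h - integral {-n..n} h) <= C * (4 / ep) * exp (- ep * n / 2)"
proof -
 have C: "C \<ge> 0" using order_trans[OF norm_ge_zero bound[of 0]] by simp
 have h: "h integrable_on UNIV"
  using exp_decay_integrable(1)[of h ep C 0] assms by simp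
 have hn: "h integrable_on {-n..n}"
  by (intro integrable_continuous_interval continuous_on_subset[OF cont]) auto
 let ?g = "%s. h s - (if s \<in> {-n..n} then h s else 0)"
 have g: "(?g has_integral (IU h - integral {-n..n} h)) UNIV"
 proof -
  have "((%s. if s \<in> {-n..n} then h s else 0) has_integral integral {-n..n} h) UNIV"
   using integrable_integral[OF hn] by (simp only: has_integral_restrict_UNIV)
  from has_integral_diff[OF integrable_integral[OF h] this] show ?thesis .
 qed
 have e: "((%s. C * exp (- ep * n / 2) * exp (- (ep/2) * \<bar>s - 0\<bar>)) has_integral
   C * exp (- ep * n / 2) * (2 / (ep/2))) UNIV"
  using eps by (intro has_integral_mult_right exp_abs_has_integral) auto
 have b: "norm (?g s) <= C * exp (- ep * n / 2) * exp (- (ep/2) * \<bar>s - 0\<bar>)" for s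
 proof (cases "s \<in> {-n..n}")
  case False
  then have "\<bar>s\<bar> \<ge> n" by auto
  then have "ed ep s <= exp (- ep * n / 2 - (ep/2) * \<bar>s\<bar>)"
   using eps by (simp add: field_simps)
  then have "C * ed ep s <= C * (exp (- ep * n / 2) * exp (- (ep/2) * \<bar>s\<bar>))"
   using C by (intro mult_left_mono) (simp_all add: exp_add[symmetric])
  moreover have "norm (?g s) = norm (h s)" using False by (simp only: if_False diff_zero)
  ultimately show ?thesis using bound[of s] by (simp add: mult.assoc)
 qed (use C in auto)
 have "norm (IU h - integral {-n..n} h) <= C * exp (- ep * n / 2) * (2 / (ep/2))"
  using integral_norm_bound_integral[OF has_integral_integrable[OF g] has_integral_integrable[OF e] b]
  by (simp only: integral_unique[OF g] integral_unique[OF e])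
 then show ?thesis by (simp add: mult.commute mult.left_commute)
qed

lemma tail_tendsto_0: "(ep::real) > 0 ==> (%n. K * exp (- ep * real n / 2)) \<longlonglongrightarrow> 0"
proof -
 assume "ep > 0"
 then have "(%n. exp (- ep * real n / 2)) \<longlonglongrightarrow> 0" by real_asymp
 from tendsto_mult_right_zero[OF this] show ?thesis .
qed

lemma exp_decay_tendsto:
 fixes h :: "real => 'b::banach"
 assumes "cont h" "ep > 0" "!!s. norm (h s) <= C * ed ep s"
 shows "(%n. integral {- real n..real n} h) \<longlonglongrightarrow> IU h"
proof -
 have "(%n. integral {- real n..real n} h - IU h) \<longlonglongrightarrow> 0"
 proof (rule Lim_null_comparison[OF _ tail_tendsto_0[OF assms(2)]], intro always_eventually allI)
  fix n show "norm (integral {- real n..real n} h - IU h)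
    <= C * (4 / ep) * exp (- ep * real n / 2)"
   by (subst norm_minus_commute, rule exp_decay_tail[OF assms(1,2) _ assms(3)]) simp
 qed
 then show ?thesis by (rule LIM_zero_cancel)
qed

text \<open>The values lie in a Banach space, so dominated convergence is applied to the real
  functions \<open>norm (h k s - g s)\<close>, whose integrals bound the difference of the vector
  integrals.\<close>

lemma exp_decay_dominated:
 fixes h :: "nat => real => 'b::banach"
 assumes cont: "!!k. cont (h k)" and contg: "cont g" and eps: "ep > 0"
  and bound: "!!k s. norm (h k s) <= C * exp (- ep * \<bar>s - x\<bar>)"
  and conv: "!!s. (%k. h k s) \<longlonglongrightarrow> g s"
 shows "(%k. IU (h k)) \<longlonglongrightarrow> IU g"
proof -
 have bg: "norm (g s) <= C * exp (- ep * \<bar>s - x\<bar>)" for s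
  by (rule tendsto_upperbound[OF tendsto_norm[OF conv[of s]]]) (use bound in auto)
 have hi: "h k integrable_on UNIV" and gi: "g integrable_on UNIV" for k
  using exp_decay_integrable(1)[OF cont eps bound] exp_decay_integrable(1)[OF contg eps bg] by auto
 have nb: "norm (h k s - g s) <= (2 * C) * exp (- ep * \<bar>s - x\<bar>)" for k s
  using norm_triangle_ineq4[of "h k s" "g s"] bound[of k s] bg[of s] by linarith
 have ni: "(%s. norm (h k s - g s)) integrable_on UNIV" for k
  by (rule exp_decay_integrable(1)[OF _ eps, of _ "2 * C" x])
   (use nb cont contg in \<open>auto intro!: continuous_intros\<close>)
 have "(%k. IU (%s. norm (h k s - g s))) \<longlonglongrightarrow> IU (%s::real. 0::real)"
 proof (rule dominated_convergence(2)[where h = "%s. (2 * C) * exp (- ep * \<bar>s - x\<bar>)"])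
  show "(%s. 2 * C * exp (- ep * \<bar>s - x\<bar>)) integrable_on UNIV"
   by (rule has_integral_integrable[OF has_integral_mult_right[OF exp_abs_has_integral[OF eps]]])
  show "(%k. norm (h k s - g s)) \<longlonglongrightarrow> 0" for s
   using conv[of s] by (simp add: LIM_zero_iff tendsto_norm_zero)
  show "norm (norm (h k s - g s)) <= 2 * C * exp (- ep * \<bar>s - x\<bar>)" for k s
   using nb by simp
 qed (use ni in auto)
 then have lim: "(%k. IU (%s. norm (h k s - g s))) \<longlonglongrightarrow> 0" by simp
 have "norm (IU (h k) - IU g) <= IU (%s. norm (h k s - g s))" for k
  using integral_norm_bound_integral[OF integrable_diff[OF hi[of k] gi] ni[of k]]
  by (simp add: integral_diff[OF hi gi])
 then have "(%k. IU (h k) - IU g) \<longlonglongrightarrow> 0"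
  by (rule Lim_null_comparison[OF always_eventually[OF allI] lim])
 then show ?thesis by (rule LIM_zero_cancel)
qed

lemma exp_decay_continuous:
 fixes h :: "'p::metric_space => real => 'b::banach"
 assumes cont: "!!p. p \<in> P ==> cont (h p)" and eps: "ep > 0"
  and bound: "!!p s. p \<in> P ==> norm (h p s) <= C * ed ep s"
  and contp: "!!s. continuous_on P (%p. h p s)"
 shows "continuous_on P (%p. IU (h p))"
 unfolding continuous_on_sequentially
proof (intro allI ballI impI, elim conjE)
 fix X a assume a: "a \<in> P" "\<forall>n. X n \<in> P" "X \<longlonglongrightarrow> a"
 show "((%p. IU (h p)) \<circ> X) \<longlonglongrightarrow> IU (h a)"
  unfolding o_def
 proof (rule exp_decay_dominated[OF _ _ eps, where x = 0 and C = C])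
  show "(%k. h (X k) s) \<longlonglongrightarrow> h a s" for s
   using contp[of s, unfolded continuous_on_sequentially, rule_format, of a X] a by (simp add: o_def)
 qed (use a cont bound in auto)
qed

text \<open>Fubini for continuous functions on the rectangle \<open>{a..b}\<close> times
  \<open>{-n..n}\<close>, combined with tail estimates uniform in \<open>t\<close>: both sides
  differ from the common truncated integral by a multiple of
  \<open>exp (- ep * n / 2)\<close>.\<close>

lemma exp_decay_swap_Icc:
 fixes h :: "real => real => 'b::banach"
 assumes cont: "continuous_on ({a..b} \<times> UNIV) (%(t, s). h t s)" and eps: "ep > 0"
  and bound: "!!t s. t \<in> {a..b} ==> norm (h t s) <= C * ed ep s"
 shows "integral {a..b} (%t. IU (h t)) = IU (%s. integral {a..b} (%t. h t s))"
proof (cases "a <= b")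
 case True
 have ct: "cont (h t)" if "t \<in> {a..b}" for t
  using continuous_on_compose2[OF cont continuous_on_Pair_left[of UNIV t]] that by (simp add: image_subset_iff)
 have cs: "continuous_on {a..b} (%t. h t s)" for s
  using continuous_on_compose2[OF cont continuous_on_Pair_right[of "{a..b}" s]] by (simp add: image_subset_iff)
 have cI: "continuous_on {a..b} (%t. IU (h t))"
  by (rule exp_decay_continuous[OF ct eps bound cs])
 have swapcont: "continuous_on (UNIV \<times> cbox a b) (%(s, t). h t s)"
  using continuous_on_compose2[OF cont continuous_on_swap[of "UNIV \<times> cbox a b"]]
  by (simp add: case_prod_unfold image_subset_iff)
 have cJ: "cont (%s. integral {a..b} (%t. h t s))"
  using integral_continuous_on_param[OF swapcont] by simp
 have bJ: "norm (integral {a..b} (%t. h t s)) <= C * (b - a) * ed ep s" for s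
  using integral_bound[OF True cs, of s "C * ed ep s"] bound by (simp add: algebra_simps)
 let ?L = "integral {a..b} (%t. IU (h t))"
 let ?R = "IU (%s. integral {a..b} (%t. h t s))"
 have "norm (?L - ?R) <= 2 * C * (b - a) * (4 / ep) * exp (- ep * real n / 2)" for n :: nat
 proof -
  let ?Ln = "integral {a..b} (%t. integral {-real n..real n} (h t))"
  let ?Rn = "integral {-real n..real n} (%s. integral {a..b} (%t. h t s))"
  have "?Ln = ?Rn"
  proof -
   have "continuous_on (cbox (a, - real n) (b, real n)) (%(t, s). h t s)"
    by (rule continuous_on_subset[OF cont]) auto
   from integral_swap_continuous[OF this] show ?thesis by simp
  qed
  moreover have cLn: "continuous_on {a..b} (%t. integral {-real n..real n} (h t))"
  proof -
   have "continuous_on ({a..b} \<times> cbox (- real n) (real n)) (%(t, s). h t s)"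
    by (rule continuous_on_subset[OF cont]) auto
   from integral_continuous_on_param[OF this] show ?thesis by simp
  qed
  moreover have "norm (?L - ?Ln) <= (b - a) * (C * (4 / ep) * exp (- ep * real n / 2))"
  proof -
   have "?L - ?Ln = integral {a..b} (%t. IU (h t) - integral {-real n..real n} (h t))"
    by (intro integral_diff[symmetric] integrable_continuous_interval cI cLn)
   also have "norm ... <= (C * (4 / ep) * exp (- ep * real n / 2)) * (b - a)"
   proof (rule integral_bound[OF True continuous_on_diff[OF cI cLn]])
    fix t assume t: "t \<in> {a..b}"
    show "norm (IU (h t) - integral {- real n..real n} (h t))
      <= C * (4 / ep) * exp (- ep * real n / 2)"
     by (rule exp_decay_tail[OF ct[OF t] eps _ bound[OF t]]) simp
   qed
   finally show ?thesis by (simp add: mult.commute)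
  qed
  moreover have "norm (?R - ?Rn) <= C * (b - a) * (4 / ep) * exp (- ep * real n / 2)"
   by (rule exp_decay_tail[OF cJ eps _ bJ]) auto
  moreover have "norm (?L - ?R) <= norm (?L - ?Ln) + norm (?R - ?Rn)"
   using norm_triangle_ineq4[of "?L - ?Ln" "?R - ?Rn"] \<open>?Ln = ?Rn\<close> by simp
  moreover have "2 * C * (b - a) * (4 / ep) * exp (- ep * real n / 2)
    = (b - a) * (C * (4 / ep) * exp (- ep * real n / 2)) + C * (b - a) * (4 / ep) * exp (- ep * real n / 2)"
   by (simp only: mult_ac) simp
  ultimately show ?thesis by linarith
 qed
 then have "norm (?L - ?R) <= 0"
  by (intro LIMSEQ_le_const[OF tail_tendsto_0[OF eps]]) blast
 then show ?thesis by simp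
qed simp

text \<open>The outer integral is truncated to \<open>{-n..n}\<close>, where the half-compact case
  applies. The product bound dominates the truncated inner integrals uniformly in \<open>n\<close>,
  so the truncation can be removed on both sides.\<close>

lemma exp_decay_swap:
 fixes h :: "real => real => 'b::banach"
 assumes cont: "cont (%(t, s). h t s)" and eps: "ep > 0" and C: "C \<ge> 0"
  and bound: "!!t s. norm (h t s) <= C * ed ep t * ed ep s"
 shows "IU (%t. IU (h t)) = IU (%s. IU (%t. h t s))"
  "(%t. IU (h t)) integrable_on UNIV" "(%s. IU (%t. h t s)) integrable_on UNIV"
proof -
 have ct: "cont (h t)" for t
  using continuous_on_compose2[OF cont continuous_on_Pair_left[of UNIV t]] by simp
 have cs: "cont (%t. h t s)" for s
  using continuous_on_compose2[OF cont continuous_on_Pair_right[of UNIV s]] by simp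
 have b1: "norm (h t s) <= C * ed ep s" for t s
 proof -
  have "C * ed ep t * ed ep s <= C * 1 * ed ep s"
   using eps C by (intro mult_right_mono mult_left_mono) auto
  then show ?thesis using bound[of t s] by simp
 qed
 have b2: "norm (h t s) <= C * ed ep t" for t s
 proof -
  have "C * ed ep t * ed ep s <= C * ed ep t * 1"
   using eps C by (intro mult_left_mono) auto
  then show ?thesis using bound[of t s] by simp
 qed
 have c1: "cont (%t. IU (h t))"
  by (rule exp_decay_continuous[OF ct eps b1 cs])
 have c2: "cont (%s. IU (%t. h t s))"
  by (rule exp_decay_continuous[OF cs eps b2 ct])
 have B1: "norm (IU (h t)) <= C * (2 / ep) * ed ep t" for t
 proof -
  have "norm (h t s) <= C * ed ep t * exp (- ep * \<bar>s - 0\<bar>)" for s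
   using bound[of t s] by simp
  from exp_decay_integrable(2)[OF ct eps this] show ?thesis by (simp add: mult_ac)
 qed
 have l1: "(%n. integral {- real n..real n} (%t. IU (h t)))
   \<longlonglongrightarrow> IU (%t. IU (h t))"
  by (rule exp_decay_tendsto[OF c1 eps B1])
 have sw: "integral {- real n..real n} (%t. IU (h t))
   = IU (%s. integral {- real n..real n} (%t. h t s))" for n
  by (rule exp_decay_swap_Icc[OF _ eps b1]) (rule continuous_on_subset[OF cont], auto)
 have swapcont: "continuous_on (UNIV \<times> cbox a b) (%(s, t). h t s)" for a b
  using continuous_on_compose2[OF cont continuous_on_swap[of "UNIV \<times> cbox a b"]]
  by (simp add: case_prod_unfold image_subset_iff)
 have cJ: "cont (%s. integral {a..b} (%t. h t s))" for a b
  using integral_continuous_on_param[OF swapcont] by simp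
 have "(%n. IU (%s. integral {- real n..real n} (%t. h t s)))
   \<longlonglongrightarrow> IU (%s. IU (%t. h t s))"
 proof (rule exp_decay_dominated[OF cJ c2 eps, of _ _ "C * (2 / ep)" 0])
  fix k s
  have "norm (integral {- real k..real k} (%t. h t s))
    <= integral {- real k..real k} (%t. C * ed ep s * exp (- ep * \<bar>t - 0\<bar>))"
  proof (rule integral_norm_bound_integral)
   show "(%t. h t s) integrable_on {- real k..real k}"
    by (rule integrable_continuous_interval[OF continuous_on_subset[OF cs]]) simp
   show "(%t. C * ed ep s * exp (- ep * \<bar>t - 0\<bar>)) integrable_on {- real k..real k}"
    by (intro integrable_continuous_interval continuous_intros)
  qed (use bound in \<open>simp add: mult_ac\<close>)
  also have "... <= IU (%t. C * ed ep s * exp (- ep * \<bar>t - 0\<bar>))"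
  proof (rule integral_subset_le)
   show "(%t. C * ed ep s * exp (- ep * \<bar>t - 0\<bar>)) integrable_on {- real k..real k}"
    by (intro integrable_continuous_interval continuous_intros)
   show "(%t. C * ed ep s * exp (- ep * \<bar>t - 0\<bar>)) integrable_on UNIV"
    by (rule has_integral_integrable[OF has_integral_mult_right[OF exp_abs_has_integral[OF eps]]])
  qed (use C in simp_all)
  also have "... = C * ed ep s * (2 / ep)"
   by (rule integral_unique[OF has_integral_mult_right[OF exp_abs_has_integral[OF eps]]])
  finally show "norm (integral {- real k..real k} (%t. h t s)) <= C * (2 / ep) * exp (- ep * \<bar>s - 0\<bar>)"
   by (simp add: mult_ac)
 next
  show "(%k. integral {- real k..real k} (%t. h t s)) \<longlonglongrightarrow> IU (%t. h t s)" for s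
   by (rule exp_decay_tendsto[OF cs eps b2])
 qed
 from LIMSEQ_unique[OF l1[unfolded sw] this]
 show "IU (%t. IU (h t)) = IU (%s. IU (%t. h t s))" .
 show "(%t. IU (h t)) integrable_on UNIV"
  by (rule exp_decay_integrable(1)[OF c1 eps, where x = 0 and C = "C * (2 / ep)"]) (use B1 in simp)
 have "norm (IU (%t. h t s)) <= C * (2 / ep) * exp (- ep * \<bar>s - 0\<bar>)" for s
 proof -
  have "norm (h t s) <= C * ed ep s * exp (- ep * \<bar>t - 0\<bar>)" for t
   using bound[of t s] by (simp add: mult_ac)
  from exp_decay_integrable(2)[OF cs eps this] show ?thesis by (simp add: mult_ac)
 qed
 from exp_decay_integrable(1)[OF c2 eps this] show "(%s. IU (%t. h t s)) integrable_on UNIV" .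
qed

section \<open>Cauchy's theorem and Cauchy's formula in horizontal strips\<close>

lemma has_vector_derivative_Complex_Re:
 assumes "(F has_field_derivative d) (at (Complex s ps))"
 shows "((%s. F (Complex s ps)) hvd d) (at s)"
proof -
 have "((%s. Complex s ps) hvd 1) (at s)"
  unfolding Complex_eq by (auto intro!: derivative_eq_intros)
 from field_vector_diff_chain_at[OF this assms] show ?thesis by (simp add: o_def)
qed

lemma has_vector_derivative_Complex_Im:
 assumes "(F has_field_derivative d) (at (Complex s ps))"
 shows "((%ps. F (Complex s ps)) hvd \<i> * d) (at ps)"
proof -
 have "((%ps. Complex s ps) hvd \<i>) (at ps)"
  unfolding Complex_eq by (auto intro!: derivative_eq_intros simp: mult.commute)
 from field_vector_diff_chain_at[OF this assms] show ?thesis by (simp add: o_def)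
qed

lemma continuous_on_Complex [continuous_intros]:
 assumes "continuous_on S f" "continuous_on S g"
 shows "continuous_on S (%x. Complex (f x) (g x))"
 unfolding Complex_eq using assms by (intro continuous_intros)

text \<open>\<open>I\<close> stands for multiplication by the imaginary unit, so \<open>dS\<close>
  and \<open>dP\<close> together are the Cauchy-Riemann equation of a vector-valued
  \<open>H\<close>. Both sides are the integral of \<open>I (D w)\<close> over the rectangle,
  evaluated in the two orders.\<close>

lemma rectangle_shift:
 fixes H D :: "complex => 'b::banach"
 assumes ab: "a <= b" and pq: "p <= q" and I: "bounded_linear I"
  and dS: "!!s ps. s \<in> {a..b} ==> ps \<in> {p..q} ==>
   ((%s. H (Complex s ps)) hvd D (Complex s ps)) (at s)"
  and dP: "!!s ps. s \<in> {a..b} ==> ps \<in> {p..q} ==>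
   ((%ps. H (Complex s ps)) hvd I (D (Complex s ps))) (at ps)"
  and cont: "continuous_on {w. Re w \<in> {a..b} \<and> Im w \<in> {p..q}} D"
 shows "integral {a..b} (%s. H (Complex s q)) - integral {a..b} (%s. H (Complex s p))
  = integral {p..q} (%ps. I (H (Complex b ps) - H (Complex a ps)))"
proof -
 interpret I: bounded_linear I by fact
 have int: "(%s. H (Complex s ps)) integrable_on {a..b}" if "ps \<in> {p..q}" for ps
  by (intro integrable_continuous_interval continuous_at_imp_continuous_on ballI
    has_vector_derivative_continuous[OF dS] that)
 have cD: "continuous_on ({a..b} \<times> {p..q}) (%(s, ps). D (Complex s ps))"
  unfolding case_prod_unfold
  by (rule continuous_on_compose2[OF cont]) (auto intro!: continuous_intros)
 have cDs: "(%s. D (Complex s ps)) integrable_on {a..b}" if "ps \<in> {p..q}" for ps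
  by (intro integrable_continuous_interval continuous_on_compose2[OF cont])
   (use that in \<open>auto intro!: continuous_intros\<close>)
 have 1: "H (Complex s q) - H (Complex s p) = integral {p..q} (%ps. I (D (Complex s ps)))" if "s \<in> {a..b}" for s
  using fundamental_theorem_of_calculus[OF pq, of "%ps. H (Complex s ps)" "%ps. I (D (Complex s ps))"]
   has_vector_derivative_at_within[OF dP[OF that]] by (simp add: integral_unique)
 have 2: "H (Complex b ps) - H (Complex a ps) = integral {a..b} (%s. D (Complex s ps))" if "ps \<in> {p..q}" for ps
  using fundamental_theorem_of_calculus[OF ab, of "%s. H (Complex s ps)" "%s. D (Complex s ps)"]
   has_vector_derivative_at_within[OF dS[OF _ that]] by (simp add: integral_unique)
 have "integral {a..b} (%s. H (Complex s q)) - integral {a..b} (%s. H (Complex s p))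
   = integral {a..b} (%s. H (Complex s q) - H (Complex s p))"
  using pq by (intro integral_diff[symmetric] int) auto
 also have "... = integral {a..b} (%s. integral {p..q} (%ps. I (D (Complex s ps))))"
  by (intro integral_cong 1)
 also have "... = integral {p..q} (%ps. integral {a..b} (%s. I (D (Complex s ps))))"
 proof -
  have "continuous_on (cbox (a, p) (b, q)) (%(s, ps). I (D (Complex s ps)))"
   using I.continuous_on[OF cD] by (simp add: case_prod_unfold cbox_Pair_eq)
  from integral_swap_continuous[OF this] show ?thesis by simp
 qed
 also have "... = integral {p..q} (%ps. I (H (Complex b ps) - H (Complex a ps)))"
 proof (intro integral_cong)
  fix ps assume ps: "ps \<in> {p..q}"
  show "integral {a..b} (%s. I (D (Complex s ps))) = I (H (Complex b ps) - H (Complex a ps))"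
   unfolding 2[OF ps] using integral_linear[OF cDs[OF ps] I] by (simp add: o_def)
 qed
 finally show ?thesis .
qed

text \<open>The integrand may have nonzero limits \<open>L\<close> and \<open>L'\<close> at the two
  ends of the strip. The vertical sides then survive in the limit, each with its length
  \<open>q - p\<close> as weight; these terms later add up to the full angle
  \<open>2 * pi\<close>.\<close>

lemma rectangle_shift_limit:
 fixes H D :: "complex => 'b::banach"
 assumes pq: "p <= q" and I: "bounded_linear I"
  and dS: "!!s ps. ps \<in> {p..q} ==>
   ((%s. H (Complex s ps)) hvd D (Complex s ps)) (at s)"
  and dP: "!!s ps. ps \<in> {p..q} ==>
   ((%ps. H (Complex s ps)) hvd I (D (Complex s ps))) (at ps)"
  and cont: "continuous_on {w. Im w \<in> {p..q}} D"
  and right: "!!n ps. ps \<in> {p..q} ==> n \<ge> N ==> norm (H (Complex (real n) ps) - L) <= e n"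
  and left: "!!n ps. ps \<in> {p..q} ==> n \<ge> N ==> norm (H (Complex (- real n) ps) - L') <= e n"
  and e: "e \<longlonglongrightarrow> 0"
 shows "(%n. integral {- real n..real n} (%s. H (Complex s q))
   - integral {- real n..real n} (%s. H (Complex s p))) \<longlonglongrightarrow> (q - p) *\<^sub>R I (L - L')"
proof -
 interpret I: bounded_linear I by fact
 obtain K where K: "K > 0" "!!x. norm (I x) <= norm x * K" using I.pos_bounded by blast
 have eq: "integral {- real n..real n} (%s. H (Complex s q)) - integral {- real n..real n} (%s. H (Complex s p))
  = integral {p..q} (%ps. I (H (Complex (real n) ps) - H (Complex (- real n) ps)))" for n
  by (rule rectangle_shift[OF _ pq I dS dP]) (auto intro: continuous_on_subset[OF cont])
 have "norm (integral {p..q} (%ps. I (H (Complex (real n) ps) - H (Complex (- real n) ps)))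
   - (q - p) *\<^sub>R I (L - L')) <= 2 * K * (q - p) * e n" if n: "n \<ge> N" for n
 proof -
  have ci: "continuous_on {p..q} (%ps. H (Complex s ps))" for s
   by (intro continuous_at_imp_continuous_on ballI has_vector_derivative_continuous[OF dP])
  have cI: "continuous_on {p..q} (%ps. I (H (Complex (real n) ps) - H (Complex (- real n) ps)))"
   by (intro I.continuous_on continuous_on_diff ci)
  have "integral {p..q} (%ps. I (H (Complex (real n) ps) - H (Complex (- real n) ps))) - (q - p) *\<^sub>R I (L - L')
   = integral {p..q} (%ps. I (H (Complex (real n) ps) - H (Complex (- real n) ps)) - I (L - L'))"
   using pq by (subst integral_diff[OF integrable_continuous_interval[OF cI]]) auto
  also have "norm ... <= (2 * K * e n) * (q - p)"
  proof (rule integral_bound[OF pq continuous_on_diff[OF cI continuous_on_const]])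
   fix ps assume ps: "ps \<in> {p..q}"
   have "I (H (Complex (real n) ps) - H (Complex (- real n) ps)) - I (L - L')
    = I ((H (Complex (real n) ps) - L) - (H (Complex (- real n) ps) - L'))"
    by (simp add: I.diff I.add)
   also have "norm ... <= norm ((H (Complex (real n) ps) - L) - (H (Complex (- real n) ps) - L')) * K"
    by (rule K(2))
   also have "... <= (e n + e n) * K"
    using K(1) add_mono[OF right[OF ps n] left[OF ps n]]
    by (intro mult_right_mono order_trans[OF norm_triangle_ineq4]) auto
   finally show "norm (I (H (Complex (real n) ps) - H (Complex (- real n) ps)) - I (L - L')) <= 2 * K * e n"
    by (simp add: algebra_simps)
  qed
  finally show ?thesis by (simp add: algebra_simps)
 qed
 then have ev: "\<forall>\<^sub>F n in sequentially. norm (integral {p..q} (%ps. I (H (Complex (real n) ps) - H (Complex (- real n) ps)))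
   - (q - p) *\<^sub>R I (L - L')) <= 2 * K * (q - p) * e n"
  unfolding eventually_sequentially by blast
 have "(%n. integral {p..q} (%ps. I (H (Complex (real n) ps) - H (Complex (- real n) ps)))
   - (q - p) *\<^sub>R I (L - L')) \<longlonglongrightarrow> 0"
  by (rule Lim_null_comparison[OF ev tendsto_mult_right_zero[OF e]])
 then have "(%n. integral {p..q} (%ps. I (H (Complex (real n) ps) - H (Complex (- real n) ps))))
  \<longlonglongrightarrow> (q - p) *\<^sub>R I (L - L')" by (rule LIM_zero_cancel)
 then show ?thesis unfolding eq .
qed

lemma rectangle_shift_limit_holomorphic:
 fixes F :: "complex => complex"
 assumes pq: "p <= q" and hol: "F holomorphic_on S" "open S" "{w. Im w \<in> {p..q}} \<subseteq> S"
  and right: "!!n ps. ps \<in> {p..q} ==> n \<ge> N ==> norm (F (Complex (real n) ps) - L) <= e n"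
  and left: "!!n ps. ps \<in> {p..q} ==> n \<ge> N ==> norm (F (Complex (- real n) ps) - L') <= e n"
  and e: "e \<longlonglongrightarrow> 0"
 shows "(%n. integral {- real n..real n} (%s. F (Complex s q))
   - integral {- real n..real n} (%s. F (Complex s p))) \<longlonglongrightarrow> of_real (q - p) * (\<i> * (L - L'))"
proof -
 have d: "(F has_field_derivative deriv F (Complex s ps)) (at (Complex s ps))" if "ps \<in> {p..q}" for s ps
  by (rule holomorphic_derivI[OF hol(1,2)]) (use hol(3) that in auto)
 have c: "continuous_on {w. Im w \<in> {p..q}} (deriv F)"
  by (rule continuous_on_subset[OF holomorphic_on_imp_continuous_on[OF holomorphic_deriv[OF hol(1,2)]] hol(3)])
 from rectangle_shift_limit[OF pq bounded_linear_mult_right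
   has_vector_derivative_Complex_Re[OF d] has_vector_derivative_Complex_Im[OF d] c right left e]
 show ?thesis by (simp add: scaleR_conv_of_real)
qed

text \<open>The arguments of \<open>exp w\<close> and \<open>exp w0\<close> differ by at least
  \<open>et\<close> modulo \<open>2 * pi\<close>. With \<open>r\<close> the quotient of the moduli,
  the law of cosines bounds the squared distance, relative to \<open>exp (Re w0)\<close>, below by
  \<open>r\<^sup>2 - 2 * r * cos et + 1\<close>; completing the square in two ways leaves
  \<open>(sin et)\<^sup>2\<close> or \<open>(r * sin et)\<^sup>2\<close>.\<close>

lemma exp_diff_lower_bound:
 assumes et: "0 < et" "et <= pi / 2" and w: "et <= \<bar>Im w - Im w0\<bar>" "\<bar>Im w - Im w0\<bar> <= 2 * pi - et"
 shows "sin et * exp (Re w) <= cmod (exp w - exp w0)" "sin et * exp (Re w0) <= cmod (exp w - exp w0)"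
proof -
 define th where "th = \<bar>Im w - Im w0\<bar>"
 define r where "r = exp (Re w - Re w0)"
 define c where "c = cos th"
 have r: "r > 0" by (simp add: r_def)
 have c: "c <= cos et"
 proof (cases "th <= pi")
  case True
  then show ?thesis unfolding c_def using et w by (intro cos_monotone_0_pi_le) (auto simp: th_def)
 next
  case False
  have "cos (2 * pi - th) <= cos et"
   using False et w by (intro cos_monotone_0_pi_le) (auto simp: th_def)
  then show ?thesis by (simp add: c_def cos_2pi_minus)
 qed
 have c0: "0 <= cos et" using et by (intro cos_ge_zero) auto
 have s0: "0 < sin et" using et by (intro sin_gt_zero) auto
 have nrm: "(cmod (exp w - exp w0))\<^sup>2 = (exp (Re w0))\<^sup>2 * (r\<^sup>2 - 2 * r * c + 1)"
 proof -
  have "exp w - exp w0 = exp w0 * (exp (w - w0) - 1)" by (simp add: exp_diff algebra_simps)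
  then have "cmod (exp w - exp w0) = exp (Re w0) * cmod (exp (w - w0) - 1)" by (simp add: norm_mult)
  moreover have "(cmod (exp (w - w0) - 1))\<^sup>2 = r\<^sup>2 - 2 * r * c + 1"
  proof -
   have "c = cos (Im w - Im w0)" unfolding c_def th_def by (simp add: cos_abs_real)
   then have "(cmod (exp (w - w0) - 1))\<^sup>2 = (r * c - 1)\<^sup>2 + (r * sin (Im w - Im w0))\<^sup>2"
    by (simp add: cmod_power2 Re_exp Im_exp r_def)
   also have "... = r\<^sup>2 * (c\<^sup>2 + (sin (Im w - Im w0))\<^sup>2) - 2 * r * c + 1"
    by (simp add: power2_eq_square algebra_simps)
   also have "c\<^sup>2 + (sin (Im w - Im w0))\<^sup>2 = 1"
    by (simp add: \<open>c = cos (Im w - Im w0)\<close>)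
   finally show ?thesis by simp
  qed
  ultimately show ?thesis by (simp add: power_mult_distrib)
 qed
 have q: "r\<^sup>2 - 2 * r * cos et + 1 <= r\<^sup>2 - 2 * r * c + 1" using c r by simp
 have s2: "(sin et)\<^sup>2 = 1 - (cos et)\<^sup>2" by (simp add: sin_squared_eq)
 have "(sin et)\<^sup>2 <= r\<^sup>2 - 2 * r * cos et + 1"
  using zero_le_power2[of "r - cos et"] by (simp add: s2 power2_diff algebra_simps)
 with q have "(sin et)\<^sup>2 <= r\<^sup>2 - 2 * r * c + 1" by linarith
 then have "(sin et * exp (Re w0))\<^sup>2 <= (cmod (exp w - exp w0))\<^sup>2"
  unfolding nrm by (simp add: power_mult_distrib mult.commute mult_left_mono)
 then show "sin et * exp (Re w0) <= cmod (exp w - exp w0)" by (rule power2_le_imp_le) simp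
 have "r\<^sup>2 * (sin et)\<^sup>2 <= r\<^sup>2 - 2 * r * cos et + 1"
  using zero_le_power2[of "1 - r * cos et"]
  by (simp add: s2 power2_diff power_mult_distrib algebra_simps)
 with q have "r\<^sup>2 * (sin et)\<^sup>2 <= r\<^sup>2 - 2 * r * c + 1" by linarith
 then have "(exp (Re w0))\<^sup>2 * (r\<^sup>2 * (sin et)\<^sup>2) <= (cmod (exp w - exp w0))\<^sup>2"
  unfolding nrm by (simp add: mult_left_mono)
 moreover have "exp (Re w) = exp (Re w0) * r" by (simp add: r_def exp_add[symmetric])
 ultimately have "(sin et * exp (Re w))\<^sup>2 <= (cmod (exp w - exp w0))\<^sup>2"
  by (simp add: power_mult_distrib mult_ac)
 then show "sin et * exp (Re w) <= cmod (exp w - exp w0)" by (rule power2_le_imp_le) simp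
qed

text \<open>In the variable \<open>exp w\<close> these are the functions holomorphic near the closed
  sector of half angle \<open>b\<close>, apart from its vertex, that decay like a power at 0 and at
  infinity: the elementary class of the sectorial calculus.\<close>

definition strip_decay :: "real => (complex => complex) => bool" where
 "strip_decay b F \<longleftrightarrow>
  (\<exists>S. open S \<and> {w. \<bar>Im w\<bar> <= b} \<subseteq> S \<and> F holomorphic_on S) \<and>
  (\<exists>C ep. 0 < ep \<and> (\<forall>w. \<bar>Im w\<bar> <= b \<longrightarrow> cmod (F w) <= C * exp (- ep * \<bar>Re w\<bar>)))"

lemma strip_decayI:
 assumes "F holomorphic_on S" "open S" "{w. \<bar>Im w\<bar> <= b} \<subseteq> S" "0 < ep"
  and "!!w. \<bar>Im w\<bar> <= b ==> cmod (F w) <= C * exp (- ep * \<bar>Re w\<bar>)"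
 shows "strip_decay b F"
 using assms unfolding strip_decay_def by blast

lemma holomorphic_on_line_continuous:
 assumes "F holomorphic_on S" "!!s. Complex s ps \<in> S"
 shows "cont (%s. F (Complex s ps))"
 by (rule continuous_on_compose2[OF holomorphic_on_imp_continuous_on[OF assms(1)]])
  (auto intro!: continuous_intros simp: assms(2))

lemma strip_decay_continuous:
 assumes "strip_decay b F" "\<bar>ps\<bar> <= b"
 shows "cont (%s. F (Complex s ps))"
proof -
 obtain S where "F holomorphic_on S" "{w. \<bar>Im w\<bar> <= b} \<subseteq> S"
  using assms(1) unfolding strip_decay_def by blast
 then show ?thesis using assms(2) by (intro holomorphic_on_line_continuous) auto
qed

lemma strip_decayE:
 assumes "strip_decay b F"
 obtains C ep where "0 < ep" "0 < C" "!!w. \<bar>Im w\<bar> <= b ==> cmod (F w) <= C * exp (- ep * \<bar>Re w\<bar>)"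
proof -
 obtain C ep where *: "0 < ep" "!!w. \<bar>Im w\<bar> <= b ==> cmod (F w) <= C * exp (- ep * \<bar>Re w\<bar>)"
  using assms unfolding strip_decay_def by blast
 have "cmod (F w) <= (\<bar>C\<bar> + 1) * exp (- ep * \<bar>Re w\<bar>)" if "\<bar>Im w\<bar> <= b" for w
  by (rule order_trans[OF *(2)[OF that]]) (intro mult_right_mono, auto)
 from that[OF *(1) _ this] show thesis by simp
qed

lemma exp_neg_real_tendsto_0: "(ep::real) > 0 ==> (%n. K * exp (- ep * real n)) \<longlonglongrightarrow> 0"
 using tail_tendsto_0[of "2 * ep" K] by simp

lemma strip_decay_Cauchy:
 assumes F: "strip_decay b F" and b: "0 <= b"
 shows "IU (%s. F (Complex s b)) = IU (%s. F (Complex s (- b)))"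
proof -
 obtain S where S: "open S" "{w. \<bar>Im w\<bar> <= b} \<subseteq> S" "F holomorphic_on S"
  using F unfolding strip_decay_def by blast
 obtain C ep where C: "0 < ep" "0 < C" "!!w. \<bar>Im w\<bar> <= b ==> cmod (F w) <= C * exp (- ep * \<bar>Re w\<bar>)"
  using strip_decayE[OF F] by blast
 have "(%n. integral {- real n..real n} (%s. F (Complex s b))
   - integral {- real n..real n} (%s. F (Complex s (- b)))) \<longlonglongrightarrow> of_real (b - (- b)) * (\<i> * (0 - 0))"
 proof (rule rectangle_shift_limit_holomorphic[OF _ S(3,1)])
  show "norm (F (Complex (real n) ps) - 0) <= C * exp (- ep * real n)" if "ps \<in> {- b..b}" for n ps
   using C(3)[of "Complex (real n) ps"] that by auto
  show "norm (F (Complex (- real n) ps) - 0) <= C * exp (- ep * real n)" if "ps \<in> {- b..b}" for n ps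
   using C(3)[of "Complex (- real n) ps"] that by auto
 qed (use b S(2) exp_neg_real_tendsto_0[OF C(1)] in auto)
 moreover have "(%n. integral {- real n..real n} (%s. F (Complex s ps)))
   \<longlonglongrightarrow> IU (%s. F (Complex s ps))" if "\<bar>ps\<bar> <= b" for ps
  by (rule exp_decay_tendsto[OF strip_decay_continuous[OF F that] C(1)])
   (use C(3)[of "Complex _ ps"] that in auto)
 ultimately have "(%n. integral {- real n..real n} (%s. F (Complex s b))
   - integral {- real n..real n} (%s. F (Complex s (- b)))) \<longlonglongrightarrow> 0"
  "(%n. integral {- real n..real n} (%s. F (Complex s b))
   - integral {- real n..real n} (%s. F (Complex s (- b)))) \<longlonglongrightarrow>
  IU (%s. F (Complex s b)) - IU (%s. F (Complex s (- b)))"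
  using b by (auto intro!: tendsto_diff)
 from LIMSEQ_unique[OF this] show ?thesis by simp
qed

text \<open>With the variable \<open>exp w\<close>, \<open>K w\<close> dw is the usual Cauchy
  kernel. As \<open>K\<close> tends to 1 on the right, the integrand is split into
  \<open>(F w - F w0) * K w\<close>, whose singularity is removable, and \<open>F w0 * K w\<close>.
  The first part contributes the angle \<open>2 * b\<close>, the second the complementary angle
  \<open>2 * pi - 2 * b\<close>.\<close>

lemma strip_decay_Cauchy_formula:
 assumes F: "strip_decay b F" and b: "\<bar>Im w0\<bar> < b" "b < pi"
 defines "K \<equiv> %w. exp w / (exp w - exp w0)"
 shows "IU (%s. F (Complex s (- b)) * K (Complex s (- b)))
  - IU (%s. F (Complex s b) * K (Complex s b)) = 2 * pi * \<i> * F w0"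
proof -
 obtain S where S: "open S" "{w. \<bar>Im w\<bar> <= b} \<subseteq> S" "F holomorphic_on S"
  using F unfolding strip_decay_def by blast
 obtain C ep where C: "0 < ep" "0 < C" "!!w. \<bar>Im w\<bar> <= b ==> cmod (F w) <= C * exp (- ep * \<bar>Re w\<bar>)"
  using strip_decayE[OF F] by blast
 have b0: "b > 0" using b by linarith
 \<comment> \<open>A positive angle separating \<open>w0\<close> from both lines, capped at
   \<open>pi / 2\<close> as the distance estimate requires.\<close>
 define et where "et = min (b - \<bar>Im w0\<bar>) (pi / 2)"
 have et: "0 < et" "et <= pi / 2" "et <= b - \<bar>Im w0\<bar>" using b by (auto simp: et_def min_def)
 have sin: "sin et > 0" using et by (intro sin_gt_zero) auto
 have Kb: "cmod (K w) <= 1 / sin et" "exp w ~= exp w0" if "b <= \<bar>Im w\<bar>" "\<bar>Im w\<bar> <= 2 * pi - b" for w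
 proof -
  have *: "sin et * exp (Re w) <= cmod (exp w - exp w0)"
   by (rule exp_diff_lower_bound[OF et(1,2)]) (use et(3) that in linarith)+
  moreover have "0 < sin et * exp (Re w)" using sin by simp
  ultimately have "cmod (exp w - exp w0) > 0" by linarith
  with * show "cmod (K w) <= 1 / sin et" "exp w ~= exp w0"
   using sin by (auto simp: K_def norm_divide field_simps)
 qed
 \<comment> \<open>Beyond \<open>N\<close> the moduli of \<open>exp w\<close> and
   \<open>exp w0\<close> differ by at least the factor \<open>exp 1\<close>, hence by at least
   2.\<close>
 obtain N :: nat where N: "real N \<ge> \<bar>Re w0\<bar> + 1" using real_arch_simple by blast
 have low: "exp (Re w) / 2 <= cmod (exp w - exp w0)" if "Re w \<ge> real N" for w
 proof -
  have "exp (Re w0) * 2 <= exp (Re w0) * exp 1" using exp_ge_add_one_self[of 1] by (intro mult_left_mono) auto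
  also have "... <= exp (Re w)" using that N by (simp add: exp_add[symmetric])
  finally show ?thesis using norm_triangle_ineq2[of "exp w" "exp w0"] by simp
 qed
 have low': "exp (Re w0) / 2 <= cmod (exp w - exp w0)" if "Re w <= - real N" for w
 proof -
  have "exp (Re w) * 2 <= exp (Re w) * exp 1" using exp_ge_add_one_self[of 1] by (intro mult_left_mono) auto
  also have "... <= exp (Re w0)" using that N by (simp add: exp_add[symmetric])
  finally show ?thesis using norm_triangle_ineq2[of "exp w0" "exp w"] by (simp add: norm_minus_commute)
 qed
 have Kr: "cmod (K w - 1) <= 2 * exp (Re w0) * exp (- Re w)" if "Re w \<ge> real N" for w
 proof -
  have pos: "cmod (exp w - exp w0) > 0" using low[OF that] exp_gt_zero[of "Re w"] by linarith
  then have "K w - 1 = exp w0 / (exp w - exp w0)" by (auto simp: K_def field_simps)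
  then have "cmod (K w - 1) = exp (Re w0) / cmod (exp w - exp w0)" by (simp add: norm_divide)
  also have "... <= exp (Re w0) / (exp (Re w) / 2)" using low[OF that] pos by (intro divide_left_mono) auto
  finally show ?thesis by (simp add: exp_minus field_simps)
 qed
 have Kl: "cmod (K w) <= 2 * exp (- Re w0) * exp (Re w)" if "Re w <= - real N" for w
 proof -
  have pos: "cmod (exp w - exp w0) > 0" using low'[OF that] exp_gt_zero[of "Re w0"] by linarith
  have "cmod (K w) = exp (Re w) / cmod (exp w - exp w0)" by (simp add: norm_divide K_def)
  also have "... <= exp (Re w) / (exp (Re w0) / 2)" using low'[OF that] pos by (intro divide_left_mono) auto
  finally show ?thesis by (simp add: exp_minus field_simps)
 qed
 let ?K = "%n ps. integral {- real n..real n} (%s. K (Complex s ps))"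
 define M where "M = 2 * exp (Re w0) + 2 * exp (- Re w0)"
 have M: "2 * exp (Re w0) * exp (- real n) <= M * exp (- 1 * real n)"
  "2 * exp (- Re w0) * exp (- real n) <= M * exp (- 1 * real n)" for n
  unfolding M_def by (simp_all add: algebra_simps)
 \<comment> \<open>No translate of \<open>w0\<close> by a multiple of \<open>2 * pi * \<i>\<close>
   lies between the heights \<open>b\<close> and \<open>2 * pi - b\<close>, so \<open>K\<close> is
   holomorphic there. It tends to 1 on the right and to 0 on the left. By periodicity the upper line
   is the one at height \<open>- b\<close>.\<close>
 have 1: "(%n. ?K n (2 * pi - b) - ?K n b) \<longlonglongrightarrow> of_real ((2 * pi - b) - b) * (\<i> * (1 - 0))"
 proof (rule rectangle_shift_limit_holomorphic[where S = "{w. exp w ~= exp w0}" and N = N and e = "%n. M * exp (- 1 * real n)"])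
  show "norm (K (Complex (real n) ps) - 1) <= M * exp (- 1 * real n)" if "N <= n" for n ps
   by (rule order_trans[OF Kr]) (use that M(1) in auto)
  show "norm (K (Complex (- real n) ps) - 0) <= M * exp (- 1 * real n)" if "N <= n" for n ps
   unfolding diff_zero by (rule order_trans[OF Kl]) (use that M(2)[of n] in auto)
  show "open {w. exp w ~= exp w0}" by (intro open_Collect_neq continuous_intros)
  show "{w. Im w \<in> {b..2 * pi - b}} \<subseteq> {w. exp w ~= exp w0}" using Kb(2) b0 by auto
  show "K holomorphic_on {w. exp w ~= exp w0}"
   unfolding K_def by (intro holomorphic_intros) auto
  show "(%n. M * exp (- 1 * real n)) \<longlonglongrightarrow> 0" by (rule exp_neg_real_tendsto_0) simp
 qed (use b in simp)
 have "exp (Complex s (2 * pi - b)) = exp (Complex s (- b))" for s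
  by (simp add: complex_eq_iff Re_exp Im_exp)
 then have Kper: "K (Complex s (2 * pi - b)) = K (Complex s (- b))" for s
  by (simp only: K_def)
 \<comment> \<open>Both difference quotients are holomorphic across \<open>w0\<close> and
   \<open>dE\<close> has no zero in the strip, so \<open>dF w / dE w * exp w\<close> continues
   \<open>(F w - F w0) * K w\<close> across the pole.\<close>
 define dF where "dF = (%z. if z = w0 then deriv F w0 else (F z - F w0) / (z - w0))"
 define dE where "dE = (%z. if z = w0 then deriv exp w0 else (exp z - exp w0) / (z - w0))"
 define S' where "S' = S \<inter> {w. \<bar>Im w\<bar> < pi}"
 have S': "open S'" "{w. Im w \<in> {- b..b}} \<subseteq> S'"
  using S(1,2) b unfolding S'_def
  by (auto intro!: open_Int open_Collect_less continuous_intros)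
 have "dF holomorphic_on S'"
  unfolding dF_def by (rule holomorphic_on_subset[OF pole_lemma_open[OF S(3,1)]]) (auto simp: S'_def)
 moreover have "dE holomorphic_on S'"
  unfolding dE_def by (rule holomorphic_on_subset[OF pole_lemma_open[OF holomorphic_on_exp open_UNIV]]) auto
 moreover have dE0: "dE w ~= 0" if "\<bar>Im w\<bar> < pi" for w
 proof (cases "w = w0")
  case False
  have "exp w ~= exp w0"
  proof
   assume "exp w = exp w0"
   then obtain k where k: "w = w0 + of_int (2 * k) * of_real pi * \<i>"
    unfolding exp_eq by (auto simp: algebra_simps)
   then have "Im w - Im w0 = of_int k * (2 * pi)" by simp
   moreover have "\<bar>Im w - Im w0\<bar> < 2 * pi" using that b by linarith
   ultimately have "\<bar>real_of_int k\<bar> * (2 * pi) < 1 * (2 * pi)" by (simp add: abs_mult)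
   then have "k = 0" by (simp add: mult_less_cancel_right_pos)
   with k False show False by simp
  qed
  with False show ?thesis by (simp add: dE_def)
 next
  case True
  have "deriv exp w0 = exp w0" by (rule DERIV_imp_deriv) (rule DERIV_exp)
  with True show ?thesis by (simp add: dE_def)
 qed
 ultimately have hG: "(%w. dF w / dE w * exp w) holomorphic_on S'"
  by (intro holomorphic_intros) (auto simp: S'_def)
 have Geq: "dF w / dE w * exp w = (F w - F w0) * K w" if "exp w ~= exp w0" for w
 proof -
  from that have "w ~= w0" by auto
  then show ?thesis by (simp add: dF_def dE_def K_def)
 qed
 have neN: "exp w ~= exp w0" if "Re w \<ge> real N \<or> Re w <= - real N" for w
  using low[of w] low'[of w] that by (metis cmod_eq_Re divide_pos_pos eq_iff_diff_eq_0 exp_gt_zero not_less norm_zero zero_less_numeral)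
 have FK: "cmod (F w * K w) <= C * (1 + M) * exp (- ep * \<bar>Re w\<bar>)" if "\<bar>Im w\<bar> <= b" "Re w \<ge> real N \<or> Re w <= - real N" for w
 proof -
  have "cmod (K w) <= 1 + M"
  proof (cases "Re w \<ge> real N")
   case True
   have "exp (- Re w) <= 1" using True by simp
   then have "2 * exp (Re w0) * exp (- Re w) <= 2 * exp (Re w0) * 1" by (intro mult_left_mono) auto
   also have "... <= M" by (simp add: M_def)
   finally show ?thesis using Kr[OF True] norm_triangle_ineq2[of "K w" 1] by simp
  next
   case False
   then have *: "Re w <= - real N" using that by auto
   then have "exp (Re w) <= 1" by simp
   then have "2 * exp (- Re w0) * exp (Re w) <= 2 * exp (- Re w0) * 1" by (intro mult_left_mono) auto
   also have "... <= M" by (simp add: M_def)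
   finally show ?thesis using Kl[OF *] by simp
  qed
  then have "cmod (F w * K w) <= (C * exp (- ep * \<bar>Re w\<bar>)) * (1 + M)"
   unfolding norm_mult using C(3)[OF that(1)] by (intro mult_mono) (use C(2) in auto)
  then show ?thesis by (simp add: mult_ac)
 qed
 let ?e = "%n. C * (1 + M) * exp (- ep * real n) + cmod (F w0) * M * exp (- 1 * real n)"
 let ?G = "%n ps. integral {- real n..real n} (%s. dF (Complex s ps) / dE (Complex s ps) * exp (Complex s ps))"
 have 2: "(%n. ?G n b - ?G n (- b)) \<longlonglongrightarrow> of_real (b - (- b)) * (\<i> * (- F w0 - 0))"
 proof (rule rectangle_shift_limit_holomorphic[OF _ hG S', where N = N and e = ?e])
  show "norm (dF (Complex (real n) ps) / dE (Complex (real n) ps) * exp (Complex (real n) ps) - - F w0) <= ?e n"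
   if "ps \<in> {- b..b}" "N <= n" for n ps
  proof -
   let ?w = "Complex (real n) ps"
   have n: "real N <= Re ?w" using that by simp
   have "dF ?w / dE ?w * exp ?w - - F w0 = F ?w * K ?w - F w0 * (K ?w - 1)"
    by (subst Geq[OF neN]) (use n in \<open>auto simp: algebra_simps\<close>)
   also have "norm ... <= norm (F ?w * K ?w) + norm (F w0 * (K ?w - 1))" by (rule norm_triangle_ineq4)
   also have "... <= ?e n"
    using FK[of ?w] that mult_left_mono[OF order_trans[OF Kr[OF n]], of "M * exp (- 1 * real n)" "cmod (F w0)"] M(1)[of n]
    by (intro add_mono) (auto simp: norm_mult mult.assoc)
   finally show ?thesis .
  qed
  show "norm (dF (Complex (- real n) ps) / dE (Complex (- real n) ps) * exp (Complex (- real n) ps) - 0) <= ?e n"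
   if "ps \<in> {- b..b}" "N <= n" for n ps
  proof -
   let ?w = "Complex (- real n) ps"
   have n: "Re ?w <= - real N" using that by simp
   have "dF ?w / dE ?w * exp ?w - 0 = F ?w * K ?w - F w0 * K ?w"
    by (subst Geq[OF neN]) (use n in \<open>auto simp: algebra_simps\<close>)
   also have "norm ... <= norm (F ?w * K ?w) + norm (F w0 * K ?w)" by (rule norm_triangle_ineq4)
   also have "... <= ?e n"
    using FK[of ?w] that mult_left_mono[OF order_trans[OF Kl[OF n]], of "M * exp (- 1 * real n)" "cmod (F w0)"] M(2)[of n]
    by (intro add_mono) (auto simp: norm_mult mult.assoc)
   finally show ?thesis .
  qed
  show "?e \<longlonglongrightarrow> 0"
   using tendsto_add[OF exp_neg_real_tendsto_0[OF C(1)] exp_neg_real_tendsto_0[of 1]] by simp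
 qed (use b0 in auto)
 have cFK: "cont (%s. F (Complex s ps) * K (Complex s ps))"
  and cK: "cont (%s. K (Complex s ps))"
  and bFK: "cmod (F (Complex s ps) * K (Complex s ps)) <= C * (1 / sin et) * ed ep s"
  and spl: "?G n ps + F w0 * ?K n ps = integral {- real n..real n} (%s. F (Complex s ps) * K (Complex s ps))"
  if "ps = b \<or> ps = - b" for ps s n
 proof -
  have ab: "\<bar>ps\<bar> = b" using that b0 by auto
  have ne: "exp (Complex s ps) ~= exp w0" for s by (rule Kb(2)) (use ab b in auto)
  show cK: "cont (%s. K (Complex s ps))"
   unfolding K_def by (intro continuous_intros) (use ne in auto)
  show cFK: "cont (%s. F (Complex s ps) * K (Complex s ps))"
   by (intro continuous_on_mult cK strip_decay_continuous[OF F]) (use ab in auto)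
  have "cmod (F (Complex s ps) * K (Complex s ps)) <= (C * ed ep s) * (1 / sin et)"
   unfolding norm_mult using C(3)[of "Complex s ps"] Kb(1)[of "Complex s ps"] C(2) ab b
   by (intro mult_mono) auto
  then show "cmod (F (Complex s ps) * K (Complex s ps)) <= C * (1 / sin et) * ed ep s"
   by (simp add: mult_ac)
  have "?G n ps = integral {- real n..real n} (%s. F (Complex s ps) * K (Complex s ps) - F w0 * K (Complex s ps))"
   by (intro integral_cong) (simp only: Geq[OF ne] left_diff_distrib)
  also have "... = integral {- real n..real n} (%s. F (Complex s ps) * K (Complex s ps)) - F w0 * ?K n ps"
   by (subst integral_diff) (auto intro!: integrable_continuous_interval continuous_on_mult
     continuous_on_const continuous_on_subset[OF cFK] continuous_on_subset[OF cK])
  finally show "?G n ps + F w0 * ?K n ps = integral {- real n..real n} (%s. F (Complex s ps) * K (Complex s ps))"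
   by simp
 qed
 let ?I = "%ps. IU (%s. F (Complex s ps) * K (Complex s ps))"
 have lim: "(%n. ?G n ps + F w0 * ?K n ps) \<longlonglongrightarrow> ?I ps" if "ps = b \<or> ps = - b" for ps
  unfolding spl[OF that] by (rule exp_decay_tendsto[OF cFK[OF that] C(1) bFK[OF that]])
 have "(%n. (?G n (- b) + F w0 * ?K n (- b)) - (?G n b + F w0 * ?K n b)) \<longlonglongrightarrow> ?I (- b) - ?I b"
  by (intro tendsto_diff lim) auto
 moreover have "(%n. (?G n (- b) + F w0 * ?K n (- b)) - (?G n b + F w0 * ?K n b)) \<longlonglongrightarrow>
  F w0 * (of_real ((2 * pi - b) - b) * (\<i> * (1 - 0))) - of_real (b - (- b)) * (\<i> * (- F w0 - 0))"
 proof -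
  have Kper': "?K n (2 * pi - b) = ?K n (- b)" for n unfolding Kper ..
  have "?G n (- b) + F w0 * ?K n (- b) - (?G n b + F w0 * ?K n b)
   = F w0 * (?K n (2 * pi - b) - ?K n b) - (?G n b - ?G n (- b))" for n
   unfolding Kper' by (simp add: algebra_simps)
  then show ?thesis using tendsto_diff[OF tendsto_mult_left[OF 1] 2] by presburger
 qed
 ultimately have "?I (- b) - ?I b =
  F w0 * (of_real ((2 * pi - b) - b) * (\<i> * (1 - 0))) - of_real (b - (- b)) * (\<i> * (- F w0 - 0))"
  by (rule LIMSEQ_unique)
 then show ?thesis by (simp add: algebra_simps)
qed

section \<open>Bochner integrals with values in an arbitrary Banach space as gauge integrals\<close>

lemma simple_function_has_integral:
 fixes s :: "real => 'b::banach"
 assumes S: "S \<in> sets lebesgue"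
  and s: "Bochner_Integration.simple_bochner_integrable (lebesgue_on S) s"
 shows "(s has_integral Bochner_Integration.simple_bochner_integral (lebesgue_on S) s) S"
proof -
 let ?M = "lebesgue_on S"
 have sp: "space ?M = S" by (simp add: space_lebesgue_on)
 have sf: "simple_function ?M s" and fin: "emeasure ?M {y \<in> space ?M. s y ~= 0} ~= \<infinity>"
  using s by (auto elim: Bochner_Integration.simple_bochner_integrable.cases)
 have fs: "finite (s ` S)" using simple_functionD(1)[OF sf] by (simp add: sp)
 let ?B = "%y. {x \<in> S. s x = y}"
 have Bm: "?B y \<in> sets ?M" for y
  using simple_functionD(2)[OF sf, of "{y}"] by (simp add: sp vimage_def Int_def conj_commute)
 then have Bl: "?B y \<in> sets lebesgue" for y
  using S by (simp add: sets_restrict_space_iff)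
 \<comment> \<open>The level set of the value 0 may have infinite measure, but its term vanishes;
   every other level set has finite measure.\<close>
 have one: "((%x. indicat_real (?B y) x *\<^sub>R y) has_integral (measure ?M (?B y) *\<^sub>R y)) S" for y
 proof (cases "y = 0")
  case False
  have "{y \<in> space ?M. s y ~= 0} = s -` (- {0}) \<inter> space ?M" by auto
  then have "{y \<in> space ?M. s y ~= 0} \<in> sets ?M" using simple_functionD(2)[OF sf, of "- {0}"] by simp
  then have "emeasure ?M (?B y) <= emeasure ?M {y \<in> space ?M. s y ~= 0}"
   using False by (intro emeasure_mono) (auto simp: sp)
  then have "?B y \<in> lmeasurable"
   using Bl[of y] fin S by (auto simp: fmeasurable_def emeasure_restrict_space top.not_eq_extremum less_top intro: le_less_trans)
  then have "(indicat_real (?B y) has_integral measure lebesgue (?B y)) UNIV"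
   by (simp add: lmeasurable_iff_has_integral)
  then have "(indicat_real (?B y) has_integral measure lebesgue (?B y)) S"
   by (subst has_integral_restrict_UNIV[symmetric], elim has_integral_eq[rotated]) (auto simp: indicator_def)
  then show ?thesis
   using S Bl[of y] by (auto simp: measure_restrict_space intro!: has_integral_scaleR_left)
 qed simp
 have "((%x. \<Sum>y\<in>s ` S. indicat_real (?B y) x *\<^sub>R y) has_integral
   (\<Sum>y\<in>s ` S. measure ?M (?B y) *\<^sub>R y)) S"
  by (intro has_integral_sum fs one)
 moreover have "(\<Sum>y\<in>s ` S. indicat_real (?B y) x *\<^sub>R y) = s x" if "x \<in> S" for x
 proof -
  have "(\<Sum>y\<in>s ` S. indicat_real (?B y) x *\<^sub>R y) = (\<Sum>y\<in>s ` S. if y = s x then y else 0)"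
   using that by (intro sum.cong) (auto simp: indicator_def)
  then show ?thesis using fs that by (simp add: sum.delta)
 qed
 ultimately show ?thesis
  unfolding Bochner_Integration.simple_bochner_integral_def sp
  using has_integral_cong[of S "%x. \<Sum>y\<in>s ` S. indicat_real (?B y) x *\<^sub>R y" s] by simp
qed

text \<open>Riemann sums of a vector-valued function are dominated by those of its norm, so an approximation
 in mean by simple functions passes to the gauge integral.\<close>

lemma integrable_on_cbox_approx:
 fixes f :: "real => 'b::banach"
 assumes approx: "!!e. e > 0 ==> \<exists>g I. g integrable_on cbox a b \<and>
   ((%t. norm (f t - g t)) has_integral I) (cbox a b) \<and> I < e"
 shows "f integrable_on cbox a b"
 unfolding integrable_Cauchy
proof (intro allI impI)
 fix e :: real assume e: "e > 0"
 obtain g I where g: "g integrable_on cbox a b"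
   "((%t. norm (f t - g t)) has_integral I) (cbox a b)" "I < e / 8"
  using approx[of "e / 8"] e by auto
 obtain ga1 where ga1: "gauge ga1"
  "!!D1 D2. D1 tagged_division_of cbox a b ==> ga1 fine D1 ==> D2 tagged_division_of cbox a b ==> ga1 fine D2 ==>
   norm ((\<Sum>(x,K)\<in>D1. measure lborel K *\<^sub>R g x) - (\<Sum>(x,K)\<in>D2. measure lborel K *\<^sub>R g x)) < e / 2"
  using g(1)[unfolded integrable_Cauchy, rule_format, of "e / 2"] e by auto
 obtain ga2 where ga2: "gauge ga2"
  "!!D. D tagged_division_of cbox a b ==> ga2 fine D ==>
   norm ((\<Sum>(x,K)\<in>D. measure lborel K *\<^sub>R norm (f x - g x)) - I) < e / 8"
  using g(2)[unfolded has_integral, rule_format, of "e / 8"] e by auto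
 have small: "norm (\<Sum>(x,K)\<in>D. measure lborel K *\<^sub>R (f x - g x)) < e / 4"
  if "D tagged_division_of cbox a b" "ga2 fine D" for D
 proof -
  have "norm (\<Sum>(x,K)\<in>D. measure lborel K *\<^sub>R (f x - g x)) <= (\<Sum>(x,K)\<in>D. measure lborel K *\<^sub>R norm (f x - g x))"
   by (rule sum_norm_le) (auto simp: case_prod_unfold)
  then show ?thesis using ga2(2)[OF that] g(3) by (simp add: abs_if split: if_splits)
 qed
 show "\<exists>ga. gauge ga \<and> (\<forall>D1 D2. D1 tagged_division_of cbox a b \<and> ga fine D1 \<and> D2 tagged_division_of cbox a b \<and> ga fine D2 \<longrightarrow>
   norm ((\<Sum>(x,K)\<in>D1. measure lborel K *\<^sub>R f x) - (\<Sum>(x,K)\<in>D2. measure lborel K *\<^sub>R f x)) < e)"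
 proof (intro exI[of _ "%x. ga1 x \<inter> ga2 x"] conjI allI impI)
  show "gauge (%x. ga1 x \<inter> ga2 x)" by (rule gauge_Int[OF ga1(1) ga2(1)])
  fix D1 D2 assume "D1 tagged_division_of cbox a b \<and> (%x. ga1 x \<inter> ga2 x) fine D1 \<and>
   D2 tagged_division_of cbox a b \<and> (%x. ga1 x \<inter> ga2 x) fine D2"
  then have D: "D1 tagged_division_of cbox a b" "(%x. ga1 x \<inter> ga2 x) fine D1"
   "D2 tagged_division_of cbox a b" "(%x. ga1 x \<inter> ga2 x) fine D2" by auto
  have fn: "ga1 fine D1" "ga2 fine D1" "ga1 fine D2" "ga2 fine D2" using D by (auto simp: fine_Int)
  have split: "(\<Sum>(x,K)\<in>D. measure lborel K *\<^sub>R f x)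
    = (\<Sum>(x,K)\<in>D. measure lborel K *\<^sub>R g x) + (\<Sum>(x,K)\<in>D. measure lborel K *\<^sub>R (f x - g x))" for D :: "(real \<times> real set) set"
   by (simp add: sum.distrib[symmetric] case_prod_unfold scaleR_diff_right)
  let ?g = "%D. \<Sum>(x,K)\<in>D. measure lborel K *\<^sub>R g x" and ?h = "%D. \<Sum>(x,K)\<in>D. measure lborel K *\<^sub>R (f x - g x)"
  have "(\<Sum>(x,K)\<in>D1. measure lborel K *\<^sub>R f x) - (\<Sum>(x,K)\<in>D2. measure lborel K *\<^sub>R f x) = (?g D1 - ?g D2) + (?h D1 - ?h D2)"
   unfolding split by simp
  also have "norm ... <= norm (?g D1 - ?g D2) + (norm (?h D1) + norm (?h D2))"
   by (rule order_trans[OF norm_triangle_ineq add_left_mono[OF norm_triangle_ineq4]])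
  also have "... < e / 2 + (e / 4 + e / 4)"
   by (rule add_strict_mono[OF ga1(2)[OF D(1) fn(1) D(3) fn(3)]
     add_strict_mono[OF small[OF D(1) fn(2)] small[OF D(3) fn(4)]]])
  also have "... = e" by simp
  finally show "norm ((\<Sum>(x,K)\<in>D1. measure lborel K *\<^sub>R f x) - (\<Sum>(x,K)\<in>D2. measure lborel K *\<^sub>R f x)) < e" .
 qed
qed

text \<open>Borel measurability of \<open>f\<close> itself is not at hand in a possibly
  non-separable space. The distance to \<open>s i\<close> is nevertheless an almost everywhere limit
  of the real simple functions \<open>norm (s j t - s i t)\<close>.\<close>

lemma simple_approx_norm_measurable:
 fixes f :: "real => 'b::real_normed_vector"
 assumes s: "!!i. Bochner_Integration.simple_bochner_integrable M (s i)"
  and ae: "AE t in M. (%i. s i t) \<longlonglongrightarrow> f t"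
 obtains L where "L \<in> borel_measurable M" "AE t in M. L t = norm (f t - s i t)"
proof
 show "(%t. lim (%j. norm (s j t - s i t))) \<in> borel_measurable M"
 proof (intro borel_measurable_lim_metric)
  fix j
  have "simple_function M (s j)" "simple_function M (s i)"
   using s by (auto elim: Bochner_Integration.simple_bochner_integrable.cases)
  from simple_function_compose2[OF this, of "%x y. norm (x - y)"]
  show "(%t. norm (s j t - s i t)) \<in> borel_measurable M"
   by (rule borel_measurable_simple_function)
 qed
 show "AE t in M. lim (%j. norm (s j t - s i t)) = norm (f t - s i t)"
  using ae by eventually_elim (intro limI tendsto_intros)
qed

text \<open>From \<open>i0\<close> on the mean distance \<open>J i\<close> is finite, and through
  the measurable representative \<open>L i\<close> it is also a gauge integral. Approximation in
  mean by the gauge integrable \<open>s i\<close> then yields integrability of \<open>f\<close>, and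
  \<open>J i\<close> bounds the difference of the integrals.\<close>

lemma simple_approx_has_integral:
 fixes f :: "real => 'b::banach"
 assumes S: "S \<in> sets lebesgue"
  and s: "!!i. Bochner_Integration.simple_bochner_integrable (lebesgue_on S) (s i)"
  and ae: "AE t in lebesgue_on S. (%i. s i t) \<longlonglongrightarrow> f t"
  and nn: "(%i. \<integral>\<^sup>+t. ennreal (norm (f t - s i t)) \<partial>lebesgue_on S) \<longlonglongrightarrow> 0"
 shows "f integrable_on S"
  "(%i. Bochner_Integration.simple_bochner_integral (lebesgue_on S) (s i)) \<longlonglongrightarrow> integral S f"
proof -
 let ?M = "lebesgue_on S"
 have sp: "space ?M = S" by (simp add: space_lebesgue_on)
 have "\<exists>L. L \<in> borel_measurable ?M \<and> (AE t in ?M. L t = norm (f t - s i t))" for i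
  using simple_approx_norm_measurable[OF s ae] by blast
 then obtain L where Lm: "!!i. L i \<in> borel_measurable ?M" and Lae: "!!i. AE t in ?M. L i t = norm (f t - s i t)"
  by metis
 have "eventually (%i. (\<integral>\<^sup>+t. ennreal (norm (f t - s i t)) \<partial>?M) < 1) sequentially"
  using order_tendstoD(2)[OF nn, of 1] by simp
 then obtain i0 where i0: "!!i. i \<ge> i0 ==> (\<integral>\<^sup>+t. ennreal (norm (f t - s i t)) \<partial>?M) < 1"
  by (auto simp: eventually_sequentially)
 define J where "J i = enn2real (\<integral>\<^sup>+t. ennreal (norm (f t - s i t)) \<partial>?M)" for i
 have hI: "((%t. norm (f t - s i t)) has_integral J i) S" if i: "i \<ge> i0" for i
 proof -
  have eq: "(\<integral>\<^sup>+t. ennreal \<bar>L i t\<bar> \<partial>?M) = (\<integral>\<^sup>+t. ennreal (norm (f t - s i t)) \<partial>?M)"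
   using Lae[of i] by (intro nn_integral_cong_AE) auto
  have Lint: "integrable ?M (L i)"
   by (rule integrableI_bounded[OF Lm]) (use eq i0[OF i] in \<open>auto intro: less_trans\<close>)
  have "integral\<^sup>L ?M (L i) = J i"
   unfolding J_def eq[symmetric]
   by (subst integral_eq_nn_integral) (use Lae[of i] Lm in \<open>auto intro!: arg_cong[where f = enn2real] nn_integral_cong_AE\<close>)
  then have "(L i has_integral J i) S"
   using has_integral_integral_lebesgue_on[OF Lint S] by simp
  moreover obtain N where N: "N \<in> null_sets ?M" "{t \<in> space ?M. L i t ~= norm (f t - s i t)} \<subseteq> N"
   using Lae[of i] by (auto simp: eventually_ae_filter)
  moreover have "negligible N"
   using N(1) S by (simp add: null_sets_restrict_space negligible_iff_null_sets)
  ultimately show ?thesis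
   using sp by (intro has_integral_spike[of N S "%t. norm (f t - s i t)" "L i"]) auto
 qed
 have J0: "J \<longlonglongrightarrow> 0"
  unfolding J_def using tendsto_enn2real[where l = 0, simplified, OF nn] .
 have si: "s i integrable_on S" for i
  using simple_function_has_integral[OF S s[of i]] by (rule has_integral_integrable)
 show f: "f integrable_on S"
 proof (rule integrable_on_all_intervals_integrable_bound[where g = "%t. norm (f t - s i0 t) + norm (s i0 t)"])
  show "norm (f t) <= norm (f t - s i0 t) + norm (s i0 t)" for t
   using norm_triangle_ineq[of "f t - s i0 t" "s i0 t"] by simp
  have "(%t. norm (s i0 t)) integrable_on S"
  proof -
   have "Bochner_Integration.simple_bochner_integrable ?M (%t. norm (s i0 t))"
    using Bochner_Integration.simple_bochner_integrable_compose2[of "%x y. norm x", OF _ s[of i0] s[of i0]] by simp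
   from simple_function_has_integral[OF S this] show ?thesis by (rule has_integral_integrable)
  qed
  then show "(%t. norm (f t - s i0 t) + norm (s i0 t)) integrable_on S"
   by (intro integrable_add has_integral_integrable[OF hI]) auto
  fix a b
  let ?r = "%h x. if x \<in> S then h x else 0"
  show "?r f integrable_on cbox a b"
  proof (rule integrable_on_cbox_approx)
   fix e :: real assume "e > 0"
   from order_tendstoD(2)[OF J0 this] obtain i1 where i1: "!!i. i \<ge> i1 ==> J i < e"
    by (auto simp: eventually_sequentially)
   let ?i = "max i0 i1"
   have h: "((?r (%t. norm (f t - s ?i t))) has_integral J ?i) UNIV"
    using hI[of ?i] by (simp add: has_integral_restrict_UNIV)
   have hc: "(?r (%t. norm (f t - s ?i t))) integrable_on cbox a b"
    by (rule integrable_on_subcbox[OF has_integral_integrable[OF h]]) simp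
   have le: "integral (cbox a b) (?r (%t. norm (f t - s ?i t))) <= J ?i"
    using integral_subset_le[OF _ hc has_integral_integrable[OF h]] integral_unique[OF h] by auto
   have "?r (s ?i) integrable_on UNIV" using si[of ?i] by (simp add: integrable_restrict_UNIV)
   then have "?r (s ?i) integrable_on cbox a b"
    by (rule integrable_on_subcbox) simp
   moreover have "(%t. norm (?r f t - ?r (s ?i) t)) = ?r (%t. norm (f t - s ?i t))" by auto
   ultimately show "\<exists>g I. g integrable_on cbox a b \<and> ((%t. norm (?r f t - g t)) has_integral I) (cbox a b) \<and> I < e"
    using integrable_integral[OF hc] le_less_trans[OF le i1[of ?i]]
    by (intro exI[of _ "?r (s ?i)"] exI[of _ "integral (cbox a b) (?r (%t. norm (f t - s ?i t)))"]) auto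
  qed
 qed
 have "norm (integral S (s i) - integral S f) <= J i" if "i \<ge> i0" for i
 proof -
  have "integral S (s i) - integral S f = integral S (%t. s i t - f t)"
   by (rule integral_diff[OF si f, symmetric])
  moreover have "norm (integral S (%t. s i t - f t)) <= integral S (%t. norm (f t - s i t))"
   by (rule integral_norm_bound_integral[OF integrable_diff[OF si f] has_integral_integrable[OF hI[OF that]]])
    (simp add: norm_minus_commute)
  ultimately show ?thesis using integral_unique[OF hI[OF that]] by simp
 qed
 then have "eventually (%i. norm (integral S (s i) - integral S f) <= J i) sequentially"
  by (auto simp: eventually_sequentially)
 from Lim_null_comparison[OF this J0] have "(%i. integral S (s i)) \<longlonglongrightarrow> integral S f"
  by (rule LIM_zero_cancel)
 then show "(%i. Bochner_Integration.simple_bochner_integral ?M (s i)) \<longlonglongrightarrow> integral S f"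
  unfolding integral_unique[OF simple_function_has_integral[OF S s]] .
qed

lemma has_Bochner_integral_has_integral:
 fixes f :: "real => 'b::banach"
 assumes "S \<in> sets lebesgue" "has_Bochner_integral (lebesgue_on S) f I"
 shows "(f has_integral I) S"
proof -
 obtain s where "!!i. Bochner_Integration.simple_bochner_integrable (lebesgue_on S) (s i)"
  "AE t in lebesgue_on S. (%i. s i t) \<longlonglongrightarrow> f t"
  "(%i. \<integral>\<^sup>+t. ennreal (norm (f t - s i t)) \<partial>lebesgue_on S) \<longlonglongrightarrow> 0"
  and lim: "(%i. Bochner_Integration.simple_bochner_integral (lebesgue_on S) (s i)) \<longlonglongrightarrow> I"
  using assms(2) unfolding has_Bochner_integral_def by blast
 from simple_approx_has_integral[OF assms(1) this(1-3)] LIMSEQ_unique[OF lim] show ?thesis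
  by (metis integrable_integral)
qed

text \<open>Uniqueness of the gauge integral makes the definite description in
  \<open>Bochner_integral\<close> well defined.\<close>

lemma Bochner_integrable_has_integral:
 fixes f :: "real => 'b::banach"
 assumes S: "S \<in> sets lebesgue" and f: "Bochner_integrable (lebesgue_on S) f"
 shows "(f has_integral Bochner_integral (lebesgue_on S) f) S"
proof -
 obtain I where I: "has_Bochner_integral (lebesgue_on S) f I"
  using f unfolding Bochner_integrable_def by blast
 have "Bochner_integral (lebesgue_on S) f = I"
  unfolding Bochner_integral_def
  using I has_Bochner_integral_has_integral[OF S] has_integral_unique by (intro the_equality) blast+
 then show ?thesis using has_Bochner_integral_has_integral[OF S I] by simp
qed

text \<open>By uniform continuity \<open>f\<close> varies by less than \<open>de\<close> on pieces
  of length \<open>d\<close>. The function \<open>sg\<close> freezes \<open>f\<close> at one point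
  \<open>pick k\<close> of each piece that meets \<open>K\<close>; it is a function of
  \<open>floor (t / d)\<close>, which takes finitely many values on \<open>K\<close>.\<close>

lemma compact_simple_approx:
 fixes f :: "real => 'b::real_normed_vector"
 assumes K: "compact K" "K \<subseteq> S" and S: "S \<in> sets lebesgue" and f: "continuous_on K f" and de: "de > 0"
 obtains sg where "Bochner_Integration.simple_bochner_integrable (lebesgue_on S) sg"
  "!!t. t \<notin> K ==> sg t = 0" "!!t. t \<in> K ==> norm (f t - sg t) <= de"
proof -
 let ?M = "lebesgue_on S"
 have sp: "space ?M = S" by (simp add: space_lebesgue_on)
 have Kl: "K \<in> lmeasurable" using K(1) by (rule lmeasurable_compact)
 then have Km: "K \<in> sets ?M" using K(2) S by (auto simp: sets_restrict_space_iff)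
 obtain d where d: "d > 0" "!!x y. x \<in> K ==> y \<in> K ==> dist x y < d ==> dist (f x) (f y) < de"
  using compact_uniformly_continuous[OF f K(1)] de unfolding uniformly_continuous_on_def by metis
 obtain B where B: "!!t. t \<in> K ==> \<bar>t\<bar> <= B"
  using compact_imp_bounded[OF K(1)] by (auto simp: bounded_iff)
 define pick where "pick k = (SOME y. y \<in> K \<and> \<lfloor>y / d\<rfloor> = k)" for k :: int
 have pick: "pick \<lfloor>t / d\<rfloor> \<in> K \<and> \<lfloor>pick \<lfloor>t / d\<rfloor> / d\<rfloor> = \<lfloor>t / d\<rfloor>" if "t \<in> K" for t
  unfolding pick_def by (rule someI[of _ t]) (use that in simp)
 define sg where "sg t = (if t \<in> K then f (pick \<lfloor>t / d\<rfloor>) else 0)" for t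
 let ?c = "%t. if t \<in> K then \<lfloor>t / d\<rfloor> else 0"
 have "simple_function ?M (%t. t \<in> K)"
  unfolding simple_function_eq_measurable using Km K(2)
  by (auto simp: sp intro!: finite_subset[of _ UNIV] pred_sets2)
 moreover have "simple_function ?M ?c"
  unfolding simple_function_eq_measurable
 proof
  have "?c ` space ?M \<subseteq> insert 0 {\<lfloor>- B / d\<rfloor>..\<lfloor>B / d\<rfloor>}"
  proof
   fix k assume "k \<in> ?c ` space ?M"
   then obtain t where t: "k = ?c t" by (elim imageE)
   show "k \<in> insert 0 {\<lfloor>- B / d\<rfloor>..\<lfloor>B / d\<rfloor>}"
   proof (cases "t \<in> K")
    case True
    have "- B <= t" "t <= B" using B[OF True] by auto
    then have "- B / d <= t / d" "t / d <= B / d" 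
     using d(1) divide_right_mono[of "- B" t d] divide_right_mono[of t B d] by simp_all
    then show ?thesis using t True by (auto intro: floor_mono)
   qed (use t in simp)
  qed
  then show "finite (?c ` space ?M)" by (rule finite_subset) auto
  have "(%t. t / d) \<in> borel_measurable ?M"
   using S d(1) by (intro continuous_imp_measurable_on_sets_lebesgue continuous_intros) auto
  from measurable_compose[OF this measurable_real_floor]
  have "(%t. \<lfloor>t / d\<rfloor>) \<in> measurable ?M (count_space UNIV)" .
  moreover have "{x \<in> space ?M. x \<in> K} \<in> sets ?M" using Km K(2) by (simp add: sp Collect_conj_eq Int_absorb1)
  ultimately show "?c \<in> measurable ?M (count_space UNIV)"
   by (intro measurable_If) auto
 qed
 ultimately have "simple_function ?M (%t. if t \<in> K then f (pick (?c t)) else 0)"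
  by (rule simple_function_compose2[of _ _ _ "%b k. if b then f (pick k) else 0"])
 then have "simple_function ?M sg"
  by (rule simple_function_cong[THEN iffD1, rotated]) (simp add: sg_def)
 moreover have "emeasure ?M {y \<in> space ?M. sg y ~= 0} ~= \<infinity>"
 proof -
  have "emeasure ?M {y \<in> space ?M. sg y ~= 0} <= emeasure ?M K"
   using Km by (intro emeasure_mono) (auto simp: sg_def split: if_splits)
  also have "emeasure ?M K = emeasure lebesgue K" using K(2) S by (intro emeasure_restrict_space) auto
  also have "... < \<infinity>" using fmeasurableD2[OF Kl] by (simp add: less_top)
  finally show ?thesis by simp
 qed
 ultimately have "Bochner_Integration.simple_bochner_integrable ?M sg"
  by (rule Bochner_Integration.simple_bochner_integrable.intros)
 moreover have "norm (f t - sg t) <= de" if "t \<in> K" for t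
 proof -
  let ?k = "\<lfloor>t / d\<rfloor>"
  have "of_int ?k <= t / d" "t / d < of_int ?k + 1" "of_int ?k <= pick ?k / d" "pick ?k / d < of_int ?k + 1"
   using pick[OF that] by linarith+
  then have "\<bar>t / d - pick ?k / d\<bar> < 1" by linarith
  then have "dist t (pick ?k) < d" using d(1) by (simp add: dist_real_def diff_divide_distrib[symmetric])
  then have "dist (f t) (f (pick ?k)) < de" using pick[OF that] that by (intro d(2)) auto
  then show ?thesis using that by (simp add: sg_def dist_norm)
 qed
 ultimately show thesis using that by (metis sg_def)
qed

text \<open>On the compact set \<open>K n\<close> the function is approximated uniformly, outside it
  by 0. The first error is controlled by the choice of \<open>de n\<close>, the second by the
  integral of \<open>g\<close> over the complement of \<open>K n\<close>, which tends to 0 by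
  domination.\<close>

lemma has_Bochner_integral_continuous:
 fixes f :: "real => 'b::banach"
 assumes S: "S \<in> sets lebesgue" and K: "!!n. compact (K n)" "!!n. K n \<subseteq> S"
  and ev: "!!t. t \<in> S ==> eventually (%n. t \<in> K n) sequentially"
  and cont: "continuous_on S f" and g: "integrable (lebesgue_on S) g" "!!t. t \<in> S ==> norm (f t) <= g t"
 shows "has_Bochner_integral (lebesgue_on S) f (integral S f)"
proof -
 let ?M = "lebesgue_on S"
 have sp: "space ?M = S" by (simp add: space_lebesgue_on)
 have Kl: "K n \<in> lmeasurable" for n using K(1) by (rule lmeasurable_compact)
 have Km: "K n \<in> sets ?M" for n using Kl[of n] K(2)[of n] S by (auto simp: sets_restrict_space_iff)
 \<comment> \<open>Chosen so that \<open>de n\<close> times the measure of \<open>K n\<close> is at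
   most \<open>1 / (n + 1)\<close>; the added 1 keeps \<open>de n\<close> itself below the same
   bound, which gives pointwise convergence.\<close>
 define de where "de n = 1 / (real (Suc n) * (measure lebesgue (K n) + 1))" for n
 have de: "de n > 0" for n unfolding de_def by (intro divide_pos_pos mult_pos_pos add_nonneg_pos) auto
 have "\<exists>sg. Bochner_Integration.simple_bochner_integrable ?M sg \<and> (\<forall>t. t \<notin> K n \<longrightarrow> sg t = 0) \<and>
   (\<forall>t\<in>K n. norm (f t - sg t) <= de n)" for n
  using compact_simple_approx[OF K(1)[of n] K(2) S continuous_on_subset[OF cont K(2)] de[of n]] by metis
 then obtain s where s: "!!n. Bochner_Integration.simple_bochner_integrable ?M (s n)"
  "!!n t. t \<notin> K n ==> s n t = 0" "!!n t. t \<in> K n ==> norm (f t - s n t) <= de n"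
  by metis
 have de1: "de n <= 1 / real (Suc n)" for n
 proof -
  have "real (Suc n) * 1 <= real (Suc n) * (measure lebesgue (K n) + 1)" by (intro mult_left_mono) auto
  then show ?thesis unfolding de_def by (intro frac_le) auto
 qed
 have inv0: "(%n. 1 / real (Suc n)) \<longlonglongrightarrow> 0" by real_asymp
 have conv: "(%n. s n t) \<longlonglongrightarrow> f t" if "t \<in> S" for t
 proof -
  have "eventually (%n. norm (s n t - f t) <= 1 / real (Suc n)) sequentially"
   using ev[OF that]
  proof eventually_elim
   case (elim n)
   show ?case using order_trans[OF s(3)[OF elim] de1] by (simp add: norm_minus_commute)
  qed
  from Lim_null_comparison[OF this inv0] show ?thesis by (rule LIM_zero_cancel)
 qed
 have ae: "AE t in ?M. (%n. s n t) \<longlonglongrightarrow> f t" using conv by (intro AE_I2) (simp add: sp)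
 have gm: "g \<in> borel_measurable ?M" using g(1) by auto
 let ?u = "%n t. ennreal (g t) * indicator (- K n) t"
 have um: "?u n \<in> borel_measurable ?M" for n
 proof -
  have "space ?M - K n \<in> sets ?M" using Km by auto
  then have "(%t. ennreal (g t) * indicator (space ?M - K n) t) \<in> borel_measurable ?M"
   using gm by measurable
  then show ?thesis by (rule measurable_cong[THEN iffD1, rotated]) (auto simp: indicator_def)
 qed
 have u0: "(%n. \<integral>\<^sup>+t. ?u n t \<partial>?M) \<longlonglongrightarrow> (\<integral>\<^sup>+t. 0 \<partial>?M)"
 proof (rule nn_integral_dominated_convergence[where w = "%t. ennreal (g t)"])
  show "(\<integral>\<^sup>+t. ennreal (g t) \<partial>?M) < \<infinity>"
   using g(1) by (auto simp: real_integrable_def top.not_eq_extremum)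
  show "AE t in ?M. (%n. ?u n t) \<longlonglongrightarrow> 0"
  proof (intro AE_I2)
   fix t assume "t \<in> space ?M"
   then have "eventually (%n. t \<in> K n) sequentially" using ev by (simp add: sp)
   then have "eventually (%n. ?u n t = 0) sequentially"
    by eventually_elim simp
   then show "(%n. ?u n t) \<longlonglongrightarrow> 0" by (rule tendsto_eventually)
  qed
 qed (use um gm in \<open>auto simp: indicator_def\<close>)
 have le: "(\<integral>\<^sup>+t. ennreal (norm (f t - s n t)) \<partial>?M) <= ennreal (1 / real (Suc n)) + (\<integral>\<^sup>+t. ?u n t \<partial>?M)" for n
 proof -
  have "(\<integral>\<^sup>+t. ennreal (norm (f t - s n t)) \<partial>?M) <= (\<integral>\<^sup>+t. (ennreal (de n) * indicator (K n) t + ?u n t) \<partial>?M)"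
  proof (rule nn_integral_mono)
   fix t assume "t \<in> space ?M"
   then have t: "t \<in> S" by (simp add: sp)
   show "ennreal (norm (f t - s n t)) <= ennreal (de n) * indicator (K n) t + ?u n t"
   proof (cases "t \<in> K n")
    case True then show ?thesis using s(3)[OF True] by (simp add: ennreal_leI)
   next
    case False then show ?thesis using s(2)[OF False] g(2)[OF t] by (simp add: ennreal_leI)
   qed
  qed
  also have "... = ennreal (de n) * emeasure ?M (K n) + (\<integral>\<^sup>+t. ?u n t \<partial>?M)"
   using Km[of n] um[of n] by (subst nn_integral_add) (auto simp: nn_integral_cmult_indicator)
  also have "emeasure ?M (K n) = ennreal (measure lebesgue (K n))"
   using Kl[of n] K(2)[of n] S by (simp add: emeasure_restrict_space emeasure_eq_measure2)
  also have "ennreal (de n) * ennreal (measure lebesgue (K n)) <= ennreal (1 / real (Suc n))"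
  proof -
   have "de n * measure lebesgue (K n) <= 1 / real (Suc n)"
   proof -
    have m: "measure lebesgue (K n) / (measure lebesgue (K n) + 1) <= 1"
     by (subst divide_le_eq_1) (auto intro: add_nonneg_pos)
    have "de n * measure lebesgue (K n) = (1 / real (Suc n)) * (measure lebesgue (K n) / (measure lebesgue (K n) + 1))"
     by (simp add: de_def)
    also have "... <= (1 / real (Suc n)) * 1" using m by (intro mult_left_mono) auto
    finally show ?thesis by simp
   qed
   then show ?thesis using de[of n] by (simp add: ennreal_mult[symmetric] ennreal_leI)
  qed
  finally show ?thesis by (simp add: add_right_mono)
 qed
 have "(%n. ennreal (1 / real (Suc n)) + (\<integral>\<^sup>+t. ?u n t \<partial>?M)) \<longlonglongrightarrow> ennreal 0 + (\<integral>\<^sup>+t. 0 \<partial>?M)"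
  by (intro tendsto_add u0 tendsto_ennrealI inv0)
 then have "(%n. ennreal (1 / real (Suc n)) + (\<integral>\<^sup>+t. ?u n t \<partial>?M)) \<longlonglongrightarrow> 0" by simp
 then have nn: "(%n. \<integral>\<^sup>+t. ennreal (norm (f t - s n t)) \<partial>?M) \<longlonglongrightarrow> 0"
  by (rule tendsto_sandwich[OF _ _ tendsto_const, rotated 2]) (use le in auto)
 from simple_approx_has_integral(2)[OF S s(1) ae nn] show ?thesis
  unfolding has_Bochner_integral_def using s(1) ae nn by blast
qed

lemma has_Bochner_integral_continuous_compact:
 fixes f :: "real => 'b::banach"
 assumes K: "compact K" and f: "continuous_on K f"
 shows "has_Bochner_integral (lebesgue_on K) f (integral K f)"
proof -
 have Kl: "K \<in> lmeasurable" using K by (rule lmeasurable_compact)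
 obtain B where B: "!!t. t \<in> K ==> norm (f t) <= B"
  using compact_imp_bounded[OF compact_continuous_image[OF f K]] by (auto simp: bounded_iff)
 interpret finite_measure "lebesgue_on K" using Kl by (rule finite_measure_lebesgue_on)
 show ?thesis
  by (rule has_Bochner_integral_continuous[where K = "%_. K" and g = "%_. B"])
   (use K Kl f B in auto)
qed

text \<open>Serves to integrate a test function against \<open>A u\<close>, of which only local
  Bochner integrability is known. Simple approximants of the two factors are multiplied and extended
  by 0.\<close>

lemma Bochner_integrable_scaleC_compact:
 fixes f :: "real => 'a::complex_banach"
 assumes K: "compact K" "K \<subseteq> S" and S: "S \<in> sets lebesgue"
  and f: "Bochner_integrable (lebesgue_on K) f" and ph: "continuous_on K ph"
  and zero: "!!t. t \<in> S - K ==> ph t = 0"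
 shows "Bochner_integrable (lebesgue_on S) (%t. ph t *\<^sub>C f t)"
proof -
 let ?M = "lebesgue_on S" and ?MK = "lebesgue_on K"
 have sp: "space ?M = S" "space ?MK = K" by (simp_all add: space_lebesgue_on)
 have Kl: "K \<in> lmeasurable" using K(1) by (rule lmeasurable_compact)
 then have Kleb: "K \<in> sets lebesgue" by auto
 have Km: "K \<in> sets ?M" using Kl K(2) S by (auto simp: sets_restrict_space_iff)
 obtain s where s: "!!i. Bochner_Integration.simple_bochner_integrable ?MK (s i)"
  and ae: "AE t in ?MK. (%i. s i t) \<longlonglongrightarrow> f t"
  and nn: "(%i. \<integral>\<^sup>+t. ennreal (norm (f t - s i t)) \<partial>?MK) \<longlonglongrightarrow> 0"
  using f unfolding Bochner_integrable_def has_Bochner_integral_def by blast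
 have sf: "simple_function ?MK (s i)" and sfin: "emeasure ?MK {y \<in> space ?MK. s i y ~= 0} ~= \<infinity>" for i
  using s[of i] by (auto elim: Bochner_Integration.simple_bochner_integrable.cases)
 obtain \<Phi> where \<Phi>: "!!t. t \<in> K ==> cmod (ph t) <= \<Phi>" "\<Phi> \<ge> 0"
  using compact_imp_bounded[OF compact_continuous_image[OF ph K(1)]]
  by (auto simp: bounded_iff) (metis abs_ge_self abs_ge_zero order_trans)
 have "\<exists>J\<ge>0. (\<integral>\<^sup>+t. ennreal (norm (s i t)) \<partial>?MK) = ennreal J" for i
 proof -
  have fin: "finite (s i ` K)" using simple_functionD(1)[OF sf[of i]] by (simp add: sp)
  have "(\<integral>\<^sup>+t. ennreal (norm (s i t)) \<partial>?MK) <= (\<integral>\<^sup>+t. ennreal (Max (insert 0 (norm ` s i ` K))) \<partial>?MK)"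
   using fin by (intro nn_integral_mono ennreal_leI Max_ge) (auto simp: sp)
  also have "... = ennreal (Max (insert 0 (norm ` s i ` K))) * emeasure ?MK K"
   by (simp add: sp)
  also have "emeasure ?MK K = emeasure lebesgue K" using Kleb by (intro emeasure_restrict_space) auto
  also have "ennreal (Max (insert 0 (norm ` s i ` K))) * ... < \<infinity>"
   using fmeasurableD2[OF Kl] by (simp add: ennreal_mult_less_top less_top)
  finally show ?thesis
   by (intro exI[of _ "enn2real (\<integral>\<^sup>+t. ennreal (norm (s i t)) \<partial>?MK)"]) (simp add: less_top)
 qed
 then obtain J where J: "!!i. J i \<ge> 0" "!!i. (\<integral>\<^sup>+t. ennreal (norm (s i t)) \<partial>?MK) = ennreal (J i)" by metis
 \<comment> \<open>\<open>J i\<close> is the mean norm of \<open>s i\<close>, for which no bound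
   uniform in \<open>i\<close> is used. The accuracy for \<open>ph\<close> is adapted to it, so that
   \<open>de i * J i\<close> is at most \<open>1 / (i + 1)\<close>.\<close>
 define de where "de i = 1 / (real (Suc i) * (J i + 1))" for i
 have de: "de i > 0" for i using J(1)[of i] by (auto simp: de_def intro!: divide_pos_pos mult_pos_pos)
 have "\<exists>sg. Bochner_Integration.simple_bochner_integrable ?M sg \<and> (\<forall>t\<in>K. norm (ph t - sg t) <= de i)" for i
  using compact_simple_approx[OF K S ph de[of i]] by metis
 then obtain sg where sg: "!!i. Bochner_Integration.simple_bochner_integrable ?M (sg i)"
  "!!i t. t \<in> K ==> norm (ph t - sg i t) <= de i" by metis
 define s' where "s' i t = (if t \<in> K then s i t else 0)" for i t
 have sf': "simple_function ?M (s' i)" for i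
  unfolding simple_function_def sp
 proof (intro conjI ballI)
  have "s' i ` S \<subseteq> insert 0 (s i ` K)" by (auto simp: s'_def)
  then show "finite (s' i ` S)"
   by (rule finite_subset) (use simple_functionD(1)[OF sf[of i]] in \<open>simp add: sp\<close>)
  fix y
  have "s i -` {y} \<inter> K \<in> sets ?MK" using simple_functionD(2)[OF sf[of i], of "{y}"] by (simp add: sp)
  then have "s i -` {y} \<inter> K \<in> sets lebesgue" using Kleb by (auto simp: sets_restrict_space_iff)
  then have 1: "s i -` {y} \<inter> K \<in> sets ?M" using K(2) S by (auto simp: sets_restrict_space_iff)
  have 2: "S - K \<in> sets ?M" using sets.compl_sets[OF Km] by (simp add: sp)
  have "s' i -` {y} \<inter> S = (if y = 0 then (s i -` {y} \<inter> K) \<union> (S - K) else s i -` {y} \<inter> K)"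
   using K(2) by (auto simp: s'_def split: if_splits)
  then show "s' i -` {y} \<inter> S \<in> sets ?M" using 1 2 by auto
 qed
 define r where "r i t = sg i t *\<^sub>C s' i t" for i t
 have sc0: "(c::complex) *\<^sub>C (0::'a) = 0" for c
  using norm_scaleC[of c "0::'a"] by simp
 have s0c: "(0::complex) *\<^sub>C (x::'a) = 0" for x
  using norm_scaleC[of 0 x] by simp
 have rs: "Bochner_Integration.simple_bochner_integrable ?M (r i)" for i
 proof (rule Bochner_Integration.simple_bochner_integrable.intros)
  have "simple_function ?M (sg i)"
   using sg(1)[of i] by (auto elim: Bochner_Integration.simple_bochner_integrable.cases)
  from simple_function_compose2[OF this sf', of scaleC]
  show "simple_function ?M (r i)" unfolding r_def .
  have "emeasure ?M {y \<in> space ?M. r i y ~= 0} <= emeasure ?M K"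
   using Km by (intro emeasure_mono) (auto simp: r_def s'_def sc0 split: if_splits)
  also have "emeasure ?M K = emeasure lebesgue K" using K(2) S by (intro emeasure_restrict_space) auto
  also have "... < \<infinity>" using fmeasurableD2[OF Kl] by (simp add: less_top)
  finally show "emeasure ?M {y \<in> space ?M. r i y ~= 0} ~= \<infinity>" by simp
 qed
 have inv0: "(%n. 1 / real (Suc n)) \<longlonglongrightarrow> 0" by real_asymp
 have de1: "de i <= 1 / real (Suc i)" for i
 proof -
  have "real (Suc i) * 1 <= real (Suc i) * (J i + 1)" using J(1)[of i] by (intro mult_left_mono) auto
  then show ?thesis unfolding de_def by (intro frac_le) auto
 qed
 have scale_diff: "a *\<^sub>C x - b *\<^sub>C y = a *\<^sub>C (x - y) + (a - b) *\<^sub>C y" for a b and x y :: 'a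
  using scaleC_add_right[of a "x - y" y] scaleC_add_left[of "a - b" b y] by simp
 have diffb: "norm (ph t *\<^sub>C f t - r i t) <= \<Phi> * norm (f t - s i t) + de i * norm (s i t)" if "t \<in> K" for i t
 proof -
  have "norm (ph t *\<^sub>C f t - r i t) <= norm (ph t *\<^sub>C (f t - s i t)) + norm ((ph t - sg i t) *\<^sub>C s i t)"
   using that by (simp add: r_def s'_def scale_diff norm_triangle_ineq)
  also have "... <= \<Phi> * norm (f t - s i t) + de i * norm (s i t)"
   unfolding norm_scaleC using \<Phi>(1)[OF that] sg(2)[OF that] by (intro add_mono mult_right_mono) auto
  finally show ?thesis .
 qed
 have aer: "AE t in ?M. (%i. r i t) \<longlonglongrightarrow> ph t *\<^sub>C f t"
 proof -
  obtain N where N: "N \<in> null_sets ?MK" "{t \<in> K. \<not> (%i. s i t) \<longlonglongrightarrow> f t} \<subseteq> N"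
   using ae by (auto simp: eventually_ae_filter sp)
  have "N \<in> null_sets ?M" using N(1) K(2) S Kleb by (auto simp: null_sets_restrict_space)
  moreover have "{t \<in> space ?M. \<not> (%i. r i t) \<longlonglongrightarrow> ph t *\<^sub>C f t} \<subseteq> N"
  proof (rule subsetI, rule ccontr)
   fix t assume t: "t \<in> {t \<in> space ?M. \<not> (%i. r i t) \<longlonglongrightarrow> ph t *\<^sub>C f t}" "t \<notin> N"
   have "(%i. r i t) \<longlonglongrightarrow> ph t *\<^sub>C f t"
   proof (cases "t \<in> K")
    case True
    then have sl: "(%i. s i t) \<longlonglongrightarrow> f t" using N(2) t(2) by auto
    have "(%i. \<Phi> * norm (f t - s i t) + 1 / real (Suc i) * norm (s i t)) \<longlonglongrightarrow> \<Phi> * norm (f t - f t) + 0 * norm (f t)"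
     by (intro tendsto_intros sl inv0)
    then have lim: "(%i. \<Phi> * norm (f t - s i t) + 1 / real (Suc i) * norm (s i t)) \<longlonglongrightarrow> 0" by simp
    have "norm (r i t - ph t *\<^sub>C f t) <= \<Phi> * norm (f t - s i t) + 1 / real (Suc i) * norm (s i t)" for i
     using diffb[OF True, of i] mult_right_mono[OF de1[of i] norm_ge_zero[of "s i t"]]
     by (simp add: norm_minus_commute)
    then have "(%i. r i t - ph t *\<^sub>C f t) \<longlonglongrightarrow> 0"
     by (intro Lim_null_comparison[OF always_eventually[OF allI] lim])
    then show ?thesis by (rule LIM_zero_cancel)
   next
    case False
    then have "ph t = 0" using zero t(1) by (auto simp: sp)
    then show ?thesis using False by (simp add: r_def s'_def sc0 s0c)
   qed
   then show False using t(1) by simp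
  qed
  ultimately show ?thesis by (rule AE_I')
 qed
 have nnr: "(%i. \<integral>\<^sup>+t. ennreal (norm (ph t *\<^sub>C f t - r i t)) \<partial>?M) \<longlonglongrightarrow> 0"
 proof -
  have le: "(\<integral>\<^sup>+t. ennreal (norm (ph t *\<^sub>C f t - r i t)) \<partial>?M) <=
    ennreal \<Phi> * (\<integral>\<^sup>+t. ennreal (norm (f t - s i t)) \<partial>?MK) + ennreal (1 / real (Suc i))" for i
  proof -
   obtain L where L: "L \<in> borel_measurable ?MK" "AE t in ?MK. L t = norm (f t - s i t)"
    using simple_approx_norm_measurable[OF s ae] by blast
   have "(\<integral>\<^sup>+t. ennreal (norm (ph t *\<^sub>C f t - r i t)) \<partial>?M)
     = (\<integral>\<^sup>+t. ennreal (norm (ph t *\<^sub>C f t - r i t)) * indicator S t \<partial>lebesgue)"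
    using S by (simp add: nn_integral_restrict_space)
   also have "... = (\<integral>\<^sup>+t. ennreal (norm (ph t *\<^sub>C f t - r i t)) * indicator K t \<partial>lebesgue)"
    using zero K(2) by (intro nn_integral_cong) (auto simp: indicator_def r_def s'_def sc0 s0c)
   also have "... = (\<integral>\<^sup>+t. ennreal (norm (ph t *\<^sub>C f t - r i t)) \<partial>?MK)"
    using Kleb by (simp add: nn_integral_restrict_space)
   also have "... <= (\<integral>\<^sup>+t. (ennreal \<Phi> * ennreal \<bar>L t\<bar> + ennreal (de i) * ennreal (norm (s i t))) \<partial>?MK)"
   proof (rule nn_integral_mono_AE)
    show "AE t in ?MK. ennreal (norm (ph t *\<^sub>C f t - r i t)) <= ennreal \<Phi> * ennreal \<bar>L t\<bar> + ennreal (de i) * ennreal (norm (s i t))"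
     using L(2) AE_space
    proof eventually_elim
     case (elim t)
     have "ennreal (norm (ph t *\<^sub>C f t - r i t)) <= ennreal (\<Phi> * norm (f t - s i t) + de i * norm (s i t))"
      using diffb[of t i] elim(2) by (intro ennreal_leI) (simp add: sp)
     also have "... = ennreal \<Phi> * ennreal \<bar>L t\<bar> + ennreal (de i) * ennreal (norm (s i t))"
      using \<Phi>(2) de[of i] elim(1) by (simp add: ennreal_mult[symmetric] ennreal_plus[symmetric] del: ennreal_plus)
     finally show ?case .
    qed
   qed
   also have "... = ennreal \<Phi> * (\<integral>\<^sup>+t. ennreal \<bar>L t\<bar> \<partial>?MK) + ennreal (de i) * (\<integral>\<^sup>+t. ennreal (norm (s i t)) \<partial>?MK)"
   proof -
    have "(%t. norm (s i t)) \<in> borel_measurable ?MK"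
     using simple_function_compose1[OF sf[of i], of norm] by (rule borel_measurable_simple_function)
    then show ?thesis using L(1) by (simp add: nn_integral_add nn_integral_cmult)
   qed
   also have "(\<integral>\<^sup>+t. ennreal \<bar>L t\<bar> \<partial>?MK) = (\<integral>\<^sup>+t. ennreal (norm (f t - s i t)) \<partial>?MK)"
    using L(2) by (intro nn_integral_cong_AE) auto
   also have "ennreal (de i) * (\<integral>\<^sup>+t. ennreal (norm (s i t)) \<partial>?MK) <= ennreal (1 / real (Suc i))"
   proof -
    have m: "J i / (J i + 1) <= 1" using J(1)[of i] by simp
    have "de i * J i = (1 / real (Suc i)) * (J i / (J i + 1))" by (simp add: de_def)
    also have "... <= (1 / real (Suc i)) * 1" using m by (intro mult_left_mono) auto
    finally show ?thesis using de[of i] J by (simp add: ennreal_mult[symmetric] ennreal_leI)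
   qed
   finally show ?thesis by (simp add: add_left_mono)
  qed
  have "(%i. ennreal \<Phi> * (\<integral>\<^sup>+t. ennreal (norm (f t - s i t)) \<partial>?MK) + ennreal (1 / real (Suc i)))
    \<longlonglongrightarrow> ennreal \<Phi> * 0 + ennreal 0"
   by (intro tendsto_add ennreal_tendsto_cmult nn tendsto_ennrealI inv0) simp
  then have lim: "(%i. ennreal \<Phi> * (\<integral>\<^sup>+t. ennreal (norm (f t - s i t)) \<partial>?MK) + ennreal (1 / real (Suc i))) \<longlonglongrightarrow> 0"
   by simp
  show ?thesis
   by (rule tendsto_sandwich[OF _ _ tendsto_const lim]) (use le in auto)
 qed
 from simple_approx_has_integral(2)[OF S rs aer nnr] show ?thesis
  unfolding Bochner_integrable_def has_Bochner_integral_def using rs aer nnr by blast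
qed

lemma integral_exp_subst_Icc:
 fixes f :: "real => 'b::banach"
 assumes ab: "a <= b" and f: "continuous_on {exp a..exp b} f"
 shows "integral {exp a..exp b} f = integral {a..b} (%s. exp s *\<^sub>R f (exp s))"
proof -
 define F where "F t = integral {exp a..t} f" for t
 have F: "(F hvd f t) (at t within {exp a..exp b})" if "t \<in> {exp a..exp b}" for t
  unfolding F_def by (rule integral_has_vector_derivative[OF f that])
 have "((%s. F (exp s)) hvd exp s *\<^sub>R f (exp s)) (at s within {a..b})" if s: "s \<in> {a..b}" for s
 proof -
  have 1: "(exp hvd exp s) (at s within {a..b})"
   by (auto intro!: derivative_eq_intros simp flip: has_real_derivative_iff_has_vector_derivative)
  have sub: "exp ` {a..b} \<subseteq> {exp a..exp b}" by auto
  have 2: "(F hvd f (exp s)) (at (exp s) within exp ` {a..b})"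
   using has_vector_derivative_within_subset[OF F sub] s by auto
  from vector_diff_chain_within[OF 1 2] show ?thesis by (simp add: o_def)
 qed
 from fundamental_theorem_of_calculus[OF ab this]
 have "((%s. exp s *\<^sub>R f (exp s)) has_integral (F (exp b) - F (exp a))) {a..b}" by simp
 then show ?thesis by (simp add: integral_unique F_def)
qed

text \<open>The bridge from integrals over a ray to integrals over a line. Decay of rate
  \<open>ep\<close> in the logarithm means the majorant \<open>t powr (ep - 1)\<close> near 0 and
  \<open>t powr (- ep - 1)\<close> at infinity, and both are integrable.\<close>

lemma has_Bochner_integral_exp_subst:
 fixes f :: "real => 'b::banach"
 assumes f: "continuous_on {0<..} f" and eps: "ep > 0"
  and bound: "!!s. norm (exp s *\<^sub>R f (exp s)) <= C * ed ep s"
 shows "has_Bochner_integral (lebesgue_on {0<..}) f (IU (%s. exp s *\<^sub>R f (exp s)))"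
proof -
 define g where "g t = C * (if t \<in> {0..1} then t powr (ep - 1) else t powr (- ep - 1))" for t
 have gi: "g integrable_on {0<..}"
 proof -
  have "((%t. t powr (ep - 1)) has_integral (1 powr (ep - 1 + 1) / (ep - 1 + 1))) {0..1}"
   using eps by (intro has_integral_powr_from_0) auto
  from integrable_eq[OF has_integral_integrable[OF this]]
  have 1: "(%t. if t \<in> {0..1} then t powr (ep - 1) else t powr (- ep - 1)) integrable_on {0..1::real}"
   by simp
  have "((%t. t powr (- ep - 1)) has_integral (- (1 powr (- ep - 1 + 1)) / (- ep - 1 + 1))) {1..}"
   using eps by (intro has_integral_powr_to_inf) auto
  then have 2: "(%t. if t \<in> {0..1} then t powr (ep - 1) else t powr (- ep - 1)) integrable_on {1::real..}"
   by (rule integrable_eq[OF has_integral_integrable]) auto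
  have "(%t. if t \<in> {0..1} then t powr (ep - 1) else t powr (- ep - 1)) integrable_on ({0..1::real} \<union> {1..})"
   by (rule integrable_Un'[OF 1 2]) auto
  moreover have "{0..1::real} \<union> {1..} = {0..}" by auto
  ultimately have "g integrable_on {0..}"
   unfolding g_def by (intro integrable_on_mult_right) simp
  then show ?thesis
   by (rule integrable_spike_set) (rule negligible_subset[of "{0::real}"], simp, force)+
 qed
 have C: "C \<ge> 0" using order_trans[OF norm_ge_zero bound[of 0]] by simp
 have fg: "norm (f t) <= g t" if "t \<in> {0<..}" for t
 proof -
  have t: "t > 0" using that by simp
  have "t * norm (f t) <= C * exp (- ep * \<bar>ln t\<bar>)" using bound[of "ln t"] t by simp
  then have "norm (f t) <= C * exp (- ep * \<bar>ln t\<bar>) * (1 / t)" using t by (simp add: field_simps)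
  also have "1 / t = exp (- ln t)" using t by (simp add: exp_minus inverse_eq_divide)
  also have "C * exp (- ep * \<bar>ln t\<bar>) * exp (- ln t) = g t"
   using t by (auto simp: g_def powr_def exp_add[symmetric] algebra_simps abs_if)
  finally show ?thesis .
 qed
 have "g absolutely_integrable_on {0<..}"
  using gi C by (subst absolutely_integrable_on_iff_nonneg) (auto simp: g_def)
 then have gL: "integrable (lebesgue_on {0<..}) g"
  by (rule absolutely_integrable_imp_integrable) simp
 let ?K = "%n. {exp (- real n)..exp (real n)}"
 have ev: "eventually (%n. t \<in> ?K n) sequentially" if "t \<in> {0<..}" for t
 proof -
  have t0: "t > 0" using that by simp
  obtain N :: nat where N: "\<bar>ln t\<bar> <= real N" using real_arch_simple by blast
  have "t \<in> ?K n" if "n \<ge> N" for n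
  proof -
   have "exp (- real n) <= exp (ln t)" "exp (ln t) <= exp (real n)"
    using N that unfolding exp_le_cancel_iff by linarith+
   moreover have "exp (ln t) = t" using t0 by simp
   ultimately show ?thesis by (simp only: atLeastAtMost_iff)
  qed
  then show ?thesis by (auto simp: eventually_sequentially)
 qed
 have Ksub: "?K n \<subseteq> {0<..}" for n by (auto intro: less_le_trans[OF exp_gt_zero])
 have hB: "has_Bochner_integral (lebesgue_on {0<..}) f (integral {0<..} f)"
  by (rule has_Bochner_integral_continuous[OF _ _ Ksub ev f gL fg]) auto
 have fi: "f integrable_on {0<..}"
  using has_Bochner_integral_has_integral[OF _ hB] by (auto intro: has_integral_integrable)
 have fK: "f integrable_on ?K n" for n
  by (rule integrable_continuous_interval[OF continuous_on_subset[OF f Ksub]])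
 have "(%n. integral (?K n) f) \<longlonglongrightarrow> integral {0<..} f"
 proof -
  let ?r = "%n t. if t \<in> ?K n then 0 else g t"
  have gK: "(%t. if t \<in> ?K n then g t else 0) integrable_on {0<..}" for n
  proof -
   have "g integrable_on ?K n" by (rule integrable_on_subinterval[OF gi Ksub])
   then show ?thesis using integrable_restrict_Int[where S = "?K n" and T = "{0<..}" and f = g] Int_absorb2[OF Ksub[of n]] by simp
  qed
  have ri: "?r n integrable_on {0<..}" for n
   by (rule integrable_eq[OF integrable_diff[OF gi gK[of n]]]) auto
  have "(%n. integral {0<..} (?r n)) \<longlonglongrightarrow> integral {0<..} (%t::real. 0::real)"
  proof (rule dominated_convergence(2)[where h = g])
   show "(%n. ?r n t) \<longlonglongrightarrow> 0" if "t \<in> {0<..}" for t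
    by (rule tendsto_eventually[OF eventually_mono[OF ev[OF that]]]) simp
   show "norm (?r n t) <= g t" if "t \<in> {0<..}" for n t
    using C by (auto simp: g_def)
  qed (use ri gi in auto)
  then have lim: "(%n. integral {0<..} (?r n)) \<longlonglongrightarrow> 0" by simp
  have "norm (integral (?K n) f - integral {0<..} f) <= integral {0<..} (?r n)" for n
  proof -
   have fr: "((%t. if t \<in> ?K n then f t else 0) has_integral integral (?K n) f) {0<..}"
    using integrable_integral[OF fK[of n]] has_integral_restrict[OF Ksub[of n]] by blast
   have d: "((%t. (if t \<in> ?K n then f t else 0) - f t) has_integral (integral (?K n) f - integral {0<..} f)) {0<..}"
    by (rule has_integral_diff[OF fr integrable_integral[OF fi]])
   have "norm ((if t \<in> ?K n then f t else 0) - f t) <= ?r n t" if "t \<in> {0<..}" for t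
    using fg[OF that] by auto
   from integral_norm_bound_integral[OF has_integral_integrable[OF d] ri this]
   show ?thesis by (simp only: integral_unique[OF d])
  qed
  then have "(%n. integral (?K n) f - integral {0<..} f) \<longlonglongrightarrow> 0"
   by (intro Lim_null_comparison[OF always_eventually[OF allI] lim])
  then show ?thesis by (rule LIM_zero_cancel)
 qed
 moreover have Keq: "integral (?K n) f = integral {- real n..real n} (%s. exp s *\<^sub>R f (exp s))" for n
  by (rule integral_exp_subst_Icc[OF _ continuous_on_subset[OF f Ksub]]) simp
 moreover have "(%n. integral {- real n..real n} (%s. exp s *\<^sub>R f (exp s)))
   \<longlonglongrightarrow> IU (%s. exp s *\<^sub>R f (exp s))"
  by (rule exp_decay_tendsto[OF _ eps bound])
   (intro continuous_intros continuous_on_compose2[OF f], auto)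
 ultimately have "integral {0<..} f = IU (%s. exp s *\<^sub>R f (exp s))"
  unfolding Keq by (blast intro: LIMSEQ_unique)
 then show ?thesis using hB by simp
qed

section \<open>Modified Bessel functions in the logarithmic variable\<close>

text \<open>With \<open>z = exp ze\<close> this is \<open>z powr nu * K\<^sub>nu(z)\<close> for the modified Bessel function of the second kind.\<close>

definition bessel_kernel :: "complex => complex => real => complex" where
 "bessel_kernel nu ze sg = exp (nu * (ze + of_real sg) - exp ze * of_real (cosh sg))"

definition bessel_fun :: "complex => complex => complex" where
 "bessel_fun nu ze = IU (bessel_kernel nu ze) / 2"

lemma continuous_bessel_kernel: "cont (bessel_kernel nu ze)"
 unfolding bessel_kernel_def cosh_def by (intro continuous_intros) auto

lemma norm_bessel_kernel:
 "cmod (bessel_kernel nu ze sg)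
  = exp (Re nu * (Re ze + sg) - Im nu * Im ze - exp (Re ze) * cos (Im ze) * cosh sg)"
 by (simp add: bessel_kernel_def Re_exp algebra_simps)

lemma cosh_complex_of_real: "cosh (cr x) = of_real (cosh x)"
 and sinh_complex_of_real: "sinh (cr x) = of_real (sinh x)"
 by (simp_all add: cosh_def sinh_def scaleR_conv_of_real flip: exp_of_real)

lemma exp_neg_le_inverse: "exp (- y) <= 1 / y" if "y > 0" for y :: real
proof -
 have "y <= exp y" using exp_ge_add_one_self[of y] by linarith
 then show ?thesis using that by (simp add: exp_minus inverse_eq_divide frac_le)
qed

text \<open>For \<open>sg >= 0\<close> the bound \<open>exp (- y) <= 1 / y\<close> turns the double
  exponential into \<open>exp (- sg)\<close>, leaving rate \<open>1 - a\<close>. For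
  \<open>sg < 0\<close> the factor \<open>exp (a * sg)\<close> decays by itself.\<close>

lemma exp_neg_exp_bound:
 fixes a d sg :: real
 assumes nu: "0 < a" "a < 1" and d: "d > 0"
 shows "exp (a * sg - d * exp sg) <= (1 + 1 / d) * exp (- min a (1 - a) * \<bar>sg\<bar>)"
proof (cases "sg \<ge> 0")
 case True
 have "exp (a * sg - d * exp sg) = exp (a * sg) * exp (- (d * exp sg))" by (simp add: exp_add[symmetric])
 also have "... <= exp (a * sg) * (1 / (d * exp sg))"
  using d by (intro mult_left_mono exp_neg_le_inverse) auto
 also have "... = 1 / d * exp (- (1 - a) * sg)" by (simp add: exp_diff exp_minus field_simps exp_add[symmetric])
 also have "... <= (1 + 1 / d) * exp (- min a (1 - a) * \<bar>sg\<bar>)"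
 proof (intro mult_mono)
  have "min a (1 - a) * sg <= (1 - a) * sg" using True by (intro mult_right_mono) auto
  then show "exp (- (1 - a) * sg) <= exp (- min a (1 - a) * \<bar>sg\<bar>)" using True by (simp add: algebra_simps)
 qed (use d in auto)
 finally show ?thesis .
next
 case False
 have "exp (a * sg - d * exp sg) <= 1 * exp (a * sg)" using d by simp
 also have "... <= (1 + 1 / d) * exp (- min a (1 - a) * \<bar>sg\<bar>)"
 proof (intro mult_mono)
  have "min a (1 - a) * \<bar>sg\<bar> <= a * \<bar>sg\<bar>" by (intro mult_right_mono) auto
  then show "exp (a * sg) <= exp (- min a (1 - a) * \<bar>sg\<bar>)" using False by simp
 qed (use d in auto)
 finally show ?thesis .
qed

lemma cosh_ge_exp_abs: "exp \<bar>sg\<bar> / 2 <= cosh sg" for sg :: real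
 by (cases "sg \<ge> 0") (simp_all add: cosh_def)

lemma cosh_ge_exp: "exp sg / 2 <= cosh sg" for sg :: real
 by (simp add: cosh_def)

lemma cos_ge_on_strip: "cos b <= cos y" if "\<bar>y\<bar> <= b" "b < pi / 2" for y b :: real
 using cos_monotone_0_pi_le[of "\<bar>y\<bar>" b] that by (simp add: cos_abs_real)

lemma norm_bessel_kernel_le:
 assumes b: "\<bar>Im ze\<bar> <= b" "b < pi / 2"
 shows "cmod (bessel_kernel nu ze sg)
  <= exp (\<bar>Im nu\<bar> * b) * exp (Re nu * (Re ze + sg) - cos b * exp (Re ze) * cosh sg)"
proof -
 have "- Im nu * Im ze <= \<bar>Im nu\<bar> * b"
  using abs_ge_self[of "- Im nu * Im ze"] mult_left_mono[OF b(1), of "\<bar>Im nu\<bar>"] by (simp add: abs_mult)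
 moreover have "cos b * (exp (Re ze) * cosh sg) <= cos (Im ze) * (exp (Re ze) * cosh sg)"
  by (rule mult_right_mono[OF cos_ge_on_strip[OF b]]) simp
 then have "cos b * exp (Re ze) * cosh sg <= exp (Re ze) * cos (Im ze) * cosh sg"
  by (simp only: mult_ac)
 ultimately show ?thesis unfolding norm_bessel_kernel exp_add[symmetric] exp_le_cancel_iff by linarith
qed

text \<open>The restriction to heights at most \<open>b < pi / 2\<close> keeps the real part of
  \<open>exp ze\<close> above \<open>cos b * exp (Re ze)\<close>, so the kernel decays doubly
  exponentially. Centring the estimate at \<open>sg = - Re ze\<close> makes the constant independent
  of \<open>ze\<close>.\<close>

lemma bessel_fun_bound:
 assumes nu: "0 < Re nu" "Re nu < 1" and b: "0 <= b" "b < pi / 2"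
 obtains C d where "0 < C" "0 < d"
  "!!ze. \<bar>Im ze\<bar> <= b ==> cmod (bessel_fun nu ze) <= C * exp (- d * exp (Re ze))"
proof -
 let ?a = "Re nu"
 define ep where "ep = min ?a (1 - ?a)"
 have ep: "ep > 0" using nu by (simp add: ep_def)
 define d where "d = cos b"
 have d: "d > 0" unfolding d_def using b by (intro cos_gt_zero_pi) auto
 define C where "C = exp (\<bar>Im nu\<bar> * b) * (1 + 4 / d)"
 have C: "C > 0" using d by (simp add: C_def add_pos_pos)
 have "cmod (bessel_fun nu ze) <= C * (2 / ep) * exp (- (d / 2) * exp (Re ze))" if ze: "\<bar>Im ze\<bar> <= b" for ze
 proof -
  let ?x = "Re ze"
  have "cmod (bessel_kernel nu ze sg) <= C * exp (- (d / 2) * exp ?x) * exp (- ep * \<bar>sg - (- ?x)\<bar>)" for sg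
  proof -
   \<comment> \<open>The average of \<open>cosh sg >= 1\<close> and
     \<open>cosh sg >= exp sg / 2\<close>: the first half supplies the decay in \<open>ze\<close>,
     the second the integrability in \<open>sg\<close>.\<close>
   have "d * (exp ?x * (1 / 2 + exp sg / 4)) <= d * (exp ?x * cosh sg)"
    using cosh_ge_exp[of sg] cosh_real_ge_1[of sg] d by (intro mult_left_mono) auto
   then have "d * (exp ?x / 2 + exp (sg + ?x) / 4) <= d * exp ?x * cosh sg"
    by (simp add: exp_add algebra_simps)
   then have "exp (?a * (?x + sg) - d * exp ?x * cosh sg)
     <= exp ((?a * (sg + ?x) - d / 4 * exp (sg + ?x)) + (- (d / 2) * exp ?x))"
    by (simp add: algebra_simps)
   also have "... = exp (?a * (sg + ?x) - d / 4 * exp (sg + ?x)) * exp (- (d / 2) * exp ?x)"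
    by (simp only: exp_add)
   also have "... <= ((1 + 1 / (d / 4)) * exp (- ep * \<bar>sg + ?x\<bar>)) * exp (- (d / 2) * exp ?x)"
    unfolding ep_def using d nu by (intro mult_right_mono exp_neg_exp_bound) auto
   finally have "exp (?a * (?x + sg) - d * exp ?x * cosh sg)
     <= ((1 + 4 / d) * exp (- ep * \<bar>sg + ?x\<bar>)) * exp (- (d / 2) * exp ?x)" by simp
   from order_trans[OF norm_bessel_kernel_le[OF ze b(2), of nu sg, folded d_def]
     mult_left_mono[OF this, of "exp (\<bar>Im nu\<bar> * b)"]]
   show ?thesis by (simp add: C_def mult_ac)
  qed
  from exp_decay_integrable(2)[OF continuous_bessel_kernel ep this]
  have "cmod (IU (bessel_kernel nu ze)) <= C * exp (- (d / 2) * exp ?x) * (2 / ep)" .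
  moreover have "cmod (bessel_fun nu ze) <= cmod (IU (bessel_kernel nu ze))"
   by (simp add: bessel_fun_def norm_divide)
  ultimately have "cmod (bessel_fun nu ze) <= C * exp (- (d / 2) * exp ?x) * (2 / ep)" by linarith
  then show ?thesis by (simp add: mult_ac)
 qed
 then show thesis using C ep d by (intro that[of "C * (2 / ep)" "d / 2"]) auto
qed

text \<open>Integrating the \<open>sg\<close>-derivative of the kernel over \<open>[-n, n]\<close> turns the \<open>ze\<close>-derivative of the
 truncated integral into the truncated integral with parameter \<open>1 - nu\<close> plus a boundary term.\<close>

lemma bessel_trunc_deriv:
 "((%ze. integral {- real n..real n} (bessel_kernel nu ze)) has_field_derivative
  (bessel_kernel nu ze (real n) - bessel_kernel nu ze (- real n))
   - exp (2 * nu * ze) * integral {- real n..real n} (bessel_kernel (1 - nu) ze)) (at ze)"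
proof -
 let ?D = "%ze sg. bessel_kernel nu ze sg * (nu - exp ze * of_real (cosh sg))"
 have der: "((%ze. bessel_kernel nu ze sg) has_field_derivative ?D ze sg) (at ze within UNIV)" for ze sg
  unfolding bessel_kernel_def by (auto intro!: derivative_eq_intros simp: algebra_simps)
 have "((%ze. integral (cbox (- real n) (real n)) (bessel_kernel nu ze)) has_field_derivative
   integral (cbox (- real n) (real n)) (?D ze)) (at ze within UNIV)"
 proof (rule leibniz_rule_field_derivative[OF der])
  show "bessel_kernel nu ze integrable_on cbox (- real n) (real n)" for ze
   unfolding interval_cbox[symmetric]
   by (intro integrable_continuous_interval continuous_on_subset[OF continuous_bessel_kernel]) auto
  show "continuous_on (UNIV \<times> cbox (- real n) (real n)) (%(ze, sg). ?D ze sg)"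
   unfolding bessel_kernel_def cosh_def case_prod_unfold by (intro continuous_intros) auto
 qed auto
 moreover have "integral {- real n..real n} (?D ze) =
  (bessel_kernel nu ze (real n) - bessel_kernel nu ze (- real n))
   - exp (2 * nu * ze) * integral {- real n..real n} (bessel_kernel (1 - nu) ze)"
 proof -
  let ?E = "%sg. bessel_kernel nu ze sg * (nu - exp ze * of_real (sinh sg))"
  \<comment> \<open>The reflection of \<open>sg\<close> turns \<open>exp (- sg)\<close> times the
    kernel of order \<open>nu\<close> into the kernel of order \<open>1 - nu\<close>. This is the
    part of \<open>cosh\<close> that remains once \<open>sinh\<close> has been absorbed into a total
    derivative.\<close>
  let ?R = "%sg. exp (2 * nu * ze) * bessel_kernel (1 - nu) ze (- sg)"
  have "(bessel_kernel nu ze hvd ?E sg) (at sg within {- real n..real n})" for sg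
  proof (rule has_vector_derivative_at_within)
   have "((%z. exp (nu * (ze + z) - exp ze * cosh z)) has_field_derivative ?E sg) (at (of_real sg))"
    unfolding bessel_kernel_def
    by (auto intro!: derivative_eq_intros simp: algebra_simps simp flip: cosh_complex_of_real sinh_complex_of_real)
   from has_vector_derivative_real_field[OF this]
   show "(bessel_kernel nu ze hvd ?E sg) (at sg)"
    by (simp add: bessel_kernel_def[abs_def] cosh_complex_of_real)
  qed
  from fundamental_theorem_of_calculus[OF _ this]
  have E: "(?E has_integral (bessel_kernel nu ze (real n) - bessel_kernel nu ze (- real n))) {- real n..real n}"
   by simp
  have "bessel_kernel (1 - nu) ze integrable_on {- real n..real n}"
   by (intro integrable_continuous_interval continuous_on_subset[OF continuous_bessel_kernel]) auto
  then have "(bessel_kernel (1 - nu) ze has_integral integral {- real n..real n} (bessel_kernel (1 - nu) ze)) {- real n..real n}"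
   by (rule integrable_integral)
  from has_integral_reflect_lemma_real[OF this]
  have "(?R has_integral exp (2 * nu * ze) * integral {- real n..real n} (bessel_kernel (1 - nu) ze)) {- real n..real n}"
   by (intro has_integral_mult_right) simp
  from has_integral_diff[OF E this]
  have "((%sg. ?E sg - ?R sg) has_integral (bessel_kernel nu ze (real n) - bessel_kernel nu ze (- real n))
   - exp (2 * nu * ze) * integral {- real n..real n} (bessel_kernel (1 - nu) ze)) {- real n..real n}" .
  moreover have "?E sg - ?R sg = ?D ze sg" for sg
  proof -
   have "?R sg = bessel_kernel nu ze sg * (exp ze * exp (- of_real sg))"
    by (simp add: bessel_kernel_def exp_add[symmetric] algebra_simps)
   moreover have "exp (- cr sg) = of_real (cosh sg - sinh sg)"
    by (simp add: cosh_minus_sinh exp_of_real flip: of_real_minus)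
   ultimately show ?thesis by (simp add: algebra_simps)
  qed
  ultimately show ?thesis by (simp add: integral_unique)
 qed
 ultimately show ?thesis by simp
qed

text \<open>Since \<open>cosh sg >= exp |sg| / 2\<close>, the bound
  \<open>exp (- y) <= 1 / y\<close> yields a factor \<open>exp (- |sg|)\<close>. The growth
  \<open>exp (Re nu * |sg|)\<close> uses up part of it and leaves the rate \<open>1 - Re nu\<close>,
  uniformly for \<open>ze\<close> in a box.\<close>

lemma bessel_kernel_locally_dominated:
 assumes nu: "0 < Re nu" "Re nu < 1" and b: "0 <= b" "b < pi / 2" and x: "x0 <= x1"
 obtains C where "0 <= C"
  "!!ze sg. \<bar>Im ze\<bar> <= b ==> x0 <= Re ze ==> Re ze <= x1 ==>
   cmod (bessel_kernel nu ze sg) <= C * exp (- (1 - Re nu) * \<bar>sg\<bar>)"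
proof -
 define d where "d = cos b * exp x0 / 2"
 have d: "d > 0" unfolding d_def using b by (intro divide_pos_pos mult_pos_pos cos_gt_zero_pi) auto
 define C where "C = exp (\<bar>Im nu\<bar> * b) * (exp (Re nu * x1) / d)"
 have "cmod (bessel_kernel nu ze sg) <= C * exp (- (1 - Re nu) * \<bar>sg\<bar>)"
  if ze: "\<bar>Im ze\<bar> <= b" "x0 <= Re ze" "Re ze <= x1" for ze sg
 proof -
  have cb: "cos b > 0" using b by (intro cos_gt_zero_pi) auto
  have "d * exp \<bar>sg\<bar> = cos b * exp x0 * (exp \<bar>sg\<bar> / 2)" by (simp add: d_def)
  also have "... <= cos b * exp (Re ze) * cosh sg"
   using cb ze(2) cosh_ge_exp_abs[of sg] by (intro mult_mono) auto
  finally have 1: "d * exp \<bar>sg\<bar> <= cos b * exp (Re ze) * cosh sg" .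
  have "Re nu * (Re ze + sg) <= Re nu * (x1 + \<bar>sg\<bar>)" using nu ze(3) by (intro mult_left_mono) auto
  then have "Re nu * (Re ze + sg) - cos b * exp (Re ze) * cosh sg <= Re nu * x1 + Re nu * \<bar>sg\<bar> + (- (d * exp \<bar>sg\<bar>))"
   using 1 by (simp add: algebra_simps)
  then have "exp (Re nu * (Re ze + sg) - cos b * exp (Re ze) * cosh sg)
    <= exp (Re nu * x1 + Re nu * \<bar>sg\<bar>) * exp (- (d * exp \<bar>sg\<bar>))"
   by (simp add: exp_add[symmetric])
  also have "... <= exp (Re nu * x1 + Re nu * \<bar>sg\<bar>) * (1 / (d * exp \<bar>sg\<bar>))"
   using d by (intro mult_left_mono exp_neg_le_inverse) auto
  also have "... = exp (Re nu * x1) / d * exp (- (1 - Re nu) * \<bar>sg\<bar>)"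
   using d by (simp add: exp_add exp_minus exp_diff field_simps)
  finally have "exp (Re nu * (Re ze + sg) - cos b * exp (Re ze) * cosh sg)
   <= exp (Re nu * x1) / d * exp (- (1 - Re nu) * \<bar>sg\<bar>)" .
  from order_trans[OF norm_bessel_kernel_le[OF ze(1) b(2), of nu sg]
    mult_left_mono[OF this, of "exp (\<bar>Im nu\<bar> * b)"]]
  show ?thesis by (simp add: C_def mult_ac)
 qed
 then show thesis using d by (intro that[of C]) (auto simp: C_def)
qed

lemma bessel_trunc_limit:
 assumes nu: "0 < Re nu" "Re nu < 1" and ze: "\<bar>Im ze\<bar> < pi / 2"
 shows "(%n. integral {- real n..real n} (bessel_kernel nu ze)) \<longlonglongrightarrow> IU (bessel_kernel nu ze)"
  "(%n. bessel_kernel nu ze (real n)) \<longlonglongrightarrow> 0" "(%n. bessel_kernel nu ze (- real n)) \<longlonglongrightarrow> 0"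
proof -
 obtain C where C: "!!sg. cmod (bessel_kernel nu ze sg) <= C * exp (- (1 - Re nu) * \<bar>sg\<bar>)"
  using bessel_kernel_locally_dominated[OF nu abs_ge_zero ze order_refl[of "Re ze"]] by (metis order_refl)
 have ep: "1 - Re nu > 0" using nu by simp
 show "(%n. integral {- real n..real n} (bessel_kernel nu ze)) \<longlonglongrightarrow> IU (bessel_kernel nu ze)"
  by (rule exp_decay_tendsto[OF continuous_bessel_kernel ep C])
 show "(%n. bessel_kernel nu ze (real n)) \<longlonglongrightarrow> 0" "(%n. bessel_kernel nu ze (- real n)) \<longlonglongrightarrow> 0"
  using C[of "real _"] C[of "- real _"]
  by (auto intro!: Lim_null_comparison[OF always_eventually exp_neg_real_tendsto_0[OF ep, of C]])
qed

text \<open>With \<open>z = exp ze\<close> this is the classical relation that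
  \<open>z powr nu * K\<close> of order \<open>nu\<close> has z-derivative
  \<open>- z powr nu\<close> times \<open>K\<close> of order \<open>1 - nu\<close>. The truncated
  integrals are holomorphic and converge locally uniformly, and the boundary terms in their
  derivatives tend to 0.\<close>

theorem bessel_fun_deriv:
 assumes nu: "0 < Re nu" "Re nu < 1" and ze: "\<bar>Im ze\<bar> < pi / 2"
 shows "(bessel_fun nu has_field_derivative - exp (2 * nu * ze) * bessel_fun (1 - nu) ze) (at ze)"
proof -
 let ?S = "{ze. \<bar>Im ze\<bar> < pi / 2}"
 let ?g = "%ze. IU (bessel_kernel nu ze)"
 have opn: "open ?S" by (intro open_Collect_less continuous_intros)
 have "\<exists>g'. \<forall>x\<in>?S. (?g has_field_derivative g' x) (at x) \<and>
   (%n. (bessel_kernel nu x (real n) - bessel_kernel nu x (- real n))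
   - exp (2 * nu * x) * integral {- real n..real n} (bessel_kernel (1 - nu) x)) \<longlonglongrightarrow> g' x"
 proof (rule has_complex_derivative_uniform_sequence[OF opn bessel_trunc_deriv])
  fix x assume x: "x \<in> ?S"
  define r where "r = (pi / 2 - \<bar>Im x\<bar>) / 2"
  have r: "r > 0" using x by (simp add: r_def)
  define b where "b = \<bar>Im x\<bar> + r"
  have b: "0 <= b" "b < pi / 2" using x r by (auto simp: b_def r_def field_simps)
  obtain C where C: "0 <= C" "!!ze sg. \<bar>Im ze\<bar> <= b ==> Re x - r <= Re ze ==> Re ze <= Re x + r ==>
   cmod (bessel_kernel nu ze sg) <= C * exp (- (1 - Re nu) * \<bar>sg\<bar>)"
   using bessel_kernel_locally_dominated[OF nu b, of "Re x - r" "Re x + r"] r by auto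
  have ep: "1 - Re nu > 0" using nu by simp
  have box: "\<bar>Im ze\<bar> <= b" "Re x - r <= Re ze" "Re ze <= Re x + r" if "ze \<in> cball x r" for ze
  proof -
   have "\<bar>Re (x - ze)\<bar> <= r" "\<bar>Im (x - ze)\<bar> <= r"
    using that abs_Re_le_cmod[of "x - ze"] abs_Im_le_cmod[of "x - ze"] by (auto simp: dist_norm)
   then show "\<bar>Im ze\<bar> <= b" "Re x - r <= Re ze" "Re ze <= Re x + r" by (auto simp: b_def)
  qed
  have "uniform_limit (cball x r) (%n ze. integral {- real n..real n} (bessel_kernel nu ze)) ?g sequentially"
  proof (rule uniform_limitI)
   fix e :: real assume "e > 0"
   from order_tendstoD(2)[OF tail_tendsto_0[OF ep, of "C * (4 / (1 - Re nu))"] this]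
   show "\<forall>\<^sub>F n in sequentially. \<forall>ze\<in>cball x r. dist (integral {- real n..real n} (bessel_kernel nu ze)) (?g ze) < e"
   proof eventually_elim
    case (elim n)
    show ?case
    proof
     fix ze assume ze: "ze \<in> cball x r"
     have "dist (integral {- real n..real n} (bessel_kernel nu ze)) (?g ze)
       <= C * (4 / (1 - Re nu)) * exp (- (1 - Re nu) * real n / 2)"
      unfolding dist_norm by (subst norm_minus_commute)
       (rule exp_decay_tail[OF continuous_bessel_kernel ep _ C(2)[OF box[OF ze]]], simp)
     with elim show "dist (integral {- real n..real n} (bessel_kernel nu ze)) (?g ze) < e" by linarith
    qed
   qed
  qed
  moreover have "cball x r \<subseteq> ?S" using box(1) b by fastforce
  ultimately show "\<exists>d>0. cball x d \<subseteq> ?S \<and>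
    uniform_limit (cball x d) (%n ze. integral {- real n..real n} (bessel_kernel nu ze)) ?g sequentially"
   using r by blast
 qed
 then obtain g' where g': "(?g has_field_derivative g' ze) (at ze)"
  "(%n. (bessel_kernel nu ze (real n) - bessel_kernel nu ze (- real n))
   - exp (2 * nu * ze) * integral {- real n..real n} (bessel_kernel (1 - nu) ze)) \<longlonglongrightarrow> g' ze"
  using ze by auto
 have "(%n. (bessel_kernel nu ze (real n) - bessel_kernel nu ze (- real n))
   - exp (2 * nu * ze) * integral {- real n..real n} (bessel_kernel (1 - nu) ze))
  \<longlonglongrightarrow> (0 - 0) - exp (2 * nu * ze) * IU (bessel_kernel (1 - nu) ze)"
  using nu by (intro tendsto_intros bessel_trunc_limit ze) auto
 from LIMSEQ_unique[OF g'(2) this] g'(1)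
 have "(?g has_field_derivative - (exp (2 * nu * ze) * IU (bessel_kernel (1 - nu) ze))) (at ze)"
  by simp
 from DERIV_cdivide[OF this, of 2] show ?thesis
  unfolding bessel_fun_def by simp
qed

text \<open>Euler's integral in the logarithmic variable; the translation by \<open>ln 2\<close>
  accounts for the factor \<open>2 powr nu\<close>.\<close>

lemma Gamma_integral_exp:
 assumes "0 < Re nu" "Re nu < 1"
 shows "IU (%sg. exp (nu * of_real sg - of_real (exp sg / 2))) = 2 powr nu * Gamma nu"
proof -
 define f where "f t = cr t powr (nu - 1) / of_real (exp t)" for t :: real
 define ep where "ep = min (Re nu) (1 - Re nu)"
 have ep: "ep > 0" using assms by (simp add: ep_def)
 have f_exp: "exp s *\<^sub>R f (exp s) = exp (nu * of_real s - of_real (exp s))" for s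
 proof -
  have "cr (exp s) powr (nu - 1) = exp ((nu - 1) * of_real s)"
   by (simp add: powr_def Ln_of_real)
  then show ?thesis
   by (simp add: f_def scaleR_conv_of_real exp_of_real exp_diff exp_minus algebra_simps exp_add flip: exp_of_real)
 qed
 have bound: "norm (exp s *\<^sub>R f (exp s)) <= 2 * ed ep s" for s
  using exp_neg_exp_bound[of "Re nu" 1 s] assms by (simp add: f_exp ep_def)
 have cont: "continuous_on {0<..} f"
  unfolding f_def by (intro continuous_intros) (auto simp: complex_nonpos_Reals_iff)
 from has_Bochner_integral_has_integral[OF _ has_Bochner_integral_exp_subst[OF cont ep bound]]
 have "(f has_integral IU (%s. exp s *\<^sub>R f (exp s))) {0<..}" by simp
 moreover have "(f has_integral Gamma nu) {0<..}"
  unfolding f_def by (rule Gamma_integral_complex'[OF assms(1)])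
 ultimately have I: "IU (%s. exp s *\<^sub>R f (exp s)) = Gamma nu" by (rule has_integral_unique)
 have "(%s. exp s *\<^sub>R f (exp s)) integrable_on UNIV"
  by (rule exp_decay_integrable(1)[OF _ ep, of _ 2 0])
   (use bound in \<open>auto intro!: continuous_intros continuous_on_compose2[OF cont]\<close>)
 from integral_UNIV_shift[OF this, of "- ln 2"] I
 have "IU (%s. exp (nu * of_real (s - ln 2) - of_real (exp (s - ln 2)))) = Gamma nu"
  by (simp add: f_exp)
 moreover have "exp (nu * of_real (s - ln 2) - of_real (exp (s - ln 2)))
   = (1 / 2 powr nu) * exp (nu * of_real s - of_real (exp s / 2))" for s
 proof -
  have "(2::complex) powr nu = exp (nu * of_real (ln 2))" using Ln_of_real[of 2] by (simp add: powr_def)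
  moreover have "exp (s - ln 2) = exp s / 2" by (simp add: exp_diff)
  ultimately show ?thesis by (simp add: exp_diff exp_minus field_simps flip: exp_add)
 qed
 ultimately have "(1 / 2 powr nu) * IU (%s. exp (nu * of_real s - of_real (exp s / 2))) = Gamma nu"
  by (simp only: integral_mult_right)
 then show ?thesis by (simp add: field_simps)
qed

text \<open>The limit of \<open>bessel_fun nu ze\<close> as \<open>Re ze\<close> tends to minus
  infinity, that is, the value of \<open>z powr nu * K\<close> of order \<open>nu\<close> at
  \<open>z = 0\<close>.\<close>

definition bessel0 :: "complex => complex" where
 "bessel0 nu = 2 powr (nu - 1) * Gamma nu"

text \<open>The shift of \<open>sg\<close> by \<open>real n = - Re ze\<close> keeps the kernel
  centred. In the limit only one of the two exponentials of \<open>cosh\<close> survives, and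
  Euler's integral appears.\<close>

lemma bessel_fun_real_limit:
 assumes nu: "0 < Re nu" "Re nu < 1"
 shows "(%n. bessel_fun nu (of_real (- real n))) \<longlonglongrightarrow> bessel0 nu"
proof -
 define ep where "ep = min (Re nu) (1 - Re nu)"
 have ep: "ep > 0" using nu by (simp add: ep_def)
 let ?k = "%n sg. bessel_kernel nu (of_real (- real n)) (sg + real n)"
 have k: "?k n sg = exp (nu * of_real sg - of_real (exp sg / 2 + exp (- sg - 2 * real n) / 2))" for n sg
 proof -
  have "exp (- real n) * cosh (sg + real n) = exp sg / 2 + exp (- sg - 2 * real n) / 2"
   by (simp add: cosh_def algebra_simps flip: exp_add)
  then have "exp (cr (- real n)) * of_real (cosh (sg + real n)) = of_real (exp sg / 2 + exp (- sg - 2 * real n) / 2)"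
   by (metis exp_of_real of_real_mult)
  then show ?thesis unfolding bessel_kernel_def by simp
 qed
 have "(%n. IU (?k n)) \<longlonglongrightarrow> IU (%sg. exp (nu * of_real sg - of_real (exp sg / 2)))"
 proof (rule exp_decay_dominated[OF _ _ ep, where C = 3 and x = 0])
  show "cont (?k n)" for n unfolding k by (intro continuous_intros) auto
  show "norm (?k n sg) <= 3 * exp (- ep * \<bar>sg - 0\<bar>)" for n sg
  proof -
   have "norm (?k n sg) = exp (Re nu * sg - (exp sg / 2 + exp (- sg - 2 * real n) / 2))"
    unfolding k by simp
   also have "... <= exp (Re nu * sg - 1 / 2 * exp sg)" by simp
   also have "... <= 3 * exp (- ep * \<bar>sg - 0\<bar>)"
    using exp_neg_exp_bound[OF nu, of "1 / 2" sg] by (simp add: ep_def)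
   finally show ?thesis .
  qed
  show "(%n. ?k n sg) \<longlonglongrightarrow> exp (nu * of_real sg - of_real (exp sg / 2))" for sg
  proof -
   have "(%n. exp sg / 2 + exp (- sg - 2 * real n) / 2) \<longlonglongrightarrow> exp sg / 2" by real_asymp
   then show ?thesis unfolding k by (intro tendsto_intros)
  qed
 qed (intro continuous_intros, auto)
 moreover have "IU (?k n) = IU (bessel_kernel nu (of_real (- real n)))" for n
 proof (rule integral_UNIV_shift)
  obtain C where C0: "!!ze sg. \<bar>Im ze\<bar> <= 0 ==> - real n <= Re ze ==> Re ze <= - real n ==>
    cmod (bessel_kernel nu ze sg) <= C * exp (- (1 - Re nu) * \<bar>sg\<bar>)"
   by (rule bessel_kernel_locally_dominated[OF nu, of 0 "- real n" "- real n"]) auto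
  have C: "cmod (bessel_kernel nu (of_real (- real n)) sg) <= C * exp (- (1 - Re nu) * \<bar>sg\<bar>)" for sg
   by (rule C0) auto
  show "bessel_kernel nu (of_real (- real n)) integrable_on UNIV"
   by (rule exp_decay_integrable(1)[OF continuous_bessel_kernel, of "1 - Re nu" _ _ C 0]) (use nu C in auto)
 qed
 ultimately have "(%n. bessel_fun nu (of_real (- real n))) \<longlonglongrightarrow> (2 powr nu * Gamma nu) / 2"
  unfolding bessel_fun_def using Gamma_integral_exp[OF nu] by (intro tendsto_divide) auto
 moreover have "2 powr nu * Gamma nu / 2 = bessel0 nu"
  by (simp add: bessel0_def powr_diff)
 ultimately show ?thesis by simp
qed

lemma vertical_mean_value:
 assumes der: "!!w. \<bar>Im w\<bar> <= b ==> (f has_field_derivative f' w) (at w)"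
  and f': "!!w. \<bar>Im w\<bar> <= b ==> cmod (f' w) <= B (Re w)" and ze: "\<bar>Im ze\<bar> <= b"
 shows "cmod (f ze - f (of_real (Re ze))) <= B (Re ze) * \<bar>Im ze\<bar>"
proof -
 define S where "S = {w. Re w = Re ze} \<inter> {w. Im w <= b} \<inter> {w. Im w \<ge> - b}"
 have "convex {w. Re w = Re ze}"
  using convex_hyperplane[of "1::complex" "Re ze"] by (simp add: inner_complex_def)
 then have cvx: "convex S"
  unfolding S_def using convex_Int convex_halfspace_Im_le convex_halfspace_Im_ge by metis
 have "cmod (f ze - f (of_real (Re ze))) <= B (Re ze) * cmod (ze - of_real (Re ze))"
 proof (rule field_differentiable_bound[OF cvx])
  fix w assume w: "w \<in> S"
  then have "\<bar>Im w\<bar> <= b" "Re w = Re ze" by (auto simp: S_def)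
  then show "(f has_field_derivative f' w) (at w within S)" "cmod (f' w) <= B (Re ze)"
   using der[of w] f'[of w] by (auto intro: has_field_derivative_at_within)
 qed (use ze in \<open>auto simp: S_def\<close>)
 also have "cmod (ze - of_real (Re ze)) = \<bar>Im ze\<bar>" by (simp add: cmod_def)
 finally show ?thesis .
qed

text \<open>The kernel of order \<open>1 - nu\<close> is bounded, so the derivative is of size
  \<open>exp (2 * Re nu * Re ze)\<close>. This is integrated along the real axis from minus infinity
  and then vertically to \<open>ze\<close>.\<close>

lemma bessel_fun_near_0:
 assumes nu: "0 < Re nu" "Re nu < 1" and b: "0 <= b" "b < pi / 2"
 obtains C where "0 < C" "!!ze. \<bar>Im ze\<bar> <= b ==> cmod (bessel_fun nu ze - bessel0 nu) <= C * exp (2 * Re nu * Re ze)"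
proof -
 let ?a = "2 * Re nu"
 obtain C1 d where C1: "0 < C1" "0 < d"
  "!!ze. \<bar>Im ze\<bar> <= b ==> cmod (bessel_fun (1 - nu) ze) <= C1 * exp (- d * exp (Re ze))"
  using bessel_fun_bound[of "1 - nu" b] nu b by auto
 define C2 where "C2 = C1 * exp (2 * \<bar>Im nu\<bar> * b)"
 have C2: "C2 > 0" using C1 by (simp add: C2_def)
 let ?f' = "%ze. - exp (2 * nu * ze) * bessel_fun (1 - nu) ze"
 have der: "(bessel_fun nu has_field_derivative ?f' ze) (at ze)" if "\<bar>Im ze\<bar> <= b" for ze
  using bessel_fun_deriv[OF nu] that b by auto
 have f': "cmod (?f' ze) <= C2 * exp (?a * Re ze)" if ze: "\<bar>Im ze\<bar> <= b" for ze
 proof -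
  have "- (2 * Im nu * Im ze) <= 2 * \<bar>Im nu\<bar> * b"
   using abs_ge_self[of "- Im nu * Im ze"] mult_left_mono[OF ze, of "\<bar>Im nu\<bar>"] by (simp add: abs_mult mult_ac)
  then have 1: "cmod (exp (2 * nu * ze)) <= exp (2 * \<bar>Im nu\<bar> * b) * exp (?a * Re ze)"
   by (simp add: exp_add[symmetric])
  have "C1 * exp (- d * exp (Re ze)) <= C1 * 1" using C1 by (intro mult_left_mono) auto
  then have 2: "cmod (bessel_fun (1 - nu) ze) <= C1" using C1(3)[OF ze] by simp
  have "cmod (?f' ze) <= (exp (2 * \<bar>Im nu\<bar> * b) * exp (?a * Re ze)) * C1"
   using mult_mono[OF 1 2] by (simp add: norm_mult)
  then show ?thesis by (simp add: C2_def mult_ac)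
 qed
 have hor: "cmod (bessel_fun nu (of_real x) - bessel_fun nu (of_real x')) <= C2 / ?a * exp (?a * x)" if "x' <= x" for x x'
 proof -
  have vd: "((%s. bessel_fun nu (of_real s)) hvd ?f' (of_real s)) (at s within {x'..x})" for s
   by (rule has_vector_derivative_at_within[OF has_vector_derivative_real_field[OF der]]) (use b in simp)
  have h1: "((%s. ?f' (of_real s)) has_integral (bessel_fun nu (of_real x) - bessel_fun nu (of_real x'))) {x'..x}"
   by (rule fundamental_theorem_of_calculus[OF that vd])
  have h2: "((%s. C2 * exp (?a * s)) has_integral (C2 / ?a * exp (?a * x) - C2 / ?a * exp (?a * x'))) {x'..x}"
   using nu by (intro fundamental_theorem_of_calculus[OF that])
    (auto intro!: derivative_eq_intros simp flip: has_real_derivative_iff_has_vector_derivative)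
  have "cmod (bessel_fun nu (of_real x) - bessel_fun nu (of_real x')) <= C2 / ?a * exp (?a * x) - C2 / ?a * exp (?a * x')"
   using integral_norm_bound_integral[OF has_integral_integrable[OF h1] has_integral_integrable[OF h2]] f'[of "of_real _"] b
   by (simp only: integral_unique[OF h1] integral_unique[OF h2]) auto
  moreover have "C2 / ?a * exp (?a * x') \<ge> 0" using C2 nu by simp
  ultimately show ?thesis by linarith
 qed
 have lim: "cmod (bessel_fun nu (of_real x) - bessel0 nu) <= C2 / ?a * exp (?a * x)" for x
 proof (rule tendsto_upperbound)
  show "(%n. cmod (bessel_fun nu (of_real x) - bessel_fun nu (of_real (- real n)))) \<longlonglongrightarrow> cmod (bessel_fun nu (of_real x) - bessel0 nu)"
   by (intro tendsto_intros bessel_fun_real_limit nu)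
  obtain N :: nat where "- x <= real N" using real_arch_simple by blast
  then have "- real n <= x" if "n \<ge> N" for n using that by linarith
  then show "\<forall>\<^sub>F n in sequentially. cmod (bessel_fun nu (of_real x) - bessel_fun nu (of_real (- real n))) <= C2 / ?a * exp (?a * x)"
   unfolding eventually_sequentially using hor by blast
 qed simp
 have ver: "cmod (bessel_fun nu ze - bessel_fun nu (of_real (Re ze))) <= C2 * b * exp (?a * Re ze)" if ze: "\<bar>Im ze\<bar> <= b" for ze
 proof -
  have "cmod (bessel_fun nu ze - bessel_fun nu (of_real (Re ze))) <= C2 * exp (?a * Re ze) * \<bar>Im ze\<bar>"
   by (rule vertical_mean_value[OF der f' ze])
  also have "... <= C2 * exp (?a * Re ze) * b" using ze C2 by (intro mult_left_mono) auto
  finally show ?thesis by (simp add: mult_ac)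
 qed
 show thesis
 proof (rule that[of "C2 * b + C2 / ?a"])
  show "C2 * b + C2 / ?a > 0" using C2 b nu by (intro add_nonneg_pos) auto
  fix ze assume ze: "\<bar>Im ze\<bar> <= b"
  show "cmod (bessel_fun nu ze - bessel0 nu) <= (C2 * b + C2 / ?a) * exp (?a * Re ze)"
   using norm_triangle_ineq[of "bessel_fun nu ze - bessel_fun nu (of_real (Re ze))" "bessel_fun nu (of_real (Re ze)) - bessel0 nu"]
    ver[OF ze] lim[of "Re ze"] by (simp add: distrib_right)
 qed
qed

lemma bessel0_nonzero: "0 < Re nu ==> bessel0 nu ~= 0"
 by (auto simp: bessel0_def Gamma_eq_zero_iff elim!: nonpos_Ints_cases)

definition dtn_const :: "complex => complex" where
 "dtn_const nu = Gamma (1 - nu) / (2 powr (2 * nu - 1) * Gamma nu)"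

text \<open>This quotient is what normalising both kernels to the value 1 at 0 puts into the
  derivative rule; it is the source of the constant in the theorem.\<close>

lemma dtn_const_eq: "dtn_const nu = bessel0 (1 - nu) / bessel0 nu"
proof -
 have "(2::complex) powr (nu - 1) = 2 powr (2 * nu - 1) * 2 powr (- nu)"
  by (subst powr_add[symmetric]) (simp add: algebra_simps)
 then show ?thesis by (simp add: dtn_const_def bessel0_def)
qed

lemma dtn_const_nonzero: "0 < Re nu ==> Re nu < 1 ==> dtn_const nu ~= 0"
 using bessel0_nonzero[of nu] bessel0_nonzero[of "1 - nu"] by (simp add: dtn_const_eq)

definition nbessel :: "complex => complex => complex" where
 "nbessel nu ze = bessel_fun nu ze / bessel0 nu"

abbreviation (input) "nb n t w \<equiv> nbessel n (of_real t + w / 2)"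

lemma nbessel_deriv:
 assumes nu: "0 < Re nu" "Re nu < 1" and ze: "\<bar>Im ze\<bar> < pi / 2"
 shows "(nbessel nu has_field_derivative - dtn_const nu * exp (2 * nu * ze) * nbessel (1 - nu) ze) (at ze)"
proof -
 have "bessel0 (1 - nu) ~= 0" using nu by (intro bessel0_nonzero) auto
 then show ?thesis
  using DERIV_cdivide[OF bessel_fun_deriv[OF assms], of "bessel0 nu"]
  by (simp add: nbessel_def[abs_def] dtn_const_eq mult_ac)
qed

lemma nbessel_holomorphic:
 assumes "0 < Re nu" "Re nu < 1"
 shows "nbessel nu holomorphic_on {ze. \<bar>Im ze\<bar> < pi / 2}"
 unfolding holomorphic_on_def field_differentiable_def
 using nbessel_deriv[OF assms] has_field_derivative_at_within by blast

lemma nbessel_bound: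
 assumes nu: "0 < Re nu" "Re nu < 1" and b: "0 <= b" "b < pi / 2"
 obtains C d where "0 < C" "0 < d"
  "!!ze. \<bar>Im ze\<bar> <= b ==> cmod (nbessel nu ze) <= C * exp (- d * exp (Re ze))"
proof -
 obtain C d where C: "0 < C" "0 < d"
  "!!ze. \<bar>Im ze\<bar> <= b ==> cmod (bessel_fun nu ze) <= C * exp (- d * exp (Re ze))"
  using bessel_fun_bound[OF assms] by blast
 have "cmod (bessel0 nu) > 0" using bessel0_nonzero[OF nu(1)] by simp
 with C show thesis
  by (intro that[of "C / cmod (bessel0 nu)" d]) (auto simp: nbessel_def norm_divide divide_right_mono)
qed

lemma nbessel_near_0:
 assumes nu: "0 < Re nu" "Re nu < 1" and b: "0 <= b" "b < pi / 2"
 obtains C where "0 < C" "!!ze. \<bar>Im ze\<bar> <= b ==> cmod (nbessel nu ze - 1) <= C * exp (2 * Re nu * Re ze)"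
proof -
 obtain C where C: "0 < C" "!!ze. \<bar>Im ze\<bar> <= b ==> cmod (bessel_fun nu ze - bessel0 nu) <= C * exp (2 * Re nu * Re ze)"
  using bessel_fun_near_0[OF assms] by blast
 have p: "cmod (bessel0 nu) > 0" using bessel0_nonzero[OF nu(1)] by simp
 have "cmod (nbessel nu ze - 1) <= C / cmod (bessel0 nu) * exp (2 * Re nu * Re ze)" if "\<bar>Im ze\<bar> <= b" for ze
 proof -
  have "nbessel nu ze - 1 = (bessel_fun nu ze - bessel0 nu) / bessel0 nu"
   using bessel0_nonzero[OF nu(1)] by (simp add: nbessel_def diff_divide_distrib)
  then show ?thesis using divide_right_mono[OF C(2)[OF that], of "cmod (bessel0 nu)"] p by (simp add: norm_divide)
 qed
 then show thesis using C(1) p by (intro that[of "C / cmod (bessel0 nu)"]) auto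
qed

section \<open>Complex scalars and the algebra of resolvents\<close>

lemma scaleC_one [simp]: "1 *\<^sub>C x = x"
 using scaleR_scaleC[of 1 x] by simp

lemma bounded_bilinear_scaleC: "bounded_bilinear (scaleC :: complex => 'a => 'a::complex_normed_vector)"
proof
 fix r :: real and a b :: complex and x y :: 'a
 show "(a + b) *\<^sub>C x = a *\<^sub>C x + b *\<^sub>C x" by (rule scaleC_add_left)
 show "a *\<^sub>C (x + y) = a *\<^sub>C x + a *\<^sub>C y" by (rule scaleC_add_right)
 show "(r *\<^sub>R a) *\<^sub>C x = r *\<^sub>R (a *\<^sub>C x)"
  by (simp add: scaleR_scaleC scaleC_scaleC scaleR_conv_of_real)
 show "a *\<^sub>C (r *\<^sub>R x) = r *\<^sub>R (a *\<^sub>C x)"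
  by (simp add: scaleR_scaleC scaleC_scaleC mult.commute)
 show "\<exists>K. \<forall>(a::complex) (x::'a). norm (a *\<^sub>C x) <= cmod a * norm x * K"
  by (rule exI[of _ 1]) (simp add: norm_scaleC)
qed

interpretation scaleC: bounded_bilinear "scaleC :: complex => 'a => 'a::complex_normed_vector"
 by (rule bounded_bilinear_scaleC)

lemmas continuous_on_scaleC [continuous_intros] = scaleC.continuous_on

lemma scaleC_eq_0_iff [simp]: "a *\<^sub>C x = 0 \<longleftrightarrow> a = 0 \<or> x = 0"
 using norm_scaleC[of a x] by (metis mult_eq_0_iff norm_eq_zero)

lemma scaleC_diff_split: "a *\<^sub>C x - b *\<^sub>C y = a *\<^sub>C (x - y) + (a - b) *\<^sub>C y"
 using scaleC_add_right[of a "x - y" y] scaleC_add_left[of "a - b" b y] by simp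

lemma resolvent_mem_dom:
 assumes "z \<in> resolvent_set A"
 shows "resolvent A z x \<in> dom A"
proof -
 have "x \<in> (%x. z *\<^sub>C x - the (A x)) ` dom A"
  using assms unfolding resolvent_set_def bij_betw_def by blast
 then show ?thesis unfolding resolvent_def by (rule inv_into_into)
qed

lemma resolvent_right:
 assumes "z \<in> resolvent_set A"
 shows "z *\<^sub>C resolvent A z x - the (A (resolvent A z x)) = x"
 using assms unfolding resolvent_set_def resolvent_def bij_betw_def
 by (auto intro: f_inv_into_f[where f = "%x. z *\<^sub>C x - the (A x)"])

lemma resolvent_left:
 assumes "z \<in> resolvent_set A" "x \<in> dom A"
 shows "resolvent A z (z *\<^sub>C x - the (A x)) = x"
 using assms unfolding resolvent_set_def resolvent_def bij_betw_def
 by (auto intro: inv_into_f_f[where f = "%x. z *\<^sub>C x - the (A x)"])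

lemma resolvent_bounded_linear: "z \<in> resolvent_set A ==> bounded_linear (resolvent A z)"
 by (simp add: resolvent_set_def)

lemma resolvent_scaleC:
 assumes A: "linear_operator A" and z: "z \<in> resolvent_set A"
 shows "resolvent A z (c *\<^sub>C x) = c *\<^sub>C resolvent A z x"
proof -
 let ?y = "resolvent A z x"
 have y: "?y \<in> dom A" by (rule resolvent_mem_dom[OF z])
 then have cy: "c *\<^sub>C ?y \<in> dom A" "the (A (c *\<^sub>C ?y)) = c *\<^sub>C the (A ?y)"
  using A unfolding linear_operator_def by blast+
 have "z *\<^sub>C (c *\<^sub>C ?y) - the (A (c *\<^sub>C ?y)) = c *\<^sub>C (z *\<^sub>C ?y - the (A ?y))"
  by (simp add: cy scaleC.diff_right scaleC_scaleC mult.commute)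
 also have "... = c *\<^sub>C x" by (simp add: resolvent_right[OF z])
 finally show ?thesis using resolvent_left[OF z cy(1)] by simp
qed

lemma resolvent_identity:
 assumes A: "linear_operator A" and z: "z \<in> resolvent_set A" "z' \<in> resolvent_set A"
 shows "resolvent A z x - resolvent A z' x = (z' - z) *\<^sub>C resolvent A z (resolvent A z' x)"
proof -
 interpret R: bounded_linear "resolvent A z" by (rule resolvent_bounded_linear[OF z(1)])
 let ?y = "resolvent A z' x"
 have "?y = resolvent A z (z *\<^sub>C ?y - the (A ?y))"
  by (rule resolvent_left[OF z(1) resolvent_mem_dom[OF z(2)], symmetric])
 also have "z *\<^sub>C ?y - the (A ?y) = (z - z') *\<^sub>C ?y + x"
  using resolvent_right[OF z(2), of x] by (simp add: scaleC.diff_left algebra_simps)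
 also have "resolvent A z ... = (z - z') *\<^sub>C resolvent A z ?y + resolvent A z x"
  by (simp add: R.add resolvent_scaleC[OF A z(1)])
 finally show ?thesis by (simp add: scaleC.diff_left algebra_simps)
qed

lemma resolvent_commute:
 assumes A: "linear_operator A" and z: "z \<in> resolvent_set A" "z' \<in> resolvent_set A"
 shows "resolvent A z (resolvent A z' x) = resolvent A z' (resolvent A z x)"
proof (cases "z = z'")
 case False
 have "(z' - z) *\<^sub>C resolvent A z (resolvent A z' x) = - ((z - z') *\<^sub>C resolvent A z' (resolvent A z x))"
  unfolding resolvent_identity[OF A z, of x, symmetric] resolvent_identity[OF A z(2,1), of x, symmetric] by simp
 also have "... = (z' - z) *\<^sub>C resolvent A z' (resolvent A z x)" by (simp add: scaleC.minus_left[symmetric])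
 finally have "(z' - z) *\<^sub>C (resolvent A z (resolvent A z' x) - resolvent A z' (resolvent A z x)) = 0"
  by (simp add: scaleC.diff_right)
 with False show ?thesis by simp
qed simp

text \<open>A product rule for a vector factor that is only continuous: its increments are
  multiplied by the scalar \<open>a\<close>, which vanishes at \<open>s\<close>. This lets
  continuity of the resolvent produce its derivative.\<close>

lemma has_vector_derivative_scaleC_zero:
 fixes g :: "real => 'a::complex_normed_vector"
 assumes a: "(a hvd d) (at s)" "a s = 0" and g: "isCont g s"
 shows "((%t. a t *\<^sub>C g t) hvd d *\<^sub>C g s) (at s)"
proof -
 have lim: "((%t. norm (a t - a s - (t - s) *\<^sub>R d) / norm (t - s)) \<longlongrightarrow> 0) (at s)"
  using a(1) unfolding has_vector_derivative_def has_derivative_iff_norm by simp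
 have gl: "(g \<longlongrightarrow> g s) (at s)" using g by (simp add: isCont_def)
 have l: "((%t. norm (a t - a s - (t - s) *\<^sub>R d) / norm (t - s) * norm (g t) + cmod d * norm (g t - g s)) \<longlongrightarrow> 0 * norm (g s) + cmod d * norm (g s - g s)) (at s)"
  by (intro tendsto_intros lim gl)
 have le: "norm (norm (a t *\<^sub>C g t - a s *\<^sub>C g s - (t - s) *\<^sub>R (d *\<^sub>C g s)) / norm (t - s))
   <= norm (a t - a s - (t - s) *\<^sub>R d) / norm (t - s) * norm (g t) + cmod d * norm (g t - g s)" for t
 proof (cases "t = s")
  case False
  have "a t *\<^sub>C g t - a s *\<^sub>C g s - (t - s) *\<^sub>R (d *\<^sub>C g s)
   = (a t - a s - (t - s) *\<^sub>R d) *\<^sub>C g t + (t - s) *\<^sub>R (d *\<^sub>C (g t - g s))"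
   by (simp add: a(2) scaleC.diff_left scaleC.diff_right scaleC.scaleR_left scaleR_diff_right)
  also have "norm ... <= norm (a t - a s - (t - s) *\<^sub>R d) * norm (g t) + norm (t - s) * (cmod d * norm (g t - g s))"
   by (rule order_trans[OF norm_triangle_ineq]) (simp add: norm_scaleC)
  finally have "norm (a t *\<^sub>C g t - a s *\<^sub>C g s - (t - s) *\<^sub>R (d *\<^sub>C g s)) / norm (t - s)
   <= (norm (a t - a s - (t - s) *\<^sub>R d) * norm (g t) + norm (t - s) * (cmod d * norm (g t - g s))) / norm (t - s)"
   by (rule divide_right_mono) simp
  then show ?thesis using False by (simp add: add_divide_distrib)
 qed simp
 have "((%t. norm (a t *\<^sub>C g t - a s *\<^sub>C g s - (t - s) *\<^sub>R (d *\<^sub>C g s)) / norm (t - s)) \<longlongrightarrow> 0) (at s)"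
  by (rule Lim_null_comparison[OF always_eventually[OF allI[OF le]]]) (use l in simp)
 then show ?thesis
  unfolding has_vector_derivative_def has_derivative_iff_norm
  by (simp add: bounded_linear_scaleR_left)
qed

section \<open>The weighted resolvent outside a sector\<close>

locale sector_operator =
 fixes A :: "'a::complex_banach \<rightharpoonup> 'a" and ph0 M :: real
 assumes lin: "linear_operator A" and dense: "densely_defined A"
  and ph0: "0 < ph0" "ph0 < pi" and M: "0 < M"
  and rset: "!!w. ph0 <= \<bar>Im w\<bar> ==> \<bar>Im w\<bar> <= 2 * pi - ph0 ==> exp w \<in> resolvent_set A"
  and rbound: "!!w x. ph0 <= \<bar>Im w\<bar> ==> \<bar>Im w\<bar> <= 2 * pi - ph0 ==>
   norm (exp w *\<^sub>C resolvent A (exp w) x) <= M * norm x"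
begin

text \<open>For \<open>z = exp w\<close> one has dz / z = dw, so \<open>rho w\<close> dw is the
  resolvent times dz, while \<open>rho w\<close> is bounded by \<open>M\<close>.\<close>

definition rho :: "complex => 'a => 'a" where
 "rho w x = exp w *\<^sub>C resolvent A (exp w) x"

definition outer :: "complex set" where
 "outer = {w. ph0 < \<bar>Im w\<bar> \<and> \<bar>Im w\<bar> < 2 * pi - ph0}"

lemma open_outer: "open outer"
proof -
 have "outer = {w. ph0 < \<bar>Im w\<bar>} \<inter> {w. \<bar>Im w\<bar> < 2 * pi - ph0}" by (auto simp: outer_def)
 then show ?thesis by (auto intro!: open_Int open_Collect_less continuous_intros)
qed

lemma outer_rset: "w \<in> outer ==> exp w \<in> resolvent_set A"
 and norm_rho: "w \<in> outer ==> norm (rho w x) <= M * norm x"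
 by (auto simp: outer_def rho_def intro!: rset rbound)

lemma bounded_linear_rho: "w \<in> outer ==> bounded_linear (rho w)"
 unfolding rho_def
 by (intro bounded_linear_compose[OF scaleC.bounded_linear_right] resolvent_bounded_linear outer_rset)

lemma rho_scaleC: "w \<in> outer ==> rho w (c *\<^sub>C x) = c *\<^sub>C rho w x"
 by (simp add: rho_def resolvent_scaleC[OF lin outer_rset] scaleC_scaleC mult.commute)

text \<open>The resolvent identity, arranged so that the scalar factor vanishes at
  \<open>w = w0\<close> and the vector factor stays bounded. It gives continuity, after which the
  vector factor is continuous and differentiability follows.\<close>

lemma rho_diff:
 assumes "w \<in> outer" "w0 \<in> outer"
 shows "rho w x - rho w0 x = (exp (w - w0) - 1) *\<^sub>C (rho w0 x - rho w (rho w0 x))"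
proof -
 let ?R = "resolvent A (exp w)" and ?Q = "resolvent A (exp w0)"
 note z = outer_rset[OF assms(1)] outer_rset[OF assms(2)]
 have "rho w x - rho w0 x = exp w *\<^sub>C (?R x - ?Q x) + (exp w - exp w0) *\<^sub>C ?Q x"
  unfolding rho_def by (rule scaleC_diff_split)
 also have "?R x - ?Q x = (exp w0 - exp w) *\<^sub>C ?R (?Q x)" by (rule resolvent_identity[OF lin z])
 also have "exp w *\<^sub>C (exp w0 - exp w) *\<^sub>C ?R (?Q x) + (exp w - exp w0) *\<^sub>C ?Q x
  = ((exp (w - w0) - 1) * exp w0) *\<^sub>C (?Q x - exp w *\<^sub>C ?R (?Q x))"
  by (simp add: exp_diff scaleC.diff_right scaleC_scaleC algebra_simps flip: scaleC_add_left scaleC.minus_left)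
 also have "... = (exp (w - w0) - 1) *\<^sub>C (rho w0 x - rho w (rho w0 x))"
  by (simp add: rho_def scaleC_scaleC scaleC.diff_right resolvent_scaleC[OF lin z(1)] mult_ac)
 finally show ?thesis .
qed

lemma rho_continuous: "w0 \<in> outer ==> isCont (%w. rho w x) w0"
proof -
 assume w0: "w0 \<in> outer"
 have "((%w. rho w x - rho w0 x) \<longlongrightarrow> 0) (at w0)"
 proof (rule Lim_null_comparison)
  show "\<forall>\<^sub>F w in at w0. norm (rho w x - rho w0 x) <= cmod (exp (w - w0) - 1) * (norm (rho w0 x) + M * norm (rho w0 x))"
   using eventually_at_topological[of _ w0 UNIV]
  proof -
   have "\<forall>\<^sub>F w in at w0. w \<in> outer" using open_outer w0 eventually_at_topological by blast
   then show ?thesis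
   proof eventually_elim
    case (elim w)
    show ?case unfolding rho_diff[OF elim w0] norm_scaleC
     by (intro mult_left_mono order_trans[OF norm_triangle_ineq4] add_mono norm_rho elim) auto
   qed
  qed
  have "((%w. cmod (exp (w - w0) - 1) * (norm (rho w0 x) + M * norm (rho w0 x))) \<longlongrightarrow>
   cmod (exp (w0 - w0) - 1) * (norm (rho w0 x) + M * norm (rho w0 x))) (at w0)"
   by (intro tendsto_intros)
  then show "((%w. cmod (exp (w - w0) - 1) * (norm (rho w0 x) + M * norm (rho w0 x))) \<longlongrightarrow> 0) (at w0)" by simp
 qed
 then show ?thesis unfolding isCont_def by (rule LIM_zero_cancel)
qed

lemma continuous_on_rho: "S \<subseteq> outer ==> continuous_on S (%w. rho w x)"
 by (intro continuous_at_imp_continuous_on ballI rho_continuous) auto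

lemma rho_path_derivative:
 assumes p: "(p hvd d) (at s)" and w: "p s \<in> outer"
 shows "((%t. rho (p t) x) hvd d *\<^sub>C (rho (p s) x - rho (p s) (rho (p s) x))) (at s)"
proof -
 let ?w0 = "p s"
 have pc: "isCont p s" using p by (rule has_vector_derivative_continuous)
 have "((%t. p t - ?w0) hvd d) (at s)"
  using p by (auto intro!: derivative_eq_intros)
 moreover have "((%z. exp z - 1) has_field_derivative 1) (at (p s - ?w0))"
  by (auto intro!: derivative_eq_intros)
 ultimately have 1: "((%t. exp (p t - ?w0) - 1) hvd d) (at s)"
  using field_vector_diff_chain_at[of "%t. p t - ?w0" d s "%z. exp z - 1" 1] by (simp add: o_def)
 have 2: "isCont (%t. rho ?w0 x - rho (p t) (rho ?w0 x)) s"
  using isCont_o2[OF pc rho_continuous[OF w]] by (intro continuous_intros)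
 have "((%t. (exp (p t - ?w0) - 1) *\<^sub>C (rho ?w0 x - rho (p t) (rho ?w0 x)))
   hvd d *\<^sub>C (rho ?w0 x - rho ?w0 (rho ?w0 x))) (at s)"
  by (rule has_vector_derivative_scaleC_zero[OF 1 _ 2]) simp
 then have d: "((%t. rho ?w0 x + (exp (p t - ?w0) - 1) *\<^sub>C (rho ?w0 x - rho (p t) (rho ?w0 x)))
   hvd d *\<^sub>C (rho ?w0 x - rho ?w0 (rho ?w0 x))) (at s)"
  by (auto intro!: derivative_eq_intros)
 have "open (outer)" by (rule open_outer)
 then have "\<forall>\<^sub>F t in nhds s. p t \<in> outer"
  using pc w unfolding isCont_def tendsto_def eventually_nhds_conv_at by (auto simp: eventually_at_filter)
 then have "\<forall>\<^sub>F t in nhds s. rho ?w0 x + (exp (p t - ?w0) - 1) *\<^sub>C (rho ?w0 x - rho (p t) (rho ?w0 x)) = rho (p t) x"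
  by eventually_elim (simp add: rho_diff[OF _ w, symmetric])
 then obtain U where U: "open U" "s \<in> U"
  "!!t. t \<in> U ==> rho ?w0 x + (exp (p t - ?w0) - 1) *\<^sub>C (rho ?w0 x - rho (p t) (rho ?w0 x)) = rho (p t) x"
  unfolding eventually_nhds by blast
 show ?thesis
  by (rule has_vector_derivative_transform_within_open[OF d U(1,2)]) (use U(3) in auto)
qed

lemma rho_dom: "w \<in> outer ==> x \<in> dom A ==> rho w x = x + exp (- w) *\<^sub>C rho w (the (A x))"
proof -
 assume w: "w \<in> outer" and x: "x \<in> dom A"
 interpret R: bounded_linear "resolvent A (exp w)" by (rule resolvent_bounded_linear[OF outer_rset[OF w]])
 have "resolvent A (exp w) (exp w *\<^sub>C x) - resolvent A (exp w) (the (A x)) = x"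
  using resolvent_left[OF outer_rset[OF w] x] by (simp add: R.diff)
 then have "rho w x - resolvent A (exp w) (the (A x)) = x"
  by (simp add: rho_def resolvent_scaleC[OF lin outer_rset[OF w]])
 moreover have "resolvent A (exp w) (the (A x)) = exp (- w) *\<^sub>C rho w (the (A x))"
  by (simp add: rho_def scaleC_scaleC exp_minus)
 ultimately show ?thesis by (simp add: algebra_simps)
qed

text \<open>On the domain, \<open>rho w y - y\<close> equals \<open>exp (- w)\<close> times
  \<open>rho w\<close> applied to \<open>A y\<close>, which is small for large \<open>Re w\<close>.
  Density of the domain and the uniform bound \<open>M\<close> extend this to every
  \<open>x\<close>, uniformly in the height.\<close>

lemma rho_tendsto:
 assumes "e > 0"
 obtains S where "!!w. w \<in> outer ==> Re w \<ge> S ==> norm (rho w x - x) < e"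
proof -
 have "x \<in> closure (dom A)" using dense by (simp add: densely_defined_def)
 then obtain y where y: "y \<in> dom A" "dist y x < e / (2 * (M + 1))"
  using assms M unfolding closure_approachable by (metis add_pos_pos divide_pos_pos mult_pos_pos zero_less_numeral zero_less_one)
 define K where "K = 2 * M * norm (the (A y)) / e + 1"
 have K: "K > 0" using M assms by (simp add: K_def add_nonneg_pos)
 have "norm (rho w x - x) < e" if w: "w \<in> outer" "Re w \<ge> ln K" for w
 proof -
  interpret r: bounded_linear "rho w" by (rule bounded_linear_rho[OF w(1)])
  have "K <= exp (Re w)" using w(2) K by (metis exp_le_cancel_iff exp_ln)
  then have ek: "exp (- Re w) <= 1 / K" using K by (simp add: exp_minus inverse_eq_divide frac_le)
  have "rho w x - x = rho w (x - y) - (x - y) + exp (- w) *\<^sub>C rho w (the (A y))"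
   using rho_dom[OF w(1) y(1)] by (simp add: r.diff)
  also have "norm ... <= (M * norm (x - y) + norm (x - y)) + exp (- Re w) * (M * norm (the (A y)))"
  proof -
   have "norm (exp (- w) *\<^sub>C rho w (the (A y))) <= exp (- Re w) * (M * norm (the (A y)))"
    by (simp add: norm_scaleC norm_rho[OF w(1)])
   with norm_rho[OF w(1), of "x - y"] show ?thesis
    using norm_triangle_ineq[of "rho w (x - y) - (x - y)" "exp (- w) *\<^sub>C rho w (the (A y))"]
     norm_triangle_ineq4[of "rho w (x - y)" "x - y"] by linarith
  qed
  also have "... <= (M + 1) * norm (x - y) + 1 / K * (M * norm (the (A y)))"
   using ek M by (intro add_mono mult_right_mono) (auto simp: algebra_simps)
  also have "... < e / 2 + e / 2"
  proof (rule add_strict_mono)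
   have "(M + 1) * norm (x - y) < (M + 1) * (e / (2 * (M + 1)))"
    using y(2) M by (intro mult_strict_left_mono) (auto simp: dist_norm norm_minus_commute)
   also have "(M + 1) * (e / (2 * (M + 1))) = e / 2" using M by (simp add: field_simps)
   finally show "(M + 1) * norm (x - y) < e / 2" .
   have "M * norm (the (A y)) < e / 2 * K" using assms by (simp add: K_def field_simps)
   then show "1 / K * (M * norm (the (A y))) < e / 2" using K by (simp add: field_simps)
  qed
  finally show ?thesis by simp
 qed
 then show thesis by (rule that)
qed

end

section \<open>The contour calculus on decaying symbols\<close>

lemma strip_decay_mult_bounded:
 assumes F: "strip_decay b F" and G: "G holomorphic_on T" "open T" "{w. \<bar>Im w\<bar> <= b} \<subseteq> T"
  and K: "!!w. \<bar>Im w\<bar> <= b ==> cmod (G w) <= K"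
 shows "strip_decay b (%w. F w * G w)"
proof -
 obtain S where S: "open S" "{w. \<bar>Im w\<bar> <= b} \<subseteq> S" "F holomorphic_on S"
  using F unfolding strip_decay_def by blast
 obtain C ep where C: "0 < ep" "0 < C" "!!w. \<bar>Im w\<bar> <= b ==> cmod (F w) <= C * exp (- ep * \<bar>Re w\<bar>)"
  using strip_decayE[OF F] by blast
 show ?thesis
 proof (rule strip_decayI[where S = "S \<inter> T"])
  show "(%w. F w * G w) holomorphic_on S \<inter> T"
   using S(3) G(1) by (intro holomorphic_intros) (auto intro: holomorphic_on_subset)
  show "cmod (F w * G w) <= (C * \<bar>K\<bar>) * exp (- ep * \<bar>Re w\<bar>)" if "\<bar>Im w\<bar> <= b" for w
  proof -
   have "cmod (F w * G w) <= (C * exp (- ep * \<bar>Re w\<bar>)) * \<bar>K\<bar>"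
    unfolding norm_mult using C(3)[OF that] order_trans[OF K[OF that] abs_ge_self] C(2)
    by (intro mult_mono) auto
   then show ?thesis by (simp add: mult_ac)
  qed
 qed (use S G C in auto)
qed

lemma resolvent_kernel_bounds:
 assumes b: "0 < b" "b < \<bar>Im og\<bar>" "\<bar>Im og\<bar> < 2 * pi - b"
 obtains kp where "0 < kp"
  "!!w. \<bar>Im w\<bar> <= b ==> exp og ~= exp w \<and> kp * exp (Re w) <= cmod (exp og - exp w) \<and> kp * exp (Re og) <= cmod (exp og - exp w)"
proof -
 define et where "et = min (min (\<bar>Im og\<bar> - b) (2 * pi - \<bar>Im og\<bar> - b)) (pi / 2)"
 have et: "0 < et" "et <= pi / 2" "et <= \<bar>Im og\<bar> - b" "et <= 2 * pi - \<bar>Im og\<bar> - b"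
  using b unfolding et_def by linarith+
 have sin: "sin et > 0" using et by (intro sin_gt_zero) auto
 show thesis
 proof (rule that[OF sin])
  fix w assume w: "\<bar>Im w\<bar> <= b"
  have h: "et <= \<bar>Im og - Im w\<bar>" "\<bar>Im og - Im w\<bar> <= 2 * pi - et" using et w by linarith+
  have *: "sin et * exp (Re og) <= cmod (exp og - exp w)" "sin et * exp (Re w) <= cmod (exp og - exp w)"
   by (rule exp_diff_lower_bound[OF et(1,2) h])+
  moreover have "0 < sin et * exp (Re w)" using sin by simp
  ultimately show "exp og ~= exp w \<and> sin et * exp (Re w) <= cmod (exp og - exp w) \<and> sin et * exp (Re og) <= cmod (exp og - exp w)"
   by auto
 qed
qed

lemma strip_decay_resolvent_kernel:
 assumes F: "strip_decay b F" and b: "0 < b" "b < \<bar>Im og\<bar>" "\<bar>Im og\<bar> < 2 * pi - b"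
 shows "strip_decay b (%w. F w / (exp og - exp w))" "strip_decay b (%w. F w * (exp w / (exp og - exp w)))"
proof -
 obtain kp where kp: "0 < kp"
  "!!w. \<bar>Im w\<bar> <= b ==> exp og ~= exp w \<and> kp * exp (Re w) <= cmod (exp og - exp w) \<and> kp * exp (Re og) <= cmod (exp og - exp w)"
  using resolvent_kernel_bounds[OF b] by blast
 let ?T = "{w. exp og ~= exp w}"
 have T: "open ?T" "{w. \<bar>Im w\<bar> <= b} \<subseteq> ?T"
  using kp by (auto intro!: open_Collect_neq continuous_intros)
 have "strip_decay b (%w. F w * (1 / (exp og - exp w)))"
 proof (rule strip_decay_mult_bounded[OF F _ T])
  show "(%w. 1 / (exp og - exp w)) holomorphic_on ?T" by (intro holomorphic_intros) auto
  fix w assume w: "\<bar>Im w\<bar> <= b"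
  have "1 / cmod (exp og - exp w) <= 1 / (kp * exp (Re og))"
   using kp(1) kp(2)[OF w] by (intro divide_left_mono) auto
  then show "cmod (1 / (exp og - exp w)) <= 1 / (kp * exp (Re og))" by (simp add: norm_divide)
 qed
 then show "strip_decay b (%w. F w / (exp og - exp w))" by simp
 show "strip_decay b (%w. F w * (exp w / (exp og - exp w)))"
 proof (rule strip_decay_mult_bounded[OF F _ T])
  show "(%w. exp w / (exp og - exp w)) holomorphic_on ?T" by (intro holomorphic_intros) auto
  fix w assume w: "\<bar>Im w\<bar> <= b"
  have "cmod (exp w) / cmod (exp og - exp w) <= exp (Re w) / (kp * exp (Re w))"
   using kp(1) kp(2)[OF w] by (simp only: norm_exp_eq_Re) (intro divide_left_mono, auto)
  then show "cmod (exp w / (exp og - exp w)) <= 1 / kp" by (simp add: norm_divide)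
 qed
qed

locale sector_calculus = sector_operator A ph0 M for A :: "'a::complex_banach \<rightharpoonup> 'a" and ph0 M +
 fixes ph :: real
 assumes ph: "ph0 < ph" "ph < pi"
begin

lemma ph_pos: "0 < ph" using ph0 ph by linarith

lemma outer_line [simp]: "\<bar>ps\<bar> = ph ==> Complex s ps \<in> outer"
 using ph0 ph by (auto simp: outer_def)

definition line_decay :: "(complex => complex) => bool" where
 "line_decay F \<longleftrightarrow> (\<forall>ps. \<bar>ps\<bar> = ph \<longrightarrow> cont (%s. F (Complex s ps))) \<and>
  (\<exists>C ep. 0 < ep \<and> (\<forall>s ps. \<bar>ps\<bar> = ph \<longrightarrow> cmod (F (Complex s ps)) <= C * ed ep s))"

lemma strip_line_decay: "strip_decay ph F ==> line_decay F"
proof -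
 assume F: "strip_decay ph F"
 obtain C ep where C: "0 < ep" "!!w. \<bar>Im w\<bar> <= ph ==> cmod (F w) <= C * exp (- ep * \<bar>Re w\<bar>)"
  using strip_decayE[OF F] by blast
 show ?thesis unfolding line_decay_def
 proof (intro conjI exI allI impI)
  fix ps :: real assume "\<bar>ps\<bar> = ph"
  then show "cont (%s. F (Complex s ps))" by (intro strip_decay_continuous[OF F]) simp
 next
  fix s ps :: real assume "\<bar>ps\<bar> = ph"
  then show "cmod (F (Complex s ps)) <= C * ed ep s" using C(2)[of "Complex s ps"] by simp
 qed (rule C(1))
qed

definition line :: "real => (complex => complex) => 'a => 'a" where
 "line ps F x = IU (%s. F (Complex s ps) *\<^sub>C rho (Complex s ps) x)"

text \<open>With \<open>F w = f (exp w)\<close> this is \<open>f(A)\<close> in the elementary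
  sectorial calculus. The ray of negative angle is traversed outwards and the other one inwards,
  hence the sign.\<close>

definition calc :: "(complex => complex) => 'a => 'a" where
 "calc F x = (1 / (2 * of_real pi * \<i>)) *\<^sub>C (line (- ph) F x - line ph F x)"

lemma continuous_rho_line: "\<bar>ps\<bar> = ph ==> continuous_on S (%s. rho (Complex s ps) x)"
 by (rule continuous_on_compose2[OF continuous_on_rho[OF order_refl]]) (auto intro!: continuous_intros)

lemma continuous_line_integrand:
 assumes "\<bar>ps\<bar> = ph" "cont (%s. F (Complex s ps))"
 shows "cont (%s. F (Complex s ps) *\<^sub>C rho (Complex s ps) x)"
 using assms by (intro continuous_intros continuous_rho_line)

lemma line_integrable:
 assumes F: "line_decay F" and ps: "\<bar>ps\<bar> = ph"
 shows "(%s. F (Complex s ps) *\<^sub>C rho (Complex s ps) x) integrable_on UNIV"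
proof -
 obtain C ep where C: "0 < ep" "!!s. cmod (F (Complex s ps)) <= C * ed ep s"
  and cont: "cont (%s. F (Complex s ps))"
  using F ps unfolding line_decay_def by blast
 show ?thesis
 proof (rule exp_decay_integrable(1)[OF continuous_line_integrand[OF ps cont] C(1)])
  show "norm (F (Complex s ps) *\<^sub>C rho (Complex s ps) x) <= (C * (M * norm x)) * exp (- ep * \<bar>s - 0\<bar>)" for s
  proof -
   have "norm (F (Complex s ps) *\<^sub>C rho (Complex s ps) x) <= (C * ed ep s) * (M * norm x)"
    unfolding norm_scaleC using C(2)[of s] order_trans[OF norm_ge_zero C(2)[of s]] ps
    by (intro mult_mono norm_rho) auto
   then show ?thesis by (simp add: mult_ac)
  qed
 qed
qed

text \<open>The bound does not depend on the centre \<open>a\<close>, so all dilates of one symbol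
  give uniformly bounded operators.\<close>

lemma calc_bound:
 assumes F: "!!ps. \<bar>ps\<bar> = ph ==> cont (%s. F (Complex s ps))" and ep: "0 < ep" and C: "0 <= C"
  and b: "!!s ps. \<bar>ps\<bar> = ph ==> cmod (F (Complex s ps)) <= C * exp (- ep * \<bar>s - a\<bar>)"
 shows "norm (calc F x) <= C * (M * norm x * (2 / ep))"
proof -
 have l: "norm (line ps F x) <= C * (M * norm x) * (2 / ep)" if ps: "\<bar>ps\<bar> = ph" for ps
  unfolding line_def
 proof (rule exp_decay_integrable(2)[OF continuous_line_integrand[OF ps F[OF ps]] ep])
  show "norm (F (Complex s ps) *\<^sub>C rho (Complex s ps) x) <= (C * (M * norm x)) * exp (- ep * \<bar>s - a\<bar>)" for s
  proof -
   have "norm (F (Complex s ps) *\<^sub>C rho (Complex s ps) x) <= (C * exp (- ep * \<bar>s - a\<bar>)) * (M * norm x)"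
    unfolding norm_scaleC using b[OF ps, of s] C ps by (intro mult_mono norm_rho) auto
   then show ?thesis by (simp add: mult_ac)
  qed
 qed
 have "norm (calc F x) = 1 / (2 * pi) * norm (line (- ph) F x - line ph F x)"
  by (simp add: calc_def norm_scaleC norm_divide norm_mult)
 also have "... <= 1 / 2 * (2 * (C * (M * norm x) * (2 / ep)))"
 proof (intro mult_mono)
  show "1 / (2 * pi) <= 1 / 2" using pi_ge_two by (intro divide_left_mono) auto
  show "norm (line (- ph) F x - line ph F x) <= 2 * (C * (M * norm x) * (2 / ep))"
   using l[of "- ph"] l[of ph] ph_pos norm_triangle_ineq4[of "line (- ph) F x" "line ph F x"] by simp
 qed auto
 finally show ?thesis by (simp add: mult_ac)
qed

lemma calc_diff:
 assumes "line_decay F" "line_decay G"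
 shows "calc (%w. F w - G w) x = calc F x - calc G x"
proof -
 have "line ps (%w. F w - G w) x = line ps F x - line ps G x" if "\<bar>ps\<bar> = ph" for ps
  unfolding line_def scaleC.diff_left using that assms by (intro integral_diff line_integrable)
 from this[of "- ph"] this[of ph] ph_pos show ?thesis
  unfolding calc_def by (simp add: scaleC.diff_right)
qed

lemma integral_scaleC:
 fixes f :: "real => 'a"
 assumes "f integrable_on S"
 shows "integral S (%s. c *\<^sub>C f s) = c *\<^sub>C integral S f"
 using integral_linear[OF assms scaleC.bounded_linear_right] by (simp add: o_def)

lemma calc_mult:
 assumes "line_decay F"
 shows "calc (%w. c * F w) x = c *\<^sub>C calc F x"
proof -
 have "line ps (%w. c * F w) x = c *\<^sub>C line ps F x" if "\<bar>ps\<bar> = ph" for ps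
  unfolding line_def scaleC_scaleC[symmetric] using that assms by (intro integral_scaleC line_integrable)
 then show ?thesis using ph_pos
  by (simp add: calc_def scaleC_scaleC mult.commute flip: scaleC.diff_right)
qed

lemma calc_cong: "(!!s ps. \<bar>ps\<bar> = ph ==> F (Complex s ps) = G (Complex s ps)) ==> calc F x = calc G x"
 unfolding calc_def line_def using ph_pos by simp

text \<open>The resolvent identity produces a scalar integral that vanishes by Cauchy's theorem.\<close>

lemma calc_resolvent:
 assumes F: "strip_decay ph F" and og: "ph < \<bar>Im og\<bar>" "\<bar>Im og\<bar> < 2 * pi - ph"
 shows "resolvent A (exp og) (calc F x) = calc (%w. F w / (exp og - exp w)) x"
proof -
 let ?L = "resolvent A (exp og)"
 have ogo: "og \<in> outer" using og ph by (auto simp: outer_def)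
 note L = outer_rset[OF ogo]
 interpret L: bounded_linear ?L by (rule resolvent_bounded_linear[OF L])
 have ne: "exp og ~= exp w" if "\<bar>Im w\<bar> <= ph" for w
  using resolvent_kernel_bounds[OF ph_pos og] that by metis
 note K = strip_decay_resolvent_kernel[OF F ph_pos og]
 have line: "?L (line ps F x) = line ps (%w. F w / (exp og - exp w)) x
   - IU (%s. F (Complex s ps) * (exp (Complex s ps) / (exp og - exp (Complex s ps)))) *\<^sub>C ?L x"
  if ps: "\<bar>ps\<bar> = ph" for ps
 proof -
  let ?k = "%s. F (Complex s ps) * (exp (Complex s ps) / (exp og - exp (Complex s ps)))"
  have pt: "?L (F w *\<^sub>C rho w x) = (F w / (exp og - exp w)) *\<^sub>C rho w x - (F w * (exp w / (exp og - exp w))) *\<^sub>C ?L x"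
   if w: "w \<in> outer" "exp og ~= exp w" for w
  proof -
   note R = outer_rset[OF w(1)]
   let ?r = "resolvent A (exp w)"
   have "?r x - ?L x = (exp og - exp w) *\<^sub>C ?L (?r x)"
    using resolvent_identity[OF lin R L] resolvent_commute[OF lin R L] by simp
   then have "?L (?r x) = (1 / (exp og - exp w)) *\<^sub>C (?r x - ?L x)"
    using w(2) by (simp add: scaleC_scaleC)
   then show ?thesis
    by (simp add: rho_def resolvent_scaleC[OF lin L] scaleC_scaleC scaleC.diff_right)
  qed
  obtain C ep where C: "0 < ep" "!!w. \<bar>Im w\<bar> <= ph ==> cmod (F w * (exp w / (exp og - exp w))) <= C * exp (- ep * \<bar>Re w\<bar>)"
   using strip_decayE[OF K(2)] by blast
  have ki: "?k integrable_on UNIV"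
   by (rule exp_decay_integrable(1)[OF strip_decay_continuous[OF K(2)] C(1), of _ C 0])
    (use C(2)[of "Complex _ ps"] ps in auto)
  have kx: "((%s. ?k s *\<^sub>C ?L x) has_integral (IU ?k *\<^sub>C ?L x)) UNIV"
   using has_integral_linear[OF integrable_integral[OF ki] scaleC.bounded_linear_left, of "?L x"] by (simp add: o_def)
  have "?L (line ps F x) = IU (%s. ?L (F (Complex s ps) *\<^sub>C rho (Complex s ps) x))"
   unfolding line_def using integral_linear[OF line_integrable[OF strip_line_decay[OF F] ps] L.bounded_linear_axioms]
   by (simp add: o_def)
  also have "... = IU (%s. (F (Complex s ps) / (exp og - exp (Complex s ps))) *\<^sub>C rho (Complex s ps) x - ?k s *\<^sub>C ?L x)"
   by (rule integral_cong, rule pt) (use ps ne in auto)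
  also have "... = line ps (%w. F w / (exp og - exp w)) x - IU ?k *\<^sub>C ?L x"
   unfolding line_def
   by (subst integral_diff[OF line_integrable[OF strip_line_decay[OF K(1)] ps] has_integral_integrable[OF kx]])
    (simp only: integral_unique[OF kx])
  finally show ?thesis .
 qed
 show ?thesis
  unfolding calc_def resolvent_scaleC[OF lin L] L.diff
  using line[of ph] line[of "- ph"] strip_decay_Cauchy[OF K(2)] ph_pos by simp
qed

end

lemma exp_Complex_pi [simp]: "exp (Complex 0 pi) = - 1"
 by (simp add: complex_eq_iff Re_exp Im_exp)

lemma exp_Complex_pi_minus: "exp (Complex 0 pi) - exp w = - (1 + exp w)"
 by simp

lemma one_plus_exp_bounds:
 assumes b: "0 < b" "b < pi"
 obtains kp where "0 < kp"
  "!!w. \<bar>Im w\<bar> <= b ==> 1 + exp w ~= 0 \<and> kp * exp (Re w) <= cmod (1 + exp w) \<and> kp <= cmod (1 + exp w)"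
proof -
 obtain kp where kp: "0 < kp" "!!w. \<bar>Im w\<bar> <= b ==> exp (Complex 0 pi) ~= exp w \<and>
  kp * exp (Re w) <= cmod (exp (Complex 0 pi) - exp w) \<and> kp * exp (Re (Complex 0 pi)) <= cmod (exp (Complex 0 pi) - exp w)"
  using resolvent_kernel_bounds[of b "Complex 0 pi"] b by auto
 have n: "cmod (exp (Complex 0 pi) - exp w) = cmod (1 + exp w)" for w
  by (subst norm_minus_cancel[symmetric]) simp
 have z: "exp (Complex 0 pi) ~= exp w ==> 1 + exp w ~= 0" for w
  by (auto simp: add_eq_0_iff)
 show thesis
 proof (rule that[OF kp(1)])
  fix w assume "\<bar>Im w\<bar> <= b"
  from kp(2)[OF this] show "1 + exp w ~= 0 \<and> kp * exp (Re w) <= cmod (1 + exp w) \<and> kp <= cmod (1 + exp w)"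
   using z[of w] unfolding n by simp
 qed
qed

lemma exp_decay_two_sided:
 fixes a s :: real
 assumes "0 < a" "a < 1"
 shows "min (exp (a * s)) (exp ((a - 1) * s)) <= exp (- min a (1 - a) * \<bar>s\<bar>)"
proof (cases "s \<ge> 0")
 case True
 have "min a (1 - a) * s <= (1 - a) * s" using True by (intro mult_right_mono) auto
 then have "exp ((a - 1) * s) <= exp (- min a (1 - a) * \<bar>s\<bar>)" using True by (simp add: algebra_simps)
 then show ?thesis by (rule min.coboundedI2)
next
 case False
 have "min a (1 - a) * \<bar>s\<bar> <= a * \<bar>s\<bar>" by (intro mult_right_mono) auto
 then have "exp (a * s) <= exp (- min a (1 - a) * \<bar>s\<bar>)" using False by simp
 then show ?thesis by (rule min.coboundedI1)
qed

lemma norm_exp_mult_le: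
 assumes "\<bar>Im w\<bar> <= b"
 shows "cmod (exp (al * w)) <= exp (\<bar>Im al\<bar> * b) * exp (Re al * Re w)"
proof -
 have "- (Im al * Im w) <= \<bar>Im al\<bar> * b"
  using abs_ge_self[of "- Im al * Im w"] mult_left_mono[OF assms, of "\<bar>Im al\<bar>"] by (simp add: abs_mult)
 then show ?thesis by (simp add: exp_add[symmetric])
qed

text \<open>The quotient behaves like \<open>exp (al * w)\<close> on the left and like
  \<open>exp ((al - 1) * w)\<close> on the right, according to which of the two lower bounds on
  \<open>d\<close> is used. The smaller of the two moduli decays in both directions.\<close>

lemma power_kernel_bound:
 assumes al: "0 < Re al" "Re al < 1" and w: "\<bar>Im w\<bar> <= b" and kp: "0 < kp" "kp * exp (Re w) <= cmod d" "kp * mu <= cmod d" "0 < mu"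
 shows "cmod (exp (al * w) / d) <= exp (\<bar>Im al\<bar> * b) * (1 / kp * (1 + 1 / mu)) * exp (- min (Re al) (1 - Re al) * \<bar>Re w\<bar>)"
proof -
 let ?s = "Re w" and ?a = "Re al"
 have d: "cmod d > 0" using kp by (meson exp_gt_zero less_le_trans mult_pos_pos)
 have 1: "exp (?a * ?s) / cmod d <= 1 / kp * (1 + 1 / mu) * exp (?a * ?s)"
 proof -
  have "1 / cmod d <= 1 / (kp * mu)" using kp d by (intro divide_left_mono) auto
  also have "... <= 1 / kp * (1 + 1 / mu)" using kp by (simp add: field_simps)
  finally have "1 / cmod d * exp (?a * ?s) <= 1 / kp * (1 + 1 / mu) * exp (?a * ?s)" by (rule mult_right_mono) simp
  then show ?thesis by simp
 qed
 have 2: "exp (?a * ?s) / cmod d <= 1 / kp * (1 + 1 / mu) * exp ((?a - 1) * ?s)"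
 proof -
  have "exp (?a * ?s) / cmod d <= exp (?a * ?s) / (kp * exp ?s)" using kp d by (intro divide_left_mono) auto
  also have "... = 1 / kp * exp ((?a - 1) * ?s)" by (simp add: left_diff_distrib exp_diff)
  also have "... <= 1 / kp * (1 + 1 / mu) * exp ((?a - 1) * ?s)" using kp by (intro mult_right_mono) (auto simp: field_simps)
  finally show ?thesis .
 qed
 have K: "1 / kp * (1 + 1 / mu) \<ge> 0" using kp by simp
 have "exp (?a * ?s) / cmod d <= 1 / kp * (1 + 1 / mu) * min (exp (?a * ?s)) (exp ((?a - 1) * ?s))"
  using 1 2 by (cases "exp (?a * ?s) <= exp ((?a - 1) * ?s)") (simp_all only: min_def if_True if_False)
 also have "... <= 1 / kp * (1 + 1 / mu) * exp (- min ?a (1 - ?a) * \<bar>?s\<bar>)"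
  by (rule mult_left_mono[OF exp_decay_two_sided[OF al] K])
 finally have 3: "exp (?a * ?s) / cmod d <= 1 / kp * (1 + 1 / mu) * exp (- min ?a (1 - ?a) * \<bar>?s\<bar>)" .
 have "cmod (exp (al * w) / d) <= exp (\<bar>Im al\<bar> * b) * (exp (?a * ?s) / cmod d)"
  using divide_right_mono[OF norm_exp_mult_le[OF w, of al], of "cmod d"] by (simp add: norm_divide)
 also have "... <= exp (\<bar>Im al\<bar> * b) * (1 / kp * (1 + 1 / mu) * exp (- min ?a (1 - ?a) * \<bar>?s\<bar>))"
  by (rule mult_left_mono[OF 3]) simp
 finally show ?thesis by (simp add: mult.assoc)
qed

lemma strip_decay_power_one:
 assumes al: "0 < Re al" "Re al < 1" and b: "0 < b" "b < pi"
 shows "strip_decay b (%w. exp (al * w) / (1 + exp w))"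
proof -
 obtain kp where kp: "0 < kp"
  "!!w. \<bar>Im w\<bar> <= b ==> 1 + exp w ~= 0 \<and> kp * exp (Re w) <= cmod (1 + exp w) \<and> kp <= cmod (1 + exp w)"
  using one_plus_exp_bounds[OF b] by blast
 show ?thesis
 proof (rule strip_decayI[where S = "{w. 1 + exp w ~= 0}"])
  show "(%w. exp (al * w) / (1 + exp w)) holomorphic_on {w. 1 + exp w ~= 0}" by (intro holomorphic_intros) auto
  show "open {w::complex. 1 + exp w ~= 0}" by (intro open_Collect_neq continuous_intros)
  show "{w. \<bar>Im w\<bar> <= b} \<subseteq> {w. 1 + exp w ~= 0}" using kp(2) by auto
  show "0 < min (Re al) (1 - Re al)" using al by simp
  show "cmod (exp (al * w) / (1 + exp w)) <= exp (\<bar>Im al\<bar> * b) * (1 / kp * (1 + 1 / 1)) * exp (- min (Re al) (1 - Re al) * \<bar>Re w\<bar>)"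
   if "\<bar>Im w\<bar> <= b" for w
   by (rule power_kernel_bound[OF al that kp(1)]) (use kp(2)[OF that] in auto)
 qed
qed

lemma strip_decay_div_exp_diff:
 assumes F: "strip_decay b F" and b: "b < \<bar>Im og\<bar>" "\<bar>Im og\<bar> < 2 * pi - b"
 shows "strip_decay b (%w. F w / (exp og - exp w))"
proof -
 have "strip_decay b (%w. F w * (1 / (exp og - exp w)))"
 proof (rule strip_decay_mult_bounded[OF F, of _ "{w. exp og - exp w ~= 0}"])
  define et where "et = min (min (\<bar>Im og\<bar> - b) (2 * pi - b - \<bar>Im og\<bar>)) (pi / 2)"
  have et0: "0 < et" using b by (simp add: et_def)
  have et1: "et <= pi / 2" unfolding et_def by (rule min.cobounded2)
  have et2: "et <= \<bar>Im og\<bar> - b" "et <= 2 * pi - b - \<bar>Im og\<bar>" unfolding et_def by linarith+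
  have pos: "sin et * exp (Re og) > 0" using et0 et1 by (intro mult_pos_pos sin_gt_zero) auto
  have lb: "sin et * exp (Re og) <= cmod (exp og - exp w)" if "\<bar>Im w\<bar> <= b" for w
   using exp_diff_lower_bound(2)[OF et0 et1, of w og] that et2 unfolding norm_minus_commute[of "exp og"] by linarith
  have nz: "cmod (exp og - exp w) > 0" if "\<bar>Im w\<bar> <= b" for w using lb[OF that] pos by linarith
  show "(%w. 1 / (exp og - exp w)) holomorphic_on {w. exp og - exp w ~= 0}" by (intro holomorphic_intros) auto
  show "open {w. exp og - exp w ~= 0}" by (intro open_Collect_neq continuous_intros)
  show "{w. \<bar>Im w\<bar> <= b} \<subseteq> {w. exp og - exp w ~= 0}" using nz by fastforce
  show "cmod (1 / (exp og - exp w)) <= 1 / (sin et * exp (Re og))" if "\<bar>Im w\<bar> <= b" for w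
   unfolding norm_divide norm_one using lb[OF that] by (rule divide_left_mono) (use pos nz[OF that] in auto)
 qed
 then show ?thesis by simp
qed

text \<open>The symbol is the square of \<open>exp (w / 2) / (1 + exp w)\<close>, which decays and
  is bounded.\<close>

lemma strip_decay_rational:
 assumes b: "0 < b" "b < pi"
 shows "strip_decay b (%w. exp w / (1 + exp w)\<^sup>2)"
proof -
 obtain kp where kp: "0 < kp"
  "!!w. \<bar>Im w\<bar> <= b ==> 1 + exp w ~= 0 \<and> kp * exp (Re w) <= cmod (1 + exp w) \<and> kp <= cmod (1 + exp w)"
  using one_plus_exp_bounds[OF b] by blast
 let ?g = "%w. exp (1 / 2 * w) / (1 + exp w)"
 have "strip_decay b (%w. ?g w * ?g w)"
 proof (rule strip_decay_mult_bounded)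
  show g: "strip_decay b ?g" using strip_decay_power_one[of "1 / 2" b] b by simp
  show "?g holomorphic_on {w. 1 + exp w ~= 0}" by (intro holomorphic_intros) auto
  show "open {w::complex. 1 + exp w ~= 0}" by (intro open_Collect_neq continuous_intros)
  show "{w. \<bar>Im w\<bar> <= b} \<subseteq> {w. 1 + exp w ~= 0}" using kp(2) by auto
  show "cmod (?g w) <= exp (\<bar>Im (1 / 2 :: complex)\<bar> * b) * (1 / kp * (1 + 1 / 1))" if "\<bar>Im w\<bar> <= b" for w
   by (rule order_trans[OF power_kernel_bound[OF _ _ that kp(1), of _ _ 1] mult_left_le])
    (use kp(1) kp(2)[OF that] in simp_all)
 qed
 moreover have "?g w * ?g w = exp w / (1 + exp w)\<^sup>2" for w :: complex
  by (simp add: power2_eq_square flip: exp_add)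
 ultimately show ?thesis by simp
qed

section \<open>The inverse of 1 + A inside the calculus, and multiplicativity\<close>

context sector_calculus
begin

text \<open>This is the inverse of \<open>1 + A\<close>. It is injective and commutes with the
  calculus, so identities that involve \<open>A\<close> can be checked after applying it.\<close>

definition Rone :: "'a => 'a" where
 "Rone x = - resolvent A (- 1) x"

lemma minus_one_rset: "- 1 \<in> resolvent_set A"
 using outer_rset[of "Complex 0 pi"] ph0 by (auto simp: outer_def)

lemma bounded_linear_Rone: "bounded_linear Rone"
 unfolding Rone_def by (intro bounded_linear_minus resolvent_bounded_linear minus_one_rset)

sublocale Rone: bounded_linear Rone by (rule bounded_linear_Rone)

lemma Rone_scaleC: "Rone (c *\<^sub>C x) = c *\<^sub>C Rone x"
 by (simp add: Rone_def resolvent_scaleC[OF lin minus_one_rset] scaleC.minus_right)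

lemma Rone_dom: "Rone x \<in> dom A" and Rone_right: "Rone x + the (A (Rone x)) = x"
proof -
 let ?y = "resolvent A (- 1) x"
 have y: "?y \<in> dom A" by (rule resolvent_mem_dom[OF minus_one_rset])
 have "- ?y = (- 1) *\<^sub>C ?y" by (simp add: scaleC.minus_left)
 then have "Rone x \<in> dom A \<and> the (A (Rone x)) = (- 1) *\<^sub>C the (A ?y)"
  unfolding Rone_def using lin y unfolding linear_operator_def by metis
 then show "Rone x \<in> dom A" "Rone x + the (A (Rone x)) = x"
  using resolvent_right[OF minus_one_rset, of x] by (auto simp: Rone_def scaleC.minus_left)
qed

lemma Rone_left: "x \<in> dom A ==> Rone (x + the (A x)) = x"
proof -
 assume x: "x \<in> dom A"
 interpret r: bounded_linear "resolvent A (- 1)" by (rule resolvent_bounded_linear[OF minus_one_rset])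
 have "resolvent A (- 1) ((- 1) *\<^sub>C x - the (A x)) = x" by (rule resolvent_left[OF minus_one_rset x])
 moreover have "(- 1) *\<^sub>C x - the (A x) = - (x + the (A x))" by (simp add: scaleC.minus_left)
 ultimately show ?thesis by (simp only: Rone_def r.neg)
qed

lemma Rone_inj: "Rone x = Rone y ==> x = y"
 using Rone_right by metis

lemma Rone_rho: "w \<in> outer ==> Rone (rho w x) = rho w (Rone x)"
proof -
 assume w: "w \<in> outer"
 interpret r: bounded_linear "resolvent A (exp w)" by (rule resolvent_bounded_linear[OF outer_rset[OF w]])
 show ?thesis
  by (simp add: Rone_def rho_def resolvent_scaleC[OF lin minus_one_rset] r.neg scaleC.minus_right
    resolvent_commute[OF lin minus_one_rset outer_rset[OF w]])
qed

text \<open>The resolvent rule at \<open>og = Complex 0 pi\<close>, where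
  \<open>exp og = - 1\<close>.\<close>

lemma calc_Rone:
 assumes "strip_decay ph F"
 shows "Rone (calc F x) = calc (%w. F w / (1 + exp w)) x"
proof -
 have F1: "strip_decay ph (%w. F w / (exp (Complex 0 pi) - exp w))"
  by (rule strip_decay_resolvent_kernel(1)[OF assms ph_pos]) (use ph in auto)
 have "resolvent A (exp (Complex 0 pi)) (calc F x) = calc (%w. F w / (exp (Complex 0 pi) - exp w)) x"
  by (rule calc_resolvent[OF assms]) (use ph in auto)
 then have "Rone (calc F x) = (- 1) *\<^sub>C calc (%w. F w / (exp (Complex 0 pi) - exp w)) x"
  by (simp add: Rone_def scaleC.minus_left)
 also have "... = calc (%w. (- 1) * (F w / (exp (Complex 0 pi) - exp w))) x"
  by (rule calc_mult[OF strip_line_decay[OF F1], symmetric])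
 also have "(%w. (- 1) * (F w / (exp (Complex 0 pi) - exp w))) = (%w. F w / (1 + exp w))"
  by (rule ext) (simp only: exp_Complex_pi_minus minus_divide_right[symmetric], simp)
 finally show ?thesis .
qed

text \<open>Partial fractions for the product of the resolvents at \<open>exp w\<close> and at
  \<open>- 1\<close>.\<close>

lemma rho_Rone:
 assumes w: "w \<in> outer" and ne: "1 + exp w ~= 0"
 shows "rho w (Rone x) = (1 / (1 + exp w)) *\<^sub>C rho w x + (exp w / (1 + exp w)) *\<^sub>C Rone x"
proof -
 interpret r: bounded_linear "resolvent A (exp w)" by (rule resolvent_bounded_linear[OF outer_rset[OF w]])
 have "resolvent A (exp w) x + Rone x = (- 1 - exp w) *\<^sub>C resolvent A (exp w) (resolvent A (- 1) x)"
  using resolvent_identity[OF lin outer_rset[OF w] minus_one_rset, of x] by (simp add: Rone_def)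
 also have "... = (1 + exp w) *\<^sub>C resolvent A (exp w) (Rone x)"
  by (simp add: Rone_def r.neg scaleC.minus_right flip: scaleC.minus_left)
 finally have "resolvent A (exp w) (Rone x) = (1 / (1 + exp w)) *\<^sub>C (resolvent A (exp w) x + Rone x)"
  using ne by (simp add: scaleC_scaleC)
 then show ?thesis by (simp add: rho_def scaleC_scaleC scaleC_add_right mult.commute)
qed

lemma continuous_on_rho2:
 assumes S: "S \<subseteq> outer"
 shows "continuous_on S (%w. rho w (rho w x))"
proof (intro continuous_at_imp_continuous_on ballI)
 fix w0 assume "w0 \<in> S"
 then have w0: "w0 \<in> outer" using S by auto
 let ?b = "%w. M * norm (rho w x - rho w0 x) + norm (rho w (rho w0 x) - rho w0 (rho w0 x))"
 have "(?b \<longlongrightarrow> M * norm (rho w0 x - rho w0 x) + norm (rho w0 (rho w0 x) - rho w0 (rho w0 x))) (at w0)"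
  using rho_continuous[OF w0] unfolding isCont_def by (intro tendsto_intros) auto
 then have lim: "(?b \<longlongrightarrow> 0) (at w0)" by simp
 have ev: "\<forall>\<^sub>F w in at w0. w \<in> outer" using open_outer w0 eventually_at_topological by blast
 have "((%w. rho w (rho w x) - rho w0 (rho w0 x)) \<longlongrightarrow> 0) (at w0)"
 proof (rule Lim_null_comparison[OF _ lim])
  show "\<forall>\<^sub>F w in at w0. norm (rho w (rho w x) - rho w0 (rho w0 x)) <= ?b w"
   using ev
  proof eventually_elim
   case (elim w)
   interpret r: bounded_linear "rho w" by (rule bounded_linear_rho[OF elim])
   have "rho w (rho w x) - rho w0 (rho w0 x) = rho w (rho w x - rho w0 x) + (rho w (rho w0 x) - rho w0 (rho w0 x))"
    by (simp add: r.diff)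
   also have "norm ... <= norm (rho w (rho w x - rho w0 x)) + norm (rho w (rho w0 x) - rho w0 (rho w0 x))"
    by (rule norm_triangle_ineq)
   finally show ?case using norm_rho[OF elim, of "rho w x - rho w0 x"] by linarith
  qed
 qed
 then show "isCont (%w. rho w (rho w x)) w0" unfolding isCont_def by (rule LIM_zero_cancel)
qed

text \<open>The contour is rotated to the left. The pole at \<open>-1\<close> is avoided by rotating
 \<open>mu \<mapsto> R(mu, A) (1 + A)\<^sup>-\<^sup>1 y\<close> through the negative axis and the remaining scalar part \<open>1 / (1 + mu)\<close>
 through the positive axis.\<close>

lemma calc_one_over_one_plus:
 assumes ep: "0 < ep" and C: "0 <= C" and y: "!!s. s <= 0 ==> norm (rho (Complex s ph) y) <= C * exp (ep * s)"
 shows "calc (%w. 1 / (1 + exp w)) y = Rone y"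
proof -
 let ?v = "Rone y"
 obtain kp where kp: "0 < kp"
  "!!w. \<bar>Im w\<bar> <= ph ==> 1 + exp w ~= 0 \<and> kp * exp (Re w) <= cmod (1 + exp w) \<and> kp <= cmod (1 + exp w)"
  using one_plus_exp_bounds[OF ph_pos ph(2)] by blast
 have per: "rho (Complex s (2 * pi - ph)) x = rho (Complex s (- ph)) x" for s x
 proof -
  have "exp (Complex s (2 * pi - ph)) = exp (Complex s (- ph))" by (simp add: complex_eq_iff Re_exp Im_exp)
  then show ?thesis by (simp add: rho_def)
 qed
 have strip: "w \<in> outer" if "Im w \<in> {ph..2 * pi - ph}" for w
  using that ph ph0 by (auto simp: outer_def)
 define C' where "C' = C * (3 + 2 * M)"
 have C': "C' \<ge> 0" using C M by (simp add: C'_def)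
 \<comment> \<open>The decay assumed on one line spreads over the whole strip: the resolvent
   identity compares \<open>rho w y\<close> with its value at the same real part and height
   \<open>ph\<close>.\<close>
 have yb: "norm (rho w y) <= C' * exp (ep * Re w)" if w: "Im w \<in> {ph..2 * pi - ph}" "Re w <= 0" for w
 proof -
  let ?w1 = "Complex (Re w) ph"
  have o: "w \<in> outer" "?w1 \<in> outer" using strip[OF w(1)] ph_pos by auto
  have "cmod (exp (w - ?w1) - 1) <= 2"
   using norm_triangle_ineq4[of "exp (w - ?w1)" 1] by simp
  moreover have "norm (rho ?w1 y - rho w (rho ?w1 y)) <= norm (rho ?w1 y) + M * norm (rho ?w1 y)"
   using norm_rho[OF o(1), of "rho ?w1 y"] norm_triangle_ineq4[of "rho ?w1 y" "rho w (rho ?w1 y)"] by linarith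
  ultimately have "norm (rho w y - rho ?w1 y) <= 2 * (norm (rho ?w1 y) + M * norm (rho ?w1 y))"
   unfolding rho_diff[OF o] norm_scaleC by (intro mult_mono) auto
  then have "norm (rho w y) <= norm (rho ?w1 y) * (3 + 2 * M)"
   using norm_triangle_ineq2[of "rho w y" "rho ?w1 y"] by (simp add: algebra_simps)
  also have "... <= (C * exp (ep * Re w)) * (3 + 2 * M)" using y[OF w(2)] M by (intro mult_right_mono) auto
  finally show ?thesis by (simp add: C'_def mult_ac)
 qed
 obtain K where K: "K > 0" "!!x. norm (Rone x) <= norm x * K" using Rone.pos_bounded by blast
 let ?e = "%n. M * norm (the (A ?v)) * exp (- 1 * real n) + C' * K * exp (- ep * real n)"
 let ?H = "%n ps. integral {- real n..real n} (%s. rho (Complex s ps) ?v)"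
 \<comment> \<open>The rotation through the negative axis, from height \<open>ph\<close> to
   \<open>2 * pi - ph\<close>. On the right \<open>rho w ?v\<close> tends to \<open>?v\<close>,
   since \<open>?v\<close> lies in the domain; on the left it tends to 0 by the decay of
   \<open>rho w y\<close>.\<close>
 have 1: "(%n. ?H n (2 * pi - ph) - ?H n ph) \<longlonglongrightarrow> (2 * pi - ph - ph) *\<^sub>R (\<i> *\<^sub>C (?v - 0))"
 proof (rule rectangle_shift_limit[where D = "%w. rho w ?v - rho w (rho w ?v)" and N = 0 and e = ?e])
  show "bounded_linear ((*\<^sub>C) \<i> :: 'a => 'a)" by (rule scaleC.bounded_linear_right)
  fix s ps assume ps: "ps \<in> {ph..2 * pi - ph}"
  have o: "Complex s ps \<in> outer" using strip[of "Complex s ps"] ps by simp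
  have "((%s. Complex s ps) hvd 1) (at s)"
   using has_vector_derivative_Complex_Re[of "%z. z" 1] by simp
  from rho_path_derivative[OF this o]
  show "((%s. rho (Complex s ps) ?v) hvd rho (Complex s ps) ?v - rho (Complex s ps) (rho (Complex s ps) ?v)) (at s)"
   by simp
  have "((%ps. Complex s ps) hvd \<i>) (at ps)"
   using has_vector_derivative_Complex_Im[of "%z. z" 1] by simp
  from rho_path_derivative[OF this o]
  show "((%ps. rho (Complex s ps) ?v) hvd \<i> *\<^sub>C (rho (Complex s ps) ?v - rho (Complex s ps) (rho (Complex s ps) ?v))) (at ps)" .
 next
  show "continuous_on {w. Im w \<in> {ph..2 * pi - ph}} (%w. rho w ?v - rho w (rho w ?v))"
   using strip by (intro continuous_on_diff continuous_on_rho continuous_on_rho2) auto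
 next
  fix n ps assume ps: "ps \<in> {ph..2 * pi - ph}"
  have o: "Complex s ps \<in> outer" for s using strip[of "Complex s ps"] ps by simp
  have "norm (rho (Complex (real n) ps) ?v - ?v) <= exp (- real n) * (M * norm (the (A ?v)))"
   using rho_dom[OF o Rone_dom, of "real n" y] norm_rho[OF o, of "real n" "the (A ?v)"] by (simp add: norm_scaleC)
  moreover have "C' * K * exp (- ep * real n) \<ge> 0" using C' K by simp
  ultimately show "norm (rho (Complex (real n) ps) ?v - ?v) <= ?e n" by (simp add: mult_ac)
  have "norm (rho (Complex (- real n) ps) ?v) <= norm (rho (Complex (- real n) ps) y) * K"
   using K(2) by (simp add: Rone_rho[OF o, symmetric])
  also have "... <= (C' * exp (ep * (- real n))) * K" using yb[of "Complex (- real n) ps"] ps K(1) by (intro mult_right_mono) auto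
  finally have "norm (rho (Complex (- real n) ps) ?v) <= C' * K * exp (- ep * real n)" by (simp add: mult_ac)
  moreover have "M * norm (the (A ?v)) * exp (- 1 * real n) \<ge> 0" using M by simp
  ultimately show "norm (rho (Complex (- real n) ps) ?v - 0) <= ?e n" by simp
 next
  show "?e \<longlonglongrightarrow> 0" using tendsto_add[OF exp_neg_real_tendsto_0[of 1] exp_neg_real_tendsto_0[OF ep]] by simp
 qed (use ph in auto)
 let ?cx = "%w. exp w / (1 + exp w)"
 let ?X = "%n ps. integral {- real n..real n} (%s. ?cx (Complex s ps))"
 \<comment> \<open>The rotation of the scalar part through the positive axis. The symbol has no pole
   there and tends to 1 on the right and to 0 on the left.\<close>
 have 2: "(%n. ?X n ph - ?X n (- ph)) \<longlonglongrightarrow> of_real (ph - (- ph)) * (\<i> * (1 - 0))"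
 proof (rule rectangle_shift_limit_holomorphic[where S = "{w. 1 + exp w ~= 0}" and N = 0 and e = "%n. 1 / kp * exp (- 1 * real n)"])
  show "?cx holomorphic_on {w. 1 + exp w ~= 0}" by (intro holomorphic_intros) auto
  show "open {w::complex. 1 + exp w ~= 0}" by (intro open_Collect_neq continuous_intros)
  show "{w. Im w \<in> {- ph..ph}} \<subseteq> {w. 1 + exp w ~= 0}" using kp(2) by (auto simp: abs_le_iff)
  fix n ps assume ps: "ps \<in> {- ph..ph}"
  have b: "1 + exp w ~= 0" "kp * exp (Re w) <= cmod (1 + exp w)" "kp <= cmod (1 + exp w)" if "w = Complex s ps" for w s
   using kp(2)[of w] ps that by (auto simp: abs_le_iff)
  let ?w = "Complex (real n) ps"
  have "?cx ?w - 1 = - 1 / (1 + exp ?w)" using b(1)[OF refl] by (simp add: field_simps)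
  then have "cmod (?cx ?w - 1) = 1 / cmod (1 + exp ?w)" by (simp add: norm_divide)
  also have "... <= 1 / (kp * exp (Re ?w))" using b[OF refl, of "real n"] kp(1) by (intro divide_left_mono) (auto intro!: mult_pos_pos)
  finally show "norm (?cx ?w - 1) <= 1 / kp * exp (- 1 * real n)" by (simp add: exp_minus field_simps)
  let ?w = "Complex (- real n) ps"
  have "cmod (?cx ?w) = exp (- real n) / cmod (1 + exp ?w)" by (simp add: norm_divide)
  also have "... <= exp (- real n) / kp" using b[OF refl, of "- real n"] kp(1) by (intro divide_left_mono) (auto intro!: mult_pos_pos)
  finally show "norm (?cx ?w - 0) <= 1 / kp * exp (- 1 * real n)" by (simp add: field_simps)
 next
  show "(%n. 1 / kp * exp (- 1 * real n)) \<longlonglongrightarrow> 0" by (rule exp_neg_real_tendsto_0) simp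
 qed (use ph_pos in auto)
 let ?f = "%ps s. (1 / (1 + exp (Complex s ps))) *\<^sub>C rho (Complex s ps) y"
 have ne: "1 + exp (Complex s ps) ~= 0" "kp * exp s <= cmod (1 + exp (Complex s ps))" "kp <= cmod (1 + exp (Complex s ps))"
  if "\<bar>ps\<bar> = ph" for s ps
  using kp(2)[of "Complex s ps"] that by auto
 have ccx: "continuous_on S (%s. ?cx (Complex s ps))" and cinv: "continuous_on S (%s. 1 / (1 + exp (Complex s ps)))"
  if "\<bar>ps\<bar> = ph" for ps S
  using ne(1)[OF that] by (auto intro!: continuous_intros)
 have yb': "norm (rho (Complex s ps) y) <= C' * exp (ep * s)" if "\<bar>ps\<bar> = ph" "s <= 0" for s ps
 proof (cases "ps = ph")
  case True
  then show ?thesis using yb[of "Complex s ph"] that ph by auto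
 next
  case False
  then have "ps = - ph" using that by auto
  then show ?thesis using yb[of "Complex s (2 * pi - ph)"] that ph ph_pos by (simp add: per)
 qed
 define ep' where "ep' = min ep 1"
 have ep': "ep' > 0" using ep by (simp add: ep'_def)
 have fb: "norm (?f ps s) <= ((C' + M * norm y) / kp) * exp (- ep' * \<bar>s\<bar>)" if ps: "\<bar>ps\<bar> = ph" for ps s
 proof (cases "s <= 0")
  case True
  have "norm (?f ps s) <= 1 / kp * (C' * exp (ep * s))"
   unfolding norm_scaleC norm_divide norm_one
   using yb'[OF ps True] ne[OF ps, of s] kp(1) by (intro mult_mono divide_left_mono) (auto intro!: mult_pos_pos)
  also have "... <= 1 / kp * ((C' + M * norm y) * exp (- ep' * \<bar>s\<bar>))"
  proof (intro mult_left_mono mult_mono)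
   have "ep' * \<bar>s\<bar> <= ep * \<bar>s\<bar>" by (intro mult_right_mono) (auto simp: ep'_def)
   then show "exp (ep * s) <= exp (- ep' * \<bar>s\<bar>)" using True by simp
  qed (use C' M kp(1) in auto)
  finally show ?thesis by simp
 next
  case False
  have "norm (?f ps s) <= 1 / (kp * exp s) * (M * norm y)"
   unfolding norm_scaleC norm_divide norm_one
   using ne[OF ps, of s] kp(1) ps by (intro mult_mono divide_left_mono norm_rho) (auto intro!: mult_pos_pos)
  also have "... = 1 / kp * ((M * norm y) * exp (- s))" by (simp add: exp_minus field_simps)
  also have "... <= 1 / kp * ((C' + M * norm y) * exp (- ep' * \<bar>s\<bar>))"
  proof (intro mult_left_mono mult_mono)
   have "ep' * \<bar>s\<bar> <= 1 * \<bar>s\<bar>" by (intro mult_right_mono) (auto simp: ep'_def)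
   then show "exp (- s) <= exp (- ep' * \<bar>s\<bar>)" using False by simp
  qed (use C' M kp(1) in auto)
  finally show ?thesis by simp
 qed
 have lim: "(%n. integral {- real n..real n} (?f ps)) \<longlonglongrightarrow> line ps (%w. 1 / (1 + exp w)) y" if ps: "\<bar>ps\<bar> = ph" for ps
  unfolding line_def
  by (rule exp_decay_tendsto[OF _ ep' fb[OF ps]]) (intro continuous_on_scaleC cinv continuous_rho_line ps)
 have split: "integral {- real n..real n} (?f ps) = ?H n ps - ?X n ps *\<^sub>C ?v" if ps: "\<bar>ps\<bar> = ph" for ps n
 proof -
  have Xi: "(%s. ?cx (Complex s ps)) integrable_on {- real n..real n}"
   by (rule integrable_continuous_interval[OF ccx[OF ps]])
  have X: "((%s. ?cx (Complex s ps) *\<^sub>C ?v) has_integral ?X n ps *\<^sub>C ?v) {- real n..real n}"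
   using has_integral_linear[OF integrable_integral[OF Xi] scaleC.bounded_linear_left, of ?v] by (simp add: o_def)
  have "integral {- real n..real n} (?f ps) = integral {- real n..real n} (%s. rho (Complex s ps) ?v - ?cx (Complex s ps) *\<^sub>C ?v)"
   by (rule integral_cong) (simp add: rho_Rone[OF outer_line[OF ps] ne(1)[OF ps]])
  also have "... = ?H n ps - ?X n ps *\<^sub>C ?v"
   by (subst integral_diff[OF integrable_continuous_interval[OF continuous_rho_line[OF ps]] has_integral_integrable[OF X]])
    (simp only: integral_unique[OF X])
  finally show ?thesis .
 qed
 have "(%n. (?H n (2 * pi - ph) - ?H n ph) + (?X n ph - ?X n (- ph)) *\<^sub>C ?v) \<longlonglongrightarrow>
  (2 * pi - ph - ph) *\<^sub>R (\<i> *\<^sub>C (?v - 0)) + (of_real (ph - (- ph)) * (\<i> * (1 - 0))) *\<^sub>C ?v"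
  by (intro tendsto_add 1 scaleC.tendsto[OF 2 tendsto_const])
 moreover have "(?H n (2 * pi - ph) - ?H n ph) + (?X n ph - ?X n (- ph)) *\<^sub>C ?v
  = integral {- real n..real n} (?f (- ph)) - integral {- real n..real n} (?f ph)" for n
  using split[of "- ph" n] split[of ph n] ph_pos by (simp add: per scaleC.diff_left)
 \<comment> \<open>The two rotations sweep the angles \<open>2 * pi - 2 * ph\<close> and
   \<open>2 * ph\<close>, in total one full turn.\<close>
 moreover have "(2 * pi - ph - ph) *\<^sub>R (\<i> *\<^sub>C (?v - 0)) + (of_real (ph - (- ph)) * (\<i> * (1 - 0))) *\<^sub>C ?v = (2 * of_real pi * \<i>) *\<^sub>C ?v"
  by (simp add: scaleR_scaleC scaleC_scaleC flip: scaleC_add_left) (simp add: algebra_simps)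
 ultimately have "(%n. integral {- real n..real n} (?f (- ph)) - integral {- real n..real n} (?f ph)) \<longlonglongrightarrow> (2 * of_real pi * \<i>) *\<^sub>C ?v"
  by simp
 note l1 = this
 have l2: "(%n. integral {- real n..real n} (?f (- ph)) - integral {- real n..real n} (?f ph)) \<longlonglongrightarrow>
  line (- ph) (%w. 1 / (1 + exp w)) y - line ph (%w. 1 / (1 + exp w)) y"
  using ph_pos by (intro tendsto_diff lim) auto
 have "line (- ph) (%w. 1 / (1 + exp w)) y - line ph (%w. 1 / (1 + exp w)) y = (2 * of_real pi * \<i>) *\<^sub>C ?v"
  by (rule LIMSEQ_unique[OF l2 l1])
 then show ?thesis by (simp add: calc_def scaleC_scaleC)
qed

end

context sector_calculus
begin

text \<open>The evaluation at \<open>1 / (1 + exp w)\<close> is applied to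
  \<open>x - Rone x\<close>, which is \<open>A\<close> applied to \<open>Rone x\<close>. Its
  weighted resolvent carries an additional factor \<open>exp w / (1 + exp w)\<close>, hence decays
  on the left. The scalar term split off is the same on both lines by Cauchy's theorem.\<close>

lemma calc_rational:
 "calc (%w. exp w / (1 + exp w)\<^sup>2) x = Rone x - Rone (Rone x)"
proof -
 let ?y = "x - Rone x" and ?F = "%w::complex. exp w / (1 + exp w)\<^sup>2"
 obtain kp where kp: "0 < kp"
  "!!w. \<bar>Im w\<bar> <= ph ==> 1 + exp w ~= 0 \<and> kp * exp (Re w) <= cmod (1 + exp w) \<and> kp <= cmod (1 + exp w)"
  using one_plus_exp_bounds[OF ph_pos ph(2)] by blast
 have F: "strip_decay ph ?F" by (rule strip_decay_rational[OF ph_pos ph(2)])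
 have ry: "rho w ?y = (exp w / (1 + exp w)) *\<^sub>C (rho w x - Rone x)" if w: "w \<in> outer" "\<bar>Im w\<bar> <= ph" for w
 proof -
  interpret r: bounded_linear "rho w" by (rule bounded_linear_rho[OF w(1)])
  have ne: "1 + exp w ~= 0" using kp(2)[OF w(2)] by blast
  have "1 - 1 / (1 + exp w) = exp w / (1 + exp w)" using ne by (simp add: field_simps)
  then have "rho w x - (1 / (1 + exp w)) *\<^sub>C rho w x = (exp w / (1 + exp w)) *\<^sub>C rho w x"
   by (metis scaleC.diff_left scaleC_one)
  then show ?thesis by (simp add: r.diff rho_Rone[OF w(1) ne] scaleC.diff_right algebra_simps)
 qed
 have "calc (%w. 1 / (1 + exp w)) ?y = Rone ?y"
 proof (rule calc_one_over_one_plus[of 1])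
  fix s :: real assume "s <= 0"
  let ?w = "Complex s ph"
  have o: "?w \<in> outer" "\<bar>Im ?w\<bar> <= ph" using ph_pos by auto
  have "exp s / cmod (1 + exp ?w) <= exp s / kp"
   using kp(1) kp(2)[OF o(2)] by (intro divide_left_mono) (auto intro!: mult_pos_pos)
  moreover have "norm (rho ?w x - Rone x) <= M * norm x + norm (Rone x)"
   using norm_triangle_ineq4[of "rho ?w x" "Rone x"] norm_rho[OF o(1), of x] by linarith
  ultimately have "norm (rho ?w ?y) <= exp s / kp * (M * norm x + norm (Rone x))"
   unfolding ry[OF o] norm_scaleC using kp(1) by (intro mult_mono) (auto simp: norm_divide)
  then show "norm (rho ?w ?y) <= (1 / kp * (M * norm x + norm (Rone x))) * exp (1 * s)" by (simp add: mult_ac)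
 qed (use kp(1) M in auto)
 moreover have "line ps (%w. 1 / (1 + exp w)) ?y = line ps ?F x - IU (%s. ?F (Complex s ps)) *\<^sub>C Rone x"
  if ps: "\<bar>ps\<bar> = ph" for ps
 proof -
  have "?F (Complex s ps) = 1 / (1 + exp (Complex s ps)) * (exp (Complex s ps) / (1 + exp (Complex s ps)))" for s
   by (simp add: power2_eq_square)
  then have pt: "(1 / (1 + exp (Complex s ps))) *\<^sub>C rho (Complex s ps) ?y
    = ?F (Complex s ps) *\<^sub>C rho (Complex s ps) x - ?F (Complex s ps) *\<^sub>C Rone x" for s
   using ry[of "Complex s ps"] ps by (simp add: scaleC_scaleC scaleC.diff_right)
  obtain C ep where C: "0 < ep" "!!w. \<bar>Im w\<bar> <= ph ==> cmod (?F w) <= C * exp (- ep * \<bar>Re w\<bar>)"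
   using strip_decayE[OF F] by blast
  have ki: "(%s. ?F (Complex s ps)) integrable_on UNIV"
  proof (rule exp_decay_integrable(1)[OF strip_decay_continuous[OF F] C(1)])
   show "cmod (?F (Complex s ps)) <= C * exp (- ep * \<bar>s - 0\<bar>)" for s using C(2)[of "Complex s ps"] ps by simp
  qed (use ps in simp)
  have kx: "((%s. ?F (Complex s ps) *\<^sub>C Rone x) has_integral (IU (%s. ?F (Complex s ps)) *\<^sub>C Rone x)) UNIV"
   using has_integral_linear[OF integrable_integral[OF ki] scaleC.bounded_linear_left, of "Rone x"] by (simp add: o_def)
  show ?thesis unfolding line_def pt
   by (subst integral_diff[OF line_integrable[OF strip_line_decay[OF F] ps] has_integral_integrable[OF kx]])
    (simp only: integral_unique[OF kx])
 qed
 ultimately have "Rone ?y = (1 / (2 * of_real pi * \<i>)) *\<^sub>C (line (- ph) ?F x - line ph ?F x)"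
  using strip_decay_Cauchy[OF F] ph_pos unfolding calc_def by simp
 then show ?thesis by (simp add: calc_def Rone.diff)
qed

text \<open>Fubini, with Cauchy's formula for the inner integral over the outer contour.\<close>

lemma calc_product:
 assumes ph': "ph < ph'" "ph' < pi" and f: "strip_decay ph' f" and g: "strip_decay ph g"
 shows "(1 / (2 * of_real pi * \<i>)) *\<^sub>C (IU (%sg. f (Complex sg (- ph')) *\<^sub>C rho (Complex sg (- ph')) (calc g x))
   - IU (%sg. f (Complex sg ph') *\<^sub>C rho (Complex sg ph') (calc g x)))
  = calc (%w. f w * g w) x"
proof -
 let ?c = "1 / (2 * of_real pi * \<i>) :: complex"
 have ph'0: "0 < ph'" using ph_pos ph' by simp
 \<comment> \<open>The two contours are separated by a positive angle, also across the negative
   axis; the sine of this angle, capped at \<open>pi / 2\<close>, bounds the Cauchy kernel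
   \<open>K\<close> by \<open>1 / kp\<close>.\<close>
 define kp where "kp = sin (min (min (ph' - ph) (2 * pi - ph' - ph)) (pi / 2))"
 have et: "0 < min (min (ph' - ph) (2 * pi - ph' - ph)) (pi / 2)" "min (min (ph' - ph) (2 * pi - ph' - ph)) (pi / 2) <= pi / 2"
  subgoal using ph' ph by simp
  subgoal by (rule min.cobounded2)
  done
 have kp: "kp > 0" unfolding kp_def using et by (intro sin_gt_zero) linarith+
 have kpb: "kp * exp sg <= cmod (exp (Complex sg ps') - exp (Complex s ps))" if "\<bar>ps\<bar> = ph" "\<bar>ps'\<bar> = ph'" for sg s ps ps'
  unfolding kp_def using exp_diff_lower_bound(1)[OF et, of "Complex sg ps'" "Complex s ps"] that ph_pos by simp
 have ne: "exp (Complex sg ps') - exp (Complex s ps) ~= 0" if "\<bar>ps\<bar> = ph" "\<bar>ps'\<bar> = ph'" for sg s ps ps'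
  using kpb[OF that, of sg s] mult_pos_pos[OF kp exp_gt_zero[of sg]] by auto
 define K where "K og w = exp og / (exp og - exp w)" for og w :: complex
 have Kb: "cmod (K (Complex sg ps') (Complex s ps)) <= 1 / kp" if "\<bar>ps\<bar> = ph" "\<bar>ps'\<bar> = ph'" for sg s ps ps'
  using kpb[OF that, of sg s] ne[OF that, of sg s] kp by (simp add: K_def norm_divide field_simps)
 let ?h = "%ps' ps sg s. (f (Complex sg ps') * K (Complex sg ps') (Complex s ps) * g (Complex s ps)) *\<^sub>C rho (Complex s ps) x"
 obtain C1 ep1 where C1: "0 < ep1" "0 < C1" "!!w. \<bar>Im w\<bar> <= ph' ==> cmod (f w) <= C1 * exp (- ep1 * \<bar>Re w\<bar>)"
  using strip_decayE[OF f] by blast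
 obtain C2 ep2 where C2: "0 < ep2" "0 < C2" "!!w. \<bar>Im w\<bar> <= ph ==> cmod (g w) <= C2 * exp (- ep2 * \<bar>Re w\<bar>)"
  using strip_decayE[OF g] by blast
 define de where "de = min ep1 ep2"
 have de: "0 < de" using C1 C2 by (simp add: de_def)
 have dec: "ed ep1 s <= ed de s" "ed ep2 s <= ed de s" for s
  by (simp_all add: de_def mult_right_mono)
 have fb: "cmod (f (Complex sg ps')) <= C1 * ed de sg" if "\<bar>ps'\<bar> = ph'" for sg ps'
  using C1(3)[of "Complex sg ps'"] mult_left_mono[OF dec(1)[of sg] less_imp_le[OF C1(2)]] that by simp
 have gb: "cmod (g (Complex s ps)) <= C2 * ed de s" if "\<bar>ps\<bar> = ph" for s ps
  using C2(3)[of "Complex s ps"] mult_left_mono[OF dec(2)[of s] less_imp_le[OF C2(2)]] that by simp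
 have hb: "norm (?h ps' ps sg s) <= (C1 * (1 / kp) * C2 * (M * norm x)) * ed de sg * ed de s"
  if a: "\<bar>ps\<bar> = ph" "\<bar>ps'\<bar> = ph'" for ps' ps sg s
 proof -
  have "norm (?h ps' ps sg s) <= (C1 * ed de sg) * (1 / kp) * (C2 * ed de s) * (M * norm x)"
   unfolding norm_scaleC norm_mult using C1(2) C2(2) kp a by (intro mult_mono fb gb Kb norm_rho outer_line) auto
  then show ?thesis by (simp only: mult_ac)
 qed
 have fc: "cont (%sg. f (Complex sg ps'))" if "\<bar>ps'\<bar> = ph'" for ps'
  using that by (intro strip_decay_continuous[OF f]) auto
 have gc: "cont (%s. g (Complex s ps))" if "\<bar>ps\<bar> = ph" for ps
  using that by (intro strip_decay_continuous[OF g]) auto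
 have hc: "cont (%(sg, s). ?h ps' ps sg s)" if a: "\<bar>ps\<bar> = ph" "\<bar>ps'\<bar> = ph'" for ps' ps
  unfolding case_prod_unfold K_def using ne[OF a]
  by (intro continuous_on_scaleC continuous_on_mult continuous_on_divide continuous_intros
    continuous_on_compose2[OF fc[OF a(2)]] continuous_on_compose2[OF gc[OF a(1)]] continuous_on_compose2[OF continuous_rho_line[OF a(1), of UNIV]]) auto
 have C0: "0 <= C1 * (1 / kp) * C2 * (M * norm x)" using C1(2) C2(2) kp M by simp
 note sw = exp_decay_swap[OF hc de C0 hb]
 \<comment> \<open>The resolvent rule moves \<open>rho\<close> at a point of the outer contour into
   the symbol of the inner one, where it becomes the Cauchy kernel \<open>K\<close>.\<close>
 have outer_int: "IU (%sg. f (Complex sg ps') *\<^sub>C rho (Complex sg ps') (calc g x))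
  = ?c *\<^sub>C (IU (%sg. IU (?h ps' (- ph) sg)) - IU (%sg. IU (?h ps' ph sg)))"
  if a: "\<bar>ps'\<bar> = ph'" for ps'
 proof -
  have i1: "(%sg. IU (?h ps' (- ph) sg)) integrable_on UNIV" "(%sg. IU (?h ps' ph sg)) integrable_on UNIV"
   by (rule sw(2), use a ph_pos in simp_all)+
  have inner: "f (Complex sg ps') *\<^sub>C rho (Complex sg ps') (calc g x) = ?c *\<^sub>C (IU (?h ps' (- ph) sg) - IU (?h ps' ph sg))" for sg
  proof -
   let ?og = "Complex sg ps'"
   have og: "ph < \<bar>Im ?og\<bar>" "\<bar>Im ?og\<bar> < 2 * pi - ph" using a ph' ph by auto
   have "f ?og *\<^sub>C rho ?og (calc g x) = (f ?og * exp ?og) *\<^sub>C calc (%w. g w / (exp ?og - exp w)) x"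
    unfolding rho_def calc_resolvent[OF g og] by (simp add: scaleC_scaleC)
   also have "... = calc (%w. (f ?og * exp ?og) * (g w / (exp ?og - exp w))) x"
    by (rule calc_mult[OF strip_line_decay[OF strip_decay_div_exp_diff[OF g og]], symmetric])
   also have "... = ?c *\<^sub>C (IU (?h ps' (- ph) sg) - IU (?h ps' ph sg))"
    unfolding calc_def line_def K_def by (simp add: mult_ac)
   finally show ?thesis .
  qed
  show ?thesis unfolding inner integral_scaleC[OF integrable_diff[OF i1]] integral_diff[OF i1] ..
 qed
 have inner2: "IU (%sg. ?h ps' ps sg s) = IU (%sg. f (Complex sg ps') * K (Complex sg ps') (Complex s ps)) *\<^sub>C
   (g (Complex s ps) *\<^sub>C rho (Complex s ps) x)" if a: "\<bar>ps\<bar> = ph" "\<bar>ps'\<bar> = ph'" for ps' ps s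
 proof -
  have "(%sg. f (Complex sg ps') * K (Complex sg ps') (Complex s ps)) integrable_on UNIV"
  proof (rule exp_decay_integrable(1)[OF _ de])
   show "cont (%sg. f (Complex sg ps') * K (Complex sg ps') (Complex s ps))"
    unfolding K_def using ne[OF a] fc[OF a(2)] by (intro continuous_intros) auto
   have "cmod (f (Complex sg ps') * K (Complex sg ps') (Complex s ps)) <= (C1 * ed de sg) * (1 / kp)" for sg
    unfolding norm_mult using C1(2) kp by (intro mult_mono fb Kb a) auto
   then show "cmod (f (Complex sg ps') * K (Complex sg ps') (Complex s ps)) <= (C1 * (1 / kp)) * exp (- de * \<bar>sg - 0\<bar>)" for sg
    by (simp add: mult_ac)
  qed
  from integral_linear[OF this scaleC.bounded_linear_left, of "g (Complex s ps) *\<^sub>C rho (Complex s ps) x"]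
  show ?thesis by (simp add: o_def scaleC_scaleC)
 qed
 let ?J = "%ps' ps. IU (%sg. IU (?h ps' ps sg))"
 \<comment> \<open>After the exchange of integrals the inner point is fixed and lies inside the
   strip of half height \<open>ph'\<close>; the two outer scalar integrals then differ by
   \<open>2 * pi * \<i>\<close> times the value of \<open>f\<close> there.\<close>
 have final: "?c *\<^sub>C (?J (- ph') ps - ?J ph' ps) = line ps (%w. f w * g w) x" if a: "\<bar>ps\<bar> = ph" for ps
 proof -
  have p: "\<bar>- ph'\<bar> = ph'" "\<bar>ph'\<bar> = ph'" using ph'0 by auto
  have i: "(%s. IU (%sg. ?h (- ph') ps sg s)) integrable_on UNIV" "(%s. IU (%sg. ?h ph' ps sg s)) integrable_on UNIV"
   by (rule sw(3)[OF a p(1) a p(1)], rule sw(3)[OF a p(2) a p(2)])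
  have "?c *\<^sub>C (IU (%sg. ?h (- ph') ps sg s) - IU (%sg. ?h ph' ps sg s))
    = (f (Complex s ps) * g (Complex s ps)) *\<^sub>C rho (Complex s ps) x" for s
  proof -
   have w: "\<bar>Im (Complex s ps)\<bar> < ph'" using a ph' by simp
   have eq: "IU (%sg. ?h (- ph') ps sg s) - IU (%sg. ?h ph' ps sg s)
    = (2 * of_real pi * \<i> * f (Complex s ps)) *\<^sub>C (g (Complex s ps) *\<^sub>C rho (Complex s ps) x)"
    unfolding inner2[OF a p(1)] inner2[OF a p(2)] scaleC.diff_left[symmetric]
    using strip_decay_Cauchy_formula[OF f w ph'(2)] unfolding K_def by simp
   show ?thesis unfolding eq by (simp add: scaleC_scaleC)
  qed
  then show ?thesis unfolding sw(1)[OF a p(1) a p(1)] sw(1)[OF a p(2) a p(2)] line_def integral_diff[OF i, symmetric] integral_scaleC[OF integrable_diff[OF i], symmetric] by simp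
 qed
 have "?c *\<^sub>C (?c *\<^sub>C (?J (- ph') (- ph) - ?J (- ph') ph) - ?c *\<^sub>C (?J ph' (- ph) - ?J ph' ph))
  = ?c *\<^sub>C (?c *\<^sub>C (?J (- ph') (- ph) - ?J ph' (- ph)) - ?c *\<^sub>C (?J (- ph') ph - ?J ph' ph))"
  by (simp only: scaleC.diff_right) (simp add: algebra_simps)
 moreover have "\<bar>- ph'\<bar> = ph'" "\<bar>ph'\<bar> = ph'" "\<bar>- ph\<bar> = ph" "\<bar>ph\<bar> = ph" using ph'0 ph_pos by auto
 ultimately show ?thesis by (simp only: outer_int final calc_def[of "%w. f w * g w" x])
qed

end

section \<open>From sectoriality to uniform resolvent bounds off a sector\<close>

lemma sector_nonreal_bound:
 assumes "0 <= th" "th < pi" "z \<in> sector th"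
 shows "cmod z * cos th <= Re z"
proof (cases "th = 0")
 case True
 then show ?thesis using assms by (auto simp: sector_def)
next
 case False
 then have "\<bar>Arg z\<bar> < th" "z ~= 0" using assms by (auto simp: sector_def)
 then have "cos th <= cos \<bar>Arg z\<bar>" using assms by (intro cos_monotone_0_pi_le) auto
 then have "cmod z * cos th <= cmod z * cos (Arg z)" by (intro mult_left_mono) (auto simp: cos_abs_real)
 also have "cmod z * cos (Arg z) = Re z"
  using Arg_eq[OF \<open>z ~= 0\<close>] by (metis Re_rcis cis_conv_exp rcis_def)
 finally show ?thesis .
qed

text \<open>The inequality expresses the angle condition without \<open>Arg\<close>; it is closed,
  hence passes from the sector to its closure, including the vertex.\<close>

lemma closure_sector_bound:
 assumes "0 <= th" "th < pi" "z \<in> closure (sector th)"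
 shows "cmod z * cos th <= Re z"
proof -
 have "closed {z. cmod z * cos th <= Re z}"
  by (intro closed_Collect_le continuous_intros)
 moreover have "sector th \<subseteq> {z. cmod z * cos th <= Re z}"
  using sector_nonreal_bound[OF assms(1,2)] by auto
 ultimately show ?thesis using closure_minimal assms(3) by blast
qed

lemma exp_notin_closure_sector:
 assumes "0 <= th" "th < pi" "th < \<bar>Im w\<bar>" "\<bar>Im w\<bar> < 2 * pi - th"
 shows "exp w \<notin> closure (sector th)"
proof -
 have c: "cos (Im w) = cos \<bar>Im w\<bar>" by (simp add: cos_abs_real)
 show ?thesis
 proof
  assume "exp w \<in> closure (sector th)"
  then have "exp (Re w) * cos th <= exp (Re w) * cos (Im w)"
   using closure_sector_bound[of th "exp w"] assms by (simp add: Re_exp)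
  then have "cos th <= cos (Im w)" by simp
  then have le: "cos th <= cos \<bar>Im w\<bar>" unfolding c .
  show False
  proof (cases "\<bar>Im w\<bar> <= pi")
   case True
   then have "cos \<bar>Im w\<bar> < cos th" using assms by (intro cos_monotone_0_pi) auto
   with le show False by simp
  next
   case False
   then have "cos (2 * pi - \<bar>Im w\<bar>) < cos th" using assms by (intro cos_monotone_0_pi) auto
   with le show False by (simp add: cos_2pi_minus)
  qed
 qed
qed

lemma exp_notin_sector:
 assumes "0 < th" "th < pi" "th <= \<bar>Im w\<bar>" "\<bar>Im w\<bar> <= 2 * pi - th"
 shows "exp w \<notin> sector th"
proof -
 have c: "cos (Im w) = cos \<bar>Im w\<bar>" by (simp add: cos_abs_real)
 show "exp w \<notin> sector th"
 proof
  assume "exp w \<in> sector th"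
  then have s: "exp w \<notin> \<real>\<^sub>\<le>\<^sub>0" "\<bar>Arg (exp w)\<bar> < th" using assms by (auto simp: sector_def)
  let ?a = "Arg (exp w)"
  have "cos ?a = cos (Im w)"
  proof -
   have "exp w = of_real (cmod (exp w)) * exp (\<i> * of_real ?a)" by (rule Arg_eq) simp
   then have "Re (exp w) = cmod (exp w) * cos ?a" by (metis Re_rcis cis_conv_exp rcis_def)
   then show ?thesis by (simp add: Re_exp)
  qed
  then have e: "cos \<bar>?a\<bar> = cos \<bar>Im w\<bar>" by simp
  have lt: "cos th < cos \<bar>?a\<bar>" using s assms by (intro cos_monotone_0_pi) auto
  have "cos \<bar>Im w\<bar> <= cos th"
  proof (cases "\<bar>Im w\<bar> <= pi")
   case True
   then show ?thesis using assms by (intro cos_monotone_0_pi_le) auto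
  next
   case False
   then have "cos (2 * pi - \<bar>Im w\<bar>) <= cos th" using assms by (intro cos_monotone_0_pi_le) auto
   then show ?thesis by (simp add: cos_2pi_minus)
  qed
  with lt e show False by simp
 qed
qed

text \<open>The resolvent set is open with quantitative control: a Neumann series argument, carried out
 with the contraction mapping theorem.\<close>

lemma resolvent_set_perturb:
 fixes A :: "'a::complex_banach \<rightharpoonup> 'a"
 assumes A: "linear_operator A" and z0: "z0 \<in> resolvent_set A"
  and K: "!!x. norm (resolvent A z0 x) <= K * norm x" and h: "cmod (z - z0) * K <= 1 / 2"
 shows "z \<in> resolvent_set A" "!!x. norm (resolvent A z x) <= 2 * K * norm x"
proof -
 let ?R = "resolvent A z0"
 interpret R: bounded_linear ?R by (rule resolvent_bounded_linear[OF z0])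
 have small: "norm ((z - z0) *\<^sub>C ?R x) <= 1 / 2 * norm x" for x
 proof -
  have "norm ((z - z0) *\<^sub>C ?R x) <= cmod (z - z0) * (K * norm x)"
   unfolding norm_scaleC by (intro mult_left_mono K) auto
  also have "... <= 1 / 2 * norm x" using mult_right_mono[OF h norm_ge_zero[of x]] by (simp add: mult.assoc)
  finally show ?thesis .
 qed
 have ex: "\<exists>y. y + (z - z0) *\<^sub>C ?R y = x" for x
 proof -
  have "\<exists>!y. x - (z - z0) *\<^sub>C ?R y = y"
  proof (rule banach_fix_type[of "1 / 2"])
   show "\<forall>u v. dist (x - (z - z0) *\<^sub>C ?R u) (x - (z - z0) *\<^sub>C ?R v) <= 1 / 2 * dist u v"
   proof (intro allI)
    fix u v
    have "(x - (z - z0) *\<^sub>C ?R u) - (x - (z - z0) *\<^sub>C ?R v) = (z - z0) *\<^sub>C ?R (v - u)"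
     by (simp add: R.diff scaleC.diff_right)
    then show "dist (x - (z - z0) *\<^sub>C ?R u) (x - (z - z0) *\<^sub>C ?R v) <= 1 / 2 * dist u v"
     unfolding dist_norm using small[of "v - u"] by (simp add: norm_minus_commute)
   qed
  qed auto
  then obtain y where "x - (z - z0) *\<^sub>C ?R y = y" by blast
  then have "y + (z - z0) *\<^sub>C ?R y = x" by (metis diff_add_cancel)
  then show ?thesis by blast
 qed
 have ident: "z *\<^sub>C ?R y - the (A (?R y)) = y + (z - z0) *\<^sub>C ?R y" for y
  using resolvent_right[OF z0, of y] by (simp add: scaleC.diff_left algebra_simps)
 have dom: "?R y \<in> dom A" for y by (rule resolvent_mem_dom[OF z0])
 let ?T = "%x. z *\<^sub>C x - the (A x)"
 have img: "?T ` dom A = UNIV"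
 proof (rule set_eqI)
  fix x
  obtain y where "y + (z - z0) *\<^sub>C ?R y = x" using ex by blast
  then have "?T (?R y) = x" by (simp add: ident)
  then show "x \<in> ?T ` dom A \<longleftrightarrow> x \<in> UNIV" using dom[of y] by blast
 qed
 have lower: "norm x <= 2 * K * norm (?T x)" if x: "x \<in> dom A" for x
 proof -
  define y where "y = z0 *\<^sub>C x - the (A x)"
  have xy: "x = ?R y" unfolding y_def by (rule resolvent_left[OF z0 x, symmetric])
  have "norm y <= norm (y + (z - z0) *\<^sub>C ?R y) + norm ((z - z0) *\<^sub>C ?R y)"
   using norm_triangle_ineq4[of "y + (z - z0) *\<^sub>C ?R y" "(z - z0) *\<^sub>C ?R y"] by simp
  then have "norm y <= 2 * norm (?T x)" using small[of y] unfolding xy ident by linarith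
  moreover have "norm x <= K * norm y" unfolding xy by (rule K)
  moreover have "0 <= K * norm y" using calculation(2) norm_ge_zero order_trans by blast
  ultimately show ?thesis
  proof (cases "K \<ge> 0")
   case True
   have "K * norm y <= K * (2 * norm (?T x))" by (rule mult_left_mono[OF \<open>norm y <= 2 * norm (?T x)\<close> True])
   with \<open>norm x <= K * norm y\<close> show ?thesis by simp
  next
   case False
   then have "norm y = 0" using \<open>0 <= K * norm y\<close> by (metis mult_less_0_iff norm_ge_zero not_le order_antisym_conv)
   then have "y = 0" by simp
   then have "x = 0" "?T x = 0" using xy ident[of y] by (auto simp: R.zero)
   then show ?thesis by simp
  qed
 qed
 have add: "x + y \<in> dom A" "the (A (x + y)) = the (A x) + the (A y)" if "x \<in> dom A" "y \<in> dom A" for x y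
  using A that unfolding linear_operator_def by blast+
 have scale: "c *\<^sub>C x \<in> dom A" "the (A (c *\<^sub>C x)) = c *\<^sub>C the (A x)" if "x \<in> dom A" for x c
  using A that unfolding linear_operator_def by blast+
 have inj: "inj_on ?T (dom A)"
 proof (rule inj_onI)
  fix x y assume xy: "x \<in> dom A" "y \<in> dom A" "?T x = ?T y"
  have m: "- 1 *\<^sub>C y = - y" by (simp add: scaleC.minus_left)
  have d: "x + (- 1) *\<^sub>C y \<in> dom A" "the (A (x + (- 1) *\<^sub>C y)) = the (A x) + (- 1) *\<^sub>C the (A y)"
   using add[OF xy(1) scale(1)[OF xy(2), of "- 1"]] scale(2)[OF xy(2), of "- 1"] by auto
  have "?T (x + (- 1) *\<^sub>C y) = ?T x - ?T y"
   unfolding d(2) by (simp add: scaleC.minus_left scaleC.diff_right scaleC_add_right scaleC.minus_right)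
  then have "norm (x + (- 1) *\<^sub>C y) <= 0" using lower[OF d(1)] xy(3) by simp
  then show "x = y" by (simp add: scaleC.minus_left)
 qed
 have bij: "bij_betw ?T (dom A) UNIV" using inj img by (simp add: bij_betw_def)
 let ?r = "resolvent A z"
 have rd: "?r x \<in> dom A" and rT: "?T (?r x) = x" for x
  unfolding resolvent_def using img inv_into_into[of x ?T "dom A"] f_inv_into_f[of x ?T "dom A"] by blast+
 have rT': "?r (?T x) = x" if "x \<in> dom A" for x
  unfolding resolvent_def by (rule inv_into_f_f[OF inj that])
 have nb: "norm (?r x) <= 2 * K * norm x" for x using lower[OF rd, of x] by (simp add: rT)
 have "bounded_linear ?r"
 proof (rule bounded_linear_intro[where K = "2 * K"])
  fix x y
  have "?T (?r x + ?r y) = x + y"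
   using rT[of x] rT[of y] by (simp add: add(2)[OF rd rd] scaleC_add_right algebra_simps)
  then show "?r (x + y) = ?r x + ?r y" using rT'[OF add(1)[OF rd[of x] rd[of y]]] by simp
 next
  fix c :: real and x
  have "?T (of_real c *\<^sub>C ?r x) = of_real c *\<^sub>C ?T (?r x)"
   by (simp add: scale(2)[OF rd] scaleC.diff_right scaleC_scaleC mult.commute)
  then have "?T (of_real c *\<^sub>C ?r x) = of_real c *\<^sub>C x" by (simp only: rT)
  then show "?r (c *\<^sub>R x) = c *\<^sub>R ?r x"
   using rT'[OF scale(1)[OF rd[of x], of "of_real c"]] by (simp add: scaleR_scaleC)
 next
  show "norm (?r x) <= norm x * (2 * K)" for x using nb[of x] by (simp add: mult.commute)
 qed
 then show "z \<in> resolvent_set A" using bij by (simp add: resolvent_set_def)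
 show "norm (resolvent A z x) <= 2 * K * norm x" for x by (rule nb)
qed

text \<open>The chord from a point of the unit circle to \<open>- 1\<close> is at most the
  corresponding arc.\<close>

lemma cmod_exp_i_plus_one: "cmod (exp (\<i> * of_real t) + 1) <= \<bar>\<bar>t\<bar> - pi\<bar>"
proof -
 have *: "cmod (exp (\<i> * of_real t) + 1) <= \<bar>t - pi\<bar>" for t
 proof -
  have "exp (\<i> * of_real t) = - exp (\<i> * of_real (t - pi))"
   by (simp add: exp_diff right_diff_distrib mult.commute)
  then have "cmod (exp (\<i> * of_real t) + 1) = cmod (exp (\<i> * of_real (t - pi)) - 1)"
   by (metis add.commute diff_conv_add_uminus norm_minus_commute)
  also have "... = 2 * \<bar>sin ((t - pi) / 2)\<bar>" by (rule dist_exp_i_1)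
  also have "... <= \<bar>t - pi\<bar>" using abs_sin_x_le_abs_x[of "(t - pi) / 2"] by simp
  finally show ?thesis .
 qed
 show ?thesis
 proof (cases "t \<ge> 0")
  case False
  have "exp (\<i> * of_real t) = cnj (exp (\<i> * of_real (- t)))" by (simp add: exp_cnj)
  then have "cmod (exp (\<i> * of_real t) + 1) = cmod (cnj (exp (\<i> * of_real (- t)) + 1))" by simp
  also have "... = cmod (exp (\<i> * of_real (- t)) + 1)" by (rule complex_mod_cnj)
  finally show ?thesis using *[of "- t"] False by simp
 qed (use * in simp)
qed

lemma norm_le_onorm_bound:
 assumes "bounded_linear f" "onorm f <= B"
 shows "norm (f x) <= B * norm x"
 using onorm[OF assms(1), of x] mult_right_mono[OF assms(2) norm_ge_zero[of x]] by linarith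

lemma sector_mono: "0 < th ==> th <= th' ==> sector th \<subseteq> sector th'"
 by (auto simp: sector_def)

text \<open>The hypothesis controls the resolvent on the negative half-axis only, by
  \<open>B / l\<close> at \<open>- l\<close>. A nonzero \<open>z\<close> outside the sector of angle
  \<open>pi - de\<close> is within \<open>de * cmod z\<close> of \<open>- cmod z\<close>, and
  \<open>de * B <= 1 / 2\<close> is exactly what the perturbation lemma asks for.\<close>

lemma sectorial_angle_set_nonempty:
 fixes A :: "'a::complex_banach \<rightharpoonup> 'a"
 assumes A: "sectorial A"
 shows "{th. 0 <= th \<and> th < pi \<and> spectrum A \<subseteq> closure (sector th) \<and>
   (\<forall>ph. th < ph \<and> ph < pi \<longrightarrow>
    bdd_above ((%z. onorm (%x. z *\<^sub>C resolvent A z x)) ` (- sector ph - {0})))} ~= {}" (is "?S ~= {}")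
proof -
 have lin: "linear_operator A" using A unfolding sectorial_def by (rule conjunct1)
 have sub: "cr ` {..<0} \<subseteq> resolvent_set A"
  using A unfolding sectorial_def by (elim conjE)
 have bdd: "bdd_above ((%l. onorm (%x. - (cr l *\<^sub>C resolvent A (- cr l) x))) ` {0<..})"
  using A unfolding sectorial_def by (elim conjE)
 have neg: "- cr l \<in> resolvent_set A" if "l > 0" for l :: real
 proof -
  have "- l \<in> {..<0}" using that by simp
  then have "cr (- l) \<in> resolvent_set A" by (rule subsetD[OF sub imageI])
  then show ?thesis by simp
 qed
 obtain B0 where B0: "!!l. l > 0 ==> onorm (%x. - (cr l *\<^sub>C resolvent A (- cr l) x)) <= B0"
  using bdd unfolding bdd_above_def by auto
 define B where "B = max B0 1"
 have B: "B > 0" "B0 <= B" by (auto simp: B_def)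
 have bnd: "norm (resolvent A (- cr l) x) <= B / l * norm x" if l: "l > 0" for l x
 proof -
  have "bounded_linear (%x. - (cr l *\<^sub>C resolvent A (- cr l) x))"
   by (intro bounded_linear_minus bounded_linear_compose[OF scaleC.bounded_linear_right] resolvent_bounded_linear neg l)
  from norm_le_onorm_bound[OF this order_trans[OF B0[OF l] B(2)], of x]
  show ?thesis using l by (simp add: norm_scaleC field_simps)
 qed
 define de where "de = min (1 / (2 * B)) 1"
 have de: "0 < de" "de <= 1" "de * B <= 1 / 2"
 proof -
  show "0 < de" "de <= 1" using B by (auto simp: de_def)
  have "de * B <= 1 / (2 * B) * B" using B by (intro mult_right_mono) (auto simp: de_def)
  then show "de * B <= 1 / 2" using B by simp
 qed
 define th where "th = pi - de"
 have th: "0 < th" "th < pi" using de pi_gt3 by (auto simp: th_def)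
 have key: "z \<in> resolvent_set A" "norm (z *\<^sub>C resolvent A z x) <= 2 * B * norm x" if z: "z \<notin> sector th" "z ~= 0" for z x
 proof -
  let ?l = "cmod z"
  have l: "?l > 0" using z by simp
  have "\<bar>Arg z\<bar> \<ge> th"
  proof (cases "z \<in> \<real>\<^sub>\<le>\<^sub>0")
   case True
   then have "Re z < 0" "Im z = 0" using z by (auto simp: complex_nonpos_Reals_iff complex_eq_iff)
   then have "Arg z = pi" by (simp add: Arg_eq_pi)
   then show ?thesis using th by simp
  next
   case False
   then show ?thesis using z th by (auto simp: sector_def)
  qed
  then have a: "\<bar>\<bar>Arg z\<bar> - pi\<bar> <= de" using Arg_bounded[of z] by (auto simp: th_def)
  have "z - (- cr ?l) = of_real ?l * (exp (\<i> * of_real (Arg z)) + 1)"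
   using Arg_eq[OF z(2)] by (simp add: distrib_left)
  then have "cmod (z - (- cr ?l)) = ?l * cmod (exp (\<i> * of_real (Arg z)) + 1)"
   by (simp only: norm_mult norm_of_real) simp
  also have "... <= ?l * de" using cmod_exp_i_plus_one[of "Arg z"] a by (intro mult_left_mono) auto
  finally have "cmod (z - (- cr ?l)) * (B / ?l) <= (?l * de) * (B / ?l)"
   using B l by (intro mult_right_mono) auto
  also have "... <= 1 / 2" using de(3) l by simp
  finally have h: "cmod (z - (- cr ?l)) * (B / ?l) <= 1 / 2" .
  show "z \<in> resolvent_set A" by (rule resolvent_set_perturb(1)[OF lin neg[OF l] bnd[OF l] h])
  have "norm (resolvent A z x) <= 2 * (B / ?l) * norm x" by (rule resolvent_set_perturb(2)[OF lin neg[OF l] bnd[OF l] h])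
  then have "?l * norm (resolvent A z x) <= ?l * (2 * (B / ?l) * norm x)" using l by (intro mult_left_mono) auto
  then show "norm (z *\<^sub>C resolvent A z x) <= 2 * B * norm x" using z by (simp add: norm_scaleC)
 qed
 have "th \<in> ?S"
 proof (intro CollectI conjI allI impI)
  have "0 \<in> closure (sector th)"
   unfolding closure_approachable
  proof (intro allI impI)
   fix e :: real assume "e > 0"
   then have "cr (e / 2) \<notin> \<real>\<^sub>\<le>\<^sub>0" "Arg (cr (e / 2)) = 0"
    by (simp add: complex_nonpos_Reals_iff, subst Arg_of_real, simp)
   then have "cr (e / 2) \<in> sector th" using th unfolding sector_def by simp
   then show "\<exists>y\<in>sector th. dist y 0 < e" using \<open>e > 0\<close> by (intro bexI[of _ "cr (e / 2)"]) auto
  qed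
  moreover have "z \<in> sector th" if "z \<in> spectrum A" "z ~= 0" for z
   using key(1)[of z] that by (auto simp: spectrum_def)
  ultimately show "spectrum A \<subseteq> closure (sector th)" using closure_subset by blast
  fix ph assume ph: "th < ph \<and> ph < pi"
  show "bdd_above ((%z. onorm (%x. z *\<^sub>C resolvent A z x)) ` (- sector ph - {0}))"
  proof (rule bdd_aboveI2[of _ _ "2 * B"])
   fix z assume "z \<in> - sector ph - {0}"
   then have "z \<notin> sector th" "z ~= 0" using sector_mono[of th ph] th ph by auto
   then show "onorm (%x. z *\<^sub>C resolvent A z x) <= 2 * B" using B by (intro onorm_bound key(2)) auto
  qed
 qed (use th in auto)
 then show ?thesis by blast
qed

lemma sectoriality_angle_less_pi:
 fixes A :: "'a::complex_banach \<rightharpoonup> 'a"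
 assumes "sectorial A"
 shows "sectoriality_angle A < pi"
proof -
 let ?S = "{th. 0 <= th \<and> th < pi \<and> spectrum A \<subseteq> closure (sector th) \<and>
   (\<forall>ph. th < ph \<and> ph < pi \<longrightarrow>
    bdd_above ((%z. onorm (%x. z *\<^sub>C resolvent A z x)) ` (- sector ph - {0})))}"
 obtain th where th: "th \<in> ?S" using sectorial_angle_set_nonempty[OF assms] by blast
 have "sectoriality_angle A <= th"
  unfolding sectoriality_angle_def using th by (rule cInf_lower) (rule bdd_belowI[of _ 0], simp)
 then show ?thesis using th by simp
qed

lemma sector_calculus_exists:
 fixes A :: "'a::complex_banach \<rightharpoonup> 'a"
 assumes A: "sectorial A" "densely_defined A" and ph: "sectoriality_angle A < ph" "ph < pi"
 obtains ph0 M where "sector_calculus A ph0 M ph"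
proof -
 let ?S = "{th. 0 <= th \<and> th < pi \<and> spectrum A \<subseteq> closure (sector th) \<and>
   (\<forall>ph. th < ph \<and> ph < pi \<longrightarrow>
    bdd_above ((%z. onorm (%x. z *\<^sub>C resolvent A z x)) ` (- sector ph - {0})))}"
 obtain th where th: "th \<in> ?S" "th < ph"
  using cInf_lessD[OF sectorial_angle_set_nonempty[OF A(1)] ph(1)[unfolded sectoriality_angle_def]] by (elim bexE)
 \<comment> \<open>Strictly between \<open>th\<close> and \<open>ph\<close>: resolvent bounds are
   available only at angles above \<open>th\<close>, and the contour has to lie strictly outside the
   sector of angle \<open>ph0\<close>.\<close>
 define ph0 where "ph0 = (th + ph) / 2"
 have p: "th < ph0" "ph0 < ph" "0 <= th" "th < pi" "0 < ph0" "ph0 < pi"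
  using th(2) ph conjunct1[OF CollectD[OF th(1)]] conjunct1[OF conjunct2[OF CollectD[OF th(1)]]] by (simp_all add: ph0_def)
 have "bdd_above ((%z. onorm (%x. z *\<^sub>C resolvent A z x)) ` (- sector ph0 - {0}))"
  using p by (intro conjunct2[OF conjunct2[OF conjunct2[OF CollectD[OF th(1)]]], THEN spec, THEN mp]) auto
 then obtain B where B: "!!z. z \<in> - sector ph0 - {0} ==> onorm (%x. z *\<^sub>C resolvent A z x) <= B"
  unfolding bdd_above_def by auto
 define M where "M = max B 1"
 have lin: "linear_operator A" using A(1) unfolding sectorial_def by (rule conjunct1)
 have rs: "exp w \<in> resolvent_set A" if "ph0 <= \<bar>Im w\<bar>" "\<bar>Im w\<bar> <= 2 * pi - ph0" for w
 proof -
  have "exp w \<notin> closure (sector th)" by (rule exp_notin_closure_sector) (use that p in auto)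
  moreover have "spectrum A \<subseteq> closure (sector th)" using th(1) by simp
  ultimately show ?thesis unfolding spectrum_def by blast
 qed
 have "sector_calculus A ph0 M ph"
 proof
  show "norm (exp w *\<^sub>C resolvent A (exp w) x) <= M * norm x" if "ph0 <= \<bar>Im w\<bar>" "\<bar>Im w\<bar> <= 2 * pi - ph0" for w x
  proof (rule norm_le_onorm_bound)
   show "bounded_linear (%x. exp w *\<^sub>C resolvent A (exp w) x)"
    by (intro bounded_linear_compose[OF scaleC.bounded_linear_right] resolvent_bounded_linear rs that)
   have "exp w \<in> - sector ph0 - {0}" using exp_notin_sector[of ph0 w] that p by auto
   from order_trans[OF B[OF this]] show "onorm (%x. exp w *\<^sub>C resolvent A (exp w) x) <= M" by (simp add: M_def)
  qed
 qed (use lin A p ph rs in \<open>auto simp: M_def\<close>)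
 then show thesis by (rule that)
qed

section \<open>Explicit test functions and their action on the weak equation\<close>

definition flat :: "nat => real => real" where
 "flat p x = (if x > 0 then exp (- 1 / x) / x ^ p else 0)"

lemma flat_tendsto_0: "(flat p \<longlongrightarrow> 0) (at 0)"
proof -
 have "((%x::real. exp (- 1 / x) / x ^ p) \<longlongrightarrow> 0) (at_right 0)" by real_asymp
 then have "(flat p \<longlongrightarrow> 0) (at_right 0)"
  by (rule Lim_transform_eventually) (auto simp: flat_def eventually_at_right_less eventually_at_filter)
 moreover have "(flat p \<longlongrightarrow> 0) (at_left 0)"
  by (rule Lim_transform_eventually[OF tendsto_const]) (auto simp: flat_def eventually_at_filter)
 ultimately show ?thesis by (simp add: filterlim_split_at)
qed

text \<open>The pole order is a parameter because differentiation raises it, which keeps the family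
  closed. At the origin the difference quotient of \<open>flat p\<close> is
  \<open>flat (p + 1)\<close>, which tends to 0.\<close>

lemma flat_deriv: "(flat p has_real_derivative (flat (p + 2) x - real p * flat (p + 1) x)) (at x)"
proof -
 consider "x > 0" | "x < 0" | "x = 0" by linarith
 then show ?thesis
 proof cases
  case 1
  have "((%x. exp (- 1 / x) / x ^ p) has_real_derivative (flat (p + 2) x - real p * flat (p + 1) x)) (at x)"
  proof (cases p)
   case 0
   show ?thesis using 1 by (auto intro!: derivative_eq_intros simp: flat_def 0 power2_eq_square)
  next
   case (Suc k)
   show ?thesis using 1
    by (auto intro!: derivative_eq_intros simp: flat_def Suc power2_eq_square divide_simps power_add)
     (cases k; auto simp: algebra_simps power2_eq_square)
  qed
  then show ?thesis
   by (rule has_field_derivative_transform_within_open[where S = "{0<..}"]) (use 1 in \<open>auto simp: flat_def\<close>)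
 next
  case 2
  have "((%x. 0) has_real_derivative (flat (p + 2) x - real p * flat (p + 1) x)) (at x)"
   using 2 by (simp add: flat_def)
  then show ?thesis
   by (rule has_field_derivative_transform_within_open[where S = "{..<0}"]) (use 2 in \<open>auto simp: flat_def\<close>)
 next
  case 3
  have "((%y. (flat p y - flat p 0) / (y - 0)) \<longlongrightarrow> 0) (at 0)"
   by (rule Lim_transform_eventually[OF flat_tendsto_0[of "p + 1"]])
    (auto simp: flat_def eventually_at_filter)
  then show ?thesis using 3 by (simp add: has_field_derivative_iff flat_def)
 qed
qed

definition bump :: "nat => nat => real => real" where
 "bump p q x = flat p (1 - x) * flat q (1 + x)"

lemma bump_outside: "\<bar>x\<bar> \<ge> 1 ==> bump p q x = 0"
 by (auto simp: bump_def flat_def abs_le_iff)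

lemma bump_nonneg: "0 <= bump p q x"
 by (auto simp: bump_def flat_def)

lemma bump_0_pos: "bump p q 0 > 0"
 by (simp add: bump_def flat_def)

definition bump' :: "nat => nat => real => real" where
 "bump' p q x = real p * bump (p + 1) q x - bump (p + 2) q x + bump p (q + 2) x - real q * bump p (q + 1) x"

lemma bump_deriv: "(bump p q has_real_derivative bump' p q x) (at x)"
proof -
 have "((%x. flat p (1 - x)) has_real_derivative (flat (p + 2) (1 - x) - real p * flat (p + 1) (1 - x)) * (- 1)) (at x)"
  by (rule DERIV_chain2[OF flat_deriv]) (auto intro!: derivative_eq_intros)
 moreover have "((%x. flat q (1 + x)) has_real_derivative (flat (q + 2) (1 + x) - real q * flat (q + 1) (1 + x)) * 1) (at x)"
  by (rule DERIV_chain2[OF flat_deriv]) (auto intro!: derivative_eq_intros)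
 ultimately have "((%x. flat p (1 - x) * flat q (1 + x)) has_real_derivative bump' p q x) (at x)"
  by (rule DERIV_cong[OF DERIV_mult]) (simp add: bump'_def bump_def algebra_simps)
 then show ?thesis by (simp add: bump_def[abs_def])
qed

text \<open>The span of these functions is closed under differentiation, so its members are smooth.
 The factor is a bump in the logarithmic variable around \<open>ta\<close> of width \<open>ep\<close>.\<close>

definition log_bump :: "real => real => int => nat => nat => real => real" where
 "log_bump ta ep k p q t = (if t > 0 then t powi k * bump p q ((ta - ln t) / ep) else 0)"

inductive_set log_bump_span :: "real => real => (real => real) set" for ta ep where
 base: "log_bump ta ep k p q \<in> log_bump_span ta ep"
| add: "f \<in> log_bump_span ta ep ==> g \<in> log_bump_span ta ep ==> (%t. f t + g t) \<in> log_bump_span ta ep"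
| scale: "f \<in> log_bump_span ta ep ==> (%t. c * f t) \<in> log_bump_span ta ep"

lemma log_bump_outside:
 assumes "ep > 0" "t \<notin> {exp (ta - ep)..exp (ta + ep)}"
 shows "log_bump ta ep k p q t = 0"
proof (cases "t > 0")
 case True
 from assms(2) consider "t < exp (ta - ep)" | "t > exp (ta + ep)" by fastforce
 then have "\<bar>(ta - ln t) / ep\<bar> \<ge> 1"
 proof cases
  case 1
  then have "ln t < ta - ep" using True by (metis exp_ln exp_less_cancel_iff)
  then show ?thesis using assms(1) by (simp add: abs_if field_simps)
 next
  case 2
  then have "ln t > ta + ep" using True by (metis exp_ln exp_less_cancel_iff)
  then show ?thesis using assms(1) by (simp add: abs_if field_simps)
 qed
 then show ?thesis by (simp add: log_bump_def bump_outside)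
qed (simp add: log_bump_def)

lemma log_bump_deriv:
 assumes ep: "ep > 0" and t: "t > 0"
 shows "(log_bump ta ep k p q has_real_derivative
  (of_int k * (t powi (k - 1) * bump p q ((ta - ln t) / ep))
   - (1 / ep) * (t powi (k - 1) * bump' p q ((ta - ln t) / ep)))) (at t)"
proof -
 have 1: "((%t. bump p q ((ta - ln t) / ep)) has_real_derivative bump' p q ((ta - ln t) / ep) * (- (1 / t) / ep)) (at t)"
  by (rule DERIV_chain2[OF bump_deriv]) (use t ep in \<open>auto intro!: derivative_eq_intros simp: divide_simps\<close>)
 have 2: "((%t. t powi k) has_real_derivative of_int k * t powi (k - 1)) (at t)"
  using t by (auto intro!: derivative_eq_intros)
 have p: "t powi k * (1 / t) = t powi (k - 1)" using t by (simp add: power_int_diff)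
 have "((%t. t powi k * bump p q ((ta - ln t) / ep)) has_real_derivative
  (of_int k * (t powi (k - 1) * bump p q ((ta - ln t) / ep))
   - (1 / ep) * (t powi (k - 1) * bump' p q ((ta - ln t) / ep)))) (at t)"
  by (rule DERIV_cong[OF DERIV_mult[OF 2 1]]) (simp add: p[symmetric] algebra_simps)
 then show ?thesis
  by (rule has_field_derivative_transform_within_open[where S = "{0<..}"]) (use t in \<open>auto simp: log_bump_def\<close>)
qed

lemma log_bump_span_deriv:
 assumes ep: "ep > 0" and f: "f \<in> log_bump_span ta ep"
 shows "\<exists>f'\<in>log_bump_span ta ep. \<forall>t. (f has_real_derivative f' t) (at t)"
 using f
proof induction
 case (base k p q)
 let ?B = "%p q. log_bump ta ep (k - 1) p q"
 let ?f' = "%t. of_int k * ?B p q t + (- 1 / ep) * (real p * ?B (p + 1) q t + ((- 1) * ?B (p + 2) q t + (?B p (q + 2) t + (- real q) * ?B p (q + 1) t)))"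
 have mem: "?f' \<in> log_bump_span ta ep" by (intro log_bump_span.intros)
 have "(log_bump ta ep k p q has_real_derivative ?f' t) (at t)" for t
 proof (cases "t > 0")
  case True
  show ?thesis
   by (rule DERIV_cong[OF log_bump_deriv[OF ep True]])
    (use True in \<open>simp add: log_bump_def bump'_def algebra_simps diff_divide_distrib add_divide_distrib\<close>)
 next
  case False
  have "((%_. 0) has_real_derivative ?f' t) (at t)" using False by (simp add: log_bump_def)
  then show ?thesis
  proof (rule has_field_derivative_transform_within_open[where S = "{..<exp (ta - ep)}"])
   show "t \<in> {..<exp (ta - ep)}" using False exp_gt_zero[of "ta - ep"] by (simp del: exp_gt_zero)
   show "0 = log_bump ta ep k p q x" if "x \<in> {..<exp (ta - ep)}" for x
    using log_bump_outside[OF ep, of x ta] that by auto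
  qed auto
 qed
 then show ?case by (intro bexI[OF _ mem] allI)
next
 case (add f g)
 then obtain f' g' where *: "f' \<in> log_bump_span ta ep" "\<forall>t. (f has_real_derivative f' t) (at t)"
  "g' \<in> log_bump_span ta ep" "\<forall>t. (g has_real_derivative g' t) (at t)" by blast
 show ?case
  by (rule bexI[OF _ log_bump_span.add[OF *(1,3)]]) (use *(2,4) in \<open>auto intro: DERIV_add\<close>)
next
 case (scale f c)
 then obtain f' where *: "f' \<in> log_bump_span ta ep" "\<forall>t. (f has_real_derivative f' t) (at t)" by blast
 show ?case
  by (rule bexI[OF _ log_bump_span.scale[OF *(1), of c]]) (use *(2) in \<open>auto intro: DERIV_cmult\<close>)
qed

lemma of_real_vector_derivative:
 "(f has_real_derivative d) (at t) ==> ((%t. cr (f t)) hvd of_real d) (at t)"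
 using has_vector_derivative_of_real[of f d "at t"] by (simp add: has_real_derivative_iff_has_vector_derivative)

lemma log_bump_iterates:
 assumes ep: "ep > 0" and f: "f \<in> log_bump_span ta ep"
 shows "\<exists>g\<in>log_bump_span ta ep. ((%f t. vector_derivative f (at t)) ^^ n) (%t. cr (f t)) = (%t. of_real (g t))"
proof (induction n)
 case 0
 then show ?case using f by auto
next
 case (Suc n)
 then obtain g where g: "g \<in> log_bump_span ta ep"
  "((%f t. vector_derivative f (at t)) ^^ n) (%t. cr (f t)) = (%t. of_real (g t))" by blast
 obtain g' where g': "g' \<in> log_bump_span ta ep" "!!t. (g has_real_derivative g' t) (at t)"
  using log_bump_span_deriv[OF ep g(1)] by blast
 have "vector_derivative (%t. cr (g t)) (at t) = of_real (g' t)" for t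
  by (rule vector_derivative_at[OF of_real_vector_derivative[OF g'(2)]])
 then show ?case using g g'(1) by auto
qed

lemma test_function_log_bump:
 assumes ep: "ep > 0"
 shows "test_function (%t. cr (log_bump ta ep k p q t))"
 unfolding test_function_def
proof (intro conjI allI)
 fix n
 obtain g where g: "g \<in> log_bump_span ta ep"
  "((%f t. vector_derivative f (at t)) ^^ n) (%t. cr (log_bump ta ep k p q t)) = (%t. of_real (g t))"
  using log_bump_iterates[OF ep log_bump_span.base] by blast
 obtain g' where g': "!!t. (g has_real_derivative g' t) (at t)"
  using log_bump_span_deriv[OF ep g(1)] by blast
 show "((%f t. vector_derivative f (at t)) ^^ n) (%t. cr (log_bump ta ep k p q t)) differentiable_on UNIV"
  unfolding g(2) differentiable_on_def
  using of_real_vector_derivative[OF g'] by (auto simp: has_vector_derivative_def differentiable_def)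
next
 let ?S = "{t. cr (log_bump ta ep k p q t) ~= 0}"
 have "closure ?S \<subseteq> {exp (ta - ep)..exp (ta + ep)}"
 proof (rule closure_minimal)
  show "?S \<subseteq> {exp (ta - ep)..exp (ta + ep)}"
  proof
   fix t assume "t \<in> ?S"
   then show "t \<in> {exp (ta - ep)..exp (ta + ep)}"
    using log_bump_outside[OF ep, of t ta k p q] by (cases "t \<in> {exp (ta - ep)..exp (ta + ep)}") simp_all
  qed
 qed simp
 moreover have "{exp (ta - ep)..exp (ta + ep)} \<subseteq> {0<..}" by (auto intro: less_le_trans[OF exp_gt_zero])
 ultimately show "compact (closure ?S)" "closure ?S \<subseteq> {0<..}"
  using bounded_subset[OF bounded_closed_interval, of "closure ?S"] by (auto simp only: compact_eq_bounded_closed closed_closure)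
qed

text \<open>The profile of the mollifier; \<open>et1\<close> and \<open>et2\<close> are its first
  two derivatives. The form of \<open>et2\<close> comes from
  \<open>et1 x = bump 0 2 x - bump 2 0 x\<close>.\<close>

definition et0 :: "real => real" where "et0 = bump 0 0"
definition et1 :: "real => real" where "et1 = bump' 0 0"
definition et2 :: "real => real" where "et2 x = bump' 0 2 x - bump' 2 0 x"

lemma et0_deriv: "(et0 has_real_derivative et1 x) (at x)"
 unfolding et0_def et1_def by (rule bump_deriv)

lemma et1_eq: "et1 x = bump 0 2 x - bump 2 0 x"
 by (simp add: et1_def bump'_def numeral_2_eq_2)

lemma et1_deriv: "(et1 has_real_derivative et2 x) (at x)"
 unfolding et1_eq[abs_def] et2_def by (intro DERIV_diff bump_deriv)

lemma et_continuous: "continuous_on S et0" "continuous_on S et1" "continuous_on S et2"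
proof -
 have b: "continuous_on S (bump p q)" for p q
  by (rule DERIV_continuous_on[of S "bump p q" "bump' p q"], rule has_field_derivative_at_within, rule bump_deriv)
 show "continuous_on S et0" unfolding et0_def by (rule b)
 show "continuous_on S et1" unfolding et1_eq[abs_def] by (intro continuous_intros b)
 show "continuous_on S et2" unfolding et2_def[abs_def] bump'_def by (intro continuous_intros b)
qed

lemma et_outside: "\<bar>x\<bar> \<ge> 1 ==> et0 x = 0" "\<bar>x\<bar> \<ge> 1 ==> et1 x = 0" "\<bar>x\<bar> \<ge> 1 ==> et2 x = 0"
 by (simp_all add: et0_def et1_def et2_def bump'_def bump_outside)

text \<open>The exponent 1 in \<open>log_bump ta ep 1 0 0\<close> supplies a factor \<open>t\<close>
  that makes the adjoint operator, apart from \<open>1 / t\<close>, equal to the second minus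
  \<open>2 * al\<close> times the first \<open>ta\<close>-derivative of the mollifier
  \<open>et0 ((ta - ln t) / ep)\<close>. The remaining \<open>1 / t\<close> is cancelled by the
  Jacobian of \<open>t = exp sg\<close>.\<close>

lemma et0_test_derivs:
 fixes ta ep t :: real
 defines "ph \<equiv> %t. cr (log_bump ta ep 1 0 0 t)"
 assumes ep: "ep > 0" and t: "t > 0"
 shows "vector_derivative (%s. vector_derivative ph (at s)) (at t) - vector_derivative (%s. (1 - 2 * al) / of_real s * ph s) (at t)
  = (1 / of_real t) * (of_real (et2 ((ta - ln t) / ep) / ep\<^sup>2) - 2 * al * of_real (et1 ((ta - ln t) / ep) / ep))"
proof -
 let ?x = "%t. (ta - ln t) / ep"
 have x: "(?x has_real_derivative (- (1 / t) / ep)) (at t)" if "t > 0" for t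
  using that ep by (auto intro!: derivative_eq_intros simp: divide_simps)
 have d1: "vector_derivative ph (at s) = of_real (et0 (?x s) - et1 (?x s) / ep)" if "s > 0" for s
 proof -
  have "(log_bump ta ep 1 0 0 has_real_derivative (et0 (?x s) - et1 (?x s) / ep)) (at s)"
   by (rule DERIV_cong[OF log_bump_deriv[OF ep that]]) (use that in \<open>simp add: et0_def et1_def\<close>)
  from vector_derivative_at[OF of_real_vector_derivative[OF this]] show ?thesis by (simp add: ph_def)
 qed
 have "((%t. et0 (?x t) - et1 (?x t) / ep) has_real_derivative (et1 (?x t) * (- (1 / t) / ep) - et2 (?x t) * (- (1 / t) / ep) / ep)) (at t)"
  by (intro DERIV_diff DERIV_cdivide DERIV_chain2[OF et0_deriv x[OF t]] DERIV_chain2[OF et1_deriv x[OF t]])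
 from of_real_vector_derivative[OF this]
 have "((%s. vector_derivative ph (at s)) hvd
  of_real (et1 (?x t) * (- (1 / t) / ep) - et2 (?x t) * (- (1 / t) / ep) / ep)) (at t)"
  by (rule has_vector_derivative_transform_within_open[where S = "{0<..}"]) (use t d1 in auto)
 from vector_derivative_at[OF this]
 have d2: "vector_derivative (%s. vector_derivative ph (at s)) (at t) = of_real (et1 (?x t) * (- (1 / t) / ep) - et2 (?x t) * (- (1 / t) / ep) / ep)" .
 have "((%t. (1 - 2 * al) * cr (et0 (?x t))) hvd (1 - 2 * al) * of_real (et1 (?x t) * (- (1 / t) / ep))) (at t)"
  by (intro has_vector_derivative_mult_right of_real_vector_derivative DERIV_chain2[OF et0_deriv x[OF t]])
 then have "((%s. (1 - 2 * al) / of_real s * ph s) hvd (1 - 2 * al) * of_real (et1 (?x t) * (- (1 / t) / ep))) (at t)"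
  by (rule has_vector_derivative_transform_within_open[where S = "{0<..}"]) (use t in \<open>auto simp: ph_def log_bump_def et0_def\<close>)
 from vector_derivative_at[OF this]
 have d3: "vector_derivative (%s. (1 - 2 * al) / of_real s * ph s) (at t) = (1 - 2 * al) * of_real (et1 (?x t) * (- (1 / t) / ep))" .
 have "cr t ~= 0" "cr ep ~= 0" using t ep by auto
 then show ?thesis unfolding d2 d3 of_real_mult of_real_diff of_real_divide of_real_minus of_real_1 of_real_power power2_eq_square
  by (simp add: field_simps)
qed

text \<open>Testing with the bump centred at \<open>ta\<close> amounts to mollifying at
  \<open>ta\<close>. In the logarithmic variable the equation reads
  \<open>d'' - 2 * al * d' = g\<close> with \<open>g\<close> the right-hand side times
  \<open>exp (2 * sg)\<close>.\<close>

lemma weak_log_form: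
 fixes d f :: "real => 'a::complex_banach"
 assumes d: "continuous_on {0<..} d" and f: "continuous_on {0<..} f"
  and weak: "!!ph. test_function ph ==>
   integral {0<..} (%t. vector_derivative (%s. vector_derivative ph (at s)) (at t) *\<^sub>C d t
     - vector_derivative (%s. (1 - 2 * al) / of_real s * ph s) (at t) *\<^sub>C d t)
   = integral {0<..} (%t. ph t *\<^sub>C f t)"
  and ep: "ep > 0"
 shows "integral {ta - ep..ta + ep} (%sg. (of_real (et2 ((ta - sg) / ep) / ep\<^sup>2) - 2 * al * of_real (et1 ((ta - sg) / ep) / ep)) *\<^sub>C d (exp sg))
  = integral {ta - ep..ta + ep} (%sg. et0 ((ta - sg) / ep) *\<^sub>R (exp (2 * sg) *\<^sub>R f (exp sg)))"
proof -
 let ?ph = "%t. cr (log_bump ta ep 1 0 0 t)"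
 let ?x = "%t. (ta - ln t) / ep"
 let ?I = "{exp (ta - ep)..exp (ta + ep)}"
 have Isub: "?I \<subseteq> {0<..}" by (auto intro: less_le_trans[OF exp_gt_zero])
 have out: "\<bar>?x t\<bar> \<ge> 1" if "t > 0" "t \<notin> ?I" for t
 proof -
  from that(2) consider "t < exp (ta - ep)" | "t > exp (ta + ep)" by fastforce
  then show ?thesis
  proof cases
   case 1
   then have "ln t < ta - ep" using that by (metis exp_ln exp_less_cancel_iff)
   then show ?thesis using ep by (simp add: abs_if field_simps)
  next
   case 2
   then have "ln t > ta + ep" using that by (metis exp_ln exp_less_cancel_iff)
   then show ?thesis using ep by (simp add: abs_if field_simps)
  qed
 qed
 let ?k = "%t. (1 / of_real t) * (of_real (et2 (?x t) / ep\<^sup>2) - 2 * al * of_real (et1 (?x t) / ep)) :: complex"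
 let ?l = "%t. t * et0 (?x t)"
 have restrict: "integral {0<..} F = integral ?I F" if "!!t. t > 0 ==> t \<notin> ?I ==> F t = 0" for F :: "real => 'a"
 proof (rule integral_spike_set)
  have "{t \<in> {0<..} - ?I. F t ~= 0} = {}" using that by auto
  then show "negligible {t \<in> {0<..} - ?I. F t ~= 0}" by (simp only: negligible_empty)
  have "{t \<in> ?I - {0<..}. F t ~= 0} = {}" using Isub by blast
  then show "negligible {t \<in> ?I - {0<..}. F t ~= 0}" by (simp only: negligible_empty)
 qed
 have ck: "continuous_on {0<..} ?k" "continuous_on {0<..} ?l"
  using ep by (auto intro!: continuous_intros continuous_on_compose2[OF et_continuous(1)[of UNIV]]
    continuous_on_compose2[OF et_continuous(2)[of UNIV]] continuous_on_compose2[OF et_continuous(3)[of UNIV]])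
 have "integral {0<..} (%t. vector_derivative (%s. vector_derivative ?ph (at s)) (at t) *\<^sub>C d t
     - vector_derivative (%s. (1 - 2 * al) / of_real s * ?ph s) (at t) *\<^sub>C d t) = integral {0<..} (%t. ?k t *\<^sub>C d t)"
  by (rule integral_cong) (simp only: scaleC.diff_left[symmetric] et0_test_derivs[OF ep] greaterThan_iff)
 also have "... = integral ?I (%t. ?k t *\<^sub>C d t)"
  by (rule restrict) (simp add: et_outside[OF out])
 also have "... = integral {ta - ep..ta + ep} (%sg. exp sg *\<^sub>R (?k (exp sg) *\<^sub>C d (exp sg)))"
  using ep by (intro integral_exp_subst_Icc continuous_on_subset[OF _ Isub] continuous_on_scaleC ck d) auto
 also have "... = integral {ta - ep..ta + ep} (%sg. (of_real (et2 ((ta - sg) / ep) / ep\<^sup>2) - 2 * al * of_real (et1 ((ta - sg) / ep) / ep)) *\<^sub>C d (exp sg))"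
 proof (rule integral_cong)
  fix sg
  have "cr (exp sg) ~= 0" by simp
  then show "exp sg *\<^sub>R (?k (exp sg) *\<^sub>C d (exp sg)) = (of_real (et2 ((ta - sg) / ep) / ep\<^sup>2) - 2 * al * of_real (et1 ((ta - sg) / ep) / ep)) *\<^sub>C d (exp sg)"
   by (simp add: scaleR_scaleC scaleC_scaleC del: of_real_exp)
 qed
 finally have L: "integral {0<..} (%t. vector_derivative (%s. vector_derivative ?ph (at s)) (at t) *\<^sub>C d t
     - vector_derivative (%s. (1 - 2 * al) / of_real s * ?ph s) (at t) *\<^sub>C d t)
   = integral {ta - ep..ta + ep} (%sg. (of_real (et2 ((ta - sg) / ep) / ep\<^sup>2) - 2 * al * of_real (et1 ((ta - sg) / ep) / ep)) *\<^sub>C d (exp sg))" .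
 have "integral {0<..} (%t. ?ph t *\<^sub>C f t) = integral {0<..} (%t. ?l t *\<^sub>R f t)"
  by (rule integral_cong) (simp add: log_bump_def et0_def scaleR_scaleC)
 also have "... = integral ?I (%t. ?l t *\<^sub>R f t)"
  by (rule restrict) (simp add: et_outside[OF out])
 also have "... = integral {ta - ep..ta + ep} (%sg. exp sg *\<^sub>R (?l (exp sg) *\<^sub>R f (exp sg)))"
  using ep by (intro integral_exp_subst_Icc continuous_on_subset[OF _ Isub] continuous_on_scaleR ck f) auto
 also have "... = integral {ta - ep..ta + ep} (%sg. et0 ((ta - sg) / ep) *\<^sub>R (exp (2 * sg) *\<^sub>R f (exp sg)))"
  by (rule integral_cong) (simp add: mult_exp_exp mult_ac)
 finally show ?thesis using L weak[OF test_function_log_bump[OF ep]] by simp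
qed

section \<open>Regularity for the weak equation in the logarithmic variable\<close>

lemma has_vector_derivative_exp_of_real:
 "((%s. exp (c * cr s)) hvd c * exp (c * of_real s)) (at s within S)"
 by (rule has_vector_derivative_real_field) (auto intro!: derivative_eq_intros)

lemma moll_deriv:
 fixes d :: "real => 'a::banach"
 assumes d: "cont d" and h: "!!x. (h has_real_derivative h' x) (at x)" and h': "cont h'"
 shows "((%ta. integral {a..b} (%sg. h ((ta - sg) / ep) *\<^sub>R d sg)) hvd
  (1 / ep) *\<^sub>R integral {a..b} (%sg. h' ((ta - sg) / ep) *\<^sub>R d sg)) (at ta)"
proof -
 have ch: "cont h" by (rule DERIV_continuous_on[of UNIV h h']) (simp add: h)
 have "((%ta. integral (cbox a b) (%sg. h ((ta - sg) / ep) *\<^sub>R d sg)) hvd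
  integral (cbox a b) (%sg. (h' ((ta - sg) / ep) * (1 / ep)) *\<^sub>R d sg)) (at ta within UNIV)"
 proof (rule leibniz_rule_vector_derivative)
  fix x t :: real
  have "((%x. h ((x - t) / ep)) has_real_derivative h' ((x - t) / ep) * (1 / ep)) (at x)"
   by (rule DERIV_chain2[OF h], rule DERIV_cdivide) (auto intro!: derivative_eq_intros)
  then show "((%x. h ((x - t) / ep) *\<^sub>R d t) hvd (h' ((x - t) / ep) * (1 / ep)) *\<^sub>R d t) (at x within UNIV)"
   by (auto intro!: has_vector_derivative_eq_rhs[OF has_vector_derivative_scaleR[OF _ has_vector_derivative_const]])
 next
  fix x :: real
  show "(%sg. h ((x - sg) / ep) *\<^sub>R d sg) integrable_on cbox a b"
   by (rule integrable_continuous, intro continuous_on_scaleR continuous_on_compose2[OF ch] continuous_on_subset[OF d])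
    (simp_all add: divide_inverse continuous_intros)
 next
  have "continuous_on (UNIV \<times> cbox a b) (%p. (h' ((fst p - snd p) / ep) * (1 / ep)) *\<^sub>R d (snd p))"
   by (intro continuous_on_scaleR continuous_on_mult continuous_on_const continuous_on_compose2[OF h'] continuous_on_compose2[OF d])
    (simp_all add: divide_inverse continuous_intros)
  then show "continuous_on (UNIV \<times> cbox a b) (%(x, t). (h' ((x - t) / ep) * (1 / ep)) *\<^sub>R d t)"
   by (simp add: case_prod_unfold)
 qed auto
 moreover have "integral (cbox a b) (%sg. (h' ((ta - sg) / ep) * (1 / ep)) *\<^sub>R d sg)
   = (1 / ep) *\<^sub>R integral {a..b} (%sg. h' ((ta - sg) / ep) *\<^sub>R d sg)"
  by (simp add: mult.commute flip: integral_cmul)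
 ultimately show ?thesis by simp
qed

lemma integral_restrict_support:
 fixes F :: "real => 'a::banach"
 assumes "S \<subseteq> T" "!!x. x \<in> T ==> x \<notin> S ==> F x = 0"
 shows "integral T F = integral S F"
proof (rule integral_spike_set)
 have "{t \<in> T - S. F t ~= 0} = {}" using assms by auto
 then show "negligible {t \<in> T - S. F t ~= 0}" by (simp only: negligible_empty)
 have "{t \<in> S - T. F t ~= 0} = {}" using assms by blast
 then show "negligible {t \<in> S - T. F t ~= 0}" by (simp only: negligible_empty)
qed

definition moll_mass :: "real => real" where
 "moll_mass ep = IU (%sg. et0 (sg / ep))"

lemma et0_even: "et0 (- x) = et0 x"
 by (simp add: et0_def bump_def mult.commute)

lemma abs_div_ge_1: "ep > 0 ==> sg \<notin> {ta - ep..ta + ep} ==> \<bar>(ta - sg) / ep\<bar> \<ge> (1::real)"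
 by (auto simp: abs_if field_simps)

lemma moll_mass:
 assumes ep: "ep > 0" and sub: "{ta - ep..ta + ep} \<subseteq> {a..b}"
 shows "integral {a..b} (%sg. et0 ((ta - sg) / ep)) = moll_mass ep" "moll_mass ep > 0"
proof -
 have c: "continuous_on S (%sg. et0 ((ta - sg) / ep))" for S ta
  by (rule continuous_on_compose2[OF et_continuous(1)[of UNIV]]) (simp_all add: divide_inverse continuous_intros)
 have z: "et0 ((ta - sg) / ep) = 0" if "sg \<notin> {ta - ep..ta + ep}" for ta sg
  using that et_outside(1)[OF abs_div_ge_1[OF ep]] by blast
 have i: "(%sg. et0 ((ta - sg) / ep)) integrable_on UNIV" for ta
  by (rule integrable_on_superset[OF integrable_continuous_real[OF c[of "{ta - ep..ta + ep}"]]]) (auto simp: z)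
 have m: "moll_mass ep = IU (%sg. et0 ((ta - sg) / ep))"
 proof -
  have "(%sg. et0 ((0 - sg) / ep)) integrable_on UNIV" by (rule i)
  from integral_UNIV_shift[OF this, of "- ta"]
  show ?thesis using et0_even[of "_ / ep"] by (simp add: moll_mass_def)
 qed
 have "IU (%sg. et0 ((ta - sg) / ep)) = integral {a..b} (%sg. et0 ((ta - sg) / ep))"
  by (rule integral_restrict_support[OF subset_UNIV z]) (use sub in blast)
 then show "integral {a..b} (%sg. et0 ((ta - sg) / ep)) = moll_mass ep"
  unfolding m by (rule sym)
 have e: "moll_mass ep = integral {ta - ep..ta + ep} (%sg. et0 ((ta - sg) / ep))"
  unfolding m by (rule integral_restrict_support) (auto simp: z)
 have "moll_mass ep \<ge> 0" unfolding e
  by (rule integral_nonneg[OF integrable_continuous_real[OF c]]) (simp add: et0_def bump_nonneg)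
 moreover have "moll_mass ep ~= 0"
 proof
  assume "moll_mass ep = 0"
  then have "integral {ta - ep..ta + ep} (%sg. et0 ((ta - sg) / ep)) = 0" by (simp only: e)
  then have "\<forall>sg\<in>{ta - ep..ta + ep}. et0 ((ta - sg) / ep) = 0"
   using integral_eq_0_iff[OF c, of "ta - ep" "ta + ep"] ep by (simp add: et0_def bump_nonneg)
  then have "et0 ((ta - ta) / ep) = 0" by (rule bspec) (use ep in auto)
  then show False using bump_0_pos[of 0 0] by (simp add: et0_def)
 qed
 ultimately show "moll_mass ep > 0" by simp
qed

text \<open>Widths are at most 1, so for \<open>ta\<close> in \<open>{a..b}\<close> the mollifier
  lives inside \<open>{a - 1..b + 1}\<close>. This fixed window lets the integral depend on
  \<open>ta\<close> through the integrand only.\<close>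

lemma moll_uniform:
 fixes d :: "real => 'a::banach"
 assumes d: "cont d"
 shows "uniform_limit {a..b} (%n ta. (1 / moll_mass (inverse (Suc n))) *\<^sub>R
  integral {a - 1..b + 1} (%sg. et0 ((ta - sg) / inverse (Suc n)) *\<^sub>R d sg)) d sequentially"
proof (rule uniform_limitI)
 fix e :: real assume e: "e > 0"
 have "uniformly_continuous_on {a - 1..b + 1} d"
  by (rule compact_uniformly_continuous[OF continuous_on_subset[OF d]]) auto
 then obtain r where r: "r > 0" "!!x y. x \<in> {a - 1..b + 1} ==> y \<in> {a - 1..b + 1} ==> dist y x < r ==> dist (d y) (d x) < e / 2"
  unfolding uniformly_continuous_on_def using e by (metis half_gt_zero)
 have "\<forall>\<^sub>F n in sequentially. inverse (real (Suc n)) < r"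
  using order_tendstoD(2)[OF LIMSEQ_inverse_real_of_nat r(1)] .
 then show "\<forall>\<^sub>F n in sequentially. \<forall>ta\<in>{a..b}. dist ((1 / moll_mass (inverse (Suc n))) *\<^sub>R
  integral {a - 1..b + 1} (%sg. et0 ((ta - sg) / inverse (Suc n)) *\<^sub>R d sg)) (d ta) < e"
 proof (rule eventually_mono, intro ballI)
  fix n ta assume n: "inverse (real (Suc n)) < r" and ta: "ta \<in> {a..b}"
  define ep where "ep = inverse (real (Suc n))"
  have ep: "ep > 0" "ep <= 1" "ep < r" using n by (auto simp: ep_def inverse_le_1_iff)
  have sub: "{ta - ep..ta + ep} \<subseteq> {a - 1..b + 1}" using ta ep by auto
  note mm = moll_mass[OF ep(1) sub]
  let ?k = "%sg. et0 ((ta - sg) / ep)"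
  have ck: "continuous_on S ?k" for S
   by (rule continuous_on_compose2[OF et_continuous(1)[of UNIV]]) (simp_all add: divide_inverse continuous_intros)
  have cd: "continuous_on {a - 1..b + 1} d" by (rule continuous_on_subset[OF d]) simp
  have "integral {a - 1..b + 1} (%sg. ?k sg *\<^sub>R d sg) - moll_mass ep *\<^sub>R d ta
   = integral {a - 1..b + 1} (%sg. ?k sg *\<^sub>R d sg) - integral {a - 1..b + 1} (%sg. ?k sg *\<^sub>R d ta)"
   unfolding mm(1)[symmetric]
   using integral_linear[OF integrable_continuous_real[OF ck] bounded_linear_scaleR_left[of "d ta"], of "a - 1" "b + 1"] by (simp add: o_def)
  also have "... = integral {a - 1..b + 1} (%sg. ?k sg *\<^sub>R (d sg - d ta))"
   unfolding scaleR_diff_right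
   by (rule integral_diff[symmetric]; intro integrable_continuous_real continuous_on_scaleR ck cd continuous_on_const)
  finally have "norm (integral {a - 1..b + 1} (%sg. ?k sg *\<^sub>R d sg) - moll_mass ep *\<^sub>R d ta)
   = norm (integral {a - 1..b + 1} (%sg. ?k sg *\<^sub>R (d sg - d ta)))" by simp
  also have "... <= integral {a - 1..b + 1} (%sg. (e / 2) * ?k sg)"
  proof (rule integral_norm_bound_integral)
   fix sg assume sg: "sg \<in> {a - 1..b + 1}"
   show "norm (?k sg *\<^sub>R (d sg - d ta)) <= e / 2 * ?k sg"
   proof (cases "sg \<in> {ta - ep..ta + ep}")
    case True
    then have "dist (d sg) (d ta) < e / 2" using sg ta ep by (intro r(2)) (auto simp: dist_real_def)
    moreover have "0 <= ?k sg" by (simp add: et0_def bump_nonneg)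
    ultimately show ?thesis using mult_right_mono[of "norm (d sg - d ta)" "e / 2" "?k sg"]
     by (simp add: dist_norm mult.commute)
   next
    case False
    then show ?thesis using et_outside(1)[OF abs_div_ge_1[OF ep(1)]] by simp
   qed
  qed (intro integrable_continuous_real continuous_on_scaleR continuous_on_mult continuous_on_diff ck cd continuous_on_const)+
  also have "... = (e / 2) * moll_mass ep" using mm(1) by simp
  finally have *: "norm (integral {a - 1..b + 1} (%sg. ?k sg *\<^sub>R d sg) - moll_mass ep *\<^sub>R d ta) <= (e / 2) * moll_mass ep" .
  have "(1 / moll_mass ep) *\<^sub>R integral {a - 1..b + 1} (%sg. ?k sg *\<^sub>R d sg) - d ta
   = (1 / moll_mass ep) *\<^sub>R (integral {a - 1..b + 1} (%sg. ?k sg *\<^sub>R d sg) - moll_mass ep *\<^sub>R d ta)"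
   using mm(2) by (simp add: scaleR_diff_right)
  then have "norm ((1 / moll_mass ep) *\<^sub>R integral {a - 1..b + 1} (%sg. ?k sg *\<^sub>R d sg) - d ta) <= e / 2"
   using * mm(2) by (simp add: divide_simps mult.commute)
  then show "dist ((1 / moll_mass (inverse (Suc n))) *\<^sub>R
   integral {a - 1..b + 1} (%sg. et0 ((ta - sg) / inverse (Suc n)) *\<^sub>R d sg)) (d ta) < e"
   using e unfolding ep_def dist_norm by simp
 qed
qed

text \<open>The equation of the mollified function is multiplied by
  \<open>exp (2 * al * (ta - s)) - 1\<close>, which vanishes at \<open>s = ta\<close>. Integration
  removes the derivative except for its value \<open>h\<close> at \<open>a\<close>, so the identity
  involves only functions that converge uniformly as the width shrinks.\<close>

lemma mollified_identity:
 fixes d g :: "real => 'a::complex_banach" and a b ep :: real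
 assumes d: "cont d" and g: "cont g"
  and weak: "!!ta. integral {ta - ep..ta + ep} (%sg. (of_real (et2 ((ta - sg) / ep) / ep\<^sup>2) - 2 * al * of_real (et1 ((ta - sg) / ep) / ep)) *\<^sub>C d sg)
   = integral {ta - ep..ta + ep} (%sg. et0 ((ta - sg) / ep) *\<^sub>R g sg)"
  and ep: "0 < ep" "ep <= 1"
 defines "c \<equiv> %ta. integral {a - 1..b + 1} (%sg. et0 ((ta - sg) / ep) *\<^sub>R d sg)"
  and "ga \<equiv> %ta. integral {a - 1..b + 1} (%sg. et0 ((ta - sg) / ep) *\<^sub>R g sg)"
 shows "\<exists>h. \<forall>ta\<in>{a..b}. ((%sg. (exp (2 * al * of_real (ta - sg)) - 1) *\<^sub>C ga sg) has_integral
  ((2 * al) *\<^sub>C (c ta - c a) - (exp (2 * al * of_real (ta - a)) - 1) *\<^sub>C h)) {a..ta}"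
proof -
 define c1 where "c1 = (%ta. (1 / ep) *\<^sub>R integral {a - 1..b + 1} (%sg. et1 ((ta - sg) / ep) *\<^sub>R d sg))"
 define c2 where "c2 = (%ta. (1 / ep) *\<^sub>R (1 / ep) *\<^sub>R integral {a - 1..b + 1} (%sg. et2 ((ta - sg) / ep) *\<^sub>R d sg))"
 have dc: "(c hvd c1 ta) (at ta)" for ta
  unfolding c_def c1_def by (rule moll_deriv[OF d et0_deriv et_continuous(2)])
 have dc1: "(c1 hvd c2 ta) (at ta)" for ta
  unfolding c1_def c2_def
  by (rule bounded_linear.has_vector_derivative[OF bounded_linear_scaleR_right moll_deriv[OF d et1_deriv et_continuous(3)]])
 have ode: "c2 ta - (2 * al) *\<^sub>C c1 ta = ga ta" if ta: "ta \<in> {a..b}" for ta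
 proof -
  have sub: "{ta - ep..ta + ep} \<subseteq> {a - 1..b + 1}" using ta ep by auto
  have cc: "continuous_on S (%sg. h ((ta - sg) / ep) *\<^sub>R d sg)" if "cont h" for h S
   by (intro continuous_on_scaleR continuous_on_compose2[OF that] continuous_on_subset[OF d])
    (simp_all add: divide_inverse continuous_intros)
  have eq: "(1 / ep) *\<^sub>R (1 / ep) *\<^sub>R (et2 ((ta - sg) / ep) *\<^sub>R d sg) - (2 * al) *\<^sub>C (1 / ep) *\<^sub>R (et1 ((ta - sg) / ep) *\<^sub>R d sg)
   = (of_real (et2 ((ta - sg) / ep) / ep\<^sup>2) - 2 * al * of_real (et1 ((ta - sg) / ep) / ep)) *\<^sub>C d sg" for sg
   by (simp add: scaleR_scaleC scaleC_scaleC scaleC.diff_left power2_eq_square mult_ac)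
  have z: "et0 ((ta - sg) / ep) = 0" "et1 ((ta - sg) / ep) = 0" "et2 ((ta - sg) / ep) = 0" if "sg \<notin> {ta - ep..ta + ep}" for sg
   using et_outside[OF abs_div_ge_1[OF ep(1) that]] by blast+
  have i: "(%sg. h ((ta - sg) / ep) *\<^sub>R d sg) integrable_on {a - 1..b + 1}" if "cont h" for h
   by (rule integrable_continuous_real[OF cc[OF that]])
  have "((%sg. (1 / ep) *\<^sub>R (1 / ep) *\<^sub>R (et2 ((ta - sg) / ep) *\<^sub>R d sg) - (2 * al) *\<^sub>C (1 / ep) *\<^sub>R (et1 ((ta - sg) / ep) *\<^sub>R d sg)) has_integral
    (c2 ta - (2 * al) *\<^sub>C c1 ta)) {a - 1..b + 1}"
   unfolding c1_def c2_def
   by (intro has_integral_diff has_integral_cmul has_integral_linear[OF _ scaleC.bounded_linear_right, unfolded o_def] integrable_integral i et_continuous)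
  then have "c2 ta - (2 * al) *\<^sub>C c1 ta = integral {a - 1..b + 1} (%sg. (of_real (et2 ((ta - sg) / ep) / ep\<^sup>2) - 2 * al * of_real (et1 ((ta - sg) / ep) / ep)) *\<^sub>C d sg)"
   unfolding eq by (rule integral_unique[symmetric])
  also have "... = integral {ta - ep..ta + ep} (%sg. (of_real (et2 ((ta - sg) / ep) / ep\<^sup>2) - 2 * al * of_real (et1 ((ta - sg) / ep) / ep)) *\<^sub>C d sg)"
   by (rule integral_restrict_support[OF sub]) (simp add: z)
  also have "... = integral {ta - ep..ta + ep} (%sg. et0 ((ta - sg) / ep) *\<^sub>R g sg)" by (rule weak)
  also have "... = ga ta" unfolding ga_def
   by (rule integral_restrict_support[OF sub, symmetric]) (simp add: z)
  finally show ?thesis .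
 qed
 show ?thesis
 proof (intro exI[of _ "c1 a"] ballI)
  fix ta assume ta: "ta \<in> {a..b}"
  let ?F = "%s. (exp (2 * al * of_real (ta - s)) - 1) *\<^sub>C c1 s + (2 * al) *\<^sub>C c s"
  have "((%sg. (exp (2 * al * of_real (ta - sg)) - 1) *\<^sub>C ga sg) has_integral (?F ta - ?F a)) {a..ta}"
  proof (rule fundamental_theorem_of_calculus)
   fix s assume s: "s \<in> {a..ta}"
   have e: "((%s. exp (2 * al * of_real (ta - s)) - 1) hvd - (2 * al) * exp (2 * al * of_real (ta - s))) (at s)"
   proof -
    have "((%s. exp (2 * al * (of_real ta - s)) - 1) has_field_derivative - (2 * al) * exp (2 * al * (of_real ta - of_real s))) (at (of_real s))"
     by (auto intro!: derivative_eq_intros)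
    from has_vector_derivative_real_field[OF this] show ?thesis by simp
   qed
   have "(?F hvd
    (exp (2 * al * of_real (ta - s)) - 1) *\<^sub>C c2 s + (- (2 * al) * exp (2 * al * of_real (ta - s))) *\<^sub>C c1 s + (2 * al) *\<^sub>C c1 s) (at s)"
    by (intro has_vector_derivative_add scaleC.has_vector_derivative e dc1
      bounded_linear.has_vector_derivative[OF scaleC.bounded_linear_right dc])
   moreover have "(exp (2 * al * of_real (ta - s)) - 1) *\<^sub>C c2 s + (- (2 * al) * exp (2 * al * of_real (ta - s))) *\<^sub>C c1 s + (2 * al) *\<^sub>C c1 s
    = (exp (2 * al * of_real (ta - s)) - 1) *\<^sub>C ga s"
   proof -
    have "s \<in> {a..b}" using s ta by auto
    from ode[OF this] have ga: "ga s = c2 s - (2 * al) *\<^sub>C c1 s" by simp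
    show ?thesis unfolding ga
     by (simp add: scaleC.diff_right scaleC_scaleC scaleC.diff_left scaleC.minus_left right_diff_distrib left_diff_distrib mult_ac)
   qed
   ultimately show "(?F hvd (exp (2 * al * of_real (ta - s)) - 1) *\<^sub>C ga s) (at s within {a..ta})"
    by (simp add: has_vector_derivative_at_within)
  qed (use ta in auto)
  moreover have "?F ta - ?F a = (2 * al) *\<^sub>C (c ta - c a) - (exp (2 * al * of_real (ta - a)) - 1) *\<^sub>C c1 a"
   by (simp add: scaleC.diff_right scaleC.zero_left)
  ultimately show "((%sg. (exp (2 * al * of_real (ta - sg)) - 1) *\<^sub>C ga sg) has_integral
   ((2 * al) *\<^sub>C (c ta - c a) - (exp (2 * al * of_real (ta - a)) - 1) *\<^sub>C c1 a)) {a..ta}" by (simp only:)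
 qed
qed

text \<open>The mollified identities pass to the limit once the unknown initial slopes converge. The
  identity at \<open>ta = b\<close> determines them, because their coefficient there is
  nonzero.\<close>

lemma weak_ode_regularity_Icc:
 fixes d g :: "real => 'a::complex_banach"
 assumes d: "cont d" and g: "cont g"
  and weak: "!!ta ep. ep > 0 ==> integral {ta - ep..ta + ep} (%sg. (of_real (et2 ((ta - sg) / ep) / ep\<^sup>2) - 2 * al * of_real (et1 ((ta - sg) / ep) / ep)) *\<^sub>C d sg)
   = integral {ta - ep..ta + ep} (%sg. et0 ((ta - sg) / ep) *\<^sub>R g sg)"
  and al: "Re al > 0" and ab: "a < b"
 shows "\<exists>h. \<forall>ta\<in>{a..b}. ((%sg. (exp (2 * al * of_real (ta - sg)) - 1) *\<^sub>C g sg) has_integral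
  ((2 * al) *\<^sub>C (d ta - d a) - (exp (2 * al * of_real (ta - a)) - 1) *\<^sub>C h)) {a..ta}"
proof -
 define m where "m = (%n. 1 / moll_mass (inverse (real (Suc n))))"
 define c where "c = (%n ta. integral {a - 1..b + 1} (%sg. et0 ((ta - sg) / inverse (Suc n)) *\<^sub>R d sg))"
 define ga where "ga = (%n ta. integral {a - 1..b + 1} (%sg. et0 ((ta - sg) / inverse (Suc n)) *\<^sub>R g sg))"
 define K where "K = (%ta. exp (2 * al * cr (ta - a)) - 1)"
 have ed: "inverse (real (Suc n)) > 0" "inverse (real (Suc n)) <= 1" for n by (auto simp: inverse_le_1_iff)
 have "\<forall>n. \<exists>h. \<forall>ta\<in>{a..b}. ((%sg. (exp (2 * al * of_real (ta - sg)) - 1) *\<^sub>C ga n sg) has_integral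
  ((2 * al) *\<^sub>C (c n ta - c n a) - K ta *\<^sub>C h)) {a..ta}"
  unfolding c_def ga_def K_def using mollified_identity[OF d g weak[OF ed(1)] ed] by blast
 then have "\<exists>h. \<forall>n. \<forall>ta\<in>{a..b}. ((%sg. (exp (2 * al * of_real (ta - sg)) - 1) *\<^sub>C ga n sg) has_integral
  ((2 * al) *\<^sub>C (c n ta - c n a) - K ta *\<^sub>C h n)) {a..ta}" by (rule choice)
 then obtain h where h': "\<forall>n. \<forall>ta\<in>{a..b}. ((%sg. (exp (2 * al * of_real (ta - sg)) - 1) *\<^sub>C ga n sg) has_integral
  ((2 * al) *\<^sub>C (c n ta - c n a) - K ta *\<^sub>C h n)) {a..ta}" by (rule exE)
 note h = h'[rule_format]
 have ud: "(%n. m n *\<^sub>R c n ta) \<longlonglongrightarrow> d ta" if "ta \<in> {a..b}" for ta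
  unfolding m_def c_def by (rule tendsto_uniform_limitI[OF moll_uniform[OF d] that])
 have ug: "uniform_limit {a..b} (%n ta. m n *\<^sub>R ga n ta) g sequentially"
  unfolding m_def ga_def by (rule moll_uniform[OF g])
 have cga: "continuous_on S (ga n)" for S n
  unfolding ga_def
  by (intro continuous_at_imp_continuous_on ballI has_vector_derivative_continuous[OF moll_deriv[OF g et0_deriv et_continuous(2)]])
 let ?k = "%ta sg. exp (2 * al * cr (ta - sg)) - 1"
 let ?J = "%ta. integral {a..ta} (%sg. ?k ta sg *\<^sub>C g sg)"
 have ck: "continuous_on S (?k ta)" for S ta by (intro continuous_intros)
 have J: "((%sg. ?k ta sg *\<^sub>C g sg) has_integral ?J ta) {a..ta}" for ta
  by (intro integrable_integral integrable_continuous_real continuous_on_scaleC ck continuous_on_subset[OF g]) simp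
 have lim: "(%n. m n *\<^sub>R ((2 * al) *\<^sub>C (c n ta - c n a) - K ta *\<^sub>C h n)) \<longlonglongrightarrow> ?J ta" if ta: "ta \<in> {a..b}" for ta
 proof -
  have u: "uniform_limit {a..ta} (%n sg. ?k ta sg *\<^sub>C (m n *\<^sub>R ga n sg)) (%sg. ?k ta sg *\<^sub>C g sg) sequentially"
  proof (rule scaleC.bounded_uniform_limit[OF uniform_limit_const])
   show "uniform_limit {a..ta} (%n ta. m n *\<^sub>R ga n ta) g sequentially"
    by (rule uniform_limit_on_subset[OF ug]) (use ta in auto)
   show "bounded (g ` {a..ta})"
    by (rule compact_imp_bounded[OF compact_continuous_image[OF continuous_on_subset[OF g]]]) auto
   show "bounded (?k ta ` {a..ta})"
    by (rule compact_imp_bounded[OF compact_continuous_image[OF ck]]) auto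
  qed
  obtain I J' where IJ: "!!n. ((%sg. ?k ta sg *\<^sub>C (m n *\<^sub>R ga n sg)) has_integral I n) {a..ta}"
   "((%sg. ?k ta sg *\<^sub>C g sg) has_integral J') {a..ta}" "(I \<longlonglongrightarrow> J')"
   by (rule uniform_limit_integral[OF u])
    (intro continuous_on_scaleC continuous_on_scaleR continuous_on_const cga ck, simp, blast)
  have "I = (%n. m n *\<^sub>R ((2 * al) *\<^sub>C (c n ta - c n a) - K ta *\<^sub>C h n))"
  proof (rule ext, rule has_integral_unique[OF IJ(1)])
   fix n
   show "((%sg. ?k ta sg *\<^sub>C (m n *\<^sub>R ga n sg)) has_integral m n *\<^sub>R ((2 * al) *\<^sub>C (c n ta - c n a) - K ta *\<^sub>C h n)) {a..ta}"
    using has_integral_cmul[OF h[OF ta, of n], of "m n"] by (simp add: scaleC.scaleR_right)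
  qed
  moreover have "J' = ?J ta" by (rule has_integral_unique[OF IJ(2) J])
  ultimately show ?thesis using IJ(3) by (simp only:)
 qed
 have K: "(%n. K ta *\<^sub>C (m n *\<^sub>R h n)) \<longlonglongrightarrow> (2 * al) *\<^sub>C (d ta - d a) - ?J ta" if ta: "ta \<in> {a..b}" for ta
 proof -
  have aI: "a \<in> {a..b}" using ab by simp
  have "(%n. (2 * al) *\<^sub>C (m n *\<^sub>R c n ta - m n *\<^sub>R c n a) - m n *\<^sub>R ((2 * al) *\<^sub>C (c n ta - c n a) - K ta *\<^sub>C h n)) \<longlonglongrightarrow> (2 * al) *\<^sub>C (d ta - d a) - ?J ta"
   by (intro tendsto_diff lim[OF ta] bounded_linear.tendsto[OF scaleC.bounded_linear_right] ud ta aI)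
  moreover have "(2 * al) *\<^sub>C (m n *\<^sub>R c n ta - m n *\<^sub>R c n a) - m n *\<^sub>R ((2 * al) *\<^sub>C (c n ta - c n a) - K ta *\<^sub>C h n) = K ta *\<^sub>C (m n *\<^sub>R h n)" for n
   by (simp add: scaleC.diff_right scaleC.scaleR_right scaleR_diff_right)
  ultimately show ?thesis by simp
 qed
 \<comment> \<open>The exponential has modulus \<open>exp (2 * Re al * (b - a))\<close>, which
   differs from 1 as \<open>Re al > 0\<close>.\<close>
 have Kb: "K b ~= 0"
 proof
  assume "K b = 0"
  then have "cmod (exp (2 * al * cr (b - a))) = 1" by (simp add: K_def)
  then have "2 * Re al * (b - a) = 0" by (simp add: norm_exp_eq_Re)
  then show False using al ab by simp
 qed
 define h0 where "h0 = inverse (K b) *\<^sub>C ((2 * al) *\<^sub>C (d b - d a) - ?J b)"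
 have "(%n. inverse (K b) *\<^sub>C (K b *\<^sub>C (m n *\<^sub>R h n))) \<longlonglongrightarrow> h0"
  unfolding h0_def by (intro bounded_linear.tendsto[OF scaleC.bounded_linear_right] K) (use ab in auto)
 then have h0: "(%n. m n *\<^sub>R h n) \<longlonglongrightarrow> h0" using Kb by (simp add: scaleC_scaleC)
 have JK: "?J ta = (2 * al) *\<^sub>C (d ta - d a) - K ta *\<^sub>C h0" if ta: "ta \<in> {a..b}" for ta
 proof -
  have "(%n. K ta *\<^sub>C (m n *\<^sub>R h n)) \<longlonglongrightarrow> K ta *\<^sub>C h0"
   by (intro bounded_linear.tendsto[OF scaleC.bounded_linear_right] h0)
  from LIMSEQ_unique[OF K[OF ta] this] show ?thesis by (simp add: algebra_simps)
 qed
 show ?thesis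
 proof (intro exI[of _ h0] ballI)
  fix ta assume ta: "ta \<in> {a..b}"
  show "((%sg. ?k ta sg *\<^sub>C g sg) has_integral
   ((2 * al) *\<^sub>C (d ta - d a) - (exp (2 * al * of_real (ta - a)) - 1) *\<^sub>C h0)) {a..ta}"
   using J[of ta] unfolding JK[OF ta] by (simp only: K_def)
 qed
qed

text \<open>The integrated identity can be solved for \<open>d\<close>, and then contains only
  integrals of continuous functions, so it may be differentiated. \<open>P\<close> is defined
  through the derivative of \<open>d\<close>, so the functions found on different intervals agree
  with it.\<close>

lemma weak_ode_regularity:
 fixes d g :: "real => 'a::complex_banach"
 assumes d: "cont d" and g: "cont g"
  and weak: "!!ta ep. ep > 0 ==> integral {ta - ep..ta + ep} (%sg. (of_real (et2 ((ta - sg) / ep) / ep\<^sup>2) - 2 * al * of_real (et1 ((ta - sg) / ep) / ep)) *\<^sub>C d sg)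
   = integral {ta - ep..ta + ep} (%sg. et0 ((ta - sg) / ep) *\<^sub>R g sg)"
  and al: "Re al > 0"
 obtains P where "!!ta. (d hvd exp (2 * al * of_real ta) *\<^sub>C P ta) (at ta)"
  "!!ta. (P hvd exp (- (2 * al * of_real ta)) *\<^sub>C g ta) (at ta)"
proof -
 define P where "P ta = exp (- (2 * al * of_real ta)) *\<^sub>C vector_derivative d (at ta)" for ta
 have al0: "al ~= 0" using al by auto
 have local: "\<exists>Q. \<forall>ta\<in>{-N<..<N}. (d hvd exp (2 * al * of_real ta) *\<^sub>C Q ta) (at ta) \<and>
  (Q hvd exp (- (2 * al * of_real ta)) *\<^sub>C g ta) (at ta)" if N: "N > 0" for N :: real
 proof -
  have "\<exists>h. \<forall>ta\<in>{-N..N}. ((%sg. (exp (2 * al * of_real (ta - sg)) - 1) *\<^sub>C g sg) has_integral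
   ((2 * al) *\<^sub>C (d ta - d (-N)) - (exp (2 * al * of_real (ta + N)) - 1) *\<^sub>C h)) {-N..ta}"
   using weak_ode_regularity_Icc[OF d g weak al, of "-N" N] N by simp
  then obtain h where h: "\<forall>ta\<in>{-N..N}. ((%sg. (exp (2 * al * of_real (ta - sg)) - 1) *\<^sub>C g sg) has_integral
   ((2 * al) *\<^sub>C (d ta - d (-N)) - (exp (2 * al * of_real (ta + N)) - 1) *\<^sub>C h)) {-N..ta}" by (rule exE)
  let ?e = "%ta. exp (2 * al * cr ta)"
  let ?en = "%ta. exp (- (2 * al * cr ta))"
  let ?G = "%ta. integral {-N..ta} (%sg. ?en sg *\<^sub>C g sg)"
  let ?H = "%ta. integral {-N..ta} g"
  have cen: "continuous_on S ?en" for S by (intro continuous_intros)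
  have cg: "continuous_on S g" for S by (rule continuous_on_subset[OF g]) simp
  have dG: "(?G hvd ?en ta *\<^sub>C g ta) (at ta)" and dH: "(?H hvd g ta) (at ta)" if "ta \<in> {-N<..<N}" for ta
  proof -
   have w: "at ta within {-N..N} = at ta" using that by (intro at_within_interior) auto
   show "(?G hvd ?en ta *\<^sub>C g ta) (at ta)"
    using integral_has_vector_derivative[OF continuous_on_scaleC[OF cen cg], of ta "-N" N] that by (simp add: w)
   show "(?H hvd g ta) (at ta)"
    using integral_has_vector_derivative[OF cg, of ta "-N" N] that by (simp add: w)
  qed
  define k where "k = ?e N *\<^sub>C h"
  have eq: "d ta = d (-N) + inverse (2 * al) *\<^sub>C (?e ta *\<^sub>C (k + ?G ta) - h - ?H ta)" if ta: "ta \<in> {-N..N}" for ta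
  proof -
   have "((%sg. ?e ta *\<^sub>C (?en sg *\<^sub>C g sg) - g sg) has_integral (?e ta *\<^sub>C ?G ta - ?H ta)) {-N..ta}"
    by (intro has_integral_diff has_integral_linear[OF _ scaleC.bounded_linear_right, unfolded o_def]
      integrable_integral integrable_continuous_real continuous_on_scaleC cen cg)
   moreover have "(%sg. ?e ta *\<^sub>C (?en sg *\<^sub>C g sg) - g sg) = (%sg. (exp (2 * al * of_real (ta - sg)) - 1) *\<^sub>C g sg)"
    by (simp add: fun_eq_iff scaleC_scaleC scaleC.diff_left mult_exp_exp algebra_simps)
   ultimately have "?e ta *\<^sub>C ?G ta - ?H ta = (2 * al) *\<^sub>C (d ta - d (-N)) - (exp (2 * al * of_real (ta + N)) - 1) *\<^sub>C h"
    using has_integral_unique[OF _ h[rule_format, OF ta]] by simp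
   moreover have "exp (2 * al * of_real (ta + N)) *\<^sub>C h = ?e ta *\<^sub>C k"
    unfolding k_def by (simp add: scaleC_scaleC mult_exp_exp algebra_simps)
   ultimately have "(2 * al) *\<^sub>C (d ta - d (-N)) = ?e ta *\<^sub>C (k + ?G ta) - h - ?H ta"
    by (simp add: scaleC.diff_left scaleC.add_right algebra_simps)
   then have "inverse (2 * al) *\<^sub>C (2 * al) *\<^sub>C (d ta - d (-N)) = inverse (2 * al) *\<^sub>C (?e ta *\<^sub>C (k + ?G ta) - h - ?H ta)" by simp
   moreover have "inverse (2 * al) * (2 * al) = 1" using al0 by simp
   ultimately have "d ta - d (-N) = inverse (2 * al) *\<^sub>C (?e ta *\<^sub>C (k + ?G ta) - h - ?H ta)"
    by (simp only: scaleC_scaleC scaleC_one)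
   then show ?thesis by (simp add: algebra_simps)
  qed
  show ?thesis
  proof (intro exI[of _ "%ta. k + ?G ta"] ballI conjI)
   fix ta assume ta: "ta \<in> {-N<..<N}"
   have "((%ta. d (-N) + inverse (2 * al) *\<^sub>C (?e ta *\<^sub>C (k + ?G ta) - h - ?H ta)) hvd
    0 + inverse (2 * al) *\<^sub>C (?e ta *\<^sub>C (0 + ?en ta *\<^sub>C g ta) + (2 * al * ?e ta) *\<^sub>C (k + ?G ta) - 0 - g ta)) (at ta)"
    by (intro has_vector_derivative_add has_vector_derivative_const has_vector_derivative_diff dG dH ta
      bounded_linear.has_vector_derivative[OF scaleC.bounded_linear_right] scaleC.has_vector_derivative has_vector_derivative_exp_of_real)
   then have "(d hvd
    0 + inverse (2 * al) *\<^sub>C (?e ta *\<^sub>C (0 + ?en ta *\<^sub>C g ta) + (2 * al * ?e ta) *\<^sub>C (k + ?G ta) - 0 - g ta)) (at ta)"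
   proof (rule has_vector_derivative_transform_within_open[where S = "{-N<..<N}"])
    show "d (-N) + inverse (2 * al) *\<^sub>C (?e y *\<^sub>C (k + ?G y) - h - ?H y) = d y" if "y \<in> {-N<..<N}" for y
     by (rule eq[symmetric]) (use that in auto)
   qed (use ta in auto)
   moreover have "0 + inverse (2 * al) *\<^sub>C (?e ta *\<^sub>C (0 + ?en ta *\<^sub>C g ta) + (2 * al * ?e ta) *\<^sub>C (k + ?G ta) - 0 - g ta) = ?e ta *\<^sub>C (k + ?G ta)"
    using al0 by (simp add: scaleC_scaleC mult_exp_exp flip: mult.assoc)
   ultimately show "(d hvd ?e ta *\<^sub>C (k + ?G ta)) (at ta)" by simp
   show "((%ta. k + ?G ta) hvd ?en ta *\<^sub>C g ta) (at ta)"
    using has_vector_derivative_add[OF has_vector_derivative_const dG[OF ta], of k] by simp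
  qed
 qed
 have loc: "(d hvd exp (2 * al * of_real ta) *\<^sub>C P ta) (at ta) \<and> (P hvd exp (- (2 * al * of_real ta)) *\<^sub>C g ta) (at ta)" for ta
 proof -
  let ?I = "{- (\<bar>ta\<bar> + 1)<..<\<bar>ta\<bar> + 1}"
  have ta: "ta \<in> ?I" by auto
  obtain Q where Q: "!!sg. sg \<in> ?I ==> (d hvd exp (2 * al * of_real sg) *\<^sub>C Q sg) (at sg)"
  "!!sg. sg \<in> ?I ==> (Q hvd exp (- (2 * al * of_real sg)) *\<^sub>C g sg) (at sg)"
   using local[of "\<bar>ta\<bar> + 1"] by (metis abs_ge_zero add_nonneg_pos zero_less_one)
  have PQ: "Q sg = P sg" if "sg \<in> ?I" for sg
   unfolding P_def vector_derivative_at[OF Q(1)[OF that]] by (simp add: scaleC_scaleC mult_exp_exp)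
  have "(P hvd exp (- (2 * al * of_real ta)) *\<^sub>C g ta) (at ta)"
   by (rule has_vector_derivative_transform_within_open[OF Q(2)[OF ta], where S = ?I]) (use ta PQ in auto)
  then show ?thesis using Q(1)[OF ta] PQ[OF ta] by simp
 qed
 then show ?thesis using that by blast
qed

lemma test_function_props:
 fixes al :: complex
 assumes ph: "test_function ph"
 defines "K \<equiv> closure {t. ph t ~= 0}"
  and "ps \<equiv> %t. vector_derivative (%s. vector_derivative ph (at s)) (at t) - vector_derivative (%s. (1 - 2 * al) / of_real s * ph s) (at t)"
 shows "compact K" "K \<subseteq> {0<..}" "continuous_on S ph" "continuous_on K ps"
  "t \<notin> K ==> ph t = 0" "t \<notin> K ==> ps t = 0"
  "!!t. (ph hvd vector_derivative ph (at t)) (at t)"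
  "!!t. ((%s. vector_derivative ph (at s)) hvd vector_derivative (%s. vector_derivative ph (at s)) (at t)) (at t)"
  "!!t. t > 0 ==> ((%s. (1 - 2 * al) / of_real s * ph s) hvd
   vector_derivative (%s. (1 - 2 * al) / of_real s * ph s) (at t)) (at t)"
  "t \<notin> K ==> vector_derivative ph (at t) = 0"
proof -
 let ?d1 = "%t. vector_derivative ph (at t)"
 let ?d2 = "%t. vector_derivative ?d1 (at t)"
 have *: "((%f t. vector_derivative f (at t)) ^^ n) ph differentiable_on UNIV" for n
  using ph by (simp add: test_function_def)
 have df: "ph differentiable_on UNIV" "?d1 differentiable_on UNIV" "?d2 differentiable_on UNIV"
  using *[of 0] *[of 1] *[of 2] by (simp_all add: numeral_2_eq_2)
 show K: "compact K" "K \<subseteq> {0<..}" using ph by (auto simp: test_function_def K_def)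
 show c: "continuous_on S ph" for S using df(1) by (meson continuous_on_subset differentiable_imp_continuous_on subset_UNIV)
 have c1: "continuous_on S ?d1" for S using df(2) by (meson continuous_on_subset differentiable_imp_continuous_on subset_UNIV)
 have c2: "continuous_on S ?d2" for S using df(3) by (meson continuous_on_subset differentiable_imp_continuous_on subset_UNIV)
 show d1: "(ph hvd ?d1 t) (at t)" for t
  using df(1) by (simp add: differentiable_on_def vector_derivative_works)
 show d2: "(?d1 hvd ?d2 t) (at t)" for t
  using df(2) by (simp add: differentiable_on_def vector_derivative_works)
 have d3: "((%s. (1 - 2 * al) / of_real s * ph s) hvd
   ((1 - 2 * al) / of_real t * ?d1 t - (1 - 2 * al) / of_real t ^ 2 * ph t)) (at t)" if "t > 0" for t
 proof -
  have "((%z. (1 - 2 * al) / z) has_field_derivative - (1 - 2 * al) / of_real t ^ 2) (at (of_real t))"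
   using that by (auto intro!: derivative_eq_intros simp: power2_eq_square)
  from has_vector_derivative_mult[OF has_vector_derivative_real_field[OF this] d1] show ?thesis
   by (rule has_vector_derivative_eq_rhs) (simp add: minus_divide_left[symmetric] del: minus_diff_eq)
 qed
 show "((%s. (1 - 2 * al) / of_real s * ph s) hvd
   vector_derivative (%s. (1 - 2 * al) / of_real s * ph s) (at t)) (at t)" if "t > 0" for t
  using d3[OF that] unfolding vector_derivative_at[OF d3[OF that]] .
 show "continuous_on K ps"
 proof (rule continuous_on_eq)
  show "continuous_on K (%t. ?d2 t - ((1 - 2 * al) / of_real t * ?d1 t - (1 - 2 * al) / of_real t ^ 2 * ph t))"
   using K(2) by (intro continuous_intros c c1 c2) auto
  show "?d2 t - ((1 - 2 * al) / of_real t * ?d1 t - (1 - 2 * al) / of_real t ^ 2 * ph t) = ps t" if "t \<in> K" for t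
   using K(2) that vector_derivative_at[OF d3, of t] by (auto simp: ps_def)
 qed
 have z: "ph t = 0" if "t \<notin> K" for t using that closure_subset[of "{t. ph t ~= 0}"] unfolding K_def by blast
 then show "t \<notin> K ==> ph t = 0" .
 have oK: "open (- K)" using K(1) by (simp add: compact_imp_closed open_Compl)
 have z1: "?d1 t = 0" if "t \<notin> K" for t
  by (rule vector_derivative_at, rule has_vector_derivative_transform_within_open[OF has_vector_derivative_const oK])
   (use that z in auto)
 then show "t \<notin> K ==> ?d1 t = 0" .
 show "ps t = 0" if t: "t \<notin> K"
 proof -
  have "?d2 t = 0"
   by (rule vector_derivative_at, rule has_vector_derivative_transform_within_open[OF has_vector_derivative_const oK])
    (use t z1 in auto)
  moreover have "vector_derivative (%s. (1 - 2 * al) / of_real s * ph s) (at t) = 0"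
   by (rule vector_derivative_at, rule has_vector_derivative_transform_within_open[OF has_vector_derivative_const oK])
    (use t z in auto)
  ultimately show ?thesis by (simp add: ps_def)
 qed
qed

section \<open>Regularity of arbitrary solutions of the abstract problem\<close>

context sector_calculus
begin

text \<open>Applying \<open>Rone\<close> replaces \<open>A u\<close>, which is merely locally
  integrable, by the continuous function \<open>u - Rone u\<close>.\<close>

lemma solution_Rone_weak:
 assumes u: "is_solution A al x u" and g: "test_function g"
 shows "integral {0<..} (%t. vector_derivative (%s. vector_derivative g (at s)) (at t) *\<^sub>C Rone (u t)
     - vector_derivative (%s. (1 - 2 * al) / of_real s * g s) (at t) *\<^sub>C Rone (u t))
   = integral {0<..} (%t. g t *\<^sub>C (u t - Rone (u t)))"
proof -
 define K where "K = closure {t. g t ~= 0}"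
 let ?ps = "%t. vector_derivative (%s. vector_derivative g (at s)) (at t) - vector_derivative (%s. (1 - 2 * al) / of_real s * g s) (at t)"
 note tp = test_function_props[OF g, folded K_def]
 have L: "{0<..} \<in> sets (lebesgue :: real measure)" by simp
 have cu: "continuous_on K u" using u tp(2) unfolding is_solution_def by (auto elim!: continuous_on_subset)
 have "Bochner_integrable (lebesgue_on K) u"
  using has_Bochner_integral_continuous_compact[OF tp(1) cu] unfolding Bochner_integrable_def by blast
 from Bochner_integrable_scaleC_compact[OF tp(1,2) L this tp(4)]
 have "Bochner_integrable (lebesgue_on {0<..}) (%t. ?ps t *\<^sub>C u t)" using tp(6) by simp
 from Bochner_integrable_has_integral[OF L this]
 have 1: "((%t. Rone (?ps t *\<^sub>C u t)) has_integral Rone (Bochner_integral (lebesgue_on {0<..}) (%t. ?ps t *\<^sub>C u t))) {0<..}"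
  by (rule has_integral_linear[OF _ bounded_linear_Rone, unfolded o_def])
 have "Bochner_integrable (lebesgue_on K) (%t. the (A (u t)))"
  using u tp(1,2) unfolding is_solution_def L1_loc_pos_def by blast
 from Bochner_integrable_scaleC_compact[OF tp(1,2) L this tp(3)]
 have "Bochner_integrable (lebesgue_on {0<..}) (%t. g t *\<^sub>C the (A (u t)))" using tp(5) by simp
 from Bochner_integrable_has_integral[OF L this]
 have 2: "((%t. Rone (g t *\<^sub>C the (A (u t)))) has_integral Rone (Bochner_integral (lebesgue_on {0<..}) (%t. g t *\<^sub>C the (A (u t))))) {0<..}"
  by (rule has_integral_linear[OF _ bounded_linear_Rone, unfolded o_def])
 have "Bochner_integral (lebesgue_on {0<..}) (%t. ?ps t *\<^sub>C u t) = Bochner_integral (lebesgue_on {0<..}) (%t. g t *\<^sub>C the (A (u t)))"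
  using u g unfolding is_solution_def scaleC.diff_left by blast
 then have "integral {0<..} (%t. Rone (?ps t *\<^sub>C u t)) = integral {0<..} (%t. Rone (g t *\<^sub>C the (A (u t))))"
  using integral_unique[OF 1] integral_unique[OF 2] by simp
 moreover have "Rone (the (A (u t))) = u t - Rone (u t)" if "t > 0" for t
 proof -
  have "u t \<in> dom A" using u that unfolding is_solution_def by blast
  then have "Rone (u t) + Rone (the (A (u t))) = u t" using Rone_left by (simp add: Rone.add)
  then show ?thesis by (simp add: algebra_simps)
 qed
 then have "integral {0<..} (%t. Rone (g t *\<^sub>C the (A (u t)))) = integral {0<..} (%t. g t *\<^sub>C (u t - Rone (u t)))"
  by (intro integral_cong) (simp add: Rone_scaleC)
 ultimately show ?thesis unfolding scaleC.diff_left[symmetric] by (simp only: Rone_scaleC)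
qed

text \<open>Regularity of \<open>Rone u\<close> is lifted to \<open>u\<close>. From the primitive of
  \<open>A u\<close> a continuous \<open>F\<close> is built such that \<open>Rone F\<close> and
  \<open>P\<close> have the same derivative. The constants of integration turn out to lie in the
  range of \<open>Rone\<close>, so injectivity removes \<open>Rone\<close> from the resulting
  formula for \<open>u\<close>.\<close>

lemma solution_regularity_local:
 assumes u: "is_solution A al x u" and al: "Re al > 0" and N: "N > (0::real)"
  and P1: "!!ta. ((%ta. Rone (u (exp ta))) hvd exp (2 * al * of_real ta) *\<^sub>C P ta) (at ta)"
  and P2: "!!ta. (P hvd exp (of_real ta * (2 - 2 * al)) *\<^sub>C (u (exp ta) - Rone (u (exp ta)))) (at ta)"
 shows "\<exists>Q. \<forall>ta\<in>{-N<..<N}. ((%ta. u (exp ta)) hvd exp (2 * al * of_real ta) *\<^sub>C Q ta) (at ta) \<and> Rone (Q ta) = P ta"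
proof -
 have al0: "al ~= 0" using al by auto
 define v where "v t = the (A (u t))" for t
 let ?a = "exp (-N)" and ?b = "exp N"
 have Isub: "{?a..?b} \<subseteq> {0<..}" by (auto intro: less_le_trans[OF exp_gt_zero])
 have "Bochner_integrable (lebesgue_on {?a..?b}) v"
  using u Isub unfolding is_solution_def L1_loc_pos_def v_def by (meson compact_Icc)
 then have vi: "v integrable_on {?a..?b}"
  using Bochner_integrable_has_integral[of "{?a..?b}" v] by auto
 have cu: "continuous_on {?a..?b} u" using u Isub unfolding is_solution_def by (auto elim!: continuous_on_subset)
 have Rv: "Rone (v t) = u t - Rone (u t)" if "t \<in> {?a..?b}" for t
 proof -
  have "u t \<in> dom A" using u that Isub unfolding is_solution_def by blast
  then have "Rone (u t) + Rone (v t) = u t" using Rone_left by (simp add: Rone.add v_def)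
  then show ?thesis by (simp add: algebra_simps)
 qed
 define F0 where "F0 t = integral {?a..t} v" for t
 have cF0: "continuous_on {?a..?b} F0" unfolding F0_def by (rule indefinite_integral_continuous_1[OF vi])
 have eI: "exp ta \<in> {?a..?b}" if "ta \<in> {-N..N}" for ta using that by simp
 have RF0: "Rone (F0 t) = integral {?a..t} (%t. u t - Rone (u t))" if "t \<in> {?a..?b}" for t
 proof -
  have "v integrable_on {?a..t}" by (rule integrable_on_subinterval[OF vi]) (use that in auto)
  from integral_linear[OF this bounded_linear_Rone]
  have "Rone (F0 t) = integral {?a..t} (%t. Rone (v t))" by (simp add: F0_def o_def)
  also have "... = integral {?a..t} (%t. u t - Rone (u t))" by (rule integral_cong) (use that Rv in auto)
  finally show ?thesis .
 qed
 have dRF0: "((%t. Rone (F0 t)) hvd (u t - Rone (u t))) (at t)" if t: "t \<in> {?a<..<?b}" for t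
 proof -
  have w: "at t within {?a..?b} = at t" using t by (intro at_within_interior) auto
  have "((%t. integral {?a..t} (%t. u t - Rone (u t))) hvd (u t - Rone (u t))) (at t within {?a..?b})"
   by (rule integral_has_vector_derivative) (use t in \<open>auto intro!: continuous_on_diff cu Rone.continuous_on\<close>)
  then show ?thesis unfolding w
   by (rule has_vector_derivative_transform_within_open[where S = "{?a<..<?b}"]) (use t RF0 in auto)
 qed
 let ?e1 = "%ta. exp ((1 - 2 * al) * cr ta)"
 let ?e = "%ta. exp (2 * al * cr ta)"
 let ?h = "%sg. ((1 - 2 * al) * ?e1 sg) *\<^sub>C F0 (exp sg)"
 \<comment> \<open>The integral of \<open>t powr (1 - 2 * al)\<close> times \<open>A u\<close>,
   integrated by parts: only the continuous primitive \<open>F0\<close> occurs, next to smooth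
   weights.\<close>
 define F where "F ta = ?e1 ta *\<^sub>C F0 (exp ta) - integral {-N..ta} ?h" for ta
 have cFe: "continuous_on {-N..N} (%sg. F0 (exp sg))"
  by (rule continuous_on_compose2[OF cF0]) (auto intro!: continuous_intros)
 have ch: "continuous_on {-N..N} ?h" by (intro continuous_on_scaleC continuous_intros cFe)
 have cF: "continuous_on {-N..N} F" unfolding F_def
  by (intro continuous_on_diff continuous_on_scaleC cFe indefinite_integral_continuous_1 integrable_continuous_real ch) (intro continuous_intros)
 have w: "at ta within {-N..N} = at ta" if "ta \<in> {-N<..<N}" for ta :: real using that by (intro at_within_interior) auto
 have dRF: "((%ta. Rone (F ta)) hvd exp (of_real ta * (2 - 2 * al)) *\<^sub>C (u (exp ta) - Rone (u (exp ta)))) (at ta)"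
  if ta: "ta \<in> {-N<..<N}" for ta
 proof -
  have ex: "((%ta. Rone (F0 (exp ta))) hvd exp ta *\<^sub>R (u (exp ta) - Rone (u (exp ta)))) (at ta)"
  proof -
   have "exp ta \<in> {?a<..<?b}" using ta by simp
   from vector_diff_chain_at[where f = exp and x = ta and f' = "exp ta", OF _ dRF0[OF this]] show ?thesis
    by (simp add: o_def has_real_derivative_iff_has_vector_derivative[symmetric])
  qed
  have "((%ta. integral {-N..ta} ?h) hvd ?h ta) (at ta within {-N..N})"
   by (rule integral_has_vector_derivative[OF ch]) (use ta in auto)
  then have ih: "((%ta. Rone (integral {-N..ta} ?h)) hvd Rone (?h ta)) (at ta)"
   unfolding w[OF ta] by (rule Rone.has_vector_derivative)
  have "((%ta. ?e1 ta *\<^sub>C Rone (F0 (exp ta)) - Rone (integral {-N..ta} ?h)) hvd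
   ?e1 ta *\<^sub>C exp ta *\<^sub>R (u (exp ta) - Rone (u (exp ta))) + ((1 - 2 * al) * ?e1 ta) *\<^sub>C Rone (F0 (exp ta)) - Rone (?h ta)) (at ta)"
   by (intro has_vector_derivative_diff scaleC.has_vector_derivative has_vector_derivative_exp_of_real ex ih)
  moreover have "?e1 ta * cr (exp ta) = exp (of_real ta * (2 - 2 * al))"
   unfolding exp_of_real[symmetric] mult_exp_exp by (simp add: algebra_simps)
  ultimately show ?thesis
   by (simp add: F_def Rone.diff Rone_scaleC scaleR_scaleC scaleC_scaleC)
 qed
 have zc: "\<exists>c. \<forall>ta\<in>{-N<..<N}. G ta = c" if z: "!!ta. ta \<in> {-N<..<N} ==> (G hvd 0) (at ta)" for G :: "real => 'a"
 proof -
  obtain c where "!!ta. ta \<in> {-N<..<N} ==> G ta = c"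
   by (rule has_vector_derivative_zero_constant[of "{-N<..<N}" G]) (use z in \<open>auto intro: has_vector_derivative_at_within\<close>)
  then show ?thesis by blast
 qed
 obtain k where k: "!!ta. ta \<in> {-N<..<N} ==> P ta - Rone (F ta) = k"
  using zc[of "%ta. P ta - Rone (F ta)"] has_vector_derivative_diff[OF P2 dRF] by auto
 define H where "H ta = integral {-N..ta} (%sg. ?e sg *\<^sub>C F sg)" for ta
 have dH: "(H hvd ?e ta *\<^sub>C F ta) (at ta)" if ta: "ta \<in> {-N<..<N}" for ta
 proof -
  have "(H hvd ?e ta *\<^sub>C F ta) (at ta within {-N..N})" unfolding H_def
   by (rule integral_has_vector_derivative, intro continuous_on_scaleC cF continuous_intros) (use ta in auto)
  then show ?thesis unfolding w[OF ta] .
 qed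
 have e2: "(2 * al * ?e ta) *\<^sub>C inverse (2 * al) *\<^sub>C z = ?e ta *\<^sub>C z" for ta :: real and z :: 'a
  unfolding scaleC_scaleC by (rule arg_cong[where f = "%a. a *\<^sub>C z"]) (simp add: al0 field_simps)
 let ?G = "%ta. Rone (u (exp ta)) - (?e ta *\<^sub>C inverse (2 * al) *\<^sub>C k + Rone (H ta))"
 have "(?G hvd 0) (at ta)" if ta: "ta \<in> {-N<..<N}" for ta
 proof -
  have "(?G hvd ?e ta *\<^sub>C P ta - ((?e ta *\<^sub>C 0 + (2 * al * ?e ta) *\<^sub>C inverse (2 * al) *\<^sub>C k) + Rone (?e ta *\<^sub>C F ta))) (at ta)"
   by (intro has_vector_derivative_diff has_vector_derivative_add P1 Rone.has_vector_derivative dH ta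
     scaleC.has_vector_derivative has_vector_derivative_exp_of_real has_vector_derivative_const)
  moreover have "?e ta *\<^sub>C P ta - ((?e ta *\<^sub>C 0 + (2 * al * ?e ta) *\<^sub>C inverse (2 * al) *\<^sub>C k) + Rone (?e ta *\<^sub>C F ta)) = 0"
  proof -
   have "P ta = k + Rone (F ta)" using k[OF ta] by (simp add: algebra_simps)
   then show ?thesis by (simp only: e2 scaleC.add_right Rone_scaleC scaleC.zero_right add_0_left diff_self)
  qed
  ultimately show ?thesis by simp
 qed
 from zc[OF this] obtain k2 where k2: "!!ta. ta \<in> {-N<..<N} ==> ?G ta = k2" by blast
 let ?s = "N / 2"
 have I: "0 \<in> {-N<..<N}" "?s \<in> {-N<..<N}" using N by auto
 have e1: "?e ?s - 1 ~= 0"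
 proof
  assume "?e ?s - 1 = 0"
  then have "cmod (?e ?s) = 1" by simp
  then have "2 * Re al * ?s = 0" by (simp add: norm_exp_eq_Re)
  then show False using al N by simp
 qed
 \<comment> \<open>Comparing the formula for \<open>Rone u\<close> at \<open>0\<close> and at
   \<open>N / 2\<close> expresses \<open>k\<close> as \<open>Rone q\<close>; the division is
   possible because the exponential takes different values at the two points.\<close>
 define q where "q = inverse ((?e ?s - 1) * inverse (2 * al)) *\<^sub>C (u (exp ?s) - u 1 - (H ?s - H 0))"
 have kq: "k = Rone q"
 proof -
  have "?G ?s = ?G 0" using k2[OF I(1)] k2[OF I(2)] by simp
  then have "Rone (u (exp ?s) - u 1 - (H ?s - H 0)) = ((?e ?s - 1) * inverse (2 * al)) *\<^sub>C k"
   unfolding Rone.diff left_diff_distrib scaleC.diff_left by (simp add: scaleC_scaleC algebra_simps)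
  then have "Rone q = inverse ((?e ?s - 1) * inverse (2 * al)) *\<^sub>C ((?e ?s - 1) * inverse (2 * al)) *\<^sub>C k"
   unfolding q_def Rone_scaleC by simp
  moreover have "inverse ((?e ?s - 1) * inverse (2 * al)) * ((?e ?s - 1) * inverse (2 * al)) = 1"
   using e1 al0 by (intro left_inverse) simp
  ultimately show ?thesis by (simp only: scaleC_scaleC scaleC_one)
 qed
 let ?c = "u 1 - (inverse (2 * al) *\<^sub>C q + H 0)"
 have uq: "?c + (?e ta *\<^sub>C inverse (2 * al) *\<^sub>C q + H ta) = u (exp ta)" if ta: "ta \<in> {-N<..<N}" for ta
 proof -
  have "Rone (?c + (?e ta *\<^sub>C inverse (2 * al) *\<^sub>C q + H ta)) = Rone (u (exp ta))"
   using k2[OF I(1)] k2[OF ta] unfolding kq Rone.diff Rone.add Rone_scaleC by (simp add: algebra_simps)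
  then show ?thesis by (rule Rone_inj)
 qed
 show ?thesis
 proof (intro exI[of _ "%ta. q + F ta"] ballI conjI)
  fix ta assume ta: "ta \<in> {-N<..<N}"
  show "Rone (q + F ta) = P ta" using k[OF ta] by (simp add: Rone.add kq algebra_simps)
  have "((%ta. ?c + (?e ta *\<^sub>C inverse (2 * al) *\<^sub>C q + H ta)) hvd
   0 + ((?e ta *\<^sub>C 0 + (2 * al * ?e ta) *\<^sub>C inverse (2 * al) *\<^sub>C q) + ?e ta *\<^sub>C F ta)) (at ta)"
   by (intro has_vector_derivative_add dH ta scaleC.has_vector_derivative has_vector_derivative_exp_of_real has_vector_derivative_const)
  then have "((%ta. u (exp ta)) hvd
   0 + ((?e ta *\<^sub>C 0 + (2 * al * ?e ta) *\<^sub>C inverse (2 * al) *\<^sub>C q) + ?e ta *\<^sub>C F ta)) (at ta)"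
  proof (rule has_vector_derivative_transform_within_open[where S = "{-N<..<N}"])
   show "?c + (?e y *\<^sub>C inverse (2 * al) *\<^sub>C q + H y) = u (exp y)" if "y \<in> {-N<..<N}" for y
    by (rule uq[OF that])
  qed (use ta in auto)
  moreover have "0 + ((?e ta *\<^sub>C 0 + (2 * al * ?e ta) *\<^sub>C inverse (2 * al) *\<^sub>C q) + ?e ta *\<^sub>C F ta) = ?e ta *\<^sub>C (q + F ta)"
   by (simp only: e2 scaleC.add_right scaleC.zero_right add_0_left)
  ultimately show "((%ta. u (exp ta)) hvd ?e ta *\<^sub>C (q + F ta)) (at ta)" by simp
 qed
qed

lemma solution_regularity:
 assumes u: "is_solution A al x u" and al: "Re al > 0"
 obtains p where "!!ta. ((%ta. u (exp ta)) hvd exp (2 * al * of_real ta) *\<^sub>C p ta) (at ta)"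
  "!!ta. ((%ta. Rone (p ta)) hvd exp (of_real ta * (2 - 2 * al)) *\<^sub>C (u (exp ta) - Rone (u (exp ta)))) (at ta)"
proof -
 have cu: "continuous_on {0<..} u" using u unfolding is_solution_def by (auto elim!: continuous_on_subset)
 have cR: "continuous_on {0<..} (%t. Rone (u t))" by (rule Rone.continuous_on[OF cu])
 have cf: "continuous_on {0<..} (%t. u t - Rone (u t))" by (intro continuous_on_diff cu cR)
 have ce: "cont (%ta. f (exp ta))" if "continuous_on {0<..} f" for f :: "real => 'a"
  by (rule continuous_on_compose2[OF that]) (auto intro!: continuous_intros)
 obtain P where P1: "!!ta. ((%ta. Rone (u (exp ta))) hvd exp (2 * al * of_real ta) *\<^sub>C P ta) (at ta)"
  and P2': "!!ta. (P hvd exp (- (2 * al * of_real ta)) *\<^sub>C exp (2 * ta) *\<^sub>R (u (exp ta) - Rone (u (exp ta)))) (at ta)"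
 proof (rule weak_ode_regularity[OF ce[OF cR] _ _ al])
  show "cont (%ta. exp (2 * ta) *\<^sub>R (u (exp ta) - Rone (u (exp ta))))"
   by (intro continuous_on_scaleR ce[OF cf] continuous_intros)
  show "integral {ta - ep..ta + ep} (%sg. (of_real (et2 ((ta - sg) / ep) / ep\<^sup>2) - 2 * al * of_real (et1 ((ta - sg) / ep) / ep)) *\<^sub>C Rone (u (exp sg)))
   = integral {ta - ep..ta + ep} (%sg. et0 ((ta - sg) / ep) *\<^sub>R (exp (2 * sg) *\<^sub>R (u (exp sg) - Rone (u (exp sg)))))" if "ep > 0" for ta ep
   by (rule weak_log_form[OF cR cf solution_Rone_weak[OF u] that])
 qed (rule that; blast)
 have e2: "exp (- (2 * al * of_real ta)) * of_real (exp (2 * ta)) = exp (of_real ta * (2 - 2 * al))" for ta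
  unfolding exp_of_real[symmetric] mult_exp_exp by (simp add: algebra_simps)
 have P2: "(P hvd exp (of_real ta * (2 - 2 * al)) *\<^sub>C (u (exp ta) - Rone (u (exp ta)))) (at ta)" for ta
  using P2'[of ta] unfolding scaleR_scaleC scaleC_scaleC e2 .
 define p where "p ta = exp (- (2 * al * of_real ta)) *\<^sub>C vector_derivative (%ta. u (exp ta)) (at ta)" for ta
 have p: "((%ta. u (exp ta)) hvd exp (2 * al * of_real ta) *\<^sub>C p ta) (at ta) \<and> Rone (p ta) = P ta" for ta
 proof -
  have N: "\<bar>ta\<bar> + 1 > 0" and ta: "ta \<in> {- (\<bar>ta\<bar> + 1)<..<\<bar>ta\<bar> + 1}" by auto
  obtain Q where "\<forall>ta\<in>{- (\<bar>ta\<bar> + 1)<..<\<bar>ta\<bar> + 1}. ((%ta. u (exp ta)) hvd exp (2 * al * of_real ta) *\<^sub>C Q ta) (at ta) \<and> Rone (Q ta) = P ta"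
   using solution_regularity_local[OF u al N P1 P2] by blast
  from bspec[OF this ta] have Q: "((%ta. u (exp ta)) hvd exp (2 * al * of_real ta) *\<^sub>C Q ta) (at ta)" "Rone (Q ta) = P ta" by auto
  have "p ta = Q ta" unfolding p_def vector_derivative_at[OF Q(1)] by (simp add: scaleC_scaleC mult_exp_exp)
  then show ?thesis using Q by simp
 qed
 show ?thesis
 proof (rule that[of p])
  show "((%ta. u (exp ta)) hvd exp (2 * al * of_real ta) *\<^sub>C p ta) (at ta)" for ta using p by blast
  have "(%ta. Rone (p ta)) = P" using p by blast
  then show "((%ta. Rone (p ta)) hvd exp (of_real ta * (2 - 2 * al)) *\<^sub>C (u (exp ta) - Rone (u (exp ta)))) (at ta)" for ta
   using P2 by simp
 qed
qed

end

section \<open>From a Neumann limit to the fractional power: the Bessel transform of a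
  solution\<close>

lemma exp_neg_exp_le:
 fixes d k K r :: real
 assumes d: "d > 0" and k: "0 <= k" "k <= K"
 shows "exp (- d * exp r) <= exp (K\<^sup>2 / (2 * d)) * exp (- k * r)"
proof -
 have "k * r - d * exp r <= K\<^sup>2 / (2 * d)"
 proof (cases "r \<ge> 0")
  case True
  \<comment> \<open>The quadratic lower bound for \<open>exp\<close> reduces the claim to completing
    the square, which is the origin of \<open>K\<^sup>2 / (2 * d)\<close>.\<close>
  have "exp r \<ge> 1 + r + r\<^sup>2 / 2" using exp_lower_Taylor_quadratic[OF True] by simp
  then have e: "exp r \<ge> r\<^sup>2 / 2" using True by linarith
  have "k * r <= K * r" using k True by (simp add: mult_right_mono)
  moreover have "d * exp r \<ge> d * (r\<^sup>2 / 2)" using e d by (simp add: mult_left_mono)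
  moreover have "K * r - d * (r\<^sup>2 / 2) <= K\<^sup>2 / (2 * d)"
  proof -
   have "0 <= (K - d * r)\<^sup>2" by simp
   then have "0 <= (K - d * r)\<^sup>2 / (2 * d)" using d by simp
   also have "... = K\<^sup>2 / (2 * d) - (K * r - d * (r\<^sup>2 / 2))"
    using d by (simp add: power2_eq_square field_simps)
   finally show ?thesis by simp
  qed
  ultimately show ?thesis by linarith
 next
  case False
  then have "k * r <= 0" using k by (simp add: mult_nonneg_nonpos)
  moreover have "0 <= d * exp r" "0 <= K\<^sup>2 / (2 * d)" using d by auto
  ultimately show ?thesis by linarith
 qed
 then have "- d * exp r <= K\<^sup>2 / (2 * d) + - k * r" by linarith
 then show ?thesis unfolding mult_exp_exp by simp
qed

text \<open>One constant serves all rates between 0 and \<open>K\<close>: rate 0 is boundedness,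
  positive rates compensate exponential weights.\<close>

lemma nbessel_decay:
 assumes nu: "0 < Re nu" "Re nu < 1" and b: "0 <= b" "b < pi / 2"
 obtains C where "0 < C"
  "!!ze k. \<bar>Im ze\<bar> <= b ==> 0 <= k ==> k <= K ==> cmod (nbessel nu ze) <= C * exp (- k * Re ze)"
proof -
 obtain C d where C: "0 < C" "0 < d" "!!ze. \<bar>Im ze\<bar> <= b ==> cmod (nbessel nu ze) <= C * exp (- d * exp (Re ze))"
  by (rule nbessel_bound[OF nu b]) blast
 show ?thesis
 proof (rule that[of "C * exp (K\<^sup>2 / (2 * d))"])
  fix ze k assume ze: "\<bar>Im ze\<bar> <= b" and k: "0 <= k" "k <= K"
  have "cmod (nbessel nu ze) <= C * exp (- d * exp (Re ze))" by (rule C(3)[OF ze])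
  also have "... <= C * (exp (K\<^sup>2 / (2 * d)) * exp (- k * Re ze))"
   using exp_neg_exp_le[OF C(2) k] C(1) by (simp add: mult_left_mono)
  finally show "cmod (nbessel nu ze) <= C * exp (K\<^sup>2 / (2 * d)) * exp (- k * Re ze)" by (simp add: mult.assoc)
 qed (use C(1) in simp)
qed

lemma nbessel_power_bound:
 assumes al: "0 < Re al" "Re al < 1" and b: "0 <= b" "b < pi"
 obtains C where "0 < C" "!!ta w. \<bar>Im w\<bar> <= b ==>
  cmod (exp (of_real ta * (2 - 2 * al)) * nb al ta w)
   <= C * exp (- (1 - Re al) * Re w) * exp (- min (Re al) (1 - Re al) * \<bar>ta + Re w / 2\<bar>)"
proof -
 let ?m = "min (Re al) (1 - Re al)"
 obtain C where C: "0 < C" "!!ze k. \<bar>Im ze\<bar> <= b / 2 ==> 0 <= k ==> k <= 3 ==> cmod (nbessel al ze) <= C * exp (- k * Re ze)"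
  using nbessel_decay[OF al, of "b / 2" 3] b by auto
 show ?thesis
 proof (rule that[OF C(1)])
  fix ta :: real and w assume w: "\<bar>Im w\<bar> <= b"
  let ?ze = "of_real ta + w / 2"
  let ?r = "ta + Re w / 2"
  \<comment> \<open>The rate \<open>2 * (1 - Re al)\<close> exactly balances the weight. Adding
    \<open>?m\<close> on the right of \<open>?r = 0\<close> and subtracting it on the left leaves
    decay away from that point.\<close>
  define k where "k = (if ?r \<ge> 0 then 2 * (1 - Re al) + ?m else 2 * (1 - Re al) - ?m)"
  have k: "0 <= k" "k <= 3" using al by (auto simp: k_def)
  have kr: "2 * (1 - Re al) * ta + - k * ?r = - (1 - Re al) * Re w + - ?m * \<bar>?r\<bar>"
   by (auto simp: k_def field_simps)
  have "cmod (exp (of_real ta * (2 - 2 * al)) * nbessel al ?ze) <= exp (2 * (1 - Re al) * ta) * (C * exp (- k * ?r))"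
   unfolding norm_mult using C(2)[of ?ze k] w k by (intro mult_mono) (auto simp: algebra_simps)
  also have "... = C * exp (2 * (1 - Re al) * ta + - k * ?r)" unfolding exp_add by simp
  also have "... = C * exp (- (1 - Re al) * Re w) * exp (- ?m * \<bar>?r\<bar>)" unfolding kr exp_add by simp
  finally show "cmod (exp (of_real ta * (2 - 2 * al)) * nbessel al ?ze) <= C * exp (- (1 - Re al) * Re w) * exp (- ?m * \<bar>?r\<bar>)" .
 qed
qed

lemma nbessel_shift_derivative:
 assumes nu: "0 < Re nu" "Re nu < 1" and w: "\<bar>Im w\<bar> < pi"
 shows "((%ta. nb nu ta w) hvd
  - dtn_const nu * exp (2 * nu * (of_real ta + w / 2)) * nb (1 - nu) ta w) (at ta)"
proof -
 have "((%z. nbessel nu (z + w / 2)) has_field_derivative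
  (- dtn_const nu * exp (2 * nu * (of_real ta + w / 2)) * nb (1 - nu) ta w) * 1) (at (of_real ta))"
  by (rule DERIV_chain2[OF nbessel_deriv[OF nu]]) (use w in \<open>auto intro!: derivative_eq_intros\<close>)
 from has_vector_derivative_real_field[OF this] show ?thesis by simp
qed

lemma nbessel_continuous_shift:
 assumes nu: "0 < Re nu" "Re nu < 1" and f: "continuous_on S f" and im: "!!z. z \<in> S ==> \<bar>Im (f z)\<bar> < pi / 2"
 shows "continuous_on S (%z. nbessel nu (f z))"
 by (rule continuous_on_compose2[OF holomorphic_on_imp_continuous_on[OF nbessel_holomorphic[OF nu]] f]) (use im in auto)

lemma filterlim_exp_at_right_0: "filterlim (exp :: real => real) (at_right 0) at_bot"
 unfolding filterlim_at using exp_at_bot by auto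

lemma vector_derivative_log:
 fixes u :: "real => 'a::complex_banach"
 assumes "((%ta. u (exp ta)) hvd exp (2 * al * of_real ta) *\<^sub>C p) (at ta)"
 shows "(u hvd exp (- ta) *\<^sub>R exp (2 * al * of_real ta) *\<^sub>C p) (at (exp ta))"
  "cr (exp ta) powr (1 - 2 * al) *\<^sub>C vector_derivative u (at (exp ta)) = p"
proof -
 have l: "(ln hvd exp (- ta)) (at (exp ta))"
  unfolding has_real_derivative_iff_has_vector_derivative[symmetric]
  by (auto intro!: derivative_eq_intros simp: exp_minus field_simps)
 have "((%ta. u (exp ta)) hvd exp (2 * al * of_real ta) *\<^sub>C p) (at (ln (exp ta)))"
  using assms by simp
 from vector_diff_chain_at[where f = ln and x = "exp ta" and f' = "exp (- ta)", OF l this]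
 have "((%t. u (exp (ln t))) hvd exp (- ta) *\<^sub>R exp (2 * al * of_real ta) *\<^sub>C p) (at (exp ta))"
  by (simp add: o_def)
 then show d: "(u hvd exp (- ta) *\<^sub>R exp (2 * al * of_real ta) *\<^sub>C p) (at (exp ta))"
  by (rule has_vector_derivative_transform_within_open[where S = "{0<..}"]) auto
 have "cr (exp ta) powr (1 - 2 * al) = exp ((1 - 2 * al) * of_real ta)"
  by (simp add: powr_def Ln_of_real del: of_real_exp)
 moreover have "exp ((1 - 2 * al) * of_real ta) * cr (exp (- ta)) * exp (2 * al * of_real ta) = 1"
  unfolding exp_of_real[symmetric] mult_exp_exp by (simp add: algebra_simps)
 ultimately show "cr (exp ta) powr (1 - 2 * al) *\<^sub>C vector_derivative u (at (exp ta)) = p"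
  unfolding vector_derivative_at[OF d] by (simp add: scaleR_scaleC scaleC_scaleC mult.assoc)
qed

context sector_calculus
begin

text \<open>Green's identity. The kernel \<open>V\<close> solves the scalar equation with
  \<open>exp w\<close> in place of \<open>A\<close>, and \<open>?Q\<close> is \<open>Rone\<close>
  applied to the weighted Wronskian of \<open>V\<close> and \<open>U\<close>. At infinity
  \<open>?Q\<close> vanishes; at 0 it yields the Dirichlet value \<open>x\<close> with factor
  \<open>c * exp (al * w)\<close> and the Neumann value \<open>y\<close>.\<close>

lemma transform_identity:
 fixes s ps :: real
 assumes al: "0 < Re al" "Re al < 1" and ps: "\<bar>ps\<bar> = ph"
  and U: "cont U" and B: "!!ta. norm (U ta) <= B"
  and Ux: "(U \<longlongrightarrow> x) at_bot" and Py: "(P \<longlongrightarrow> - y) at_bot"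
  and dU: "!!ta. (U hvd exp (2 * al * of_real ta) *\<^sub>C P ta) (at ta)"
  and dP: "!!ta. ((%ta. Rone (P ta)) hvd exp (of_real ta * (2 - 2 * al)) *\<^sub>C (U ta - Rone (U ta))) (at ta)"
 defines "w \<equiv> Complex s ps"
 shows "exp w *\<^sub>C IU (%ta. (exp (of_real ta * (2 - 2 * al)) * nb al ta w) *\<^sub>C U ta)
  = (dtn_const al * exp (al * w)) *\<^sub>C rho w x - rho w y"
proof -
 define c where "c = dtn_const al"
 have al': "0 < Re (1 - al)" "Re (1 - al) < 1" using al by auto
 have c': "dtn_const (1 - al) = 1 / c" by (simp add: c_def dtn_const_eq)
 have c0: "c ~= 0" unfolding c_def by (rule dtn_const_nonzero[OF al])
 have w: "w \<in> outer" "\<bar>Im w\<bar> < pi" "\<bar>Im w\<bar> <= ph" "\<bar>Im w\<bar> = ph" using ps ph by (auto simp: w_def)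
 let ?z = "%ta. cr ta + w / 2"
 let ?V = "%ta. nbessel al (?z ta)"
 let ?W = "%ta. nbessel (1 - al) (?z ta)"
 let ?e = "%ta. exp (cr ta * (2 - 2 * al))"
 let ?h = "%ta. (?e ta * ?V ta) *\<^sub>C U ta"
 define I where "I = IU ?h"
 let ?Q = "%ta. (c * exp (al * w) * ?W ta) *\<^sub>C Rone (U ta) + ?V ta *\<^sub>C Rone (P ta)"
 have dQ: "(?Q hvd (?h ta - (1 + exp w) *\<^sub>C Rone (?h ta))) (at ta)" for ta
 proof -
  have "(?Q hvd
   ((c * exp (al * w) * ?W ta) *\<^sub>C Rone (exp (2 * al * of_real ta) *\<^sub>C P ta)
    + (c * exp (al * w) * (- dtn_const (1 - al) * exp (2 * (1 - al) * ?z ta) * nbessel (1 - (1 - al)) (?z ta))) *\<^sub>C Rone (U ta))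
   + (?V ta *\<^sub>C (?e ta *\<^sub>C (U ta - Rone (U ta))) + (- dtn_const al * exp (2 * al * ?z ta) * ?W ta) *\<^sub>C Rone (P ta))) (at ta)"
   by (intro has_vector_derivative_add scaleC.has_vector_derivative has_vector_derivative_mult_right
     nbessel_shift_derivative al al' w Rone.has_vector_derivative dU dP)
  moreover have "((c * exp (al * w) * ?W ta) *\<^sub>C Rone (exp (2 * al * of_real ta) *\<^sub>C P ta)
    + (c * exp (al * w) * (- dtn_const (1 - al) * exp (2 * (1 - al) * ?z ta) * nbessel (1 - (1 - al)) (?z ta))) *\<^sub>C Rone (U ta))
   + (?V ta *\<^sub>C (?e ta *\<^sub>C (U ta - Rone (U ta))) + (- dtn_const al * exp (2 * al * ?z ta) * ?W ta) *\<^sub>C Rone (P ta))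
   = ?h ta - (1 + exp w) *\<^sub>C Rone (?h ta)"
  proof -
   have e1: "exp (2 * al * ?z ta) = exp (al * w) * exp (2 * al * of_real ta)"
    unfolding mult_exp_exp by (simp add: algebra_simps)
   have e2: "exp (al * w) * exp (2 * (1 - al) * ?z ta) = ?e ta * exp w"
    unfolding mult_exp_exp by (simp add: algebra_simps)
   have e3: "c * exp (al * w) * (- dtn_const (1 - al) * exp (2 * (1 - al) * ?z ta) * nbessel (1 - (1 - al)) (?z ta)) = - (?e ta * ?V ta * exp w)"
   proof -
    have "c * exp (al * w) * (- dtn_const (1 - al) * exp (2 * (1 - al) * ?z ta) * nbessel (1 - (1 - al)) (?z ta))
     = - (c * dtn_const (1 - al)) * (exp (al * w) * exp (2 * (1 - al) * ?z ta)) * ?V ta" by simp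
    also have "... = - (?e ta * ?V ta * exp w)" unfolding e2 c' using c0 by simp
    finally show ?thesis .
   qed
   show ?thesis unfolding e3 e1
    by (simp add: c_def[symmetric] Rone_scaleC scaleC_scaleC scaleC.diff_right scaleC.add_left scaleC.minus_left distrib_right mult_ac)
  qed
  ultimately show ?thesis by simp
 qed
 have imz: "\<bar>Im (?z ta)\<bar> < pi / 2" for ta using w(2) by simp
 have ch: "cont ?h"
  by (intro continuous_on_scaleC continuous_on_mult U nbessel_continuous_shift al imz continuous_intros)
 obtain C where C: "0 < C" "!!ta w. \<bar>Im w\<bar> <= ph ==>
  cmod (exp (of_real ta * (2 - 2 * al)) * nb al ta w)
   <= C * exp (- (1 - Re al) * Re w) * exp (- min (Re al) (1 - Re al) * \<bar>ta + Re w / 2\<bar>)"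
  using nbessel_power_bound[OF al, of ph] ph ph_pos by (metis less_imp_le)
 let ?m = "min (Re al) (1 - Re al)"
 have m: "?m > 0" using al by auto
 have B0: "B \<ge> 0" using order_trans[OF norm_ge_zero B] .
 have hb: "norm (?h ta) <= (C * exp (- (1 - Re al) * Re w) * exp (?m * \<bar>Re w / 2\<bar>) * B) * exp (- ?m * \<bar>ta\<bar>)" for ta
 proof -
  have "\<bar>ta\<bar> - \<bar>Re w / 2\<bar> <= \<bar>ta + Re w / 2\<bar>" by linarith
  then have "?m * (\<bar>ta\<bar> - \<bar>Re w / 2\<bar>) <= ?m * \<bar>ta + Re w / 2\<bar>" using m by (intro mult_left_mono) auto
  then have le: "- ?m * \<bar>ta + Re w / 2\<bar> <= ?m * \<bar>Re w / 2\<bar> + - ?m * \<bar>ta\<bar>" by (simp add: right_diff_distrib)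
  have "norm (?h ta) <= (C * exp (- (1 - Re al) * Re w) * exp (- ?m * \<bar>ta + Re w / 2\<bar>)) * B"
   unfolding norm_scaleC by (rule mult_mono[OF C(2)[OF w(3)] B]) (use C(1) in auto)
  also have "... <= (C * exp (- (1 - Re al) * Re w) * exp (?m * \<bar>Re w / 2\<bar> + - ?m * \<bar>ta\<bar>)) * B"
   using le C(1) B0 by (intro mult_right_mono mult_left_mono) auto
  finally show ?thesis unfolding exp_add by (simp add: mult_ac)
 qed
 have lim1: "(%n. integral {- real n..real n} ?h) \<longlonglongrightarrow> I"
  unfolding I_def by (rule exp_decay_tendsto[OF ch m hb])
 have FTC: "integral {- real n..real n} ?h - (1 + exp w) *\<^sub>C Rone (integral {- real n..real n} ?h) = ?Q (real n) - ?Q (- real n)" for n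
 proof (rule has_integral_unique)
  have i: "(?h has_integral integral {- real n..real n} ?h) {- real n..real n}"
   by (intro integrable_integral integrable_continuous_real continuous_on_subset[OF ch]) simp
  show "((%ta. ?h ta - (1 + exp w) *\<^sub>C Rone (?h ta)) has_integral
   integral {- real n..real n} ?h - (1 + exp w) *\<^sub>C Rone (integral {- real n..real n} ?h)) {- real n..real n}"
   by (intro has_integral_diff i has_integral_linear[OF _ scaleC.bounded_linear_right, unfolded o_def]
     has_integral_linear[OF i bounded_linear_Rone, unfolded o_def])
  show "((%ta. ?h ta - (1 + exp w) *\<^sub>C Rone (?h ta)) has_integral ?Q (real n) - ?Q (- real n)) {- real n..real n}"
   by (rule fundamental_theorem_of_calculus) (auto intro: has_vector_derivative_at_within dQ)
 qed
 obtain K where K: "K > 0" "!!x. norm (Rone x) <= norm x * K" using Rone.pos_bounded by blast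
 have b2: "0 <= ph / 2" "ph / 2 < pi / 2" using ph ph_pos by auto
 have Imz: "\<bar>Im (?z ta)\<bar> <= ph / 2" for ta using w(3) by simp
 have near: "((%ta. nbessel nu (?z ta)) \<longlongrightarrow> 1) at_bot" if nu: "0 < Re nu" "Re nu < 1" for nu
 proof -
  obtain D where D: "0 < D" "!!ze. \<bar>Im ze\<bar> <= ph / 2 ==> cmod (nbessel nu ze - 1) <= D * exp (2 * Re nu * Re ze)"
   by (rule nbessel_near_0[OF nu b2]) blast
  have "((%ta. D * exp (2 * Re nu * (ta + Re w / 2))) \<longlongrightarrow> 0) at_bot" using nu(1) by real_asymp
  then have "((%ta. nbessel nu (?z ta) - 1) \<longlongrightarrow> 0) at_bot"
   by (rule Lim_null_comparison[rotated]) (use D(2)[OF Imz] in simp)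
  then show ?thesis by (rule LIM_zero_cancel)
 qed
 have Qbot: "((%ta. ?Q ta) \<longlongrightarrow> (c * exp (al * w) * 1) *\<^sub>C Rone x + 1 *\<^sub>C Rone (- y)) at_bot"
  by (intro tendsto_add scaleC.tendsto tendsto_mult tendsto_const near al al' Rone.tendsto Ux Py)
 have Wtop: "((%ta. (c * exp (al * w) * ?W ta) *\<^sub>C Rone (U ta)) \<longlongrightarrow> 0) at_top"
 proof -
  obtain D where D: "0 < D" "!!ze k. \<bar>Im ze\<bar> <= ph / 2 ==> 0 <= k ==> k <= 1 ==> cmod (nbessel (1 - al) ze) <= D * exp (- k * Re ze)"
   by (rule nbessel_decay[OF al' b2, of 1]) blast
  have "((%ta. cmod (c * exp (al * w)) * (D * exp (- (ta + Re w / 2))) * (B * K)) \<longlongrightarrow> 0) at_top" by real_asymp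
  then show ?thesis
  proof (rule Lim_null_comparison[rotated], intro always_eventually allI)
   fix ta
   have "cmod (?W ta) <= D * exp (- (ta + Re w / 2))" using D(2)[OF Imz, of 1 ta] by simp
   moreover have "norm (Rone (U ta)) <= B * K" using K(2)[of "U ta"] mult_right_mono[OF B, of K ta] K(1) by linarith
   ultimately show "norm ((c * exp (al * w) * ?W ta) *\<^sub>C Rone (U ta)) <= cmod (c * exp (al * w)) * (D * exp (- (ta + Re w / 2))) * (B * K)"
    unfolding norm_scaleC norm_mult[of "c * exp (al * w)"] using D(1) by (intro mult_mono mult_left_mono) auto
  qed
 qed
 \<comment> \<open>Only a crude bound for \<open>Rone (P ta)\<close> is available, of order
   \<open>exp (2 * ta) * ta\<close> from integrating its derivative; decay of rate 3 of the kernel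
   beats it.\<close>
 have Vtop: "((%ta. ?V ta *\<^sub>C Rone (P ta)) \<longlongrightarrow> 0) at_top"
 proof -
  obtain D where D: "0 < D" "!!ze k. \<bar>Im ze\<bar> <= ph / 2 ==> 0 <= k ==> k <= 3 ==> cmod (nbessel al ze) <= D * exp (- k * Re ze)"
   by (rule nbessel_decay[OF al b2, of 3]) blast
  define E where "E = norm (Rone (P 0))"
  have RP: "norm (Rone (P ta)) <= E + B * (1 + K) * exp (2 * ta) * ta" if ta: "ta \<ge> 0" for ta
  proof -
   have "((%ta. exp (of_real ta * (2 - 2 * al)) *\<^sub>C (U ta - Rone (U ta))) has_integral (Rone (P ta) - Rone (P 0))) {0..ta}"
    by (rule fundamental_theorem_of_calculus[OF ta]) (rule has_vector_derivative_at_within[OF dP])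
   then have "norm (Rone (P ta) - Rone (P 0)) <= (B * (1 + K) * exp (2 * ta)) * measure lborel (cbox 0 ta)"
    unfolding box_real[symmetric]
   proof (rule has_integral_bound[rotated])
    fix sg assume sg: "sg \<in> cbox 0 ta"
    have "norm (U sg - Rone (U sg)) <= B + B * K"
     using norm_triangle_ineq4[of "U sg" "Rone (U sg)"] B[of sg] K(2)[of "U sg"] mult_right_mono[OF B[of sg], of K] K(1) by linarith
    moreover have "cmod (exp (of_real sg * (2 - 2 * al))) <= exp (2 * ta)"
    proof -
     have "sg * (2 - 2 * Re al) <= ta * 2" using sg al ta by (intro mult_mono) auto
     then show ?thesis by (simp add: norm_exp_eq_Re mult.commute)
    qed
    ultimately show "norm (exp (of_real sg * (2 - 2 * al)) *\<^sub>C (U sg - Rone (U sg))) <= B * (1 + K) * exp (2 * ta)"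
     unfolding norm_scaleC using mult_mono[of "cmod (exp (of_real sg * (2 - 2 * al)))" "exp (2 * ta)" "norm (U sg - Rone (U sg))" "B + B * K"]
     by (simp add: algebra_simps)
   qed (use B0 K(1) in simp)
   then have "norm (Rone (P ta) - Rone (P 0)) <= B * (1 + K) * exp (2 * ta) * ta" using ta by simp
   then show ?thesis using norm_triangle_ineq2[of "Rone (P ta)" "Rone (P 0)"] by (simp add: E_def)
  qed
  have "((%ta. (D * exp (- 3 * (ta + Re w / 2))) * (E + B * (1 + K) * exp (2 * ta) * ta)) \<longlongrightarrow> 0) at_top" by real_asymp
  then show ?thesis
  proof (rule Lim_null_comparison[rotated], intro eventually_mono[OF eventually_ge_at_top[of "0::real"]])
   fix ta :: real assume ta: "0 <= ta"
   show "norm (?V ta *\<^sub>C Rone (P ta)) <= D * exp (- 3 * (ta + Re w / 2)) * (E + B * (1 + K) * exp (2 * ta) * ta)"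
    unfolding norm_scaleC using D(2)[OF Imz, of 3 ta] RP[OF ta] D(1) by (intro mult_mono) auto
  qed
 qed
 have Qtop: "((%ta. ?Q ta) \<longlongrightarrow> 0) at_top" using tendsto_add[OF Wtop Vtop] by simp
 have "(%n. ?Q (real n) - ?Q (- real n)) \<longlonglongrightarrow> 0 - ((c * exp (al * w) * 1) *\<^sub>C Rone x + 1 *\<^sub>C Rone (- y))"
  by (intro tendsto_diff filterlim_compose[OF Qtop filterlim_real_sequentially]
    filterlim_compose[OF Qbot filterlim_compose[OF filterlim_uminus_at_bot_at_top filterlim_real_sequentially]])
 moreover have "(%n. integral {- real n..real n} ?h - (1 + exp w) *\<^sub>C Rone (integral {- real n..real n} ?h)) \<longlonglongrightarrow> I - (1 + exp w) *\<^sub>C Rone I"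
  by (intro tendsto_diff lim1 bounded_linear.tendsto[OF scaleC.bounded_linear_right] Rone.tendsto)
 ultimately have "I - (1 + exp w) *\<^sub>C Rone I = 0 - ((c * exp (al * w) * 1) *\<^sub>C Rone x + 1 *\<^sub>C Rone (- y))"
  unfolding FTC by (rule LIMSEQ_unique[rotated])
 \<comment> \<open>As \<open>A\<close> applied to \<open>Rone I\<close> is
   \<open>I - Rone I\<close>, the left side is \<open>exp w - A\<close> applied to
   \<open>Rone I\<close>, and the resolvent solves for it.\<close>
 then have "exp w *\<^sub>C Rone I - (I - Rone I) = Rone ((c * exp (al * w)) *\<^sub>C x - y)"
  by (simp add: scaleC.add_left Rone_scaleC Rone.diff Rone.neg algebra_simps)
 moreover have "the (A (Rone I)) = I - Rone I" using Rone_right[of I] by (simp add: algebra_simps)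
 ultimately have "resolvent A (exp w) (exp w *\<^sub>C Rone I - the (A (Rone I))) = resolvent A (exp w) (Rone ((c * exp (al * w)) *\<^sub>C x - y))" by simp
 then have "Rone I = resolvent A (exp w) (Rone ((c * exp (al * w)) *\<^sub>C x - y))"
  by (simp add: resolvent_left[OF outer_rset[OF w(1)] Rone_dom])
 then have "Rone (exp w *\<^sub>C I) = Rone (rho w ((c * exp (al * w)) *\<^sub>C x - y))"
  unfolding Rone_scaleC Rone_rho[OF w(1)] by (simp add: rho_def)
 then have "exp w *\<^sub>C I = rho w ((c * exp (al * w)) *\<^sub>C x - y)" by (rule Rone_inj)
 then show ?thesis
  using bounded_linear_rho[OF w(1)] by (simp add: I_def c_def linear_diff[OF bounded_linear.linear] rho_scaleC[OF w(1)])
qed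

end

context sector_calculus
begin

text \<open>For fixed \<open>ta\<close> the kernel is a scalar holomorphic function of
  \<open>w\<close>, and \<open>U ta\<close> does not depend on \<open>w\<close>. After Fubini,
  Cauchy's theorem applies to the scalar integral.\<close>

lemma transform_line_invariant:
 fixes U :: "real => 'a"
 assumes al: "0 < Re al" "Re al < 1"
  and U: "cont U" and B: "!!ta. norm (U ta) <= B"
 defines "I \<equiv> %w. IU (%ta. (exp (of_real ta * (2 - 2 * al)) * nb al ta w) *\<^sub>C U ta)"
 shows "IU (%s. (exp (Complex s ph) / (1 + exp (Complex s ph))) *\<^sub>C I (Complex s ph))
  = IU (%s. (exp (Complex s (- ph)) / (1 + exp (Complex s (- ph)))) *\<^sub>C I (Complex s (- ph)))"
proof -
 let ?m = "min (Re al) (1 - Re al)"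
 have m: "?m > 0" using al by auto
 have B0: "B \<ge> 0" using order_trans[OF norm_ge_zero B] .
 obtain C where C: "0 < C" "!!ta w. \<bar>Im w\<bar> <= ph ==>
  cmod (exp (of_real ta * (2 - 2 * al)) * nb al ta w)
   <= C * exp (- (1 - Re al) * Re w) * exp (- ?m * \<bar>ta + Re w / 2\<bar>)"
  using nbessel_power_bound[OF al, of ph] ph ph_pos by (metis less_imp_le)
 obtain kp where kp: "0 < kp"
  "!!w. \<bar>Im w\<bar> <= ph ==> 1 + exp w ~= 0 \<and> kp * exp (Re w) <= cmod (1 + exp w) \<and> kp <= cmod (1 + exp w)"
  using one_plus_exp_bounds[OF ph_pos ph(2)] by blast
 let ?k = "%ta w. exp (of_real ta * (2 - 2 * al)) * nb al ta w"
 let ?cx = "%w. exp w / (1 + exp w) :: complex"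
 have kb: "cmod (?cx w * ?k ta w) <= (C / kp) * exp (- (?m / 2) * \<bar>Re w\<bar>) * exp (- (?m / 2) * \<bar>ta\<bar>)"
  if w: "\<bar>Im w\<bar> <= ph" for w ta
 proof -
  have cx: "cmod (?cx w) <= 1 / kp * min 1 (exp (Re w))"
  proof -
   have "cmod (1 + exp w) > 0" using kp(2)[OF w] by simp
   then have "cmod (?cx w) <= 1 / kp" "cmod (?cx w) <= exp (Re w) / kp"
    using kp(1) kp(2)[OF w] by (auto simp: norm_divide field_simps mult_right_mono)
   then show ?thesis by (simp add: min_def)
  qed
  have "min 1 (exp (Re w)) * exp (- (1 - Re al) * Re w) = min (exp (Re al * Re w)) (exp ((Re al - 1) * Re w))"
   by (auto simp: min_def mult_exp_exp algebra_simps)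
  then have mm: "min 1 (exp (Re w)) * exp (- (1 - Re al) * Re w) <= exp (- ?m * \<bar>Re w\<bar>)"
   using exp_decay_two_sided[OF al, of "Re w"] by simp
  have "\<bar>ta\<bar> <= \<bar>ta + Re w / 2\<bar> + \<bar>Re w\<bar> / 2" by linarith
  then have "?m * \<bar>ta\<bar> <= ?m * (\<bar>ta + Re w / 2\<bar> + \<bar>Re w\<bar> / 2)" using m by (intro mult_left_mono) auto
  moreover have "0 <= ?m * \<bar>ta\<bar>" "0 <= ?m * \<bar>Re w\<bar>" using m by simp_all
  ultimately have le: "- ?m * \<bar>Re w\<bar> + - ?m * \<bar>ta + Re w / 2\<bar> <= - (?m / 2) * \<bar>Re w\<bar> + - (?m / 2) * \<bar>ta\<bar>"
   by (simp add: distrib_left)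
  have "cmod (?cx w * ?k ta w) <= (1 / kp * min 1 (exp (Re w))) * (C * exp (- (1 - Re al) * Re w) * exp (- ?m * \<bar>ta + Re w / 2\<bar>))"
   unfolding norm_mult[of "?cx w"] using kp(1) by (intro mult_mono cx C(2) w) auto
  also have "... = (C / kp) * ((min 1 (exp (Re w)) * exp (- (1 - Re al) * Re w)) * exp (- ?m * \<bar>ta + Re w / 2\<bar>))"
   by (simp only: divide_inverse mult_ac mult_1_left)
  also have "... <= (C / kp) * (exp (- ?m * \<bar>Re w\<bar>) * exp (- ?m * \<bar>ta + Re w / 2\<bar>))"
   using mm C(1) kp(1) by (intro mult_left_mono mult_right_mono) auto
  also have "... <= (C / kp) * (exp (- (?m / 2) * \<bar>Re w\<bar>) * exp (- (?m / 2) * \<bar>ta\<bar>))"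
   unfolding mult_exp_exp using le C(1) kp(1) by (intro mult_left_mono) auto
  finally show ?thesis by (simp only: mult.assoc)
 qed
 have sd: "strip_decay ph (%w. ?cx w * ?k ta w)" for ta
 proof (rule strip_decayI)
  show "{w. \<bar>Im w\<bar> <= ph} \<subseteq> {w. \<bar>Im w\<bar> < pi} \<inter> {w. 1 + exp w ~= 0}" using ph(2) kp(2) by auto
  show "open ({w. \<bar>Im w\<bar> < pi} \<inter> {w. 1 + exp w ~= (0::complex)})"
   by (intro open_Int open_Collect_less open_Collect_neq continuous_intros)
  have "(%w. nb al ta w) holomorphic_on {w. \<bar>Im w\<bar> < pi} \<inter> {w. 1 + exp w ~= 0}"
   by (rule holomorphic_on_compose_gen[OF _ nbessel_holomorphic[OF al], unfolded o_def]) (auto intro!: holomorphic_intros)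
  then show "(%w. ?cx w * ?k ta w) holomorphic_on {w. \<bar>Im w\<bar> < pi} \<inter> {w. 1 + exp w ~= 0}"
   by (intro holomorphic_on_mult) (auto intro!: holomorphic_intros)
  show "?m / 2 > 0" using m by simp
  show "cmod (?cx w * ?k ta w) <= ((C / kp) * exp (- (?m / 2) * \<bar>ta\<bar>)) * exp (- (?m / 2) * \<bar>Re w\<bar>)" if "\<bar>Im w\<bar> <= ph" for w
   using kb[OF that, of ta] by (simp only: mult_ac)
 qed
 have swap: "IU (%s. ?cx (Complex s ps) *\<^sub>C I (Complex s ps))
  = IU (%ta. IU (%s. ?cx (Complex s ps) * ?k ta (Complex s ps)) *\<^sub>C U ta)" if ps: "\<bar>ps\<bar> = ph" for ps
 proof -
  have nz: "1 + exp (Complex s ps) ~= 0" for s using kp(2)[of "Complex s ps"] ps by simp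
  let ?h = "%s ta. (?cx (Complex s ps) * ?k ta (Complex s ps)) *\<^sub>C U ta"
  have hb: "norm (?h s ta) <= (C / kp * B) * exp (- (?m / 2) * \<bar>s\<bar>) * exp (- (?m / 2) * \<bar>ta\<bar>)" for s ta
  proof -
   have "norm (?h s ta) <= ((C / kp) * exp (- (?m / 2) * \<bar>s\<bar>) * exp (- (?m / 2) * \<bar>ta\<bar>)) * B"
    unfolding norm_scaleC using kb[of "Complex s ps" ta] ps C(1) kp(1) by (intro mult_mono B) auto
   then show ?thesis by (simp only: mult_ac)
  qed
  have imz: "\<bar>Im (of_real t + Complex s ps / 2)\<bar> < pi / 2" for t s using ps ph(2) by simp
  have c2: "cont (%p. ?h (fst p) (snd p))"
   using nz by (intro continuous_on_scaleC continuous_on_mult continuous_on_compose2[OF U] nbessel_continuous_shift[OF al] imz continuous_intros) auto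
  have ck: "cont (%ta. ?k ta (Complex s ps) *\<^sub>C U ta)" for s
   by (intro continuous_on_scaleC continuous_on_mult U nbessel_continuous_shift[OF al] imz continuous_intros)
  have "?cx (Complex s ps) *\<^sub>C I (Complex s ps) = IU (?h s)" for s
  proof -
   have i: "(%ta. ?k ta (Complex s ps) *\<^sub>C U ta) integrable_on UNIV"
   proof (rule exp_decay_integrable(1)[OF _ m])
    show "cont (%ta. ?k ta (Complex s ps) *\<^sub>C U ta)" by (rule ck)
    fix ta
    have "norm (?k ta (Complex s ps) *\<^sub>C U ta) <= (C * exp (- (1 - Re al) * s) * exp (- ?m * \<bar>ta + s / 2\<bar>)) * B"
     unfolding norm_scaleC using C(2)[of "Complex s ps" ta] ps C(1) by (intro mult_mono B) auto
    then show "norm (?k ta (Complex s ps) *\<^sub>C U ta) <= (C * exp (- (1 - Re al) * s) * B) * exp (- ?m * \<bar>ta - (- s / 2)\<bar>)"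
     by (simp add: mult_ac)
   qed
   show ?thesis unfolding I_def by (simp only: integral_scaleC[OF i, symmetric] scaleC_scaleC)
  qed
  then have "IU (%s. ?cx (Complex s ps) *\<^sub>C I (Complex s ps)) = IU (%s. IU (?h s))" by simp
  also have "... = IU (%ta. IU (%s. ?h s ta))"
   by (rule exp_decay_swap[where ep = "?m / 2" and C = "C / kp * B"])
    (use c2 hb m C(1) kp(1) B0 in \<open>auto simp: case_prod_unfold\<close>)
  also have "... = IU (%ta. IU (%s. ?cx (Complex s ps) * ?k ta (Complex s ps)) *\<^sub>C U ta)"
  proof (rule integral_cong)
   fix ta
   have "(%s. ?cx (Complex s ps) * ?k ta (Complex s ps)) integrable_on UNIV"
   proof (rule exp_decay_integrable(1))
    show "cont (%s. ?cx (Complex s ps) * ?k ta (Complex s ps))" by (rule strip_decay_continuous[OF sd]) (use ps in simp)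
    show "cmod (?cx (Complex s ps) * ?k ta (Complex s ps)) <= (C / kp * exp (- (?m / 2) * \<bar>ta\<bar>)) * exp (- (?m / 2) * \<bar>s - 0\<bar>)" for s
     using kb[of "Complex s ps" ta] ps by (simp add: mult_ac)
   qed (use m in simp)
   from integral_linear[OF this scaleC.bounded_linear_left[of "U ta"]]
   show "IU (%s. ?h s ta) = IU (%s. ?cx (Complex s ps) * ?k ta (Complex s ps)) *\<^sub>C U ta"
    by (simp add: o_def)
  qed
  finally show ?thesis .
 qed
 have "\<bar>ph\<bar> = ph" "\<bar>- ph\<bar> = ph" using ph_pos by auto
 from swap[OF this(1)] swap[OF this(2)] show ?thesis
  using strip_decay_Cauchy[OF sd less_imp_le[OF ph_pos]] by simp
qed

text \<open>The transform identity is divided by \<open>1 + exp w\<close> and integrated over both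
  lines. The transform itself cancels by line invariance; what remains is \<open>c\<close> times the
  regularised power of \<open>A\<close> at \<open>x\<close> on one side and the integral of
  \<open>1 / (1 + exp w)\<close> at \<open>y\<close> on the other.\<close>

lemma Neumann_limit_imp_power:
 assumes al: "0 < Re al" "Re al < 1" and y: "Neumann_limit A al x y"
 shows "dtn_const al *\<^sub>C calc (%w. exp (al * w) / (1 + exp w)) x = Rone y"
proof -
 obtain u where u: "is_solution A al x u"
  and lim: "((%t. - (cr t powr (1 - 2 * al) *\<^sub>C vector_derivative u (at t))) \<longlongrightarrow> y) (at_right 0)"
  using y unfolding Neumann_limit_def by blast
 obtain P where dU: "!!ta. ((%ta. u (exp ta)) hvd exp (2 * al * of_real ta) *\<^sub>C P ta) (at ta)"
  and dP: "!!ta. ((%ta. Rone (P ta)) hvd exp (of_real ta * (2 - 2 * al)) *\<^sub>C (u (exp ta) - Rone (u (exp ta)))) (at ta)"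
  by (rule solution_regularity[OF u al(1)]) blast
 let ?U = "%ta. u (exp ta)"
 have cU: "cont ?U" using dU by (intro continuous_at_imp_continuous_on ballI has_vector_derivative_continuous) auto
 have "bounded (u ` {0..})" using u unfolding is_solution_def by blast
 then obtain B where "!!t. t \<ge> 0 ==> norm (u t) <= B" unfolding bounded_iff by auto
 then have B: "norm (?U ta) <= B" for ta by simp
 have B0: "B \<ge> 0" using order_trans[OF norm_ge_zero B] .
 have "(u \<longlongrightarrow> u 0) (at 0 within {0..})" using u unfolding is_solution_def continuous_on_def by auto
 then have "(u \<longlongrightarrow> x) (at_right 0)" using u unfolding is_solution_def by (auto intro: tendsto_within_subset)
 then have Ux: "(?U \<longlongrightarrow> x) at_bot" by (rule filterlim_compose[OF _ filterlim_exp_at_right_0])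
 have "((%ta. - P ta) \<longlongrightarrow> y) at_bot"
  using filterlim_compose[OF lim filterlim_exp_at_right_0] unfolding vector_derivative_log(2)[OF dU] .
 then have Py: "(P \<longlongrightarrow> - y) at_bot" by (simp add: tendsto_minus_cancel_left)
 define c where "c = dtn_const al"
 define I where "I w = IU (%ta. (exp (of_real ta * (2 - 2 * al)) * nb al ta w) *\<^sub>C ?U ta)" for w
 have id: "exp (Complex s ps) *\<^sub>C I (Complex s ps) = (c * exp (al * Complex s ps)) *\<^sub>C rho (Complex s ps) x - rho (Complex s ps) y"
  if "\<bar>ps\<bar> = ph" for s ps
  unfolding I_def c_def by (rule transform_identity[OF al that cU B Ux Py dU dP])
 let ?m = "min (Re al) (1 - Re al)"
 have m: "?m > 0" using al by auto
 obtain C where C: "0 < C" "!!ta w. \<bar>Im w\<bar> <= ph ==>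
  cmod (exp (of_real ta * (2 - 2 * al)) * nb al ta w)
   <= C * exp (- (1 - Re al) * Re w) * exp (- ?m * \<bar>ta + Re w / 2\<bar>)"
  using nbessel_power_bound[OF al, of ph] ph ph_pos by (metis less_imp_le)
 have Ib: "norm (I (Complex s ps)) <= (C * exp (- (1 - Re al) * s) * B) * (2 / ?m)" if ps: "\<bar>ps\<bar> = ph" for s ps
  unfolding I_def
 proof (rule exp_decay_integrable(2)[OF _ m, where x = "- s / 2"])
  have imz: "\<bar>Im (of_real t + Complex s ps / 2)\<bar> < pi / 2" for t using ps ph(2) by simp
  show "cont (%ta. (exp (of_real ta * (2 - 2 * al)) * nbessel al (of_real ta + Complex s ps / 2)) *\<^sub>C ?U ta)"
   by (intro continuous_on_scaleC continuous_on_mult cU nbessel_continuous_shift[OF al] imz continuous_intros)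
  fix ta
  have "norm ((exp (of_real ta * (2 - 2 * al)) * nbessel al (of_real ta + Complex s ps / 2)) *\<^sub>C ?U ta)
   <= (C * exp (- (1 - Re al) * s) * exp (- ?m * \<bar>ta + s / 2\<bar>)) * B"
   unfolding norm_scaleC using C(2)[of "Complex s ps" ta] ps C(1) by (intro mult_mono B) auto
  then show "norm ((exp (of_real ta * (2 - 2 * al)) * nbessel al (of_real ta + Complex s ps / 2)) *\<^sub>C ?U ta)
   <= (C * exp (- (1 - Re al) * s) * B) * exp (- ?m * \<bar>ta - (- s / 2)\<bar>)" by (simp add: mult_ac)
 qed
 define D where "D = cmod c * exp (\<bar>Im al\<bar> * ph) * (M * norm x) + C * B * (2 / ?m)"
 have D0: "D \<ge> 0" unfolding D_def using M C(1) B0 m by (intro add_nonneg_nonneg mult_nonneg_nonneg) auto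
 \<comment> \<open>The transform identity is read backwards: the terms with \<open>x\<close> and
   with the transform are both of size \<open>exp (Re al * s)\<close>. This decay on the left is
   what makes the symbol \<open>1 / (1 + exp w)\<close> admissible at \<open>y\<close>.\<close>
 have yb: "norm (rho (Complex s ps) y) <= D * exp (Re al * s)" if ps: "\<bar>ps\<bar> = ph" for s ps
 proof -
  let ?w = "Complex s ps"
  have "rho ?w y = (c * exp (al * ?w)) *\<^sub>C rho ?w x - exp ?w *\<^sub>C I ?w" using id[OF ps, of s] by (simp add: algebra_simps)
  then have "norm (rho ?w y) <= cmod c * cmod (exp (al * ?w)) * norm (rho ?w x) + exp s * norm (I ?w)"
   using norm_triangle_ineq4[of "(c * exp (al * ?w)) *\<^sub>C rho ?w x" "exp ?w *\<^sub>C I ?w"] by (simp add: norm_scaleC norm_mult norm_exp_eq_Re)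
  also have "... <= cmod c * (exp (\<bar>Im al\<bar> * ph) * exp (Re al * s)) * (M * norm x) + exp s * ((C * exp (- (1 - Re al) * s) * B) * (2 / ?m))"
  proof (intro add_mono mult_mono mult_left_mono)
   show "cmod (exp (al * ?w)) <= exp (\<bar>Im al\<bar> * ph) * exp (Re al * s)"
    using norm_exp_mult_le[of ?w ph al] ps by simp
   show "norm (rho ?w x) <= M * norm x" by (rule norm_rho[OF outer_line[OF ps]])
   show "norm (I ?w) <= (C * exp (- (1 - Re al) * s) * B) * (2 / ?m)" by (rule Ib[OF ps])
  qed (use M in auto)
  also have "... = cmod c * exp (\<bar>Im al\<bar> * ph) * (M * norm x) * exp (Re al * s) + (C * B * (2 / ?m)) * (exp s * exp (- (1 - Re al) * s))"
   by (simp only: mult_ac)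
  also have "exp s * exp (- (1 - Re al) * s) = exp (Re al * s)" unfolding mult_exp_exp by (simp add: algebra_simps)
  finally show ?thesis by (simp only: D_def distrib_right)
 qed
 have y1: "calc (%w. 1 / (1 + exp w)) y = Rone y"
  by (rule calc_one_over_one_plus[OF al(1) D0 yb]) (use ph_pos in simp)
 obtain kp where kp: "0 < kp"
  "!!w. \<bar>Im w\<bar> <= ph ==> 1 + exp w ~= 0 \<and> kp * exp (Re w) <= cmod (1 + exp w) \<and> kp <= cmod (1 + exp w)"
  using one_plus_exp_bounds[OF ph_pos ph(2)] by blast
 let ?F = "%w. exp (al * w) / (1 + exp w)"
 have F: "line_decay ?F" by (rule strip_line_decay[OF strip_decay_power_one[OF al ph_pos ph(2)]])
 have L: "IU (%s. (exp (Complex s ps) / (1 + exp (Complex s ps))) *\<^sub>C I (Complex s ps))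
  = c *\<^sub>C line ps ?F x - line ps (%w. 1 / (1 + exp w)) y" if ps: "\<bar>ps\<bar> = ph" for ps
 proof -
  have nz: "1 + exp (Complex s ps) ~= 0" for s using kp(2)[of "Complex s ps"] ps by simp
  have eq: "(exp (Complex s ps) / (1 + exp (Complex s ps))) *\<^sub>C I (Complex s ps)
   = c *\<^sub>C (?F (Complex s ps) *\<^sub>C rho (Complex s ps) x) - (1 / (1 + exp (Complex s ps))) *\<^sub>C rho (Complex s ps) y" for s
  proof -
   have "(exp (Complex s ps) / (1 + exp (Complex s ps))) *\<^sub>C I (Complex s ps)
    = (1 / (1 + exp (Complex s ps))) *\<^sub>C exp (Complex s ps) *\<^sub>C I (Complex s ps)" by (simp add: scaleC_scaleC)
   then show ?thesis unfolding id[OF ps] by (simp add: scaleC.diff_right scaleC_scaleC)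
  qed
  have i1: "(%s. ?F (Complex s ps) *\<^sub>C rho (Complex s ps) x) integrable_on UNIV" by (rule line_integrable[OF F ps])
  have i1': "(%s. c *\<^sub>C (?F (Complex s ps) *\<^sub>C rho (Complex s ps) x)) integrable_on UNIV"
   using integrable_linear[OF i1 scaleC.bounded_linear_right[of c]] by (simp add: o_def)
  have i2: "(%s. (1 / (1 + exp (Complex s ps))) *\<^sub>C rho (Complex s ps) y) integrable_on UNIV"
  proof (rule exp_decay_integrable(1)[OF _ m, where x = 0])
   show "cont (%s. (1 / (1 + exp (Complex s ps))) *\<^sub>C rho (Complex s ps) y)"
    by (intro continuous_on_scaleC continuous_rho_line ps continuous_intros) (use nz in auto)
   fix s
   let ?w = "Complex s ps"
   have p: "cmod (1 + exp ?w) > 0" using nz by simp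
   have "kp * exp s <= cmod (1 + exp ?w)" "kp <= cmod (1 + exp ?w)" using kp(2)[of ?w] ps by auto
   then have "cmod (1 / (1 + exp ?w)) <= 1 / kp" "cmod (1 / (1 + exp ?w)) <= 1 / kp * exp (- s)"
    using kp(1) p by (auto simp: norm_divide exp_minus field_simps)
   then have b1: "cmod (1 / (1 + exp ?w)) <= 1 / kp * min 1 (exp (- s))" by (simp add: min_def)
   have "min 1 (exp (- s)) * exp (Re al * s) = min (exp (Re al * s)) (exp ((Re al - 1) * s))"
    by (auto simp: min_def mult_exp_exp algebra_simps)
   then have mm: "min 1 (exp (- s)) * exp (Re al * s) <= exp (- ?m * \<bar>s\<bar>)"
    using exp_decay_two_sided[OF al, of s] by simp
   have "norm ((1 / (1 + exp ?w)) *\<^sub>C rho ?w y) <= (1 / kp * min 1 (exp (- s))) * (D * exp (Re al * s))"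
    unfolding norm_scaleC using kp(1) by (intro mult_mono b1 yb ps) auto
   also have "... = (1 / kp * D) * (min 1 (exp (- s)) * exp (Re al * s))" by (simp only: mult_ac)
   also have "... <= (1 / kp * D) * exp (- ?m * \<bar>s\<bar>)" using mm kp(1) D0 by (intro mult_left_mono) auto
   finally show "norm ((1 / (1 + exp ?w)) *\<^sub>C rho ?w y) <= (1 / kp * D) * exp (- ?m * \<bar>s - 0\<bar>)" by simp
  qed
  show ?thesis unfolding eq line_def integral_diff[OF i1' i2] integral_scaleC[OF i1] ..
 qed
 have pha: "\<bar>ph\<bar> = ph" "\<bar>- ph\<bar> = ph" using ph_pos by auto
 have "c *\<^sub>C line ph ?F x - line ph (%w. 1 / (1 + exp w)) y = c *\<^sub>C line (- ph) ?F x - line (- ph) (%w. 1 / (1 + exp w)) y"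
  using transform_line_invariant[OF al cU B] L[OF pha(1)] L[OF pha(2)] by (simp add: I_def)
 then have "c *\<^sub>C (line (- ph) ?F x - line ph ?F x) = line (- ph) (%w. 1 / (1 + exp w)) y - line ph (%w. 1 / (1 + exp w)) y"
  by (simp add: scaleC.diff_right algebra_simps)
 then have "(1 / (2 * of_real pi * \<i>)) *\<^sub>C c *\<^sub>C (line (- ph) ?F x - line ph ?F x) = calc (%w. 1 / (1 + exp w)) y"
  unfolding calc_def by simp
 then have "c *\<^sub>C calc ?F x = calc (%w. 1 / (1 + exp w)) y" unfolding calc_def by (simp add: scaleC_scaleC mult_ac)
 then show ?thesis unfolding y1 c_def .
qed

end

section \<open>Decay of the Bessel symbols on the contour\<close>

lemma nbessel_weighted_bound:
 assumes nu: "0 < Re nu" "Re nu < 1" and be: "0 < Re be" "Re be < 2" and b: "0 <= b" "b < pi"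
 obtains C where "0 < C" "!!ta w. \<bar>Im w\<bar> <= b ==>
  cmod (exp (be * w) * nb nu ta w) <= C * (1 + exp (- 4 * ta)) * exp (- min (Re be) (2 - Re be) * \<bar>Re w\<bar>)"
proof -
 let ?m = "min (Re be) (2 - Re be)"
 obtain D where D: "0 < D" "!!ze k. \<bar>Im ze\<bar> <= b / 2 ==> 0 <= k ==> k <= 4 ==> cmod (nbessel nu ze) <= D * exp (- k * Re ze)"
  by (rule nbessel_decay[OF nu, of "b / 2" 4]) (use b in auto)
 define E where "E = exp (\<bar>Im be\<bar> * b)"
 show ?thesis
 proof (rule that[of "E * D"])
  show "E * D > 0" using D(1) by (simp add: E_def)
  fix ta :: real and w assume w: "\<bar>Im w\<bar> <= b"
  let ?z = "of_real ta + w / 2"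
  have z: "\<bar>Im ?z\<bar> <= b / 2" using w by simp
  have e: "cmod (exp (be * w)) <= E * exp (Re be * Re w)" unfolding E_def by (rule norm_exp_mult_le[OF w])
  show "cmod (exp (be * w) * nbessel nu ?z) <= E * D * (1 + exp (- 4 * ta)) * exp (- ?m * \<bar>Re w\<bar>)"
  proof (cases "Re w \<ge> 0")
   case True
   \<comment> \<open>Decay of rate 4 gives \<open>exp (- 2 * Re w)\<close>, which beats
     \<open>exp (Re be * Re w)\<close> because \<open>Re be < 2\<close>; the price is the factor
     \<open>exp (- 4 * ta)\<close>.\<close>
   have "?m * Re w <= (2 - Re be) * Re w" using True by (intro mult_right_mono) auto
   then have le: "Re be * Re w + - 4 * (ta + Re w / 2) <= - 4 * ta + - ?m * \<bar>Re w\<bar>" using True by (simp add: left_diff_distrib)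
   have "cmod (exp (be * w) * nbessel nu ?z) <= (E * exp (Re be * Re w)) * (D * exp (- 4 * (ta + Re w / 2)))"
    unfolding norm_mult using D(2)[OF z, of 4] D(1) by (intro mult_mono e) (auto simp: E_def)
   also have "... = E * D * exp (Re be * Re w + - 4 * (ta + Re w / 2))" unfolding exp_add by simp
   also have "... <= E * D * exp (- 4 * ta + - ?m * \<bar>Re w\<bar>)" using le D(1) by (intro mult_left_mono) (auto simp: E_def)
   also have "... = E * D * exp (- 4 * ta) * exp (- ?m * \<bar>Re w\<bar>)" unfolding exp_add by simp
   also have "... <= E * D * (1 + exp (- 4 * ta)) * exp (- ?m * \<bar>Re w\<bar>)"
    using D(1) by (intro mult_right_mono mult_left_mono) (auto simp: E_def)
   finally show ?thesis .
  next
   case False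
   have "?m * (- Re w) <= Re be * (- Re w)" using False by (intro mult_right_mono) auto
   then have le: "Re be * Re w <= - ?m * \<bar>Re w\<bar>" using False by simp
   have "cmod (exp (be * w) * nbessel nu ?z) <= (E * exp (Re be * Re w)) * D"
    unfolding norm_mult using D(2)[OF z, of 0] by (intro mult_mono e) (auto simp: E_def)
   also have "... <= (E * exp (- ?m * \<bar>Re w\<bar>)) * D" using le D(1) by (intro mult_right_mono mult_left_mono) (auto simp: E_def)
   also have "... = E * D * 1 * exp (- ?m * \<bar>Re w\<bar>)" by simp
   also have "... <= E * D * (1 + exp (- 4 * ta)) * exp (- ?m * \<bar>Re w\<bar>)"
    using D(1) by (intro mult_right_mono mult_left_mono) (auto simp: E_def)
   finally show ?thesis .
  qed
 qed
qed

lemma nbessel_shift_holomorphic: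
 assumes nu: "0 < Re nu" "Re nu < 1"
 shows "(%w. nb nu ta w) holomorphic_on {w. \<bar>Im w\<bar> < pi}"
 by (rule holomorphic_on_compose_gen[OF _ nbessel_holomorphic[OF nu], unfolded o_def]) (auto intro!: holomorphic_intros)

lemma open_strip: "open {w. \<bar>Im w\<bar> < b}"
 by (intro open_Collect_less continuous_intros)

lemma nbessel_weighted_strip_decay:
 assumes nu: "0 < Re nu" "Re nu < 1" and be: "0 < Re be" "Re be < 2" and b: "0 <= b" "b < pi"
 shows "strip_decay b (%w. exp (be * w) * nb nu ta w)"
proof -
 obtain C where C: "0 < C" "!!ta w. \<bar>Im w\<bar> <= b ==>
  cmod (exp (be * w) * nb nu ta w) <= C * (1 + exp (- 4 * ta)) * exp (- min (Re be) (2 - Re be) * \<bar>Re w\<bar>)"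
  by (rule nbessel_weighted_bound[OF nu be b]) blast
 show ?thesis
 proof (rule strip_decayI[OF _ open_strip[of pi] _ _ C(2)])
  show "(%w. exp (be * w) * nb nu ta w) holomorphic_on {w. \<bar>Im w\<bar> < pi}"
   by (intro holomorphic_on_mult nbessel_shift_holomorphic nu holomorphic_intros)
 qed (use be b in auto)
qed

text \<open>Both functions tend to 1 on the left and to 0 on the right, so their difference decays
  at both ends. The constant of the first estimate depends on \<open>ta\<close>; a further factor
  \<open>1 / (1 + exp w)\<close> makes the second one uniform for \<open>ta <= 0\<close>, as the
  passage to time 0 requires.\<close>

lemma nbessel_minus_bound:
 assumes nu: "0 < Re nu" "Re nu < 1" and b: "0 < b" "b < pi"
 obtains C where "0 < C" "!!ta w. \<bar>Im w\<bar> <= b ==>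
  cmod (nb nu ta w - 1 / (1 + exp w)) <= C * (1 + exp (- 2 * ta) + exp (2 * Re nu * ta)) * exp (- Re nu * \<bar>Re w\<bar>)"
  "!!ta w. \<bar>Im w\<bar> <= b ==> ta <= 0 ==>
  cmod ((nb nu ta w - 1 / (1 + exp w)) / (1 + exp w)) <= C * exp (- Re nu * \<bar>Re w\<bar>)"
proof -
 obtain D where D: "0 < D" "!!ze k. \<bar>Im ze\<bar> <= b / 2 ==> 0 <= k ==> k <= 4 ==> cmod (nbessel nu ze) <= D * exp (- k * Re ze)"
  by (rule nbessel_decay[OF nu, of "b / 2" 4]) (use b in auto)
 obtain E where E: "0 < E" "!!ze. \<bar>Im ze\<bar> <= b / 2 ==> cmod (nbessel nu ze - 1) <= E * exp (2 * Re nu * Re ze)"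
  by (rule nbessel_near_0[OF nu, of "b / 2"]) (use b in auto)
 obtain kp where kp: "0 < kp"
  "!!w. \<bar>Im w\<bar> <= b ==> 1 + exp w ~= 0 \<and> kp * exp (Re w) <= cmod (1 + exp w) \<and> kp <= cmod (1 + exp w)"
  using one_plus_exp_bounds[OF b] by blast
 define i where "i = 1 / kp"
 define a1 a2 a3 where a: "a1 = D * i" "a2 = E * i" "a3 = i * i"
 define C where "C = 2 * D + 2 * E + 2 * a1 + a2 + 2 * i + 8 * a3"
 have k1: "i > 0" using kp(1) by (simp add: i_def)
 then have k2: "i * i > 0" by simp
 have prods: "D * i > 0" "E * i > 0" using D(1) E(1) k1 by auto
 have ap: "a1 > 0" "a2 > 0" "a3 > 0" using k2 prods by (auto simp: a)
 have C0: "C > 0" unfolding C_def using D(1) E(1) k1 ap by linarith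
 have inv: "cmod (1 / (1 + exp w)) <= i" "cmod (1 / (1 + exp w)) <= i * exp (- Re w)"
  "cmod (exp w / (1 + exp w)) <= i * exp (Re w)" "1 + exp w ~= 0" if "\<bar>Im w\<bar> <= b" for w
 proof -
  note k = kp(2)[OF that]
  have p: "cmod (1 + exp w) > 0" using k by simp
  show "cmod (1 / (1 + exp w)) <= i" "cmod (1 / (1 + exp w)) <= i * exp (- Re w)"
   using kp(1) p k by (auto simp: i_def norm_divide exp_minus field_simps)
  show "cmod (exp w / (1 + exp w)) <= i * exp (Re w)"
   using kp(1) p k by (auto simp: i_def norm_divide field_simps)
  show "1 + exp w ~= 0" using k by simp
 qed
 have ra: "exp s <= exp (Re nu * s)" if "s <= 0" for s
  using mult_right_mono_neg[OF less_imp_le[OF nu(2)] that] by simp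
 have ra': "exp (- s) <= exp (- Re nu * s)" if "s \<ge> 0" for s
  using mult_right_mono[OF less_imp_le[OF nu(2)] that] by simp
 show ?thesis
 proof (rule that[OF C0])
  fix ta :: real and w assume w: "\<bar>Im w\<bar> <= b"
  let ?z = "of_real ta + w / 2"
  let ?s = "Re w"
  have z: "\<bar>Im ?z\<bar> <= b / 2" using w by simp
  have X: "cmod (nbessel nu ?z - 1 / (1 + exp w)) <= (D * exp (- 2 * ta) + i) * exp (- Re nu * ?s)" if s: "?s \<ge> 0"
  proof -
   have "cmod (nbessel nu ?z - 1 / (1 + exp w)) <= D * exp (- 2 * (ta + ?s / 2)) + i * exp (- ?s)"
    using norm_triangle_ineq4[of "nbessel nu ?z" "1 / (1 + exp w)"] D(2)[OF z, of 2] inv(2)[OF w] by simp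
   also have "exp (- 2 * (ta + ?s / 2)) = exp (- 2 * ta) * exp (- ?s)" unfolding mult_exp_exp by simp
   also have "D * (exp (- 2 * ta) * exp (- ?s)) + i * exp (- ?s) = (D * exp (- 2 * ta) + i) * exp (- ?s)"
    by (simp only: distrib_right mult.assoc)
   also have "... <= (D * exp (- 2 * ta) + i) * exp (- Re nu * ?s)"
    using ra'[OF s] D(1) k1 by (intro mult_left_mono) auto
   finally show ?thesis .
  qed
  have Y: "cmod (nbessel nu ?z - 1 / (1 + exp w)) <= (E * exp (2 * Re nu * ta) + i) * exp (Re nu * ?s)" if s: "?s <= 0"
  proof -
   have eq: "nbessel nu ?z - 1 / (1 + exp w) = (nbessel nu ?z - 1) + exp w / (1 + exp w)" using inv(4)[OF w] by (simp add: field_simps)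
   have "cmod (nbessel nu ?z - 1 / (1 + exp w)) <= E * exp (2 * Re nu * (ta + ?s / 2)) + i * exp ?s"
    unfolding eq using norm_triangle_ineq[of "nbessel nu ?z - 1" "exp w / (1 + exp w)"] E(2)[OF z] inv(3)[OF w] by simp
   also have "exp (2 * Re nu * (ta + ?s / 2)) = exp (2 * Re nu * ta) * exp (Re nu * ?s)" unfolding mult_exp_exp by (simp add: algebra_simps)
   also have "E * (exp (2 * Re nu * ta) * exp (Re nu * ?s)) + i * exp ?s
    <= E * (exp (2 * Re nu * ta) * exp (Re nu * ?s)) + i * exp (Re nu * ?s)"
    using ra[OF s] k1 E(1) by (intro add_mono mult_left_mono) auto
   also have "... = (E * exp (2 * Re nu * ta) + i) * exp (Re nu * ?s)" by (simp only: distrib_right mult.assoc)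
   finally show ?thesis .
  qed
  have CDE: "D <= C" "E <= C" "i <= C" using D(1) E(1) k1 ap unfolding C_def a[symmetric] by linarith+
  show "cmod (nbessel nu ?z - 1 / (1 + exp w)) <= C * (1 + exp (- 2 * ta) + exp (2 * Re nu * ta)) * exp (- Re nu * \<bar>?s\<bar>)"
  proof -
   have h: "D * exp (- 2 * ta) <= C * exp (- 2 * ta)" "E * exp (2 * Re nu * ta) <= C * exp (2 * Re nu * ta)"
    by (intro mult_right_mono CDE exp_ge_zero)+
   have p: "C * exp (- 2 * ta) > 0" "C * exp (2 * Re nu * ta) > 0" using C0 by simp_all
   have "D * exp (- 2 * ta) + i <= C * (1 + exp (- 2 * ta) + exp (2 * Re nu * ta))"
    "E * exp (2 * Re nu * ta) + i <= C * (1 + exp (- 2 * ta) + exp (2 * Re nu * ta))"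
    unfolding distrib_left mult_1_right using h p CDE(3) by linarith+
   then show ?thesis using X Y
    by (cases "?s \<ge> 0") (auto intro: order_trans[OF _ mult_right_mono[OF _ exp_ge_zero]])
  qed
  show "cmod ((nbessel nu ?z - 1 / (1 + exp w)) / (1 + exp w)) <= C * exp (- Re nu * \<bar>?s\<bar>)" if ta: "ta <= 0"
  proof (cases "?s \<ge> 0")
   case True
   have "cmod (nbessel nu ?z - 1 / (1 + exp w)) <= D + i"
    using norm_triangle_ineq4[of "nbessel nu ?z" "1 / (1 + exp w)"] D(2)[OF z, of 0] inv(1)[OF w] by simp
   then have "cmod (nbessel nu ?z - 1 / (1 + exp w)) * cmod (1 / (1 + exp w)) <= (D + i) * (i * exp (- ?s))"
    using inv(2)[OF w] D(1) k1 by (intro mult_mono) auto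
   also have "... = (D * i + i * i) * exp (- ?s)" by (simp add: distrib_right)
   also have "... <= C * exp (- Re nu * ?s)"
    using D(1) E(1) k1 ap unfolding C_def a[symmetric] by (intro mult_mono ra'[OF True]) auto
   finally show ?thesis using True by (simp add: norm_divide)
  next
   case False
   have "exp (2 * Re nu * ta) <= 1" using ta nu(1) by (simp add: mult_nonneg_nonpos)
   then have "E * exp (2 * Re nu * ta) <= E" using E(1) by (simp add: mult_le_cancel_left1)
   then have "(E * exp (2 * Re nu * ta) + i) * exp (Re nu * ?s) <= (E + i) * exp (Re nu * ?s)"
    by (intro mult_right_mono) auto
   then have "cmod (nbessel nu ?z - 1 / (1 + exp w)) <= (E + i) * exp (Re nu * ?s)"
    using Y False by linarith
   then have "cmod (nbessel nu ?z - 1 / (1 + exp w)) * cmod (1 / (1 + exp w)) <= ((E + i) * exp (Re nu * ?s)) * i"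
    using inv(1)[OF w] E(1) k1 by (intro mult_mono) auto
   also have "... = (E * i + i * i) * exp (Re nu * ?s)" by (simp add: algebra_simps)
   also have "... <= C * exp (Re nu * ?s)"
    using D(1) E(1) k1 ap unfolding C_def a[symmetric] by (intro mult_right_mono) auto
   finally show ?thesis using False by (simp add: norm_divide)
  qed
 qed
qed

text \<open>\<open>nb nu ta w\<close> depends on \<open>ta\<close> only through
  \<open>w + 2 * ta\<close>. When the rational function is translated along, the whole symbol is a
  translate of its value at \<open>ta = 0\<close>, so the constant does not depend on
  \<open>ta\<close>.\<close>

lemma nbessel_minus_shift:
 assumes nu: "0 < Re nu" "Re nu < 1" and b: "0 < b" "b < pi"
 obtains C where "0 < C" "!!ta w. \<bar>Im w\<bar> <= b ==>
   cmod (nb nu ta w - 1 / (1 + exp (w + of_real (2 * ta)))) <= C * exp (- Re nu * \<bar>Re w + 2 * ta\<bar>)"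
  "!!ta. strip_decay b (%w. nb nu ta w - 1 / (1 + exp (w + of_real (2 * ta))))"
proof -
 obtain C where C: "0 < C" "!!ta w. \<bar>Im w\<bar> <= b ==>
  cmod (nb nu ta w - 1 / (1 + exp w)) <= C * (1 + exp (- 2 * ta) + exp (2 * Re nu * ta)) * exp (- Re nu * \<bar>Re w\<bar>)"
  by (rule nbessel_minus_bound[OF nu b]) blast
 obtain kp where kp: "!!w. \<bar>Im w\<bar> <= b ==> 1 + exp w ~= 0" using one_plus_exp_bounds[OF b] by blast
 \<comment> \<open>The factor 3 is \<open>1 + exp (- 2 * ta) + exp (2 * Re nu * ta)\<close> at
   \<open>ta = 0\<close>.\<close>
 have gb: "cmod (nb nu ta w - 1 / (1 + exp (w + of_real (2 * ta)))) <= (C * 3) * exp (- Re nu * \<bar>Re w + 2 * ta\<bar>)"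
  if w: "\<bar>Im w\<bar> <= b" for ta w
 proof -
  have e: "of_real 0 + (w + of_real (2 * ta)) / 2 = of_real ta + w / 2" by (simp add: complex_eq_iff)
  show ?thesis using C(2)[of "w + of_real (2 * ta)" 0, unfolded e] w by simp
 qed
 show ?thesis
 proof (rule that[OF _ gb])
  show "0 < C * 3" using C(1) by simp
  fix ta :: real
  let ?S = "{w. \<bar>Im w\<bar> < pi} \<inter> {w. 1 + exp (w + of_real (2 * ta)) ~= 0}"
  show "strip_decay b (%w. nb nu ta w - 1 / (1 + exp (w + of_real (2 * ta))))"
  proof (rule strip_decayI[of _ ?S, OF _ _ _ nu(1)])
   show "(%w. nb nu ta w - 1 / (1 + exp (w + of_real (2 * ta)))) holomorphic_on ?S"
    by (intro holomorphic_on_diff holomorphic_on_subset[OF nbessel_shift_holomorphic[OF nu]] holomorphic_intros) auto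
   show "open ?S" by (intro open_Int open_strip open_Collect_neq continuous_intros)
   show "{w. \<bar>Im w\<bar> <= b} \<subseteq> ?S" using b(2) kp[of "_ + of_real (2 * ta)"] by auto
   fix w assume w: "\<bar>Im w\<bar> <= b"
   have "\<bar>Re w\<bar> <= \<bar>Re w + 2 * ta\<bar> + 2 * \<bar>ta\<bar>" by linarith
   then have "Re nu * \<bar>Re w\<bar> <= Re nu * (\<bar>Re w + 2 * ta\<bar> + 2 * \<bar>ta\<bar>)" using nu(1) by (intro mult_left_mono) auto
   then have le: "exp (- Re nu * \<bar>Re w + 2 * ta\<bar>) <= exp (2 * Re nu * \<bar>ta\<bar>) * exp (- Re nu * \<bar>Re w\<bar>)"
    unfolding mult_exp_exp by (simp add: distrib_left mult_ac)
   note gb[OF w, of ta]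
   also have "(C * 3) * exp (- Re nu * \<bar>Re w + 2 * ta\<bar>) <= (C * 3) * (exp (2 * Re nu * \<bar>ta\<bar>) * exp (- Re nu * \<bar>Re w\<bar>))"
    using le C(1) by (intro mult_left_mono) auto
   finally show "cmod (nb nu ta w - 1 / (1 + exp (w + of_real (2 * ta)))) <= (C * 3 * exp (2 * Re nu * \<bar>ta\<bar>)) * exp (- Re nu * \<bar>Re w\<bar>)"
    by (simp only: mult.assoc)
  qed
 qed
qed

lemma strip_decay_div_one_plus:
 assumes F: "strip_decay b F" and b: "0 < b" "b < pi"
 shows "strip_decay b (%w. F w / (1 + exp w))"
proof -
 obtain kp where kp: "0 < kp"
  "!!w. \<bar>Im w\<bar> <= b ==> 1 + exp w ~= 0 \<and> kp * exp (Re w) <= cmod (1 + exp w) \<and> kp <= cmod (1 + exp w)"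
  using one_plus_exp_bounds[OF b] by blast
 have "strip_decay b (%w. F w * (1 / (1 + exp w)))"
 proof (rule strip_decay_mult_bounded[OF F, of _ "{w. 1 + exp w ~= 0}"])
  show "(%w. 1 / (1 + exp w)) holomorphic_on {w. 1 + exp w ~= 0}" by (intro holomorphic_intros) auto
  show "open {w. 1 + exp w ~= (0::complex)}" by (intro open_Collect_neq continuous_intros)
  show "{w. \<bar>Im w\<bar> <= b} \<subseteq> {w. 1 + exp w ~= 0}" using kp(2) by auto
  show "cmod (1 / (1 + exp w)) <= 1 / kp" if "\<bar>Im w\<bar> <= b" for w
   using kp(1) kp(2)[OF that] by (auto simp: norm_divide field_simps)
 qed
 then show ?thesis by simp
qed

section \<open>The solution as a contour integral, and the equation it satisfies\<close>

context sector_calculus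
begin

text \<open>Differentiation under the contour integral is obtained from integration: the exchange of
  integrals shows that the contour integral of \<open>F\<close> is a primitive of the continuous
  contour integral of \<open>F'\<close>.\<close>

lemma calc_param_derivative:
 assumes d: "!!ta w. \<bar>Im w\<bar> = ph ==> ((%ta. F ta w) hvd F' ta w) (at ta)"
  and F: "!!ta. line_decay (F ta)"
  and F': "!!ps. \<bar>ps\<bar> = ph ==> cont (%p. F' (fst p) (Complex (snd p) ps))"
  and b: "!!N. \<exists>C ep. 0 < ep \<and> (\<forall>ta\<in>{-N..N}. \<forall>s ps. \<bar>ps\<bar> = ph \<longrightarrow> cmod (F' ta (Complex s ps)) <= C * ed ep s)"
 shows "((%ta. calc (F ta) x) hvd calc (F' ta) x) (at ta)"
proof -
 have L: "((%ta. line ps (F ta) x) hvd line ps (F' ta) x) (at ta)" if ps: "\<bar>ps\<bar> = ph" for ps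
 proof -
  define N where "N = \<bar>ta\<bar> + 1"
  have N: "ta \<in> {-N<..<N}" by (auto simp: N_def)
  obtain C ep where C: "0 < ep" "!!ta s. ta \<in> {-N..N} ==> cmod (F' ta (Complex s ps)) <= C * ed ep s"
   using b[of N] ps by blast
  let ?h = "%t s. F' t (Complex s ps) *\<^sub>C rho (Complex s ps) x"
  have hb: "norm (?h t s) <= (C * (M * norm x)) * ed ep s" if "t \<in> {-N..N}" for t s
  proof -
   have "norm (?h t s) <= (C * ed ep s) * (M * norm x)"
    unfolding norm_scaleC using order_trans[OF norm_ge_zero C(2)[OF that]]
    by (intro mult_mono C(2)[OF that] norm_rho outer_line ps) auto
   then show ?thesis by (simp only: mult_ac)
  qed
  have c2: "continuous_on S (%p. ?h (fst p) (snd p))" for S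
   by (intro continuous_on_scaleC continuous_on_subset[OF F'[OF ps]] continuous_on_compose2[OF continuous_rho_line[OF ps, of UNIV]])
    (auto intro!: continuous_intros)
  have c1: "continuous_on S (%t. ?h t s)" for S s
   using continuous_on_compose2[OF c2[of UNIV], of S "%t. (t, s)"] by (simp add: continuous_intros)
  have c1': "continuous_on S (%s. ?h t s)" for S t
   using continuous_on_compose2[OF c2[of UNIV], of S "%s. (t, s)"] by (simp add: continuous_intros)
  have cl: "continuous_on {-N..N} (%t. line ps (F' t) x)"
   unfolding line_def by (rule exp_decay_continuous[OF c1' C(1) hb c1])
  have eq: "line ps (F (-N)) x + integral {-N..t} (%t. line ps (F' t) x) = line ps (F t) x" if t: "t \<in> {-N..N}" for t
  proof -
   have "integral {-N..t} (%t. line ps (F' t) x) = IU (%s. integral {-N..t} (%t. ?h t s))"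
    unfolding line_def
    by (rule exp_decay_swap_Icc[OF _ C(1) hb]) (use t c2 in \<open>auto simp: case_prod_unfold\<close>)
   also have "... = IU (%s. F t (Complex s ps) *\<^sub>C rho (Complex s ps) x - F (-N) (Complex s ps) *\<^sub>C rho (Complex s ps) x)"
   proof (rule integral_cong)
    fix s
    have "((%t. F' t (Complex s ps)) has_integral (F t (Complex s ps) - F (-N) (Complex s ps))) {-N..t}"
     by (rule fundamental_theorem_of_calculus) (use t d[of "Complex s ps"] ps in \<open>auto intro: has_vector_derivative_at_within\<close>)
    from has_integral_linear[OF this scaleC.bounded_linear_left[of "rho (Complex s ps) x"]]
    show "integral {-N..t} (%t. ?h t s) = F t (Complex s ps) *\<^sub>C rho (Complex s ps) x - F (-N) (Complex s ps) *\<^sub>C rho (Complex s ps) x"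
     by (simp add: o_def scaleC.diff_left integral_unique)
   qed
   also have "... = line ps (F t) x - line ps (F (-N)) x"
    unfolding line_def by (rule integral_diff[OF line_integrable[OF F ps] line_integrable[OF F ps]])
   finally show ?thesis by simp
  qed
  have "((%t. integral {-N..t} (%t. line ps (F' t) x)) hvd line ps (F' ta) x) (at ta within {-N..N})"
   by (rule integral_has_vector_derivative[OF cl]) (use N in auto)
  moreover have "at ta within {-N..N} = at ta" using N by (intro at_within_interior) auto
  ultimately have "((%t. line ps (F (-N)) x + integral {-N..t} (%t. line ps (F' t) x)) hvd 0 + line ps (F' ta) x) (at ta)"
   by (intro has_vector_derivative_add has_vector_derivative_const) simp
  then have "((%t. line ps (F t) x) hvd 0 + line ps (F' ta) x) (at ta)"
   by (rule has_vector_derivative_transform_within_open[where S = "{-N<..<N}"]) (use N eq in auto)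
  then show ?thesis by simp
 qed
 show ?thesis unfolding calc_def
  by (intro bounded_linear.has_vector_derivative[OF scaleC.bounded_linear_right] has_vector_derivative_diff L) (use ph_pos in auto)
qed

text \<open>The kernel applied to \<open>A\<close>. Since it tends to 1 at the left end, its
  rational part \<open>1 / (1 + exp w)\<close> is realised by \<open>Rone\<close>.\<close>

definition sol_u :: "complex => 'a => real => 'a" where
 "sol_u al x ta = Rone x + calc (%w. nb al ta w - 1 / (1 + exp w)) x"

text \<open>This is \<open>- t powr (1 - 2 * al)\<close> times the derivative of the solution at
  \<open>t = exp ta\<close>, the quantity whose limit defines the Dirichlet-to-Neumann
  operator.\<close>

definition sol_n :: "complex => 'a => real => 'a" where
 "sol_n al x ta = dtn_const al *\<^sub>C calc (%w. exp (al * w) * nb (1 - al) ta w) x"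

text \<open>This is \<open>A\<close> applied to \<open>sol_u al x ta\<close>.\<close>

definition sol_m :: "complex => 'a => real => 'a" where
 "sol_m al x ta = calc (%w. exp w * nb al ta w) x"

lemma strip_decay_sol_u:
 assumes al: "0 < Re al" "Re al < 1"
 shows "strip_decay ph (%w. nb al ta w - 1 / (1 + exp w))"
proof -
 obtain C where C: "!!ta w. \<bar>Im w\<bar> <= ph ==>
  cmod (nb al ta w - 1 / (1 + exp w)) <= C * (1 + exp (- 2 * ta) + exp (2 * Re al * ta)) * exp (- Re al * \<bar>Re w\<bar>)"
  by (rule nbessel_minus_bound[OF al ph_pos ph(2)]) blast
 obtain kp where kp: "0 < kp"
  "!!w. \<bar>Im w\<bar> <= ph ==> 1 + exp w ~= 0 \<and> kp * exp (Re w) <= cmod (1 + exp w) \<and> kp <= cmod (1 + exp w)"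
  using one_plus_exp_bounds[OF ph_pos ph(2)] by blast
 show ?thesis
 proof (rule strip_decayI[OF _ _ _ al(1) C])
  let ?S = "{w. \<bar>Im w\<bar> < pi} \<inter> {w. 1 + exp w ~= 0}"
  show "{w. \<bar>Im w\<bar> <= ph} \<subseteq> ?S" using ph(2) kp(2) by auto
  show "open ?S" by (intro open_Int open_strip open_Collect_neq continuous_intros)
  show "(%w. nb al ta w - 1 / (1 + exp w)) holomorphic_on ?S"
   by (intro holomorphic_on_diff holomorphic_on_subset[OF nbessel_shift_holomorphic[OF al]] holomorphic_intros) auto
 qed
qed

lemma calc_scaled_weighted_derivative:
 assumes nu: "0 < Re nu" "Re nu < 1" and be: "0 < Re be" "Re be < 2"
  and d: "!!ta w. \<bar>Im w\<bar> = ph ==> ((%ta. F ta w) hvd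
   (k * exp (ga * of_real ta)) * (exp (be * w) * nb nu ta w)) (at ta)"
  and F: "!!ta. line_decay (F ta)"
 shows "((%ta. calc (F ta) x) hvd
  (k * exp (ga * of_real ta)) *\<^sub>C calc (%w. exp (be * w) * nb nu ta w) x) (at ta)"
proof -
 have p: "0 <= ph" using ph_pos by simp
 obtain C where C: "0 < C" "!!ta w. \<bar>Im w\<bar> <= ph ==>
  cmod (exp (be * w) * nb nu ta w) <= C * (1 + exp (- 4 * ta)) * exp (- min (Re be) (2 - Re be) * \<bar>Re w\<bar>)"
  by (rule nbessel_weighted_bound[OF nu be p ph(2)]) blast
 let ?F' = "%ta w. (k * exp (ga * of_real ta)) * (exp (be * w) * nb nu ta w)"
 have "((%ta. calc (F ta) x) hvd calc (?F' ta) x) (at ta)"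
 proof (rule calc_param_derivative[OF d F])
  fix ps assume ps: "\<bar>ps\<bar> = ph"
  have im: "\<bar>Im (of_real (fst p) + Complex (snd p) ps / 2)\<bar> < pi / 2" for p :: "real \<times> real" using ps ph(2) by simp
  show "cont (%p. ?F' (fst p) (Complex (snd p) ps))"
   by (intro continuous_on_mult nbessel_continuous_shift[OF nu] im continuous_intros) simp_all
 next
  fix N :: real
  show "\<exists>C ep. 0 < ep \<and> (\<forall>ta\<in>{-N..N}. \<forall>s ps. \<bar>ps\<bar> = ph \<longrightarrow> cmod (?F' ta (Complex s ps)) <= C * ed ep s)"
  proof (intro exI conjI ballI allI impI)
   show "0 < min (Re be) (2 - Re be)" using be by simp
   fix ta s ps :: real assume ta: "ta \<in> {-N..N}" and ps: "\<bar>ps\<bar> = ph"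
   have "\<bar>Re ga\<bar> * \<bar>ta\<bar> <= \<bar>Re ga\<bar> * N" using ta by (intro mult_left_mono) auto
   then have "Re ga * ta <= \<bar>Re ga\<bar> * N" using abs_le_D1[of "Re ga * ta" "\<bar>Re ga\<bar> * \<bar>ta\<bar>"] by (simp add: abs_mult)
   then have "cmod (k * exp (ga * of_real ta)) <= cmod k * exp (\<bar>Re ga\<bar> * N)" by (simp add: norm_mult norm_exp_eq_Re mult_left_mono)
   moreover have "cmod (exp (be * Complex s ps) * nbessel nu (of_real ta + Complex s ps / 2)) <= C * (1 + exp (4 * N)) * exp (- min (Re be) (2 - Re be) * \<bar>s\<bar>)"
   proof (rule order_trans[OF C(2)])
    have "exp (- 4 * ta) <= exp (4 * N)" using ta by simp
    then show "C * (1 + exp (- 4 * ta)) * exp (- min (Re be) (2 - Re be) * \<bar>Re (Complex s ps)\<bar>) <= C * (1 + exp (4 * N)) * exp (- min (Re be) (2 - Re be) * \<bar>s\<bar>)"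
     using C(1) by (simp add: mult_right_mono)
   qed (use ps in simp)
   ultimately have "cmod (?F' ta (Complex s ps)) <= (cmod k * exp (\<bar>Re ga\<bar> * N)) * (C * (1 + exp (4 * N)) * exp (- min (Re be) (2 - Re be) * \<bar>s\<bar>))"
    unfolding norm_mult[of "k * exp (ga * of_real ta)"] by (intro mult_mono) auto
   then show "cmod (?F' ta (Complex s ps)) <= (cmod k * exp (\<bar>Re ga\<bar> * N) * (C * (1 + exp (4 * N)))) * exp (- min (Re be) (2 - Re be) * \<bar>s\<bar>)"
    by (simp only: mult.assoc)
  qed
 qed
 then show ?thesis
  unfolding calc_mult[OF strip_line_decay[OF nbessel_weighted_strip_decay[OF nu be p ph(2)]]] .
qed

lemma sol_u_derivative:
 assumes al: "0 < Re al" "Re al < 1"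
 shows "(sol_u al x hvd exp (2 * al * of_real ta) *\<^sub>C (- sol_n al x ta)) (at ta)"
proof -
 have al': "0 < Re (1 - al)" "Re (1 - al) < 1" "Re al < 2" using al by auto
 have "((%ta. calc (%w. nb al ta w - 1 / (1 + exp w)) x) hvd
  (- dtn_const al * exp (2 * al * of_real ta)) *\<^sub>C calc (%w. exp (al * w) * nb (1 - al) ta w) x) (at ta)"
 proof (rule calc_scaled_weighted_derivative[OF al'(1,2) al(1) al'(3) _ strip_line_decay[OF strip_decay_sol_u[OF al]]])
  fix ta w assume w: "\<bar>Im w\<bar> = ph"
  have "((%ta. nb al ta w - 1 / (1 + exp w)) hvd
   (- dtn_const al * exp (2 * al * (of_real ta + w / 2)) * nb (1 - al) ta w) - 0) (at ta)"
   by (intro has_vector_derivative_diff has_vector_derivative_const nbessel_shift_derivative al) (use w ph(2) in simp)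
  moreover have "exp (2 * al * (of_real ta + w / 2)) = exp (2 * al * of_real ta) * exp (al * w)" unfolding mult_exp_exp by (simp add: algebra_simps)
  ultimately show "((%ta. nb al ta w - 1 / (1 + exp w)) hvd
   (- dtn_const al * exp (2 * al * of_real ta)) * (exp (al * w) * nb (1 - al) ta w)) (at ta)" by (simp add: mult_ac)
 qed
 then have "(sol_u al x hvd 0 + (- dtn_const al * exp (2 * al * of_real ta)) *\<^sub>C calc (%w. exp (al * w) * nb (1 - al) ta w) x) (at ta)"
  unfolding sol_u_def by (intro has_vector_derivative_add has_vector_derivative_const)
 then show ?thesis by (simp add: sol_n_def scaleC_scaleC mult.commute flip: scaleC.minus_left)
qed

lemma sol_n_derivative:
 assumes al: "0 < Re al" "Re al < 1"
 shows "(sol_n al x hvd - (exp ((2 - 2 * al) * of_real ta) *\<^sub>C sol_m al x ta)) (at ta)"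
proof -
 have al': "0 < Re (1 - al)" "Re (1 - al) < 1" "Re al < 2" using al by auto
 have p: "0 <= ph" using ph_pos by simp
 \<comment> \<open>The constants of the orders \<open>al\<close> and \<open>1 - al\<close> are
   reciprocal, so no constant is left in the second derivative.\<close>
 have cc: "dtn_const al * dtn_const (1 - al) = 1"
  using bessel0_nonzero[OF al(1)] bessel0_nonzero[OF al'(1)] by (simp add: dtn_const_eq)
 have "((%ta. calc (%w. exp (al * w) * nb (1 - al) ta w) x) hvd
  (- dtn_const (1 - al) * exp ((2 - 2 * al) * of_real ta)) *\<^sub>C calc (%w. exp (1 * w) * nb al ta w) x) (at ta)"
 proof (rule calc_scaled_weighted_derivative[OF al _ _ _ strip_line_decay[OF nbessel_weighted_strip_decay[OF al'(1,2) al(1) al'(3) p ph(2)]]])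
  fix ta w assume w: "\<bar>Im w\<bar> = ph"
  have "((%ta. exp (al * w) * nb (1 - al) ta w) hvd
   exp (al * w) * (- dtn_const (1 - al) * exp (2 * (1 - al) * (of_real ta + w / 2)) * nbessel (1 - (1 - al)) (of_real ta + w / 2))) (at ta)"
   by (intro has_vector_derivative_mult_right nbessel_shift_derivative al') (use w ph(2) in simp)
  moreover have "exp (al * w) * exp (2 * (1 - al) * (of_real ta + w / 2)) = exp ((2 - 2 * al) * of_real ta) * exp (1 * w)"
   unfolding mult_exp_exp by (simp add: algebra_simps)
  moreover have "exp (al * w) * (- dtn_const (1 - al) * exp (2 * (1 - al) * (of_real ta + w / 2)) * nbessel (1 - (1 - al)) (of_real ta + w / 2))
   = - dtn_const (1 - al) * (exp (al * w) * exp (2 * (1 - al) * (of_real ta + w / 2))) * nb al ta w" by simp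
  ultimately show "((%ta. exp (al * w) * nb (1 - al) ta w) hvd
   (- dtn_const (1 - al) * exp ((2 - 2 * al) * of_real ta)) * (exp (1 * w) * nb al ta w)) (at ta)" by (simp only: mult.assoc)
 qed auto
 from bounded_linear.has_vector_derivative[OF scaleC.bounded_linear_right this, of "dtn_const al"]
 show ?thesis unfolding sol_n_def[abs_def]
 proof (rule has_vector_derivative_eq_rhs)
  have e: "dtn_const al * (- dtn_const (1 - al) * exp ((2 - 2 * al) * of_real ta)) = - exp ((2 - 2 * al) * of_real ta)"
   using cc by (simp flip: mult.assoc)
  show "dtn_const al *\<^sub>C (- dtn_const (1 - al) * exp ((2 - 2 * al) * of_real ta)) *\<^sub>C calc (%w. exp (1 * w) * nb al ta w) x
   = - (exp ((2 - 2 * al) * of_real ta) *\<^sub>C sol_m al x ta)"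
   unfolding scaleC_scaleC e sol_m_def scaleC.minus_left mult_1_left ..
 qed
qed

text \<open>Equivalent to the fixed-point form \<open>sol_u = Rone (sol_u + sol_m)\<close>. In the
  calculus it reduces to an algebraic identity between symbols together with the value of
  \<open>calc\<close> at \<open>exp w / (1 + exp w)\<^sup>2\<close>.\<close>

lemma sol_u_operator:
 assumes al: "0 < Re al" "Re al < 1"
 shows "sol_u al x ta \<in> dom A" "the (A (sol_u al x ta)) = sol_m al x ta"
proof -
 let ?V = "%w. nb al ta w"
 have p: "0 <= ph" using ph_pos by simp
 obtain kp where kp: "0 < kp"
  "!!w. \<bar>Im w\<bar> <= ph ==> 1 + exp w ~= 0 \<and> kp * exp (Re w) <= cmod (1 + exp w) \<and> kp <= cmod (1 + exp w)"
  using one_plus_exp_bounds[OF ph_pos ph(2)] by blast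
 have nz: "1 + exp (Complex s ps) ~= 0" if "\<bar>ps\<bar> = ph" for s ps using kp(2)[of "Complex s ps"] that by simp
 have g: "strip_decay ph (%w. ?V w - 1 / (1 + exp w))" by (rule strip_decay_sol_u[OF al])
 have m: "strip_decay ph (%w. exp w * ?V w)" using nbessel_weighted_strip_decay[OF al, of 1 ph ta] p ph(2) by simp
 have r: "strip_decay ph (%w. exp w / (1 + exp w)\<^sup>2)" by (rule strip_decay_rational[OF ph_pos ph(2)])
 have f1: "Rone (calc (%w. exp w * ?V w) x) = calc (%w. exp w * ?V w / (1 + exp w)) x" by (rule calc_Rone[OF m])
 have f2: "Rone (calc (%w. ?V w - 1 / (1 + exp w)) x) = calc (%w. (?V w - 1 / (1 + exp w)) / (1 + exp w)) x" by (rule calc_Rone[OF g])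
 have f3: "calc (%w. (?V w - 1 / (1 + exp w)) - (?V w - 1 / (1 + exp w)) / (1 + exp w)) x
   = calc (%w. exp w * ?V w / (1 + exp w) - exp w / (1 + exp w)\<^sup>2) x"
 proof (rule calc_cong)
  fix s ps :: real assume ps: "\<bar>ps\<bar> = ph"
  have "(v - 1 / y) - (v - 1 / y) / y = (y - 1) * v / y - (y - 1) / y\<^sup>2" if "y ~= 0" for v y :: complex
   using that by (simp add: field_simps power2_eq_square)
  from this[OF nz[OF ps, of s]]
  show "(?V (Complex s ps) - 1 / (1 + exp (Complex s ps))) - (?V (Complex s ps) - 1 / (1 + exp (Complex s ps))) / (1 + exp (Complex s ps))
   = exp (Complex s ps) * ?V (Complex s ps) / (1 + exp (Complex s ps)) - exp (Complex s ps) / (1 + exp (Complex s ps))\<^sup>2"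
   by (simp only: add_diff_cancel_left')
 qed
 have "S + G = T + G1 + B1" if "G - G1 = B1 - (S - T)" for G G1 B1 S T :: 'a
  using that by (simp add: algebra_simps)
 from this[OF f3[unfolded calc_diff[OF strip_line_decay[OF g] strip_line_decay[OF strip_decay_div_one_plus[OF g ph_pos ph(2)]], of x]
  calc_diff[OF strip_line_decay[OF strip_decay_div_one_plus[OF m ph_pos ph(2)]] strip_line_decay[OF r], of x] calc_rational]]
 have "sol_u al x ta = Rone (sol_u al x ta + sol_m al x ta)"
  unfolding sol_u_def sol_m_def Rone.add f1 f2 .
 then show "sol_u al x ta \<in> dom A" "the (A (sol_u al x ta)) = sol_m al x ta"
  using Rone_dom[of "sol_u al x ta + sol_m al x ta"] Rone_right[of "sol_u al x ta + sol_m al x ta"] by (simp_all add: algebra_simps)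
qed

end

section \<open>Behaviour of the constructed solution at time 0, and its boundedness\<close>

lemma tendsto_at_bot_nonpos_seqI:
 fixes f :: "real => 'b::first_countable_topology"
 assumes "!!X. filterlim X at_bot sequentially ==> (!!n. X n <= 0) ==> (%n. f (X n)) \<longlonglongrightarrow> l"
 shows "(f \<longlongrightarrow> l) at_bot"
 unfolding filterlim_at_bot_mirror
proof (rule tendsto_at_topI_sequentially)
 fix X :: "nat => real" assume X: "filterlim X at_top sequentially"
 then have b: "filterlim (%n. - X n) at_bot sequentially" by (simp add: filterlim_uminus_at_top)
 have m: "filterlim (%n. min (- X n) 0) at_bot sequentially"
  using b unfolding filterlim_at_bot by (auto elim!: eventually_mono intro: min.coboundedI1)
 have e: "\<forall>\<^sub>F n in sequentially. - X n <= 0" using b unfolding filterlim_at_bot by blast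
 show "(%n. f (- X n)) \<longlonglongrightarrow> l"
  by (rule Lim_transform_eventually[OF assms[OF m]]) (use e in \<open>auto elim!: eventually_mono\<close>)
qed

lemma nbessel_tendsto_1:
 assumes nu: "0 < Re nu" "Re nu < 1" and w: "\<bar>Im w\<bar> < pi"
 shows "((%ta. nb nu ta w) \<longlongrightarrow> 1) at_bot"
proof -
 obtain D where D: "0 < D" "!!ze. \<bar>Im ze\<bar> <= \<bar>Im w\<bar> / 2 ==> cmod (nbessel nu ze - 1) <= D * exp (2 * Re nu * Re ze)"
  by (rule nbessel_near_0[OF nu, of "\<bar>Im w\<bar> / 2"]) (use w in auto)
 have "((%ta. D * exp (2 * Re nu * (ta + Re w / 2))) \<longlongrightarrow> 0) at_bot" using nu(1) by real_asymp
 then have "((%ta. nb nu ta w - 1) \<longlongrightarrow> 0) at_bot"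
  by (rule Lim_null_comparison[rotated]) (use D(2)[of "of_real _ + w / 2"] in simp)
 then show ?thesis by (rule LIM_zero_cancel)
qed

text \<open>For \<open>t = exp ta\<close> the point \<open>exp og\<close> is
  \<open>- 1 / t\<^sup>2\<close>, and the weighted resolvent there is the inverse of
  \<open>1 + t\<^sup>2 A\<close>.\<close>

lemma exp_minus_shift:
 assumes "og = Complex (- 2 * ta) pi"
 shows "exp og ~= 0" "exp og / (exp og - exp w) = 1 / (1 + exp (w + of_real (2 * ta)))" "1 - exp (of_real (2 * ta)) = (exp og + 1) / exp og"
proof -
 have e: "exp og = - exp (- of_real (2 * ta))"
  unfolding assms by (simp add: complex_eq_iff Re_exp Im_exp)
 show n: "exp og ~= 0" by simp
 have "exp og - exp w = exp og * (1 + exp (w + of_real (2 * ta)))"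
  unfolding e by (simp add: distrib_left exp_add exp_minus)
 then show "exp og / (exp og - exp w) = 1 / (1 + exp (w + of_real (2 * ta)))" using n by simp
 show "1 - exp (of_real (2 * ta)) = (exp og + 1) / exp og"
  unfolding e by (simp add: exp_minus field_simps)
qed

context sector_calculus
begin

lemma line_decay_mult:
 assumes "line_decay F"
 shows "line_decay (%w. c * F w)"
proof -
 obtain C ep where C: "0 < ep" "!!s ps. \<bar>ps\<bar> = ph ==> cmod (F (Complex s ps)) <= C * ed ep s"
  using assms unfolding line_decay_def by blast
 have "cmod (c * F (Complex s ps)) <= (cmod c * C) * ed ep s" if "\<bar>ps\<bar> = ph" for s ps
  using mult_left_mono[OF C(2)[OF that, of s], of "cmod c"] by (simp add: norm_mult mult.assoc)
 moreover have "cont (%s. c * F (Complex s ps))" if "\<bar>ps\<bar> = ph" for ps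
  using assms that unfolding line_decay_def by (intro continuous_on_mult_left) blast
 ultimately show ?thesis using C(1) unfolding line_decay_def by blast
qed

text \<open>With \<open>q\<close> the fractional power at \<open>x\<close>, multiplicativity
  rewrites \<open>sol_n\<close> as the constant times the kernel of order \<open>1 - al\<close>
  applied to \<open>q\<close>. That kernel is the inverse of \<open>1 + t\<^sup>2 A\<close>, which
  tends strongly to the identity, plus a remainder whose contour integral tends to a scalar multiple
  of \<open>q\<close> with factor 0 by Cauchy's theorem.\<close>

lemma sol_n_limit:
 assumes al: "0 < Re al" "Re al < 1"
  and p: "p = calc (%w. exp (al * w) / (1 + exp w)) x" "p \<in> dom A"
 shows "(sol_n al x \<longlongrightarrow> dtn_const al *\<^sub>C (p + the (A p))) at_bot"
proof -
 define q where "q = p + the (A p)"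
 have Rq: "Rone q = p" unfolding q_def by (rule Rone_left[OF p(2)])
 have al': "0 < Re (1 - al)" "Re (1 - al) < 1" "Re al < 2" using al by auto
 \<comment> \<open>The product rule requires a second contour at a strictly larger angle.\<close>
 define ph' where "ph' = (ph + pi) / 2"
 have ph': "ph < ph'" "ph' < pi" "0 < ph'" using ph ph_pos by (auto simp: ph'_def)
 have p0: "0 <= ph" using ph_pos by simp
 interpret C': sector_calculus A ph0 M ph' by unfold_locales (use ph ph' in auto)
 let ?ep = "Re (1 - al)"
 let ?f = "%ta w. nb (1 - al) ta w - 1 / (1 + exp (w + of_real (2 * ta)))"
 obtain C where C: "0 < C" "!!ta w. \<bar>Im w\<bar> <= ph' ==> cmod (?f ta w) <= C * exp (- ?ep * \<bar>Re w + 2 * ta\<bar>)"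
  and f: "!!ta. strip_decay ph' (?f ta)"
  by (rule nbessel_minus_shift[OF al'(1,2) ph'(3,2)]) blast
 let ?om = "%ta. Complex (- 2 * ta) pi"
 let ?h = "%z ta ps sg. ?f ta (Complex sg ps) *\<^sub>C rho (Complex sg ps) z"
 let ?J = "%z ta ps. IU (?h z ta ps)"
 have omo: "?om ta \<in> outer" for ta using ph0 by (auto simp: outer_def)
 have cf: "cont (%sg. ?f ta (Complex sg ps))" if "\<bar>ps\<bar> = ph'" for ta ps
  by (rule strip_decay_continuous[OF f]) (use that in simp)
 have hi: "?h z ta ps integrable_on UNIV" if ps: "\<bar>ps\<bar> = ph'" for z ta ps
 proof (rule exp_decay_integrable(1)[OF _ al'(1)])
  show "cont (?h z ta ps)" by (intro continuous_on_scaleC cf C'.continuous_rho_line ps)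
  fix sg
  have "norm (?h z ta ps sg) <= (C * exp (- ?ep * \<bar>sg + 2 * ta\<bar>)) * (M * norm z)"
   unfolding norm_scaleC using C(2)[of "Complex sg ps" ta] ps C(1) by (intro mult_mono norm_rho C'.outer_line) auto
  then show "norm (?h z ta ps sg) <= (C * (M * norm z)) * exp (- ?ep * \<bar>sg - (- 2 * ta)\<bar>)" by (simp add: mult_ac)
 qed
 \<comment> \<open>The identity is checked after applying \<open>Rone\<close>, which turns
   \<open>q\<close> into \<open>p\<close>, the value of the calculus at a symbol decaying at both
   ends; only then is the product rule applicable.\<close>
 have split: "calc (%w. exp (al * w) * nb (1 - al) ta w) x
   = (1 / (2 * of_real pi * \<i>)) *\<^sub>C (?J q ta (- ph') - ?J q ta ph') + rho (?om ta) q" for ta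
 proof (rule Rone_inj)
  let ?og = "?om ta"
  let ?g = "%w. exp (al * w) / (1 + exp w)"
  let ?W = "%w. exp (al * w) * nb (1 - al) ta w"
  have og: "ph < \<bar>Im ?og\<bar>" "\<bar>Im ?og\<bar> < 2 * pi - ph" using ph by auto
  have g: "strip_decay ph ?g" by (rule strip_decay_power_one[OF al ph_pos ph(2)])
  have W: "strip_decay ph ?W" by (rule nbessel_weighted_strip_decay[OF al'(1,2) al(1) al'(3) p0 ph(2)])
  have K: "line_decay (%w. ?g w / (exp ?og - exp w))" by (rule strip_line_decay[OF strip_decay_div_exp_diff[OF g og]])
  have RJ: "Rone (?J q ta ps) = ?J p ta ps" if ps: "\<bar>ps\<bar> = ph'" for ps
   using integral_linear[OF hi[OF ps, where z = q and ta = ta] bounded_linear_Rone] by (simp add: o_def Rone_scaleC Rone_rho C'.outer_line[OF ps] Rq)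
  have "Rone (calc ?W x) = calc (%w. ?W w / (1 + exp w)) x" by (rule calc_Rone[OF W])
  moreover have "(1 / (2 * of_real pi * \<i>)) *\<^sub>C (?J p ta (- ph') - ?J p ta ph') = calc (%w. ?f ta w * ?g w) x"
   unfolding p(1) by (rule calc_product[OF ph'(1,2) f g])
  moreover have "... = calc (%w. ?W w / (1 + exp w) - exp ?og * (?g w / (exp ?og - exp w))) x"
  proof (rule calc_cong)
   fix s ps :: real
   let ?w = "Complex s ps"
   have "exp ?og * (?g ?w / (exp ?og - exp ?w)) = ?g ?w * (exp ?og / (exp ?og - exp ?w))" by simp
   also have "exp ?og / (exp ?og - exp ?w) = 1 / (1 + exp (?w + of_real (2 * ta)))" by (rule exp_minus_shift(2)[OF refl])
   finally have e: "exp ?og * (?g ?w / (exp ?og - exp ?w)) = ?g ?w * (1 / (1 + exp (?w + of_real (2 * ta))))" .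
   have dist: "(v - 1 / h) * (a / y) = a * v / y - a / y * (1 / h)" for v h a y :: complex
    unfolding left_diff_distrib by (simp add: mult.commute)
   show "?f ta ?w * ?g ?w = ?W ?w / (1 + exp ?w) - exp ?og * (?g ?w / (exp ?og - exp ?w))"
    unfolding e by (rule dist)
  qed
  moreover have "... = calc (%w. ?W w / (1 + exp w)) x - calc (%w. exp ?og * (?g w / (exp ?og - exp w))) x"
   by (rule calc_diff[OF strip_line_decay[OF strip_decay_div_one_plus[OF W ph_pos ph(2)]] line_decay_mult[OF K]])
  moreover have "calc (%w. exp ?og * (?g w / (exp ?og - exp w))) x = rho ?og p"
   unfolding calc_mult[OF K] rho_def p(1) calc_resolvent[OF g og] ..
  ultimately have e: "Rone (calc ?W x) = (1 / (2 * of_real pi * \<i>)) *\<^sub>C (?J p ta (- ph') - ?J p ta ph') + rho ?og p"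
   by (simp only: diff_add_cancel)
  show "Rone (calc ?W x) = Rone ((1 / (2 * of_real pi * \<i>)) *\<^sub>C (?J q ta (- ph') - ?J q ta ph') + rho (?om ta) q)"
   unfolding e Rone.add Rone_scaleC Rone.diff Rone_rho[OF omo] Rq using RJ[of "- ph'"] RJ[of ph'] ph'(3) by simp
 qed
 have "((%ta. dtn_const al *\<^sub>C ((1 / (2 * of_real pi * \<i>)) *\<^sub>C (?J q ta (- ph') - ?J q ta ph') + rho (?om ta) q)) \<longlongrightarrow> dtn_const al *\<^sub>C q) at_bot"
 proof (rule tendsto_at_bot_nonpos_seqI)
  fix X :: "nat => real" assume X: "filterlim X at_bot sequentially"
  have ev: "\<forall>\<^sub>F n in sequentially. X n <= T" for T using X unfolding filterlim_at_bot by blast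
  have rq: "(%n. rho (Complex (s - 2 * X n) ps) q) \<longlonglongrightarrow> q" if "!!n. Complex (s - 2 * X n) ps \<in> outer" for s ps
  proof (rule LIMSEQ_I)
   fix e :: real assume "e > 0"
   from rho_tendsto[OF this, of q] obtain S where S: "!!w. w \<in> outer ==> Re w \<ge> S ==> norm (rho w q - q) < e" by blast
   have "\<forall>\<^sub>F n in sequentially. norm (rho (Complex (s - 2 * X n) ps) q - q) < e"
    by (rule eventually_mono[OF ev[of "(s - S) / 2"]]) (rule S[OF that], simp add: field_simps)
   then show "\<exists>no. \<forall>n\<ge>no. norm (rho (Complex (s - 2 * X n) ps) q - q) < e" by (simp add: eventually_sequentially)
  qed
  have f0: "(%sg. ?f 0 (Complex sg ps)) integrable_on UNIV" if ps: "\<bar>ps\<bar> = ph'" for ps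
   by (rule exp_decay_integrable(1)[OF cf[OF ps] al'(1), of _ C 0]) (use C(2)[of "Complex _ ps" 0] ps in simp)
  \<comment> \<open>A translation by \<open>2 * X n\<close> moves the dilation from the symbol to
    the resolvent, whose argument then runs off to the right, where \<open>rho\<close> tends to the
    identity.\<close>
  have J: "(%n. ?J q (X n) ps) \<longlonglongrightarrow> IU (%sg. ?f 0 (Complex sg ps)) *\<^sub>C q" if ps: "\<bar>ps\<bar> = ph'" for ps
  proof -
   let ?k = "%n sg. ?f 0 (Complex sg ps) *\<^sub>C rho (Complex (sg - 2 * X n) ps) q"
   have ch: "cont (?k n)" for n
    by (intro continuous_on_scaleC cf ps continuous_on_compose2[OF C'.continuous_rho_line[OF ps, of UNIV]] continuous_intros) simp
   have hb: "norm (?k n sg) <= (C * (M * norm q)) * exp (- ?ep * \<bar>sg - 0\<bar>)" for n sg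
   proof -
    have "norm (?k n sg) <= (C * exp (- ?ep * \<bar>sg\<bar>)) * (M * norm q)"
     unfolding norm_scaleC using C(2)[of "Complex sg ps" 0] ps C(1) by (intro mult_mono norm_rho C'.outer_line) auto
    then show ?thesis by (simp add: mult_ac)
   qed
   have "(%n. IU (?k n)) \<longlonglongrightarrow> IU (%sg. ?f 0 (Complex sg ps) *\<^sub>C q)"
    by (rule exp_decay_dominated[OF ch _ al'(1) hb])
     (intro continuous_on_scaleC cf ps continuous_on_const, intro bounded_linear.tendsto[OF scaleC.bounded_linear_right] rq C'.outer_line ps)
   also have "IU (%sg. ?f 0 (Complex sg ps) *\<^sub>C q) = IU (%sg. ?f 0 (Complex sg ps)) *\<^sub>C q"
    using integral_linear[OF f0[OF ps] scaleC.bounded_linear_left[of q]] by (simp only: o_def)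
   also have "(%n. IU (?k n)) = (%n. ?J q (X n) ps)"
   proof
    fix n
    have "IU (?k n) = IU (%sg. ?k n (sg + 2 * X n))"
     by (rule integral_UNIV_shift[symmetric], rule exp_decay_integrable(1)[OF ch al'(1) hb])
    also have "... = ?J q (X n) ps"
    proof (rule integral_cong)
     fix sg
     have "of_real 0 + Complex (sg + 2 * X n) ps / 2 = of_real (X n) + Complex sg ps / 2"
      "Complex (sg + 2 * X n) ps + of_real (2 * 0) = Complex sg ps + of_real (2 * X n)" "sg + 2 * X n - 2 * X n = sg" by (simp_all add: complex_eq_iff)
     then show "?k n (sg + 2 * X n) = ?h q (X n) ps sg" by (simp only:)
    qed
    finally show "IU (?k n) = ?J q (X n) ps" .
   qed
   finally show ?thesis .
  qed
  have "(%n. ?J q (X n) (- ph') - ?J q (X n) ph') \<longlonglongrightarrow> IU (%sg. ?f 0 (Complex sg (- ph'))) *\<^sub>C q - IU (%sg. ?f 0 (Complex sg ph')) *\<^sub>C q"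
   by (intro tendsto_diff J) (use ph'(3) in auto)
  then have J0: "(%n. ?J q (X n) (- ph') - ?J q (X n) ph') \<longlonglongrightarrow> 0"
   unfolding strip_decay_Cauchy[OF f less_imp_le[OF ph'(3)]] diff_self .
  have oms: "?om (X n) = Complex (0 - 2 * X n) pi" for n by simp
  have r1: "(%n. rho (?om (X n)) q) \<longlonglongrightarrow> q" unfolding oms by (rule rq) (use omo in \<open>simp add: outer_def\<close>)
  have "(%n. dtn_const al *\<^sub>C ((1 / (2 * of_real pi * \<i>)) *\<^sub>C (?J q (X n) (- ph') - ?J q (X n) ph') + rho (?om (X n)) q)) \<longlonglongrightarrow> dtn_const al *\<^sub>C ((1 / (2 * of_real pi * \<i>)) *\<^sub>C 0 + q)"
   by (intro bounded_linear.tendsto[OF scaleC.bounded_linear_right] tendsto_add J0 r1)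
  then show "(%n. dtn_const al *\<^sub>C ((1 / (2 * of_real pi * \<i>)) *\<^sub>C (?J q (X n) (- ph') - ?J q (X n) ph') + rho (?om (X n)) q)) \<longlonglongrightarrow> dtn_const al *\<^sub>C q"
   by (simp only: scaleC.zero_right add_0_left)
 qed
 then show ?thesis unfolding split[symmetric] q_def[symmetric] sol_n_def[abs_def] .
qed

text \<open>The rational part \<open>1 / (1 + exp w)\<close> is exchanged for its translate by
  \<open>2 * ta\<close>. The contour symbol then is a translate of a fixed one, so its operator is
  bounded uniformly in \<open>ta\<close>, and the remaining term is a weighted resolvent, bounded by
  \<open>M\<close>.\<close>

lemma sol_u_bounded:
 assumes al: "0 < Re al" "Re al < 1"
 shows "\<exists>B. \<forall>ta. norm (sol_u al x ta) <= B"
proof -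
 let ?f = "%ta w. nb al ta w - 1 / (1 + exp (w + of_real (2 * ta)))"
 obtain C where C: "0 < C" "!!ta w. \<bar>Im w\<bar> <= ph ==> cmod (?f ta w) <= C * exp (- Re al * \<bar>Re w + 2 * ta\<bar>)"
  and f: "!!ta. strip_decay ph (?f ta)"
  by (rule nbessel_minus_shift[OF al ph_pos ph(2)]) blast
 obtain kp where kp: "0 < kp"
  "!!w. \<bar>Im w\<bar> <= ph ==> 1 + exp w ~= 0 \<and> kp * exp (Re w) <= cmod (1 + exp w) \<and> kp <= cmod (1 + exp w)"
  using one_plus_exp_bounds[OF ph_pos ph(2)] by blast
 \<comment> \<open>At \<open>ta = 0\<close> one has \<open>exp ?og = - 1\<close> and the partial
   fractions against \<open>Rone\<close> degenerate; this single value is added to the final bound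
   instead.\<close>
 have eq: "sol_u al x ta = calc (%w. nb al ta w - 1 / (1 + exp (w + of_real (2 * ta)))) x + rho (Complex (- 2 * ta) pi) x
  \<and> norm (calc (%w. nb al ta w - 1 / (1 + exp (w + of_real (2 * ta)))) x) <= C * (M * norm x * (2 / Re al))"
  if ta: "ta ~= 0" for ta
 proof -
  let ?og = "Complex (- 2 * ta) pi"
  let ?E = "exp ?og"
  let ?t = "exp (cr (2 * ta))"
  let ?g = "%w. nb al ta w - 1 / (1 + exp w)"
  let ?gc = "%w. nb al ta w - 1 / (1 + exp (w + of_real (2 * ta)))"
  let ?h = "%w. 1 / (1 + exp (w + of_real (2 * ta)))"
  let ?r = "%w. exp w / (1 + exp w)\<^sup>2"
  let ?d = "%w. ?r w * ((1 + exp w) * ?h w)"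
  have og: "ph < \<bar>Im ?og\<bar>" "\<bar>Im ?og\<bar> < 2 * pi - ph" using ph by auto
  have omo: "?og \<in> outer" using ph0 by (auto simp: outer_def)
  note E = exp_minus_shift[OF refl, of ta]
  have E1: "1 + ?E ~= 0"
  proof
   assume "1 + ?E = 0"
   then have "?E + 1 = 0" by (simp only: add.commute)
   then have "?t = 1" using E(3) by simp
   then have "cmod ?t = 1" by simp
   then show False using ta by (simp add: norm_exp_eq_Re)
  qed
  have hn: "1 + exp (w + of_real (2 * ta)) ~= 0" "kp * exp (Re w + 2 * ta) <= cmod (1 + exp (w + of_real (2 * ta)))" "kp <= cmod (1 + exp (w + of_real (2 * ta)))"
   if "\<bar>Im w\<bar> <= ph" for w using kp(2)[of "w + of_real (2 * ta)"] that by auto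
  let ?S = "{w. 1 + exp w ~= 0} \<inter> {w::complex. 1 + exp (w + of_real (2 * ta)) ~= 0}"
  have oS: "open ?S" by (intro open_Int open_Collect_neq continuous_intros)
  have sS: "{w. \<bar>Im w\<bar> <= ph} \<subseteq> ?S" using kp(2) hn(1) by auto
  have r: "strip_decay ph ?r" by (rule strip_decay_rational[OF ph_pos ph(2)])
  have d: "strip_decay ph ?d"
  proof (rule strip_decay_mult_bounded[OF r _ oS sS])
   show "(%w. (1 + exp w) * ?h w) holomorphic_on ?S" by (intro holomorphic_intros) auto
   fix w assume w: "\<bar>Im w\<bar> <= ph"
   have pos: "cmod (1 + exp (w + of_real (2 * ta))) > 0" using hn(1)[OF w] by simp
   have "cmod (1 + exp w) <= 1 + exp (Re w)" using norm_triangle_ineq[of 1 "exp w"] by (simp add: norm_exp_eq_Re)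
   also have "... <= (1 / kp * (1 + exp (- 2 * ta))) * cmod (1 + exp (w + of_real (2 * ta)))"
   proof -
    let ?D = "cmod (1 + exp (w + of_real (2 * ta)))"
    have "1 <= 1 / kp * ?D" using hn(3)[OF w] kp(1) by (simp add: field_simps)
    moreover have "exp (Re w) <= 1 / kp * exp (- 2 * ta) * ?D"
    proof -
     have "exp (- 2 * ta) * (kp * exp (Re w + 2 * ta)) <= exp (- 2 * ta) * ?D" by (intro mult_left_mono hn(2) w) auto
     moreover have "exp (- 2 * ta) * (kp * exp (Re w + 2 * ta)) = kp * exp (Re w)" by (simp add: exp_add exp_minus)
     ultimately have "kp * exp (Re w) <= exp (- 2 * ta) * ?D" by linarith
     then show ?thesis using kp(1) by (simp add: field_simps)
    qed
    ultimately show ?thesis by (simp add: algebra_simps)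
   qed
   finally show "cmod ((1 + exp w) * ?h w) <= 1 / kp * (1 + exp (- 2 * ta))"
    using pos by (simp add: norm_mult norm_divide divide_le_eq)
  qed
  have "Rone (calc ?d x) = calc (%w. ?d w / (1 + exp w)) x" by (rule calc_Rone[OF d])
  also have "... = calc (%w. ?E * (?r w / (?E - exp w))) x"
  proof (rule calc_cong)
   fix s ps :: real assume ps: "\<bar>ps\<bar> = ph"
   let ?w = "Complex s ps"
   have "?E * (?r ?w / (?E - exp ?w)) = ?r ?w * (?E / (?E - exp ?w))" by simp
   also have "... = ?r ?w * ?h ?w" unfolding E(2) ..
   also have "... = ?d ?w / (1 + exp ?w)" using kp(2)[of ?w] ps by simp
   finally show "?d ?w / (1 + exp ?w) = ?E * (?r ?w / (?E - exp ?w))" by (rule sym)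
  qed
  also have "... = rho ?og (calc ?r x)"
  proof -
   have "line_decay (%w. ?r w / (?E - exp w))"
    by (rule strip_line_decay[OF strip_decay_div_exp_diff[OF r og]])
   from calc_mult[OF this] show ?thesis unfolding rho_def calc_resolvent[OF r og] .
  qed
  also have "... = rho ?og (Rone (x - Rone x))" by (simp only: calc_rational Rone.diff)
  also have "... = Rone (rho ?og (x - Rone x))" by (rule Rone_rho[OF omo, symmetric])
  finally have dx: "calc ?d x = rho ?og (x - Rone x)" by (rule Rone_inj)
  have "calc ?g x - calc ?gc x = calc (%w. ?g w - ?gc w) x"
   by (rule calc_diff[symmetric]) (intro strip_line_decay strip_decay_sol_u[OF al] f)+
  also have "... = calc (%w. (1 - ?t) * ?d w) x"
  proof (rule calc_cong)
   fix s ps :: real assume ps: "\<bar>ps\<bar> = ph"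
   let ?w = "Complex s ps"
   have id: "1 / (1 + t * z) - 1 / (1 + z) = (1 - t) * (z / (1 + z)\<^sup>2 * ((1 + z) * (1 / (1 + t * z))))" if "1 + z ~= 0" "1 + t * z ~= 0" for t z :: complex
    using that by (simp add: power2_eq_square divide_simps) (simp add: algebra_simps)
   have e: "exp (?w + of_real (2 * ta)) = ?t * exp ?w" by (simp only: exp_add mult.commute)
   have "1 + exp ?w ~= 0" "1 + ?t * exp ?w ~= 0" using kp(2)[of ?w] hn(1)[of ?w] ps unfolding e by auto
   from id[OF this] show "?g ?w - ?gc ?w = (1 - ?t) * ?d ?w" unfolding e by simp
  qed
  also have "... = (1 - ?t) *\<^sub>C rho ?og (x - Rone x)" unfolding calc_mult[OF strip_line_decay[OF d]] dx ..
  also have "... = rho ?og x - Rone x"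
  proof -
   have "rho ?og (x - Rone x) = rho ?og x - rho ?og (Rone x)" by (rule linear_diff[OF bounded_linear.linear[OF bounded_linear_rho[OF omo]]])
   also have "... = rho ?og x - ((1 / (1 + ?E)) *\<^sub>C rho ?og x + (?E / (1 + ?E)) *\<^sub>C Rone x)" unfolding rho_Rone[OF omo E1] ..
   also have "... = (1 - 1 / (1 + ?E)) *\<^sub>C rho ?og x - (?E / (1 + ?E)) *\<^sub>C Rone x" by (simp add: scaleC.diff_left)
   also have "1 - 1 / (1 + ?E) = ?E / (1 + ?E)" using E1 by (simp add: field_simps)
   finally have "rho ?og (x - Rone x) = (?E / (1 + ?E)) *\<^sub>C (rho ?og x - Rone x)" by (simp add: scaleC.diff_right)
   moreover have "(1 - ?t) * (?E / (1 + ?E)) = 1" unfolding E(3) using E1 E(1) by (simp add: add.commute)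
   ultimately show ?thesis by (simp only: scaleC_scaleC scaleC_one)
  qed
  finally have "sol_u al x ta = calc ?gc x + rho ?og x" unfolding sol_u_def by (simp add: algebra_simps)
  moreover have "norm (calc ?gc x) <= C * (M * norm x * (2 / Re al))"
  proof (rule calc_bound[where a = "- 2 * ta"])
   show "cont (%s. ?gc (Complex s ps))" if "\<bar>ps\<bar> = ph" for ps
    by (rule strip_decay_continuous[OF f]) (use that in simp)
   show "cmod (?gc (Complex s ps)) <= C * exp (- Re al * \<bar>s - - 2 * ta\<bar>)" if "\<bar>ps\<bar> = ph" for s ps
    using C(2)[of "Complex s ps" ta] that by simp
  qed (use al(1) C(1) in auto)
  ultimately show ?thesis by blast
 qed
 show ?thesis
 proof (intro exI allI)
  fix ta
  show "norm (sol_u al x ta) <= norm (sol_u al x 0) + (C * (M * norm x * (2 / Re al)) + M * norm x)"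
  proof (cases "ta = 0")
   case True
   have "0 <= C * (M * norm x * (2 / Re al)) + M * norm x" using C(1) M al(1) by (intro add_nonneg_nonneg mult_nonneg_nonneg) auto
   then show ?thesis using True by simp
  next
   case False
   have "Complex (- 2 * ta) pi \<in> outer" using ph0 by (auto simp: outer_def)
   from norm_rho[OF this, of x] conjunct2[OF eq[OF False]] show ?thesis
    unfolding conjunct1[OF eq[OF False]]
    using norm_triangle_ineq[of "calc (%w. nb al ta w - 1 / (1 + exp (w + of_real (2 * ta)))) x" "rho (Complex (- 2 * ta) pi) x"]
     norm_ge_zero[of "sol_u al x 0"] by linarith
  qed
 qed
qed

end

context sector_calculus
begin

text \<open>Convergence of \<open>sol_n\<close> bounds the derivative of \<open>sol_u\<close> near
  minus infinity by a multiple of \<open>exp (2 * Re al * ta)\<close>, so \<open>sol_u\<close> is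
  Cauchy along every sequence tending there. The limit is identified after applying
  \<open>Rone\<close>, where the symbols are dominated uniformly for \<open>ta <= 0\<close>.\<close>

lemma sol_u_limit:
 assumes al: "0 < Re al" "Re al < 1" and n: "(sol_n al x \<longlongrightarrow> y) at_bot"
 shows "(sol_u al x \<longlongrightarrow> x) at_bot"
proof -
 define K where "K = norm y + 1"
 define a where "a = 2 * Re al"
 have K: "K > 0" by (simp add: K_def add_nonneg_pos)
 have a: "a > 0" using al by (simp add: a_def)
 have "\<forall>\<^sub>F ta in at_bot. norm (sol_n al x ta) < K"
  by (rule order_tendstoD(2)[OF tendsto_norm[OF n]]) (simp add: K_def)
 then obtain T where T: "!!ta. ta <= T ==> norm (sol_n al x ta) < K" unfolding eventually_at_bot_linorder by blast
 have diff: "norm (sol_u al x ta - sol_u al x sg) <= K / a * exp (a * ta)" if sgta: "sg <= ta" "ta <= T" for sg ta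
 proof -
  have f: "((%r. exp (2 * al * of_real r) *\<^sub>C (- sol_n al x r)) has_integral (sol_u al x ta - sol_u al x sg)) {sg..ta}"
   by (rule fundamental_theorem_of_calculus[OF sgta(1)]) (rule has_vector_derivative_at_within[OF sol_u_derivative[OF al]])
  have "((%r. K / a * exp (a * r)) hvd K * exp (a * r)) (at r within S)" for r S
   unfolding has_real_derivative_iff_has_vector_derivative[symmetric] using a by (auto intro!: derivative_eq_intros)
  then have g: "((%r. K * exp (a * r)) has_integral (K / a * exp (a * ta) - K / a * exp (a * sg))) {sg..ta}"
   by (intro fundamental_theorem_of_calculus[OF sgta(1)])
  have "norm (integral {sg..ta} (%r. exp (2 * al * of_real r) *\<^sub>C (- sol_n al x r))) <= integral {sg..ta} (%r. K * exp (a * r))"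
  proof (rule integral_norm_bound_integral)
   fix r assume r: "r \<in> {sg..ta}"
   have "exp (a * r) * norm (sol_n al x r) <= exp (a * r) * K" using T[of r] r sgta by (intro mult_left_mono) auto
   then show "norm (exp (2 * al * of_real r) *\<^sub>C (- sol_n al x r)) <= K * exp (a * r)"
    by (simp add: norm_scaleC norm_exp_eq_Re a_def mult.commute)
  qed (use f g in blast)+
  also have "... <= K / a * exp (a * ta)" unfolding integral_unique[OF g] using K a by simp
  finally show ?thesis unfolding integral_unique[OF f] .
 qed
 obtain kp where kp: "0 < kp"
  "!!w. \<bar>Im w\<bar> <= ph ==> 1 + exp w ~= 0 \<and> kp * exp (Re w) <= cmod (1 + exp w) \<and> kp <= cmod (1 + exp w)"
  using one_plus_exp_bounds[OF ph_pos ph(2)] by blast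
 obtain C where C: "0 < C" "!!ta w. \<bar>Im w\<bar> <= ph ==> ta <= 0 ==>
  cmod ((nb al ta w - 1 / (1 + exp w)) / (1 + exp w)) <= C * exp (- Re al * \<bar>Re w\<bar>)"
  by (rule nbessel_minus_bound[OF al ph_pos ph(2)]) blast
 show ?thesis
 proof (rule tendsto_at_bot_nonpos_seqI)
  fix X :: "nat => real" assume X: "filterlim X at_bot sequentially" and X0: "!!n. X n <= 0"
  have "Cauchy (%k. sol_u al x (X k))"
  proof (rule CauchyI)
   fix e :: real assume e: "e > 0"
   have "((%ta. K / a * exp (a * ta)) \<longlongrightarrow> 0) at_bot" using a by real_asymp
   then have "\<forall>\<^sub>F ta in at_bot. K / a * exp (a * ta) < e" by (rule order_tendstoD(2)) (rule e)
   then have "\<forall>\<^sub>F ta in at_bot. K / a * exp (a * ta) < e \<and> ta <= T" by (intro eventually_conj eventually_le_at_bot)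
   then have "\<forall>\<^sub>F k in sequentially. K / a * exp (a * X k) < e \<and> X k <= T" using X by (rule eventually_compose_filterlim)
   then obtain N where N: "!!k. k \<ge> N ==> K / a * exp (a * X k) < e \<and> X k <= T" unfolding eventually_sequentially by blast
   show "\<exists>N. \<forall>m\<ge>N. \<forall>k\<ge>N. norm (sol_u al x (X m) - sol_u al x (X k)) < e"
   proof (intro exI[of _ N] allI impI)
    fix m k assume mk: "m \<ge> N" "k \<ge> N"
    show "norm (sol_u al x (X m) - sol_u al x (X k)) < e"
    proof (cases "X k <= X m")
     case True
     with diff[OF True] N[OF mk(1)] show ?thesis by linarith
    next
     case False
     with diff[of "X m" "X k"] N[OF mk(2)] show ?thesis by (simp add: norm_minus_commute)
    qed
   qed
  qed
  then obtain L where L: "(%k. sol_u al x (X k)) \<longlonglongrightarrow> L" using Cauchy_convergent convergent_def by blast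
  let ?g = "%ta w. (nb al ta w - 1 / (1 + exp w)) / (1 + exp w)"
  let ?r = "%w. exp w / (1 + exp w)\<^sup>2"
  have R: "Rone (sol_u al x ta) = Rone (Rone x) + calc (?g ta) x" for ta
   unfolding sol_u_def Rone.add calc_Rone[OF strip_decay_sol_u[OF al]] ..
  have lim: "(%k. line ps (?g (X k)) x) \<longlonglongrightarrow> line ps ?r x" if ps: "\<bar>ps\<bar> = ph" for ps
   unfolding line_def
  proof (rule exp_decay_dominated[OF _ _ al(1), where x = 0 and C = "C * (M * norm x)"])
   have nz: "1 + exp (Complex s ps) ~= 0" for s using kp(2)[of "Complex s ps"] ps by simp
   have im: "\<bar>Im (of_real t + Complex s ps / 2)\<bar> < pi / 2" for t s using ps ph(2) by simp
   show "cont (%s. ?g (X k) (Complex s ps) *\<^sub>C rho (Complex s ps) x)" for k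
    using nz by (intro continuous_on_scaleC continuous_on_divide continuous_on_diff nbessel_continuous_shift[OF al] im continuous_rho_line ps continuous_intros) auto
   show "cont (%s. ?r (Complex s ps) *\<^sub>C rho (Complex s ps) x)"
    using nz by (intro continuous_on_scaleC continuous_on_divide continuous_rho_line ps continuous_intros) auto
   show "norm (?g (X k) (Complex s ps) *\<^sub>C rho (Complex s ps) x) <= C * (M * norm x) * exp (- Re al * \<bar>s - 0\<bar>)" for k s
   proof -
    have "norm (?g (X k) (Complex s ps) *\<^sub>C rho (Complex s ps) x) <= (C * exp (- Re al * \<bar>s\<bar>)) * (M * norm x)"
     unfolding norm_scaleC using C(2)[of "Complex s ps" "X k"] ps X0[of k] C(1) by (intro mult_mono norm_rho outer_line) auto
    then show ?thesis by (simp add: mult_ac)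
   qed
   show "(%k. ?g (X k) (Complex s ps) *\<^sub>C rho (Complex s ps) x) \<longlonglongrightarrow> ?r (Complex s ps) *\<^sub>C rho (Complex s ps) x" for s
   proof (rule bounded_linear.tendsto[OF scaleC.bounded_linear_left])
    have V: "(%k. nbessel al (of_real (X k) + Complex s ps / 2)) \<longlonglongrightarrow> 1"
     by (rule filterlim_compose[OF nbessel_tendsto_1[OF al] X]) (use ps ph(2) in simp)
    have "(%k. ?g (X k) (Complex s ps)) \<longlonglongrightarrow> (1 - 1 / (1 + exp (Complex s ps))) / (1 + exp (Complex s ps))"
     by (intro tendsto_divide tendsto_diff V tendsto_const nz)
    moreover have "(1 - 1 / (1 + exp (Complex s ps))) / (1 + exp (Complex s ps)) = ?r (Complex s ps)"
     using nz[of s] by (simp add: power2_eq_square field_simps)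
    ultimately show "(%k. ?g (X k) (Complex s ps)) \<longlonglongrightarrow> ?r (Complex s ps)" by (simp only:)
   qed
  qed
  have "(%k. Rone (Rone x) + calc (?g (X k)) x) \<longlonglongrightarrow> Rone (Rone x) + calc ?r x"
   unfolding calc_def
   by (intro tendsto_add tendsto_const bounded_linear.tendsto[OF scaleC.bounded_linear_right] tendsto_diff lim) (use ph_pos in auto)
  then have "(%k. Rone (sol_u al x (X k))) \<longlonglongrightarrow> Rone x" unfolding R calc_rational by simp
  from LIMSEQ_unique[OF this Rone.tendsto[OF L]] have "x = L" by (rule Rone_inj)
  then show "(%k. sol_u al x (X k)) \<longlonglongrightarrow> x" using L by simp
 qed
qed

lemma sol_m_continuous:
 assumes al: "0 < Re al" "Re al < 1"
 shows "cont (sol_m al x)"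
proof -
 have p: "0 <= ph" using ph_pos by simp
 obtain C where C: "0 < C" "!!ta w. \<bar>Im w\<bar> <= ph ==>
  cmod (exp (1 * w) * nb al ta w) <= C * (1 + exp (- 4 * ta)) * exp (- min (Re 1) (2 - Re 1) * \<bar>Re w\<bar>)"
  by (rule nbessel_weighted_bound[OF al _ _ p ph(2), of 1]) auto
 have cN: "continuous_on {-N..N} (sol_m al x)" for N :: real
 proof -
  have L: "continuous_on {-N..N} (%ta. line ps (%w. exp w * nb al ta w) x)" if ps: "\<bar>ps\<bar> = ph" for ps
   unfolding line_def
  proof (rule exp_decay_continuous[where ep = 1 and C = "C * (1 + exp (4 * N)) * (M * norm x)"])
   have im: "\<bar>Im (of_real t + Complex s ps / 2)\<bar> < pi / 2" for t s using ps ph(2) by simp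
   show "cont (%s. (exp (Complex s ps) * nbessel al (of_real ta + Complex s ps / 2)) *\<^sub>C rho (Complex s ps) x)" for ta
    by (intro continuous_on_scaleC continuous_on_mult nbessel_continuous_shift[OF al] im continuous_rho_line ps continuous_intros) simp_all
   show "continuous_on {-N..N} (%ta. (exp (Complex s ps) * nbessel al (of_real ta + Complex s ps / 2)) *\<^sub>C rho (Complex s ps) x)" for s
    by (intro continuous_on_scaleC continuous_on_mult nbessel_continuous_shift[OF al] im continuous_intros)
   show "norm ((exp (Complex s ps) * nbessel al (of_real ta + Complex s ps / 2)) *\<^sub>C rho (Complex s ps) x) <= C * (1 + exp (4 * N)) * (M * norm x) * ed 1 s"
    if ta: "ta \<in> {-N..N}" for ta s
   proof -
    have "exp (- 4 * ta) <= exp (4 * N)" using ta by simp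
    then have "C * (1 + exp (- 4 * ta)) * ed 1 s <= C * (1 + exp (4 * N)) * ed 1 s"
     using C(1) by (intro mult_right_mono mult_left_mono) auto
    then have "cmod (exp (Complex s ps) * nbessel al (of_real ta + Complex s ps / 2)) <= C * (1 + exp (4 * N)) * ed 1 s"
     using C(2)[of "Complex s ps" ta] ps by simp
    then have "norm ((exp (Complex s ps) * nbessel al (of_real ta + Complex s ps / 2)) *\<^sub>C rho (Complex s ps) x)
     <= (C * (1 + exp (4 * N)) * ed 1 s) * (M * norm x)"
     unfolding norm_scaleC using C(1) ps by (intro mult_mono norm_rho outer_line) auto
    then show ?thesis by (simp only: mult_ac)
   qed
  qed simp
  show ?thesis unfolding sol_m_def[abs_def] calc_def
   by (intro continuous_on_scaleC continuous_on_const continuous_on_diff L) (use ph_pos in auto)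
 qed
 show ?thesis
 proof (intro continuous_at_imp_continuous_on ballI)
  fix ta :: real
  show "isCont (sol_m al x) ta"
   by (rule continuous_on_interior[OF cN[of "\<bar>ta\<bar> + 1"]]) auto
 qed
qed

text \<open>The contour formulas are transported back to \<open>t = exp ta\<close>. The function
  built from them is classically differentiable for \<open>t > 0\<close>, so the weak equation
  follows from the fundamental theorem of calculus.\<close>

lemma power_imp_Neumann_limit:
 assumes al: "0 < Re al" "Re al < 1"
  and p: "p = calc (%w. exp (al * w) / (1 + exp w)) x" "p \<in> dom A"
 shows "Neumann_limit A al x (dtn_const al *\<^sub>C (p + the (A p)))"
proof -
 define u where "u t = (if t <= 0 then x else sol_u al x (ln t))" for t :: real
 \<comment> \<open>\<open>e t\<close> is \<open>t powr (2 * al - 1)\<close>, so that the derivative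
   of \<open>u\<close> is \<open>- e t\<close> times \<open>n t\<close>.\<close>
 define e where "e t = exp ((2 * al - 1) * cr (ln t))" for t :: real
 define n where "n t = sol_n al x (ln t)" for t :: real
 define m where "m t = sol_m al x (ln t)" for t :: real
 note nlim = sol_n_limit[OF al p]
 have ut: "u t = sol_u al x (ln t)" if "t > 0" for t using that by (simp add: u_def)
 have Au: "u t \<in> dom A" "the (A (u t)) = m t" if "t > 0" for t
  using sol_u_operator[OF al] by (simp_all add: ut[OF that] m_def)
 have ln: "(ln hvd (1 / t)) (at t)" if "t > 0" for t :: real
  unfolding has_real_derivative_iff_has_vector_derivative[symmetric]
  using that by (auto intro!: derivative_eq_intros)
 have eln: "exp (- cr (ln t)) = of_real (1 / t)" if "t > 0" for t
 proof -
  have "exp (- cr (ln t)) = of_real (exp (- ln t))" by (simp flip: exp_of_real)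
  also have "exp (- ln t) = 1 / t" using that by (simp add: exp_minus inverse_eq_divide)
  finally show ?thesis .
 qed
 have du: "(u hvd - (e t *\<^sub>C n t)) (at t)" if t: "t > 0" for t
 proof -
  from vector_diff_chain_at[where f = ln and x = t and f' = "1 / t", OF ln[OF t] sol_u_derivative[OF al]]
  have "((%t. sol_u al x (ln t)) hvd (1 / t) *\<^sub>R exp (2 * al * of_real (ln t)) *\<^sub>C (- sol_n al x (ln t))) (at t)"
   by (simp add: o_def)
  then have "(u hvd (1 / t) *\<^sub>R exp (2 * al * of_real (ln t)) *\<^sub>C (- sol_n al x (ln t))) (at t)"
   by (rule has_vector_derivative_transform_within_open[where S = "{0<..}"]) (use t ut in auto)
  moreover have "cr (1 / t) * exp (2 * al * of_real (ln t)) = e t"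
   unfolding eln[OF t, symmetric] mult_exp_exp by (simp add: e_def algebra_simps)
  ultimately show ?thesis by (simp only: scaleR_scaleC scaleC_scaleC scaleC.minus_right n_def)
 qed
 have dn: "((%t. e t *\<^sub>C n t) hvd ((2 * al - 1) / of_real t * e t) *\<^sub>C n t - m t) (at t)" if t: "t > 0" for t
 proof -
  from vector_diff_chain_at[where f = ln and x = t and f' = "1 / t", OF ln[OF t] sol_n_derivative[OF al]]
  have 1: "(n hvd (1 / t) *\<^sub>R - (exp ((2 - 2 * al) * of_real (ln t)) *\<^sub>C m t)) (at t)"
   by (simp add: o_def n_def[abs_def] m_def)
  from vector_diff_chain_at[where f = ln and x = t and f' = "1 / t", OF ln[OF t] has_vector_derivative_exp_of_real[of "2 * al - 1"]]
  have 2: "(e hvd (1 / t) *\<^sub>R ((2 * al - 1) * e t)) (at t)"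
   by (simp add: o_def e_def[abs_def])
  have "((%t. e t *\<^sub>C n t) hvd e t *\<^sub>C ((1 / t) *\<^sub>R - (exp ((2 - 2 * al) * of_real (ln t)) *\<^sub>C m t)) + ((1 / t) *\<^sub>R ((2 * al - 1) * e t)) *\<^sub>C n t) (at t)"
   by (rule scaleC.has_vector_derivative[OF 2 1])
  moreover have "e t *\<^sub>C ((1 / t) *\<^sub>R - (exp ((2 - 2 * al) * of_real (ln t)) *\<^sub>C m t)) = - m t"
  proof -
   have "e t * cr (1 / t) * exp ((2 - 2 * al) * of_real (ln t)) = 1"
    unfolding eln[OF t, symmetric] e_def mult_exp_exp by (simp add: algebra_simps)
   then show ?thesis by (simp add: scaleR_scaleC scaleC_scaleC scaleC.minus_right)
  qed
  moreover have "(1 / t) *\<^sub>R ((2 * al - 1) * e t) = (2 * al - 1) / of_real t * e t" by (simp add: scaleR_conv_of_real)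
  ultimately show ?thesis by simp
 qed
 have cu: "continuous_on {0<..} u" using du by (intro continuous_at_imp_continuous_on ballI has_vector_derivative_continuous) auto
 have cm: "continuous_on {0<..} m" unfolding m_def
  by (rule continuous_on_compose2[OF sol_m_continuous[OF al]]) (auto intro!: continuous_intros)
 have u0: "(u \<longlongrightarrow> x) (at_right 0)"
 proof -
  have "((%t. sol_u al x (ln t)) \<longlongrightarrow> x) (at_right 0)" by (rule filterlim_compose[OF sol_u_limit[OF al nlim] ln_at_0])
  then show ?thesis
   by (rule Lim_transform_eventually) (use ut in \<open>auto simp: eventually_at_filter\<close>)
 qed
 have cu0: "continuous_on {0..} u"
  unfolding continuous_on_def
 proof
  fix t :: real assume "t \<in> {0..}"
  then consider "t = 0" | "t > 0" by fastforce
  then show "(u \<longlongrightarrow> u t) (at t within {0..})"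
  proof cases
   case 1
   have "at 0 within {0..} = at_right (0::real)" by (rule at_within_Ici_at_right)
   then show ?thesis using u0 1 by (simp add: u_def)
  next
   case 2
   have "(u \<longlongrightarrow> u t) (at t)" using has_vector_derivative_continuous[OF du[OF 2]] by (simp add: isCont_def)
   then show ?thesis by (rule tendsto_within_subset) simp
  qed
 qed
 obtain B where B: "!!ta. norm (sol_u al x ta) <= B" using sol_u_bounded[OF al] by blast
 have bu: "bounded (u ` {0..})"
  unfolding bounded_iff by (rule exI[of _ "max B (norm x)"]) (use B in \<open>auto simp: u_def le_max_iff_disj\<close>)
 have L: "{0<..} \<in> sets (lebesgue :: real measure)" by simp
 have Bi: "Bochner_integrable (lebesgue_on K) f" if "compact K" "K \<subseteq> {0<..}" "continuous_on {0<..} f" for K and f :: "real => 'a"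
  using has_Bochner_integral_continuous_compact[OF that(1) continuous_on_subset[OF that(3,2)]] unfolding Bochner_integrable_def by blast
 have BA: "Bochner_integrable (lebesgue_on K) (%t. the (A (u t)))" if "compact K" "K \<subseteq> {0<..}" for K
  using that by (intro Bi continuous_on_eq[OF cm]) (auto simp: Au)
 have weak: "Bochner_integral (lebesgue_on {0<..})
    (%t. vector_derivative (%s. vector_derivative g (at s)) (at t) *\<^sub>C u t
     - vector_derivative (%s. (1 - 2 * al) / of_real s * g s) (at t) *\<^sub>C u t)
   = Bochner_integral (lebesgue_on {0<..}) (%t. g t *\<^sub>C the (A (u t)))" if g: "test_function g" for g
 proof -
  define K where "K = closure {t. g t ~= 0}"
  let ?g1 = "%t. vector_derivative g (at t)"
  let ?g2 = "%t. vector_derivative (%s. vector_derivative g (at s)) (at t)"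
  let ?gp = "%t. vector_derivative (%s. (1 - 2 * al) / of_real s * g s) (at t)"
  note tp = test_function_props[OF g, folded K_def]
  have "Bochner_integrable (lebesgue_on {0<..}) (%t. (?g2 t - ?gp t) *\<^sub>C u t)"
   by (rule Bochner_integrable_scaleC_compact[OF tp(1,2) L Bi[OF tp(1,2) cu] tp(4)]) (use tp(6) in simp)
  from Bochner_integrable_has_integral[OF L this]
  have I1: "((%t. (?g2 t - ?gp t) *\<^sub>C u t) has_integral Bochner_integral (lebesgue_on {0<..}) (%t. (?g2 t - ?gp t) *\<^sub>C u t)) {0<..}" .
  have "Bochner_integrable (lebesgue_on {0<..}) (%t. g t *\<^sub>C the (A (u t)))"
   by (rule Bochner_integrable_scaleC_compact[OF tp(1,2) L BA[OF tp(1,2)] tp(3)]) (use tp(5) in simp)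
  from Bochner_integrable_has_integral[OF L this]
  have I2: "((%t. g t *\<^sub>C the (A (u t))) has_integral Bochner_integral (lebesgue_on {0<..}) (%t. g t *\<^sub>C the (A (u t)))) {0<..}" .
  obtain a where a: "a > 0" "!!t. t \<in> K ==> a < t"
  proof (cases "K = {}")
   case True
   then show ?thesis using that[of 1] by auto
  next
   case False
   obtain k where "k \<in> K" "!!t. t \<in> K ==> k <= t" using compact_attains_inf[OF tp(1) False] by blast
   with tp(2) show ?thesis by (intro that[of "k / 2"]) fastforce+
  qed
  obtain b' where b': "!!t. t \<in> K ==> \<bar>t\<bar> <= b'" using compact_imp_bounded[OF tp(1)] unfolding bounded_iff by auto
  define b where "b = max a b' + 1"
  have b: "a <= b" "t < b" if "t \<in> K" for t using b'[OF that] by (auto simp: b_def)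
  have ab: "a <= b" by (simp add: b_def)
  have aK: "a \<notin> K" using a(2) by blast
  have bK: "b \<notin> K" using b(2) by blast
  \<comment> \<open>The bilinear concomitant of \<open>g\<close> and \<open>u\<close>: as
    \<open>u' = - e n\<close>, it equals \<open>g' u - g u' - (1 - 2 * al) / t * g u\<close>, and
    its derivative is the difference of the two integrands. It vanishes at \<open>a\<close> and
    \<open>b\<close>, which lie outside the support of \<open>g\<close>.\<close>
  let ?X = "%t. ?g1 t *\<^sub>C u t + g t *\<^sub>C (e t *\<^sub>C n t) - ((1 - 2 * al) / of_real t * g t) *\<^sub>C u t"
  have "((%t. (?g2 t - ?gp t) *\<^sub>C u t - g t *\<^sub>C the (A (u t))) has_integral (?X b - ?X a)) {a..b}"
  proof (rule fundamental_theorem_of_calculus[OF ab])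
   fix t assume "t \<in> {a..b}"
   then have t: "t > 0" using a(1) by auto
   have "(?X hvd
    (?g1 t *\<^sub>C (- (e t *\<^sub>C n t)) + ?g2 t *\<^sub>C u t) + (g t *\<^sub>C (((2 * al - 1) / of_real t * e t) *\<^sub>C n t - m t) + ?g1 t *\<^sub>C (e t *\<^sub>C n t))
    - (((1 - 2 * al) / of_real t * g t) *\<^sub>C (- (e t *\<^sub>C n t)) + ?gp t *\<^sub>C u t)) (at t)"
    by (intro has_vector_derivative_diff has_vector_derivative_add scaleC.has_vector_derivative du dn t tp(7,8,9))
   moreover have "(?g1 t *\<^sub>C (- (e t *\<^sub>C n t)) + ?g2 t *\<^sub>C u t) + (g t *\<^sub>C (((2 * al - 1) / of_real t * e t) *\<^sub>C n t - m t) + ?g1 t *\<^sub>C (e t *\<^sub>C n t))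
    - (((1 - 2 * al) / of_real t * g t) *\<^sub>C (- (e t *\<^sub>C n t)) + ?gp t *\<^sub>C u t) = (?g2 t - ?gp t) *\<^sub>C u t - g t *\<^sub>C the (A (u t))"
   proof -
    have c: "g t * ((2 * al - 1) / of_real t * e t) = - ((1 - 2 * al) / of_real t * g t * e t)"
     by (simp add: divide_inverse algebra_simps)
    show ?thesis unfolding Au(2)[OF t]
     by (simp only: scaleC.diff_right scaleC_scaleC scaleC.minus_right scaleC.diff_left c scaleC.minus_left) simp
   qed
   ultimately show "(?X hvd (?g2 t - ?gp t) *\<^sub>C u t - g t *\<^sub>C the (A (u t))) (at t within {a..b})"
    by (simp only: has_vector_derivative_at_within)
  qed
  moreover have "?X b - ?X a = 0" using tp(5,10)[OF aK] tp(5,10)[OF bK] by (simp add: scaleC.zero_left)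
  ultimately have "((%t. (?g2 t - ?gp t) *\<^sub>C u t - g t *\<^sub>C the (A (u t))) has_integral 0) {a..b}" by (simp only:)
  then have "((%t. (?g2 t - ?gp t) *\<^sub>C u t - g t *\<^sub>C the (A (u t))) has_integral 0) {0<..}"
  proof (rule has_integral_on_superset)
   fix t assume "t \<notin> {a..b}"
   then have "t \<notin> K" using a(2) b(2) by fastforce
   then show "(?g2 t - ?gp t) *\<^sub>C u t - g t *\<^sub>C the (A (u t)) = 0" using tp(5)[of t] tp(6)[of t] by (simp add: scaleC.zero_left)
  next
   show "{a..b} \<subseteq> {0<..}" using a(1) by auto
  qed
  from has_integral_unique[OF has_integral_diff[OF I1 I2] this] show ?thesis by (simp add: scaleC.diff_left)
 qed
 have sol: "is_solution A al x u"
  unfolding is_solution_def L1_loc_pos_def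
  using cu0 bu Au(1) BA weak by (auto simp: u_def[of 0])
 have "((%t. - (cr t powr (1 - 2 * al) *\<^sub>C vector_derivative u (at t))) \<longlongrightarrow> dtn_const al *\<^sub>C (p + the (A p))) (at_right 0)"
 proof (rule Lim_transform_eventually)
  show "(n \<longlongrightarrow> dtn_const al *\<^sub>C (p + the (A p))) (at_right 0)"
   unfolding n_def by (rule filterlim_compose[OF nlim ln_at_0])
  have "n t = - (cr t powr (1 - 2 * al) *\<^sub>C vector_derivative u (at t))" if t: "t > 0" for t
  proof -
   have "cr t powr (1 - 2 * al) * e t = 1"
    using t by (simp add: powr_def Ln_of_real e_def mult_exp_exp algebra_simps)
   then show ?thesis unfolding vector_derivative_at[OF du[OF t]] by (simp add: scaleC.minus_right scaleC_scaleC)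
  qed
  then show "\<forall>\<^sub>F t in at_right 0. n t = - (cr t powr (1 - 2 * al) *\<^sub>C vector_derivative u (at t))"
   by (auto simp: eventually_at_filter)
 qed
 with sol show ?thesis unfolding Neumann_limit_def by blast
qed

end

section \<open>Agreement with the defined calculus, and the theorem\<close>

context sector_calculus
begin

text \<open>The definition integrates in the space of bounded operators. Continuity in the operator
  norm comes from \<open>rho_diff\<close>, whose estimate is uniform over vectors; the logarithmic
  substitution then turns the ray into a line, and evaluation at \<open>x\<close> commutes with the
  integral.\<close>

lemma ray_integral_apply:
 assumes F: "line_decay F" and g: "!!s. g (exp (Complex s ps)) = F (Complex s ps)" and ps: "\<bar>ps\<bar> = ph"
 shows "blinfun_apply (ray_integral A g ps) x = line ps F x"
proof -
 define k where "k s = Blinfun (%x. F (Complex s ps) *\<^sub>C rho (Complex s ps) x)" for s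
 define f where "f r = (let z = cr r * cis ps in Blinfun (%x. (g z * cis ps) *\<^sub>C resolvent A z x))" for r
 have o: "Complex s ps \<in> outer" for s by (rule outer_line[OF ps])
 have ka: "blinfun_apply (k s) x = F (Complex s ps) *\<^sub>C rho (Complex s ps) x" for s x
  unfolding k_def
  by (subst bounded_linear_Blinfun_apply)
   (auto intro: bounded_linear_compose[OF scaleC.bounded_linear_right bounded_linear_rho[OF o]])
 have fk: "f r = (1 / r) *\<^sub>R k (ln r)" if r: "r > 0" for r
 proof (rule blinfun_eqI)
  fix x
  let ?w = "Complex (ln r) ps"
  have z: "cr r * cis ps = exp ?w" using r by (simp add: complex_eq_iff Re_exp Im_exp)
  have "bounded_linear (%x. (g (exp ?w) * cis ps) *\<^sub>C resolvent A (exp ?w) x)"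
   by (rule bounded_linear_compose[OF scaleC.bounded_linear_right resolvent_bounded_linear[OF outer_rset[OF o]]])
  then have "blinfun_apply (f r) x = (F ?w * cis ps) *\<^sub>C resolvent A (exp ?w) x"
   by (simp add: f_def z bounded_linear_Blinfun_apply g)
  also have "cis ps = of_real (1 / r) * exp ?w" using r by (simp flip: z)
  finally show "blinfun_apply (f r) x = blinfun_apply ((1 / r) *\<^sub>R k (ln r)) x"
   by (simp add: blinfun.scaleR_left ka rho_def scaleR_scaleC scaleC_scaleC mult_ac)
 qed
 have cF: "cont (%s. F (Complex s ps))" using F ps unfolding line_decay_def by blast
 have ck: "cont k"
 proof (intro continuous_at_imp_continuous_on ballI)
  fix s0 :: real
  let ?w = "%s. Complex s ps"
  let ?b = "%s. cmod (F (?w s)) * cmod (exp (?w s - ?w s0) - 1) * (M + M * M) + cmod (F (?w s) - F (?w s0)) * M"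
  have le: "norm (k s - k s0) <= ?b s" for s
  proof (rule norm_blinfun_bound)
   show "0 <= ?b s" using M by simp
   fix x
   have "blinfun_apply (k s - k s0) x = F (?w s) *\<^sub>C (rho (?w s) x - rho (?w s0) x) + (F (?w s) - F (?w s0)) *\<^sub>C rho (?w s0) x"
    by (simp add: blinfun.diff_left ka scaleC_diff_split)
   then have "norm (blinfun_apply (k s - k s0) x) <= cmod (F (?w s)) * norm (rho (?w s) x - rho (?w s0) x) + cmod (F (?w s) - F (?w s0)) * norm (rho (?w s0) x)"
    by (metis norm_scaleC norm_triangle_ineq)
   also have "... <= cmod (F (?w s)) * (cmod (exp (?w s - ?w s0) - 1) * (M * norm x + M * (M * norm x))) + cmod (F (?w s) - F (?w s0)) * (M * norm x)"
   proof (intro add_mono mult_left_mono norm_rho o)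
    have "norm (rho (?w s0) x - rho (?w s) (rho (?w s0) x)) <= M * norm x + M * (M * norm x)"
     using norm_triangle_ineq4[of "rho (?w s0) x" "rho (?w s) (rho (?w s0) x)"] norm_rho[OF o, of s0 x]
      norm_rho[OF o, of s "rho (?w s0) x"] mult_left_mono[OF norm_rho[OF o, of s0 x], of M] M by linarith
    then show "norm (rho (?w s) x - rho (?w s0) x) <= cmod (exp (?w s - ?w s0) - 1) * (M * norm x + M * (M * norm x))"
     unfolding rho_diff[OF o o] norm_scaleC by (rule mult_left_mono) simp
   qed auto
   also have "... = ?b s * norm x" by (simp add: algebra_simps)
   finally show "norm (blinfun_apply (k s - k s0) x) <= ?b s * norm x" .
  qed
  have Fc: "((%s. F (?w s)) \<longlongrightarrow> F (?w s0)) (at s0)" using cF by (simp add: continuous_on_eq_continuous_at isCont_def)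
  have wc: "((%s. ?w s) \<longlongrightarrow> ?w s0) (at s0)" by (intro tendsto_intros)
  have "(?b \<longlongrightarrow> cmod (F (?w s0)) * cmod (exp (?w s0 - ?w s0) - 1) * (M + M * M) + cmod (F (?w s0) - F (?w s0)) * M) (at s0)"
   by (intro tendsto_intros Fc wc)
  then have "(?b \<longlongrightarrow> 0) (at s0)" by simp
  then have "((%s. k s - k s0) \<longlongrightarrow> 0) (at s0)"
   by (rule Lim_null_comparison[OF always_eventually[OF allI[OF le]]])
  then show "isCont k s0" unfolding isCont_def by (rule LIM_zero_cancel)
 qed
 obtain C ep where C: "0 < ep" "!!s. cmod (F (Complex s ps)) <= C * ed ep s"
  using F ps unfolding line_decay_def by blast
 have kb: "norm (k s) <= (C * M) * ed ep s" for s
 proof (rule norm_blinfun_bound)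
  have C0: "0 <= C * ed ep s" using order_trans[OF norm_ge_zero C(2)] .
  then have "0 <= (C * ed ep s) * M" by (rule mult_nonneg_nonneg[OF _ less_imp_le[OF M]])
  then show "0 <= (C * M) * ed ep s" by (simp only: mult_ac)
  fix x
  have "norm (blinfun_apply (k s) x) <= (C * ed ep s) * (M * norm x)"
   unfolding ka norm_scaleC using C0 by (intro mult_mono C(2) norm_rho o) auto
  then show "norm (blinfun_apply (k s) x) <= (C * M) * ed ep s * norm x" by (simp only: mult_ac)
 qed
 have ek: "exp s *\<^sub>R f (exp s) = k s" for s by (simp add: fk)
 have cf: "continuous_on {0<..} f"
 proof (rule continuous_on_eq)
  show "continuous_on {0<..} (%r. (1 / r) *\<^sub>R k (ln r))"
   by (intro continuous_on_scaleR continuous_on_compose2[OF ck] continuous_intros) auto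
 qed (simp add: fk)
 have "has_Bochner_integral (lebesgue_on {0<..}) f (IU (%s. exp s *\<^sub>R f (exp s)))"
  by (rule has_Bochner_integral_exp_subst[OF cf C(1)]) (use kb in \<open>simp only: ek\<close>)
 then have hb: "has_Bochner_integral (lebesgue_on {0<..}) f (IU k)" unfolding ek .
 have S: "{0<..} \<in> sets (lebesgue :: real measure)" by simp
 have "(f has_integral Bochner_integral (lebesgue_on {0<..}) f) {0<..}"
  by (rule Bochner_integrable_has_integral[OF S]) (use hb in \<open>auto simp: Bochner_integrable_def\<close>)
 from has_integral_unique[OF this has_Bochner_integral_has_integral[OF S hb]]
 have "ray_integral A g ps = IU k" unfolding ray_integral_def f_def[abs_def] .
 moreover have "k integrable_on UNIV" by (rule exp_decay_integrable(1)[OF ck C(1), where x = 0]) (use kb in simp)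
 from integral_linear[OF this blinfun.bounded_linear_left[of x]]
 have "blinfun_apply (IU k) x = IU (%s. blinfun_apply (k s) x)" by (simp only: o_def)
 ultimately show ?thesis by (simp only: ka line_def)
qed

lemma power_over_one_plus_exp:
 assumes "\<bar>ps\<bar> = ph"
 shows "exp (Complex s ps) powr al / (1 + exp (Complex s ps)) = exp (al * Complex s ps) / (1 + exp (Complex s ps))"
proof -
 have "Ln (exp (Complex s ps)) = Complex s ps" using assms ph(2) by (intro Ln_exp) auto
 then show ?thesis by (simp add: powr_def)
qed

text \<open>The constant is nonzero, so the identity between its multiple of \<open>p x\<close> and
  \<open>Rone y\<close> places \<open>p x\<close> in the domain and determines \<open>y\<close> from
  \<open>x\<close> alone. Hence the definite description in the Dirichlet-to-Neumann operator is
  well defined.\<close>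

lemma Neumann_limit_iff:
 assumes al: "0 < Re al" "Re al < 1"
 defines "p \<equiv> %x. calc (%w. exp (al * w) / (1 + exp w)) x"
 shows "Neumann_limit A al x y \<longleftrightarrow> p x \<in> dom A \<and> y = dtn_const al *\<^sub>C (p x + the (A (p x)))"
proof
 assume "Neumann_limit A al x y"
 from Neumann_limit_imp_power[OF al this] have c: "dtn_const al *\<^sub>C p x = Rone y" by (simp add: p_def)
 have c0: "dtn_const al ~= 0" by (rule dtn_const_nonzero[OF al])
 have "inverse (dtn_const al) *\<^sub>C dtn_const al *\<^sub>C p x = Rone (inverse (dtn_const al) *\<^sub>C y)" unfolding c Rone_scaleC ..
 then have px: "p x = Rone (inverse (dtn_const al) *\<^sub>C y)" using c0 by (simp add: scaleC_scaleC)
 have "p x + the (A (p x)) = inverse (dtn_const al) *\<^sub>C y" unfolding px by (rule Rone_right)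
 then show "p x \<in> dom A \<and> y = dtn_const al *\<^sub>C (p x + the (A (p x)))"
  using Rone_dom[of "inverse (dtn_const al) *\<^sub>C y", folded px] c0 by (simp add: scaleC_scaleC)
next
 assume "p x \<in> dom A \<and> y = dtn_const al *\<^sub>C (p x + the (A (p x)))"
 then show "Neumann_limit A al x y" using power_imp_Neumann_limit[OF al refl, of x] unfolding p_def by simp
qed

end

theorem theorem6p2:
  fixes A :: "'a::complex_banach \<rightharpoonup> 'a" and \<alpha> :: complex
  assumes "0 < Re \<alpha>" and "Re \<alpha> < 1"
    and "sectorial A" and "densely_defined A"
  shows "Dirichlet_to_Neumann A \<alpha> =
    scale_operator (Gamma (1 - \<alpha>) / (2 powr (2 * \<alpha> - 1) * Gamma \<alpha>)) (fractional_power A \<alpha>)"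
proof
 fix x
 \<comment> \<open>The angle chosen inside \<open>elementary_calculus\<close> is itself taken as
   contour angle; it is admissible because the sectoriality angle is below
   \<open>pi\<close>.\<close>
 define ph where "ph = (SOME ph. sectoriality_angle A < ph \<and> ph < pi)"
 have "\<exists>ph. sectoriality_angle A < ph \<and> ph < pi"
  using dense[OF sectoriality_angle_less_pi[OF assms(3)]] by blast
 then have ph: "sectoriality_angle A < ph" "ph < pi" unfolding ph_def by (metis (mono_tags, lifting) someI_ex)+
 obtain ph0 M where "sector_calculus A ph0 M ph" by (rule sector_calculus_exists[OF assms(3,4) ph])
 then interpret sector_calculus A ph0 M ph .
 let ?p = "calc (%w. exp (\<alpha> * w) / (1 + exp w)) x"
 have F: "line_decay (%w. exp (\<alpha> * w) / (1 + exp w))"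
  by (rule strip_line_decay[OF strip_decay_power_one[OF assms(1,2) ph_pos ph(2)]])
 have abs: "\<bar>ph\<bar> = ph" "\<bar>- ph\<bar> = ph" using ph_pos by auto
 have "elementary_calculus A (%z. z powr \<alpha> / (1 + z)) x = ?p"
  unfolding elementary_calculus_def Let_def ph_def[symmetric] calc_def blinfun.diff_left
   ray_integral_apply[OF F power_over_one_plus_exp[OF abs(1)] abs(1)] ray_integral_apply[OF F power_over_one_plus_exp[OF abs(2)] abs(2)] ..
 then have "fractional_power A \<alpha> x = (if ?p \<in> dom A then Some (?p + the (A ?p)) else None)"
  unfolding fractional_power_def by (simp add: Let_def)
 then show "Dirichlet_to_Neumann A \<alpha> x =
  scale_operator (Gamma (1 - \<alpha>) / (2 powr (2 * \<alpha> - 1) * Gamma \<alpha>)) (fractional_power A \<alpha>) x"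
  unfolding Dirichlet_to_Neumann_def scale_operator_def Neumann_limit_iff[OF assms(1,2)] dtn_const_def[symmetric] by simp
qed

end
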